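(* Let $\sigma^{\mathrm{sig}}(t) = (1-e^{-t})/(1+e^{-t})$. There is an algorithm that, given $\varepsilon\in(0,1)$, $w_{\max}$, and sample access to a distribution over pairs $(\mathbf x,y)\in \mathbb{R}^d\times \{\pm 1\}$ where $\|\mathbf x\|_2 \le \sqrt{d}$ and $\mathbb{E}[y \mid \mathbf x] = \sigma^{\mathrm{sig}}(\mathbf w^* \cdot \mathbf x + \tau^* )$ for some unknown $\mathbf w^*\in\mathbb{R}^d,\tau^*\in\mathbb{R}$ with $\|\mathbf w^*\|_2 + |\tau^*| \le w_{\max}$, outputs $\widehat{\mathbf w},\widehat{\tau}$ such that with probability at least $0.99$, \[ \mathbb{E}\Big[\big(\sigma^{\mathrm{sig}}(\mathbf w^* \cdot \mathbf x + \tau^* ) - \sigma^{\mathrm{sig}}(\widehat{\mathbf w} \cdot \mathbf x + \widehat{\tau})\big)^2\Big] \le \varepsilon . \] The sample complexity of the algorithm is $\tilde{O}(d / \varepsilon^2)$ and its time complexity is $\mathrm{poly}(d, 1/\varepsilon, \log w_{\max})$. *)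

theory Defs
  imports "HOL-Probability.Probability"
begin

section \<open>Labelled examples with sigmoidal conditional mean\<close>

definition sig :: "real \<Rightarrow> real" where
  "sig t = (1 - exp (- t)) / (1 + exp (- t))"

text \<open>
  The dimension is an argument of the algorithm, so it has to be an ordinary natural number.
  A vector of dimension d is a function \<^typ>\<open>nat \<Rightarrow> real\<close> of which only the values at arguments
  below d matter; its Euclidean norm is \<^const>\<open>L2_set\<close> over \<open>{..<d}\<close>.
\<close>

definition affine_form :: "nat \<Rightarrow> (nat \<Rightarrow> real) \<Rightarrow> real \<Rightarrow> (nat \<Rightarrow> real) \<Rightarrow> real" where
  "affine_form d w \<tau> x = (\<Sum>i<d. w i * x i) + \<tau>"

type_synonym example = "(nat \<Rightarrow> real) \<times> real"

definition feature_space :: "nat \<Rightarrow> (nat \<Rightarrow> real) measure" where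
  "feature_space d = PiM {..<d} (\<lambda>_. borel)"

definition example_space :: "nat \<Rightarrow> example measure" where
  "example_space d = feature_space d \<Otimes>\<^sub>M count_space {-1, 1}"

text \<open>The sub-sigma-algebra generated by the feature vector, over which \<open>E[y | x]\<close> is taken.\<close>

definition feature_algebra :: "nat \<Rightarrow> example measure \<Rightarrow> example measure" where
  "feature_algebra d D = vimage_algebra (space D) fst (feature_space d)"

definition sigmoid_model ::
    "nat \<Rightarrow> real \<Rightarrow> example measure \<Rightarrow> (nat \<Rightarrow> real) \<Rightarrow> real \<Rightarrow> bool" where
  "sigmoid_model d w_max D w \<tau> \<longleftrightarrow>
     prob_space D \<and> sets D = sets (example_space d) \<and>
     (AE (x, y) in D. L2_set x {..<d} \<le> sqrt (real d)) \<and>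
     (AE z in D. real_cond_exp D (feature_algebra d D) snd z = sig (affine_form d w \<tau> (fst z))) \<and>
     L2_set w {..<d} + \<bar>\<tau>\<bar> \<le> w_max"

text \<open>The conditional expectation above is with respect to a genuine sub-sigma-algebra.\<close>

lemma subalgebra_feature_algebra:
  assumes "sets D = sets (example_space d)"
  shows "subalgebra D (feature_algebra d D)"
proof -
  have "fst \<in> measurable D (feature_space d)"
    unfolding measurable_cong_sets[OF assms refl] example_space_def by (rule measurable_fst)
  then show ?thesis
    unfolding subalgebra_def feature_algebra_def
    by (auto simp: sets_vimage_algebra intro!: sets.sigma_sets_subset measurable_sets)
qed

definition sq_error ::
    "nat \<Rightarrow> example measure \<Rightarrow> (nat \<Rightarrow> real) \<Rightarrow> real \<Rightarrow> (nat \<Rightarrow> real) \<Rightarrow> real \<Rightarrow> real" where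
  "sq_error d D w \<tau> v \<theta> =
     (\<integral>z. (sig (affine_form d w \<tau> (fst z)) - sig (affine_form d v \<theta> (fst z)))\<^sup>2 \<partial>D)"

text \<open>
  The event \<open>Q\<close> is not presupposed to be measurable: it has to contain a measurable event of
  probability at least \<open>p\<close>.
\<close>

definition with_prob_at_least :: "'a measure \<Rightarrow> real \<Rightarrow> ('a \<Rightarrow> bool) \<Rightarrow> bool" where
  "with_prob_at_least P p Q \<longleftrightarrow> (\<exists>A\<in>sets P. p \<le> measure P A \<and> (\<forall>\<omega>\<in>A. Q \<omega>))"

lemma (in prob_space) with_prob_at_least_iff:
  assumes "{\<omega> \<in> space M. Q \<omega>} \<in> sets M"
  shows "with_prob_at_least M p Q \<longleftrightarrow> p \<le> prob {\<omega> \<in> space M. Q \<omega>}"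
proof
  assume "with_prob_at_least M p Q"
  then obtain A where A: "A \<in> sets M" "p \<le> prob A" "\<forall>\<omega>\<in>A. Q \<omega>"
    by (auto simp: with_prob_at_least_def)
  then have "A \<subseteq> {\<omega> \<in> space M. Q \<omega>}"
    using sets.sets_into_space by blast
  with A(2) assms show "p \<le> prob {\<omega> \<in> space M. Q \<omega>}"
    using finite_measure_mono order_trans by blast
next
  assume "p \<le> prob {\<omega> \<in> space M. Q \<omega>}"
  with assms show "with_prob_at_least M p Q"
    unfolding with_prob_at_least_def by blast
qed


section \<open>Real random access machines with sample access\<close>

text \<open>
  Programs act on a memory of natural numbers (counters and addresses) and a memory of exact reals,
  both with indirect addressing.  Every arithmetic operation, comparison and memory access has
  unit cost.  The real operations are the four field operations and comparison only: there is
  no rounding of a real to a natural number and no transcendental primitive, and the only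
  constants are natural numbers.  Natural numbers are only added and subtracted (truncated
  at 0), so that a number computed in time t has O(t) more bits than the input and the
  constants of the program.
\<close>

datatype nexp = NConst nat | NMem nexp | NAdd nexp nexp | NSub nexp nexp

datatype rexp = RConst nat | RMem nexp | ROfNat nexp
  | RAdd rexp rexp | RSub rexp rexp | RMul rexp rexp | RDiv rexp rexp

datatype bexp = NLe nexp nexp | RLe rexp rexp | BNot bexp | BAnd bexp bexp

datatype com = Skip
  | NAssign nexp nexp    \<comment> \<open>address, value\<close>
  | RAssign nexp rexp    \<comment> \<open>address, value\<close>
  | Draw nexp            \<comment> \<open>draw a fresh example and store it from the given address on\<close>
  | Seq com com
  | If bexp com com
  | While bexp com

record ram_state =
  nmem :: "nat \<Rightarrow> nat"
  rmem :: "nat \<Rightarrow> real"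
  drawn :: nat

primrec nval :: "nexp \<Rightarrow> ram_state \<Rightarrow> nat" where
  "nval (NConst n) s = n"
| "nval (NMem a) s = nmem s (nval a s)"
| "nval (NAdd a b) s = nval a s + nval b s"
| "nval (NSub a b) s = nval a s - nval b s"

primrec rval :: "rexp \<Rightarrow> ram_state \<Rightarrow> real" where
  "rval (RConst n) s = real n"
| "rval (RMem a) s = rmem s (nval a s)"
| "rval (ROfNat a) s = real (nval a s)"
| "rval (RAdd a b) s = rval a s + rval b s"
| "rval (RSub a b) s = rval a s - rval b s"
| "rval (RMul a b) s = rval a s * rval b s"
| "rval (RDiv a b) s = rval a s / rval b s"

primrec bval :: "bexp \<Rightarrow> ram_state \<Rightarrow> bool" where
  "bval (NLe a b) s \<longleftrightarrow> nval a s \<le> nval b s"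
| "bval (RLe a b) s \<longleftrightarrow> rval a s \<le> rval b s"
| "bval (BNot b) s \<longleftrightarrow> \<not> bval b s"
| "bval (BAnd b c) s \<longleftrightarrow> bval b s \<and> bval c s"

primrec ncost :: "nexp \<Rightarrow> nat" where
  "ncost (NConst n) = 1"
| "ncost (NMem a) = 1 + ncost a"
| "ncost (NAdd a b) = 1 + ncost a + ncost b"
| "ncost (NSub a b) = 1 + ncost a + ncost b"

primrec rcost :: "rexp \<Rightarrow> nat" where
  "rcost (RConst n) = 1"
| "rcost (RMem a) = 1 + ncost a"
| "rcost (ROfNat a) = 1 + ncost a"
| "rcost (RAdd a b) = 1 + rcost a + rcost b"
| "rcost (RSub a b) = 1 + rcost a + rcost b"
| "rcost (RMul a b) = 1 + rcost a + rcost b"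
| "rcost (RDiv a b) = 1 + rcost a + rcost b"

primrec bcost :: "bexp \<Rightarrow> nat" where
  "bcost (NLe a b) = 1 + ncost a + ncost b"
| "bcost (RLe a b) = 1 + rcost a + rcost b"
| "bcost (BNot b) = 1 + bcost b"
| "bcost (BAnd b c) = 1 + bcost b + bcost c"

definition store_example :: "nat \<Rightarrow> nat \<Rightarrow> example \<Rightarrow> (nat \<Rightarrow> real) \<Rightarrow> (nat \<Rightarrow> real)" where
  "store_example d a z m =
     (\<lambda>j. if a \<le> j \<and> j < a + d then fst z (j - a) else if j = a + d then snd z else m j)"

text \<open>
  \<open>exec d \<omega> c s t s'\<close>: started in state \<open>s\<close>, program \<open>c\<close> halts in state \<open>s'\<close> after time \<open>t\<close>,
  where \<open>\<omega>\<close> is the sequence of examples that successive draws return.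
\<close>

inductive exec ::
    "nat \<Rightarrow> (nat \<Rightarrow> example) \<Rightarrow> com \<Rightarrow> ram_state \<Rightarrow> nat \<Rightarrow> ram_state \<Rightarrow> bool"
  for d :: nat and \<omega> :: "nat \<Rightarrow> example" where
  Skip: "exec d \<omega> Skip s 1 s"
| NAssign: "exec d \<omega> (NAssign a e) s (1 + ncost a + ncost e)
     (s\<lparr>nmem := (nmem s)(nval a s := nval e s)\<rparr>)"
| RAssign: "exec d \<omega> (RAssign a e) s (1 + ncost a + rcost e)
     (s\<lparr>rmem := (rmem s)(nval a s := rval e s)\<rparr>)"
| Draw: "exec d \<omega> (Draw a) s (1 + ncost a + (d + 1))
     (s\<lparr>rmem := store_example d (nval a s) (\<omega> (drawn s)) (rmem s), drawn := Suc (drawn s)\<rparr>)"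
| Seq: "exec d \<omega> c1 s t1 s1 \<Longrightarrow> exec d \<omega> c2 s1 t2 s2 \<Longrightarrow> exec d \<omega> (Seq c1 c2) s (t1 + t2) s2"
| IfTrue: "bval b s \<Longrightarrow> exec d \<omega> c1 s t s' \<Longrightarrow> exec d \<omega> (If b c1 c2) s (1 + bcost b + t) s'"
| IfFalse: "\<not> bval b s \<Longrightarrow> exec d \<omega> c2 s t s' \<Longrightarrow> exec d \<omega> (If b c1 c2) s (1 + bcost b + t) s'"
| WhileFalse: "\<not> bval b s \<Longrightarrow> exec d \<omega> (While b c) s (1 + bcost b) s"
| WhileTrue: "bval b s \<Longrightarrow> exec d \<omega> c s t1 s1 \<Longrightarrow> exec d \<omega> (While b c) s1 t2 s2 \<Longrightarrow>
     exec d \<omega> (While b c) s (1 + bcost b + t1 + t2) s2"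

inductive_cases exec_SkipE [consumes 1]: "exec d \<omega> Skip s t s'"
inductive_cases exec_NAssignE [consumes 1]: "exec d \<omega> (NAssign a e) s t s'"
inductive_cases exec_RAssignE [consumes 1]: "exec d \<omega> (RAssign a e) s t s'"
inductive_cases exec_DrawE [consumes 1]: "exec d \<omega> (Draw a) s t s'"
inductive_cases exec_SeqE [consumes 1]: "exec d \<omega> (Seq c1 c2) s t s'"
inductive_cases exec_IfE [consumes 1]: "exec d \<omega> (If b c1 c2) s t s'"
inductive_cases exec_WhileE [consumes 1]: "exec d \<omega> (While b c) s t s'"

lemma exec_deterministic:
  "exec d \<omega> c s t s' \<Longrightarrow> exec d \<omega> c s u s'' \<Longrightarrow> u = t \<and> s'' = s'"
proof (induction arbitrary: u s'' rule: exec.induct)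
  case (Skip s)
  then show ?case by (cases rule: exec_SkipE) simp
next
  case (NAssign a e s)
  then show ?case by (cases rule: exec_NAssignE) simp
next
  case (RAssign a e s)
  then show ?case by (cases rule: exec_RAssignE) simp
next
  case (Draw a s)
  then show ?case by (cases rule: exec_DrawE) simp
next
  case (Seq c1 s t1 s1 c2 t2 s2)
  from Seq.prems show ?case
  proof (cases rule: exec_SeqE)
    case (1 u1 v u2)
    with Seq.IH(1)[of u1 v] Seq.IH(2)[of u2 s''] show ?thesis by simp
  qed
next
  case (IfTrue b s c1 t s' c2)
  from IfTrue.prems show ?case
  proof (cases rule: exec_IfE)
    case (1 u1)
    with IfTrue.IH[of u1 s''] show ?thesis by simp
  next
    case (2 u1)
    with IfTrue.hyps show ?thesis by simp
  qed
next
  case (IfFalse b s c2 t s' c1)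
  from IfFalse.prems show ?case
  proof (cases rule: exec_IfE)
    case (1 u1)
    with IfFalse.hyps show ?thesis by simp
  next
    case (2 u1)
    with IfFalse.IH[of u1 s''] show ?thesis by simp
  qed
next
  case (WhileFalse b s c)
  from WhileFalse.prems show ?case
  proof (cases rule: exec_WhileE)
    case 1
    then show ?thesis by simp
  next
    case (2 u1 v u2)
    with WhileFalse.hyps show ?thesis by simp
  qed
next
  case (WhileTrue b s c t1 s1 t2 s2)
  from WhileTrue.prems show ?case
  proof (cases rule: exec_WhileE)
    case 1
    with WhileTrue.hyps show ?thesis by simp
  next
    case (2 u1 v u2)
    with WhileTrue.IH(1)[of u1 v] WhileTrue.IH(2)[of u2 s''] show ?thesis by simp
  qed
qed

text \<open>
  Input: d in cell 0 of the natural number memory, the accuracy and the norm bound in cells 0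
  and 1 of the real memory.  Output: the weight vector in cells 0 to d - 1 and the bias in cell d
  of the real memory.
\<close>

definition initial_state :: "nat \<Rightarrow> real \<Rightarrow> real \<Rightarrow> ram_state" where
  "initial_state d \<epsilon> w_max =
     \<lparr>nmem = (\<lambda>_. 0)(0 := d), rmem = (\<lambda>_. 0)(0 := \<epsilon>, 1 := w_max), drawn = 0\<rparr>"

definition output_weights :: "ram_state \<Rightarrow> nat \<Rightarrow> real" where
  "output_weights s = rmem s"

definition output_bias :: "nat \<Rightarrow> ram_state \<Rightarrow> real" where
  "output_bias d s = rmem s d"


section \<open>Resource bounds\<close>

text \<open>The logarithm is shifted by 1 because the sample bound is wanted for every \<open>f \<ge> 1\<close>.\<close>

definition soft_bound :: "real \<Rightarrow> nat \<Rightarrow> real \<Rightarrow> real" where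
  "soft_bound C k f = C * f * (1 + ln f) ^ k"

text \<open>
  Every polynomial in d, \<open>1 / \<epsilon>\<close> and the logarithm of the norm bound is below such a power.  The
  logarithm is shifted because the norm bound may be any nonnegative real.
\<close>

definition poly_bound :: "real \<Rightarrow> nat \<Rightarrow> nat \<Rightarrow> real \<Rightarrow> real \<Rightarrow> real" where
  "poly_bound C k d \<epsilon> w_max = C * (real d + 1 / \<epsilon> + ln (2 + w_max)) ^ k"

end

theory Submission
  imports Defs "Jordan_Normal_Form.Determinant"
begin

text \<open>
  The algorithm is logistic regression: draw \<open>n\<close> of order \<open>d m\<^sup>3 / \<epsilon>\<^sup>2\<close> examples, \<open>m\<close> of order \<open>log (d / \<epsilon>\<^sup>2)\<close>, and
  minimise the empirical logistic loss of the affine form, a convex function, by the ellipsoid method;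
  as the norm of the unknown weights enters only through the initial ball, it costs \<open>log w_max\<close>
  iterations.  Only rational operations are available, so the logistic loss is
  replaced by a maximum of lines built from harmonic numbers, which changes the average loss by \<open>O(log n / n)\<close>.

  For the statistics, predicted probabilities are first squeezed into \<open>[e, 1 - e]\<close> with \<open>e\<close> of order \<open>\<epsilon>\<close>.  The
  log loss of the squeezed prediction is at most \<open>log (1 / e)\<close>, hardly exceeds the logistic loss, and
  its upper level sets are halfspaces, so symmetrization and the Sauer--Shelah lemma bound
  its population mean by its empirical mean uniformly in the weights.  For the true weights
  Chebyshev's inequality suffices, as the logistic loss of the truth has a bounded second moment whatever
  \<open>w_max\<close> is.  The excess log loss is an expected relative entropy, which dominates the squared error.
\<close>

section \<open>Determinants of rank-one updates\<close>

text \<open>The squared error is not convex in the weights, which is why another loss is minimised.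
  The logistic loss, however, can be as large as the margins, so a uniform deviation bound for it
  would have to pay for \<open>w_max\<close>. Uniformity is needed in one direction only, for an
  upper bound on the population loss of whatever vector the minimiser returns, and there a bounded
  loss that exceeds the logistic loss by at most O(e) will do. The opposite direction concerns one
  fixed vector.

  The cube of m arises as follows. The squeezed loss has range O(m), so Markov's inequality at
  constant confidence forces the exponential parameter \<eta> of Massart's lemma down to order
  \<epsilon> / m. Balancing d log n / (\<eta> n) against \<eta>, with log n = O(m), gives n of order
  d m / \<eta>^2, that is d m^3 / \<epsilon>^2.

  All loop counts of the program depend on d, \<epsilon> and \<open>w_max\<close> alone, so the
  number of draws and the time bound hold for every sample sequence; only the accuracy is
  probabilistic.\<close>

lemma det_one_minus_rank_one:
  fixes u w :: "nat \<Rightarrow> 'a :: idom"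
  shows "det (mat n n (\<lambda>(i, j). (if i = j then 1 else 0) - u i * w j)) = 1 - (\<Sum>i<n. w i * u i)"
proof -
  define U where "U = mat n 1 (\<lambda>(i, j). u i)"
  define W where "W = mat 1 n (\<lambda>(i, j). w j)"
  define s where "s = (\<Sum>i<n. w i * u i)"
  have [simp]: "U \<in> carrier_mat n 1" "W \<in> carrier_mat 1 n"
    by (auto simp: U_def W_def)
  have UW: "mat n n (\<lambda>(i, j). (if i = j then 1 else 0) - u i * w j) = 1\<^sub>m n - U * W"
    by (rule eq_matI) (auto simp: U_def W_def scalar_prod_def)
  have WU: "1\<^sub>m 1 - W * U = mat 1 1 (\<lambda>_. 1 - s)"
    by (rule eq_matI) (auto simp: U_def W_def scalar_prod_def s_def lessThan_atLeast0)
  \<comment> \<open>Sylvester's identity: \<open>?L * ?P = ?P * ?Q\<close> for block triangular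
    matrices, which trades a determinant of size n for one of size 1.\<close>
  let ?L = "four_block_mat (1\<^sub>m n - U * W) U (0\<^sub>m 1 n) (1\<^sub>m 1)"
  let ?P = "four_block_mat (1\<^sub>m n) (0\<^sub>m n 1) W (1\<^sub>m 1)"
  let ?Q = "four_block_mat (1\<^sub>m n) U (0\<^sub>m 1 n) (1\<^sub>m 1 - W * U)"
  have "?L * ?P = four_block_mat ((1\<^sub>m n - U * W) * 1\<^sub>m n + U * W) ((1\<^sub>m n - U * W) * 0\<^sub>m n 1 + U * 1\<^sub>m 1)
      (0\<^sub>m 1 n * 1\<^sub>m n + 1\<^sub>m 1 * W) (0\<^sub>m 1 n * 0\<^sub>m n 1 + 1\<^sub>m 1 * 1\<^sub>m 1)"
    by (rule mult_four_block_mat) (auto simp: U_def W_def)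
  also have "\<dots> = four_block_mat (1\<^sub>m n) U W (1\<^sub>m 1)"
  proof -
    have "(1\<^sub>m n - U * W) * 1\<^sub>m n + U * W = 1\<^sub>m n"
      by (rule eq_matI) (auto simp: U_def W_def)
    moreover have "(1\<^sub>m n - U * W) * 0\<^sub>m n 1 + U * 1\<^sub>m 1 = U"
      by (rule eq_matI) (auto simp: U_def W_def)
    moreover have "0\<^sub>m 1 n * 1\<^sub>m n + 1\<^sub>m 1 * W = W"
      by (rule eq_matI) (auto simp: U_def W_def)
    moreover have "0\<^sub>m 1 n * 0\<^sub>m n 1 + 1\<^sub>m 1 * 1\<^sub>m 1 = (1\<^sub>m 1 :: 'a mat)"
      by (rule eq_matI) auto
    ultimately show ?thesis by simp
  qed
  also have "\<dots> = ?P * ?Q"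
  proof -
    have "?P * ?Q = four_block_mat (1\<^sub>m n * 1\<^sub>m n + 0\<^sub>m n 1 * 0\<^sub>m 1 n) (1\<^sub>m n * U + 0\<^sub>m n 1 * (1\<^sub>m 1 - W * U))
      (W * 1\<^sub>m n + 1\<^sub>m 1 * 0\<^sub>m 1 n) (W * U + 1\<^sub>m 1 * (1\<^sub>m 1 - W * U))"
      by (rule mult_four_block_mat) (auto simp: U_def W_def)
    moreover have "1\<^sub>m n * 1\<^sub>m n + 0\<^sub>m n 1 * 0\<^sub>m 1 n = (1\<^sub>m n :: 'a mat)"
      by (rule eq_matI) auto
    moreover have "1\<^sub>m n * U + 0\<^sub>m n 1 * (1\<^sub>m 1 - W * U) = U"
      by (rule eq_matI) (auto simp: U_def W_def)
    moreover have "W * 1\<^sub>m n + 1\<^sub>m 1 * 0\<^sub>m 1 n = W"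
      by (rule eq_matI) (auto simp: U_def W_def)
    moreover have "W * U + 1\<^sub>m 1 * (1\<^sub>m 1 - W * U) = 1\<^sub>m 1"
      by (rule eq_matI) (auto simp: U_def W_def)
    ultimately show ?thesis by simp
  qed
  finally have "det ?L * det ?P = det ?P * det ?Q"
    by (subst (1 2) det_mult[symmetric, where n = "n + 1"]) (auto simp: U_def W_def)
  moreover have "det ?P = 1"
    by (subst det_four_block_mat_upper_right_zero[where n = n and m = 1]) (auto simp: U_def W_def)
  moreover have "det ?L = det (1\<^sub>m n - U * W)"
    by (subst det_four_block_mat_lower_left_zero[where n = n and m = 1]) (auto simp: U_def W_def)
  moreover have "det ?Q = det (1\<^sub>m 1 - W * U)"
    by (subst det_four_block_mat_lower_left_zero[where n = n and m = 1]) (auto simp: U_def W_def)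
  moreover have "det (1\<^sub>m 1 - W * U) = 1 - s"
    unfolding WU by (subst det_single) auto
  ultimately show ?thesis by (simp add: UW s_def)
qed

text \<open>The matrix is b times B times \<open>I - (1 - a / b) h h^T / q\<close>, whose
  eigenvalues are a / b in direction h and 1 on its orthogonal complement.\<close>

lemma det_rank_one_update:
  fixes B :: "nat \<Rightarrow> nat \<Rightarrow> real"
  assumes q: "(\<Sum>j<n. (h j)\<^sup>2) = q" "q \<noteq> 0" and b: "b \<noteq> 0"
  shows "det (mat n n (\<lambda>(i, j). b * B i j - (b - a) * (\<Sum>k<n. B i k * h k) * h j / q))
    = b ^ n * (a / b) * det (mat n n (\<lambda>(i, j). B i j))"
proof -
  let ?B = "mat n n (\<lambda>(i, j). B i j)"
  let ?R = "mat n n (\<lambda>(i, j). (if i = j then 1 else 0) - (1 - a / b) * h i / q * h j)"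
  have "mat n n (\<lambda>(i, j). b * B i j - (b - a) * (\<Sum>k<n. B i k * h k) * h j / q) = b \<cdot>\<^sub>m (?B * ?R)"
  proof (rule eq_matI)
    fix i j assume "i < dim_row (b \<cdot>\<^sub>m (?B * ?R))" "j < dim_col (b \<cdot>\<^sub>m (?B * ?R))"
    then have ij: "i < n" "j < n" by auto
    have "(?B * ?R) $$ (i, j) = (\<Sum>k<n. B i k * ((if k = j then 1 else 0) - (1 - a / b) * h k / q * h j))"
      using ij by (simp add: scalar_prod_def lessThan_atLeast0)
    also have "\<dots> = (\<Sum>k<n. B i k * (if k = j then 1 else 0) - (B i k * h k) * ((1 - a / b) / q * h j))"
      by (intro sum.cong) (auto simp: algebra_simps)
    also have "\<dots> = (\<Sum>k<n. B i k * (if k = j then 1 else 0)) - (\<Sum>k<n. B i k * h k) * ((1 - a / b) / q * h j)"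
      by (simp only: sum_subtractf sum_distrib_right)
    also have "(\<Sum>k<n. B i k * (if k = j then 1 else 0)) = B i j"
      using ij by (simp add: mult_if_delta if_distrib cong: if_cong)
    finally have "(?B * ?R) $$ (i, j) = B i j - (\<Sum>k<n. B i k * h k) * ((1 - a / b) / q * h j)" .
    then have "(b \<cdot>\<^sub>m (?B * ?R)) $$ (i, j) = b * (B i j - (\<Sum>k<n. B i k * h k) * ((1 - a / b) / q * h j))"
      using ij by (subst index_smult_mat) (auto simp del: index_mult_mat(1))
    also have "\<dots> = b * B i j - (b - a) * (\<Sum>k<n. B i k * h k) * h j / q"
      using b q(2) by (simp add: field_simps)
    finally show "mat n n (\<lambda>(i, j). b * B i j - (b - a) * (\<Sum>k<n. B i k * h k) * h j / q) $$ (i, j)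
        = (b \<cdot>\<^sub>m (?B * ?R)) $$ (i, j)"
      using ij by simp
  qed auto
  moreover have "det ?R = 1 - (\<Sum>i<n. h i * ((1 - a / b) * h i / q))"
    by (rule det_one_minus_rank_one)
  moreover have "(\<Sum>i<n. h i * ((1 - a / b) * h i / q)) = (1 - a / b) / q * (\<Sum>i<n. (h i)\<^sup>2)"
    by (simp add: sum_distrib_left power2_eq_square mult_ac)
  ultimately show ?thesis
    using q b by (simp add: det_mult[where n = n])
qed

text \<open>The Leibniz formula has n! terms, each at most 1. This crude bound suffices because only
  its logarithm will enter the number of iterations.\<close>

lemma abs_det_le_fact:
  fixes Y :: "nat \<Rightarrow> nat \<Rightarrow> real"
  assumes "\<And>i j. i < n \<Longrightarrow> j < n \<Longrightarrow> \<bar>Y i j\<bar> \<le> 1"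
  shows "\<bar>det (mat n n (\<lambda>(i, j). Y i j))\<bar> \<le> fact n"
proof -
  let ?M = "mat n n (\<lambda>(i, j). Y i j)"
  have "\<bar>det ?M\<bar> \<le> (\<Sum>p\<in>{p. p permutes {0..<n}}. \<bar>signof p * (\<Prod>i = 0..<n. ?M $$ (i, p i))\<bar>)"
    by (subst det_def'[where n = n]) (auto intro: sum_abs)
  also have "\<dots> \<le> (\<Sum>p\<in>{p. p permutes {0..<n}}. 1)"
  proof (rule sum_mono)
    fix p assume "p \<in> {p. p permutes {0..<n}}"
    then have p: "\<And>i. i < n \<Longrightarrow> p i < n"
      using permutes_in_image by fastforce
    have "(\<Prod>i = 0..<n. \<bar>?M $$ (i, p i)\<bar>) \<le> 1"
      using p assms by (intro prod_le_1) auto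
    then show "\<bar>signof p * (\<Prod>i = 0..<n. ?M $$ (i, p i))\<bar> \<le> 1"
      by (simp add: abs_mult abs_prod sign_def)
  qed
  also have "\<dots> = fact n"
    by (simp add: card_permutations)
  finally show ?thesis .
qed

section \<open>The ellipsoid method\<close>

text \<open>With step \<beta> the logarithm of the determinant factor is at most 2 D \<beta>^2 -
  \<beta> / D: the first term is the price of the stretch in all directions, the second the gain in
  the cut direction. A step of order 1 / D^2 makes the gain win.\<close>

definition step_length :: "nat \<Rightarrow> real" where
  "step_length D = 1 / (8 * (real D)\<^sup>2)"

definition shrink_factor :: "nat \<Rightarrow> real" where
  "shrink_factor D = 1 - step_length D / real D"

definition stretch_factor :: "nat \<Rightarrow> real" where
  "stretch_factor D = 1 + 2 * (step_length D)\<^sup>2"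

text \<open>
  An ellipsoid is given by its center and a basis of half axes, not by a positive definite matrix.  The cut
  vector \<open>h\<close> is divided by its \<open>l\<^sub>1\<close> norm instead of its Euclidean norm, which avoids square roots.
\<close>
definition ell_center :: "nat \<Rightarrow> (nat \<Rightarrow> real) \<Rightarrow> (nat \<Rightarrow> nat \<Rightarrow> real) \<Rightarrow> (nat \<Rightarrow> real) \<Rightarrow> nat \<Rightarrow> real" where
  "ell_center D c B h i = c i - step_length D * (\<Sum>j<D. B i j * h j) / (\<Sum>j<D. \<bar>h j\<bar>)"

text \<open>B composed with the linear map that multiplies h by the shrink factor and its orthogonal
  complement by the stretch factor.\<close>

definition ell_basis :: "nat \<Rightarrow> (nat \<Rightarrow> nat \<Rightarrow> real) \<Rightarrow> (nat \<Rightarrow> real) \<Rightarrow> nat \<Rightarrow> nat \<Rightarrow> real" where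
  "ell_basis D B h i j = stretch_factor D * B i j -
     (stretch_factor D - shrink_factor D) * (\<Sum>k<D. B i k * h k) * h j / (\<Sum>k<D. (h k)\<^sup>2)"

definition in_ellipsoid :: "nat \<Rightarrow> (nat \<Rightarrow> real) \<Rightarrow> (nat \<Rightarrow> nat \<Rightarrow> real) \<Rightarrow> (nat \<Rightarrow> real) \<Rightarrow> bool" where
  "in_ellipsoid D c B x \<longleftrightarrow>
     (\<exists>z. (\<Sum>j<D. (z j)\<^sup>2) \<le> 1 \<and> (\<forall>i<D. x i = c i + (\<Sum>j<D. B i j * z j)))"

lemma step_length_bounds:
  assumes "1 \<le> D"
  shows "0 < step_length D" "step_length D \<le> 1 / 8" "step_length D / real D \<le> 1 / 8"
    "0 < step_length D / real D"
proof -
  have D: "1 \<le> real D" using assms by simp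
  then have "1 \<le> (real D)\<^sup>2" by (simp add: one_le_power)
  then show 1: "0 < step_length D" "step_length D \<le> 1 / 8"
    unfolding step_length_def using D by (auto simp: divide_le_eq)
  then show "0 < step_length D / real D" using D by simp
  have "step_length D / real D \<le> step_length D"
    using 1 D by (simp add: divide_le_eq mult_le_cancel_left1)
  also note 1(2)
  finally show "step_length D / real D \<le> 1 / 8" .
qed

lemma factor_bounds:
  assumes "1 \<le> D"
  shows "7 / 8 \<le> shrink_factor D" "shrink_factor D < 1" "1 \<le> stretch_factor D"
  using step_length_bounds[OF assms] by (auto simp: shrink_factor_def stretch_factor_def)

text \<open>In ball coordinates \<zeta> is the component of a surviving point along the unit cut
  vector and \<alpha> the displacement of the center. The left side is convex in \<zeta>, so the
  endpoints decide. At -1 the smallest \<alpha> is critical and fixes the shrink factor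
  (\<open>F1\<close>); at 0 the largest \<alpha> is critical and fixes the stretch factor
  (\<open>F0\<close>).\<close>

lemma cut_inequality:
  fixes \<zeta> \<alpha> :: real
  assumes D: "1 \<le> D" and \<zeta>: "-1 \<le> \<zeta>" "\<zeta> \<le> 0"
    and \<alpha>: "step_length D / real D \<le> \<alpha>" "\<alpha> \<le> step_length D"
  shows "(1 - \<zeta>\<^sup>2) / (stretch_factor D)\<^sup>2 + (\<zeta> + \<alpha>)\<^sup>2 / (shrink_factor D)\<^sup>2 \<le> 1"
proof -
  define a b \<beta> where "a = shrink_factor D" and "b = stretch_factor D" and "\<beta> = step_length D"
  note bnd = step_length_bounds[OF D, folded \<beta>_def] and fb = factor_bounds[OF D, folded a_def b_def]
  have a: "0 < a" "a < 1" "7 / 8 \<le> a" and b: "1 \<le> b" using fb by auto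
  have ab: "1 / b\<^sup>2 \<le> 1 / a\<^sup>2"
    using a b by (intro divide_left_mono) (auto simp: power_mono)
  have \<alpha>0: "0 < \<alpha>" using \<alpha> bnd by (auto simp: \<beta>_def)
  have F1: "(1 - \<alpha>)\<^sup>2 / a\<^sup>2 \<le> 1"
  proof -
    have "1 - \<alpha> \<le> a" using \<alpha> by (simp add: a_def shrink_factor_def)
    moreover have "0 \<le> 1 - \<alpha>" using \<alpha> bnd by (auto simp: \<beta>_def)
    ultimately have "(1 - \<alpha>)\<^sup>2 \<le> a\<^sup>2" by (intro power_mono)
    then show ?thesis using a by (simp add: divide_le_eq)
  qed
  have F0: "1 / b\<^sup>2 + \<alpha>\<^sup>2 / a\<^sup>2 \<le> 1"
  proof -
    have "\<alpha>\<^sup>2 \<le> \<beta>\<^sup>2" using \<alpha> \<alpha>0 by (intro power_mono) (auto simp: \<beta>_def)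
    moreover have "1 / 2 \<le> a\<^sup>2"
    proof -
      have "(7 / 8 :: real)\<^sup>2 \<le> a\<^sup>2" using a by (intro power_mono) auto
      then show ?thesis by (simp add: power2_eq_square)
    qed
    ultimately have "\<alpha>\<^sup>2 / a\<^sup>2 \<le> \<beta>\<^sup>2 / (1 / 2)"
      by (intro frac_le) auto
    moreover have "1 / b\<^sup>2 \<le> 1 - 2 * \<beta>\<^sup>2"
    proof -
      define r where "r = \<beta>\<^sup>2"
      have "r \<le> (1 / 8)\<^sup>2" unfolding r_def using bnd by (intro power_mono) auto
      then have r: "0 \<le> r" "r \<le> 1 / 64" by (auto simp: r_def power2_eq_square)
      have "r * r \<le> r * (1 / 64)" using r by (intro mult_left_mono) auto
      moreover have "r * r * r \<le> r * r * 1" using r by (intro mult_left_mono) auto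
      ultimately have "0 \<le> 2 * r - 4 * (r * r) - 8 * (r * r * r)" using r by linarith
      moreover have "(1 - 2 * r) * (1 + 2 * r)\<^sup>2 = 1 + (2 * r - 4 * (r * r) - 8 * (r * r * r))"
        by (simp add: power2_eq_square algebra_simps)
      ultimately have "1 \<le> (1 - 2 * r) * (1 + 2 * r)\<^sup>2"
        by linarith
      moreover have "0 < (1 + 2 * r)\<^sup>2" using r by simp
      ultimately have "1 / (1 + 2 * r)\<^sup>2 \<le> 1 - 2 * r" by (simp add: divide_le_eq)
      then show ?thesis by (simp add: b_def stretch_factor_def r_def \<beta>_def)
    qed
    ultimately show ?thesis by simp
  qed
  \<comment> \<open>Convexity in use: replacing \<open>t\<^sup>2\<close> by t leaves the
    interpolation between the values at the two endpoints.\<close>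
  define t where "t = - \<zeta>"
  have t: "0 \<le> t" "t \<le> 1" using \<zeta> by (auto simp: t_def)
  have "t\<^sup>2 \<le> t" using t by (simp add: power2_eq_square mult_left_le)
  have "(1 - \<zeta>\<^sup>2) / b\<^sup>2 + (\<zeta> + \<alpha>)\<^sup>2 / a\<^sup>2
      = 1 / b\<^sup>2 + \<alpha>\<^sup>2 / a\<^sup>2 - t * (2 * \<alpha> / a\<^sup>2) + t\<^sup>2 * (1 / a\<^sup>2 - 1 / b\<^sup>2)"
    using a b by (simp add: t_def power2_eq_square field_simps)
  also have "\<dots> \<le> 1 / b\<^sup>2 + \<alpha>\<^sup>2 / a\<^sup>2 - t * (2 * \<alpha> / a\<^sup>2) + t * (1 / a\<^sup>2 - 1 / b\<^sup>2)"
    using \<open>t\<^sup>2 \<le> t\<close> ab by (intro add_left_mono mult_right_mono) auto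
  also have "\<dots> = (1 - t) * (1 / b\<^sup>2 + \<alpha>\<^sup>2 / a\<^sup>2) + t * ((1 - \<alpha>)\<^sup>2 / a\<^sup>2)"
    using a b by (simp add: power2_eq_square field_simps)
  also have "\<dots> \<le> (1 - t) * 1 + t * 1"
    using F0 F1 t by (intro add_mono mult_left_mono) auto
  finally show ?thesis by (simp add: a_def b_def)
qed

text \<open>h is the cut g transported to ball coordinates, so the cut says that z has a negative
  product with h. In particular h is nonzero, and the component of z along h lies in [-1, 0], the
  range of \<open>cut_inequality\<close>.\<close>

lemma ellipsoid_step_contains:
  assumes D: "1 \<le> D" and h: "\<And>j. j < D \<Longrightarrow> h j = (\<Sum>i<D. B i j * g i)"
    and x: "in_ellipsoid D c B x" and cut: "(\<Sum>i<D. g i * (x i - c i)) < 0"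
  shows "in_ellipsoid D (ell_center D c B h) (ell_basis D B h) x" "(\<Sum>k<D. (h k)\<^sup>2) \<noteq> 0"
proof -
  from x obtain z where z: "(\<Sum>j<D. (z j)\<^sup>2) \<le> 1" "\<And>i. i < D \<Longrightarrow> x i = c i + (\<Sum>j<D. B i j * z j)"
    by (auto simp: in_ellipsoid_def)
  have "(\<Sum>i<D. g i * (x i - c i)) = (\<Sum>i<D. \<Sum>j<D. g i * (B i j * z j))"
    using z(2) by (simp add: sum_distrib_left)
  also have "\<dots> = (\<Sum>j<D. \<Sum>i<D. g i * (B i j * z j))" by (rule sum.swap)
  also have "\<dots> = (\<Sum>j<D. z j * h j)"
    by (simp add: h sum_distrib_left mult_ac)
  finally have hz: "(\<Sum>j<D. z j * h j) < 0" using cut by simp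
  define q s N where "q = (\<Sum>k<D. (h k)\<^sup>2)" and "s = (\<Sum>k<D. \<bar>h k\<bar>)" and "N = sqrt q"
  have "q \<noteq> 0"
  proof
    assume "q = 0"
    then have "\<forall>k\<in>{..<D}. (h k)\<^sup>2 = 0"
      unfolding q_def by (subst (asm) sum_nonneg_eq_0_iff) auto
    then have "(\<Sum>j<D. z j * h j) = 0" by (intro sum.neutral) auto
    with hz show False by simp
  qed
  then show "(\<Sum>k<D. (h k)\<^sup>2) \<noteq> 0" by (simp add: q_def)
  have "0 \<le> q" unfolding q_def by (rule sum_nonneg) simp
  with \<open>q \<noteq> 0\<close> have q: "0 < q" by simp
  then have N: "0 < N" "N * N = q" by (auto simp: N_def)
  have Ns: "N \<le> s"
  proof -
    have "N = L2_set h {..<D}" by (simp add: N_def q_def L2_set_def)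
    also have "\<dots> \<le> s" unfolding s_def by (rule L2_set_le_sum_abs)
    finally show ?thesis .
  qed
  have sN: "s \<le> real D * N"
  proof -
    have "\<bar>h k\<bar> \<le> N" if "k < D" for k
    proof -
      have "(h k)\<^sup>2 \<le> q" unfolding q_def using that by (intro member_le_sum) auto
      then show ?thesis unfolding N_def by (intro real_le_rsqrt) auto
    qed
    then have "s \<le> (\<Sum>k<D. N)" unfolding s_def by (intro sum_mono) auto
    then show ?thesis by simp
  qed
  have s: "0 < s" using Ns N by simp
  define \<alpha> where "\<alpha> = step_length D * N / s"
  define \<zeta> where "\<zeta> = (\<Sum>j<D. z j * h j) / N"
  define a b where "a = shrink_factor D" and "b = stretch_factor D"
  have a: "0 < a" and b: "0 < b" using factor_bounds[OF D] by (auto simp: a_def b_def)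
  have D0: "0 < real D" using D by simp
  note \<beta> = step_length_bounds[OF D]
  have \<alpha>: "step_length D / real D \<le> \<alpha>" "\<alpha> \<le> step_length D"
    using sN Ns s \<beta> D0 by (auto simp: \<alpha>_def field_simps)
  have \<zeta>: "\<zeta> \<le> 0" "-1 \<le> \<zeta>"
  proof -
    show "\<zeta> \<le> 0" using hz N by (simp add: \<zeta>_def divide_le_0_iff)
    have "\<bar>\<Sum>j<D. z j * h j\<bar> \<le> (\<Sum>j<D. \<bar>z j\<bar> * \<bar>h j\<bar>)"
      using sum_abs[of "\<lambda>j. z j * h j" "{..<D}"] by (simp add: abs_mult)
    also have "\<dots> \<le> L2_set z {..<D} * L2_set h {..<D}" by (rule L2_set_mult_ineq)
    also have "\<dots> \<le> 1 * L2_set h {..<D}"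
      using z(1) by (intro mult_right_mono L2_set_nonneg) (simp add: L2_set_def)
    also have "\<dots> = N" by (simp add: N_def q_def L2_set_def)
    finally show "-1 \<le> \<zeta>" using N by (simp add: \<zeta>_def field_simps abs_le_iff)
  qed
  \<comment> \<open>The new coordinates divide the part of z orthogonal to h by b and turn its
    component \<zeta> along h into (\<zeta> + \<alpha>) / a; \<kappa> is the correction of that
    component.\<close>
  define \<kappa> where "\<kappa> = (\<zeta> + \<alpha>) / a - \<zeta> / b"
  define z' where "z' j = z j / b + \<kappa> * h j / N" for j
  have zh: "(\<Sum>j<D. z j * h j) = N * \<zeta>" using N by (simp add: \<zeta>_def)
  have hz': "(\<Sum>j<D. h j * z' j) = N * (\<zeta> + \<alpha>) / a"
  proof -
    have "(\<Sum>j<D. h j * z' j) = (\<Sum>j<D. z j * h j * (1 / b) + (h j)\<^sup>2 * (\<kappa> / N))"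
      by (intro sum.cong) (auto simp: z'_def field_simps power2_eq_square)
    also have "\<dots> = N * \<zeta> * (1 / b) + q * (\<kappa> / N)"
      by (simp only: sum.distrib sum_distrib_right[symmetric] zh q_def)
    also have "\<dots> = N * (\<zeta> / b + \<kappa>)" using N by (simp add: field_simps)
    finally show ?thesis by (simp add: \<kappa>_def)
  qed
  have "(\<Sum>j<D. (z' j)\<^sup>2) = (\<Sum>j<D. (z j)\<^sup>2 * (1 / b\<^sup>2) + z j * h j * (2 * \<kappa> / (b * N)) + (h j)\<^sup>2 * (\<kappa>\<^sup>2 / q))"
    using N b by (intro sum.cong) (auto simp: z'_def field_simps power2_eq_square)
  also have "\<dots> = (\<Sum>j<D. (z j)\<^sup>2) * (1 / b\<^sup>2) + N * \<zeta> * (2 * \<kappa> / (b * N)) + q * (\<kappa>\<^sup>2 / q)"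
    by (simp only: sum.distrib sum_distrib_right[symmetric] zh q_def)
  also have "\<dots> \<le> 1 * (1 / b\<^sup>2) + N * \<zeta> * (2 * \<kappa> / (b * N)) + q * (\<kappa>\<^sup>2 / q)"
    using z(1) by (intro add_right_mono mult_right_mono) auto
  also have "\<dots> = (1 - \<zeta>\<^sup>2) / b\<^sup>2 + (\<kappa> + \<zeta> / b)\<^sup>2"
    using N q b by (simp add: field_simps power2_eq_square)
  also have "\<dots> = (1 - \<zeta>\<^sup>2) / b\<^sup>2 + (\<zeta> + \<alpha>)\<^sup>2 / a\<^sup>2"
    by (simp add: \<kappa>_def power_divide)
  also have "\<dots> \<le> 1"
    using cut_inequality[OF D \<zeta>(2,1) \<alpha>] by (simp add: a_def b_def)
  finally have z'1: "(\<Sum>j<D. (z' j)\<^sup>2) \<le> 1" .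
  have "x i = ell_center D c B h i + (\<Sum>j<D. ell_basis D B h i j * z' j)" if i: "i < D" for i
  proof -
    define u where "u = (\<Sum>k<D. B i k * h k)"
    have "(\<Sum>j<D. ell_basis D B h i j * z' j)
        = (\<Sum>j<D. b * (B i j * z' j) - (b - a) * u / q * (h j * z' j))"
      by (intro sum.cong) (auto simp: ell_basis_def a_def b_def u_def q_def algebra_simps)
    also have "\<dots> = b * (\<Sum>j<D. B i j * z' j) - (b - a) * u / q * (N * (\<zeta> + \<alpha>) / a)"
      by (simp only: sum_subtractf sum_distrib_left[symmetric] hz')
    also have "(\<Sum>j<D. B i j * z' j) = (\<Sum>j<D. B i j * z j * (1 / b) + B i j * h j * (\<kappa> / N))"
      by (intro sum.cong) (auto simp: z'_def algebra_simps)
    also have "\<dots> = (\<Sum>j<D. B i j * z j) * (1 / b) + u * (\<kappa> / N)"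
      by (simp only: sum.distrib sum_distrib_right[symmetric] u_def)
    also have "b * ((\<Sum>j<D. B i j * z j) * (1 / b) + u * (\<kappa> / N)) - (b - a) * u / q * (N * (\<zeta> + \<alpha>) / a)
        = (\<Sum>j<D. B i j * z j) + u / N * \<alpha>"
    proof -
      have "(b - a) * u / q * (N * (\<zeta> + \<alpha>) / a) = (b - a) * u / N * (\<zeta> + \<alpha>) / a"
        unfolding N(2)[symmetric] using N(1) by simp
      then show ?thesis unfolding \<kappa>_def by (simp only:) (use a b N(1) in \<open>simp add: field_simps\<close>)
    qed
    also have "u / N * \<alpha> = step_length D * u / s" using N by (simp add: \<alpha>_def)
    finally show ?thesis using z(2)[OF i] by (simp add: ell_center_def u_def s_def)
  qed
  with z'1 show "in_ellipsoid D (ell_center D c B h) (ell_basis D B h) x"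
    unfolding in_ellipsoid_def by blast
qed

lemma stretch_shrink_le_exp:
  assumes "1 \<le> D"
  shows "stretch_factor D ^ D * (shrink_factor D / stretch_factor D) \<le> exp (- 3 / (32 * real D ^ 3))"
    "0 < stretch_factor D ^ D * (shrink_factor D / stretch_factor D)"
proof -
  define \<beta> where "\<beta> = step_length D"
  note fb = factor_bounds[OF assms]
  show "0 < stretch_factor D ^ D * (shrink_factor D / stretch_factor D)"
    using fb by simp
  have D: "0 < real D" using assms by simp
  have le1: "step_length D / real D \<le> 1" using step_length_bounds[OF assms] by linarith
  have "stretch_factor D ^ D * (shrink_factor D / stretch_factor D) \<le> stretch_factor D ^ D * (shrink_factor D / 1)"
    using fb by (intro mult_left_mono divide_left_mono) auto
  also have "\<dots> \<le> exp (2 * \<beta>\<^sup>2) ^ D * exp (- \<beta> / D)"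
    using fb le1 exp_ge_add_one_self[of "2 * \<beta>\<^sup>2"] exp_ge_add_one_self[of "- \<beta> / D"]
    by (intro mult_mono power_mono) (simp_all add: stretch_factor_def shrink_factor_def \<beta>_def)
  also have "\<dots> = exp (real D * (2 * \<beta>\<^sup>2) + - \<beta> / D)"
    by (simp add: exp_of_nat_mult exp_add exp_diff exp_minus divide_inverse mult_ac)
  \<comment> \<open>The two terms are 1 / (32 D^3) and -4 / (32 D^3).\<close>
  also have "real D * (2 * \<beta>\<^sup>2) + - \<beta> / D = - 3 / (32 * real D ^ 3)"
    using D by (simp add: \<beta>_def step_length_def power2_eq_square power3_eq_cube field_simps)
  finally show "stretch_factor D ^ D * (shrink_factor D / stretch_factor D) \<le> exp (- 3 / (32 * real D ^ 3))" .
qed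

text \<open>The half differences of the preimages of the points
  \<open>w \<plusminus> \<rho> e\<^sub>j\<close> form a matrix Y with entries in [-1, 1] and B Y =
  \<rho> I. Determinants thus replace volumes in the analysis of the method.\<close>

lemma abs_det_ge_of_contains_cross:
  assumes "0 < \<rho>"
    and plus: "\<And>j. j < D \<Longrightarrow> in_ellipsoid D c B (w(j := w j + \<rho>))"
    and minus: "\<And>j. j < D \<Longrightarrow> in_ellipsoid D c B (w(j := w j - \<rho>))"
  shows "\<rho> ^ D \<le> \<bar>det (mat D D (\<lambda>(i, j). B i j))\<bar> * fact D"
proof -
  have "\<forall>j. \<exists>z. j < D \<longrightarrow> (\<Sum>k<D. (z k)\<^sup>2) \<le> 1 \<and> (\<forall>i<D. (w(j := w j + \<rho>)) i = c i + (\<Sum>k<D. B i k * z k))"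
    using plus unfolding in_ellipsoid_def by blast
  then obtain P where P: "\<And>j. j < D \<Longrightarrow> (\<Sum>k<D. (P j k)\<^sup>2) \<le> 1"
      "\<And>i j. j < D \<Longrightarrow> i < D \<Longrightarrow> (w(j := w j + \<rho>)) i = c i + (\<Sum>k<D. B i k * P j k)"
    by metis
  have "\<forall>j. \<exists>z. j < D \<longrightarrow> (\<Sum>k<D. (z k)\<^sup>2) \<le> 1 \<and> (\<forall>i<D. (w(j := w j - \<rho>)) i = c i + (\<Sum>k<D. B i k * z k))"
    using minus unfolding in_ellipsoid_def by blast
  then obtain M where M: "\<And>j. j < D \<Longrightarrow> (\<Sum>k<D. (M j k)\<^sup>2) \<le> 1"
      "\<And>i j. j < D \<Longrightarrow> i < D \<Longrightarrow> (w(j := w j - \<rho>)) i = c i + (\<Sum>k<D. B i k * M j k)"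
    by metis
  have coord: "\<bar>z k\<bar> \<le> 1" if "(\<Sum>k<D. (z k)\<^sup>2) \<le> 1" "k < D" for z :: "nat \<Rightarrow> real" and k
  proof -
    have "(z k)\<^sup>2 \<le> (\<Sum>k<D. (z k)\<^sup>2)" using that(2) by (intro member_le_sum) auto
    with that(1) have "(z k)\<^sup>2 \<le> 1" by simp
    then show ?thesis by (simp add: abs_square_le_1)
  qed
  define Y where "Y k j = (P j k - M j k) / 2" for k j
  let ?B = "mat D D (\<lambda>(i, j). B i j)" and ?Y = "mat D D (\<lambda>(i, j). Y i j)"
  have "?B * ?Y = \<rho> \<cdot>\<^sub>m 1\<^sub>m D"
  proof (rule eq_matI)
    fix i j assume "i < dim_row (\<rho> \<cdot>\<^sub>m 1\<^sub>m D)" "j < dim_col (\<rho> \<cdot>\<^sub>m 1\<^sub>m D)"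
    then have ij: "i < D" "j < D" by auto
    have "(?B * ?Y) $$ (i, j) = (\<Sum>k<D. B i k * Y k j)"
      using ij by (simp add: scalar_prod_def lessThan_atLeast0)
    also have "\<dots> = ((\<Sum>k<D. B i k * P j k) - (\<Sum>k<D. B i k * M j k)) / 2"
      by (simp add: Y_def sum_subtractf[symmetric] sum_divide_distrib right_diff_distrib)
    also have "\<dots> = (if i = j then \<rho> else 0)"
      using P(2)[OF ij(2,1)] M(2)[OF ij(2,1)] by (auto split: if_splits)
    finally show "(?B * ?Y) $$ (i, j) = (\<rho> \<cdot>\<^sub>m 1\<^sub>m D) $$ (i, j)" using ij by auto
  qed auto
  then have "det ?B * det ?Y = \<rho> ^ D"
    by (subst det_mult[symmetric, where n = D]) auto
  then have "\<rho> ^ D = \<bar>det ?B\<bar> * \<bar>det ?Y\<bar>"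
    using assms(1) by (metis abs_mult abs_of_pos zero_less_power)
  also have "\<dots> \<le> \<bar>det ?B\<bar> * fact D"
  proof (intro mult_left_mono abs_det_le_fact)
    fix i j assume "i < D" "j < D"
    then show "\<bar>Y i j\<bar> \<le> 1"
      using coord[OF P(1), of j i] coord[OF M(1), of j i] by (simp add: Y_def)
  qed auto
  finally show ?thesis .
qed

text \<open>
  If every iterate were worse than \<open>V\<close>, no cut would remove a point \<open>w \<plusminus> \<rho> e\<^sub>j\<close>; an ellipsoid that contains these
  points has a determinant that is bounded from below, but every step shrinks the determinant.
\<close>
theorem ellipsoid_method:
  fixes F :: "(nat \<Rightarrow> real) \<Rightarrow> real"
  assumes D: "1 \<le> D" and \<rho>: "0 < \<rho>" and R: "L2_set w {..<D} + \<rho> \<le> R"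
    and init: "\<And>i. i < D \<Longrightarrow> c 0 i = 0" "\<And>i j. i < D \<Longrightarrow> j < D \<Longrightarrow> B 0 i j = (if i = j then R else 0)"
    and center: "\<And>k i. k < T \<Longrightarrow> i < D \<Longrightarrow> c (Suc k) i = ell_center D (c k) (B k) (h k) i"
    and basis: "\<And>k i j. k < T \<Longrightarrow> i < D \<Longrightarrow> j < D \<Longrightarrow> B (Suc k) i j = ell_basis D (B k) (h k) i j"
    and h: "\<And>k j. k < T \<Longrightarrow> j < D \<Longrightarrow> h k j = (\<Sum>i<D. B k i j * g k i)"
    and subgradient: "\<And>k u. k < T \<Longrightarrow> F (c k) + (\<Sum>i<D. g k i * (u i - c k i)) \<le> F u"
    and near: "\<And>j. j < D \<Longrightarrow> F (w(j := w j + \<rho>)) \<le> V" "\<And>j. j < D \<Longrightarrow> F (w(j := w j - \<rho>)) \<le> V"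
    and T: "32 * real D ^ 4 * ln (R * real D / \<rho>) < 3 * real T"
  shows "\<exists>k<T. F (c k) \<le> V"
proof (rule ccontr)
  assume "\<not> (\<exists>k<T. F (c k) \<le> V)"
  then have gt: "\<And>k. k < T \<Longrightarrow> V < F (c k)" by force
  have D0: "0 < real D" using D by simp
  have R0: "0 < R" using R \<rho> L2_set_nonneg[of w "{..<D}"] by linarith
  have step: "in_ellipsoid D (c (Suc k)) (B (Suc k)) x \<and> (\<Sum>j<D. (h k j)\<^sup>2) \<noteq> 0"
    if k: "k < T" and x: "in_ellipsoid D (c k) (B k) x" "F x \<le> V" for k x
  proof -
    have "(\<Sum>i<D. g k i * (x i - c k i)) < 0"
      using subgradient[OF k, of x] gt[OF k] x(2) by linarith
    note contains = ellipsoid_step_contains[OF D h[OF k] x(1) this]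
    from contains(1) obtain z where z: "(\<Sum>j<D. (z j)\<^sup>2) \<le> 1"
        "\<And>i. i < D \<Longrightarrow> x i = ell_center D (c k) (B k) (h k) i + (\<Sum>j<D. ell_basis D (B k) (h k) i j * z j)"
      unfolding in_ellipsoid_def by blast
    have "x i = c (Suc k) i + (\<Sum>j<D. B (Suc k) i j * z j)" if i: "i < D" for i
      using z(2)[OF i] basis[OF k i] by (simp add: center[OF k i] cong: sum.cong_simp)
    with z(1) contains(2) show ?thesis unfolding in_ellipsoid_def by blast
  qed
  have start: "in_ellipsoid D (c 0) (B 0) (w(j := w j + \<sigma>))" if j: "j < D" and \<sigma>: "\<bar>\<sigma>\<bar> = \<rho>" for j \<sigma>
  proof -
    let ?x = "w(j := w j + \<sigma>)"
    have "L2_set ?x {..<D} = L2_set (\<lambda>i. w i + (if i = j then \<sigma> else 0)) {..<D}"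
      by (rule L2_set_cong) auto
    also have "\<dots> \<le> L2_set w {..<D} + L2_set (\<lambda>i. if i = j then \<sigma> else 0) {..<D}"
      by (rule L2_set_triangle_ineq)
    also have "L2_set (\<lambda>i. if i = j then \<sigma> else 0) {..<D} = \<rho>"
      using j \<sigma> by (simp add: L2_set_def if_distrib[of "\<lambda>x. x\<^sup>2"] cong: if_cong)
    also have "L2_set w {..<D} + \<rho> \<le> R" by (rule R)
    finally have "(\<Sum>i<D. (?x i)\<^sup>2) \<le> R\<^sup>2"
      unfolding L2_set_def by (rule sqrt_le_D)
    then have "(\<Sum>i<D. (?x i / R)\<^sup>2) \<le> 1"
      using R0 by (simp add: power_divide sum_divide_distrib[symmetric])
    moreover have "?x i = c 0 i + (\<Sum>k<D. B 0 i k * (?x k / R))" if i: "i < D" for i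
    proof -
      have "(\<Sum>k<D. B 0 i k * (?x k / R)) = (\<Sum>k<D. if k = i then ?x i else 0)"
        using R0 init(2)[OF i] by (intro sum.cong) auto
      then show ?thesis using init(1)[OF i] i by simp
    qed
    ultimately show ?thesis unfolding in_ellipsoid_def by (intro exI[of _ "\<lambda>i. ?x i / R"]) auto
  qed
  have all: "k \<le> T \<Longrightarrow> in_ellipsoid D (c k) (B k) (w(j := w j + \<sigma>))" if j: "j < D" and \<sigma>: "\<sigma> = \<rho> \<or> \<sigma> = - \<rho>" for j \<sigma> k
  proof (induction k)
    case 0
    have "\<bar>\<sigma>\<bar> = \<rho>" using \<sigma> \<rho> by auto
    from start[OF j this] show ?case .
  next
    case (Suc k)
    then have "k < T" by simp
    have "F (w(j := w j + \<sigma>)) \<le> V" using near[OF j] \<sigma> by auto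
    with step[OF \<open>k < T\<close>, of "w(j := w j + \<sigma>)"] Suc.IH \<open>k < T\<close> show ?case by (simp del: fun_upd_apply)
  qed
  define \<gamma> where "\<gamma> = stretch_factor D ^ D * (shrink_factor D / stretch_factor D)"
  have \<gamma>: "0 < \<gamma>" "\<gamma> \<le> exp (- 3 / (32 * real D ^ 3))"
    using stretch_shrink_le_exp[OF D] by (auto simp: \<gamma>_def)
  have dets: "k \<le> T \<Longrightarrow> det (mat D D (\<lambda>(i, j). B k i j)) = R ^ D * \<gamma> ^ k" for k
  proof (induction k)
    case 0
    have "mat D D (\<lambda>(i, j). B 0 i j) = R \<cdot>\<^sub>m 1\<^sub>m D"
      using init(2) by (intro eq_matI) auto
    then show ?case by simp
  next
    case (Suc k)
    then have k: "k < T" by simp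
    \<comment> \<open>The update divides by the squared norm of the cut vector. It is nonzero
      because the cut strictly separates the center from some retained point, here the one in
      direction 0.\<close>
    have nz: "(\<Sum>j<D. (h k j)\<^sup>2) \<noteq> 0"
      using step[OF k all[of 0 \<rho> k]] D k near(1)[of 0] by auto
    have "mat D D (\<lambda>(i, j). B (Suc k) i j) = mat D D (\<lambda>(i, j). ell_basis D (B k) (h k) i j)"
      using basis[OF k] by (intro eq_matI) auto
    also have "det \<dots> = \<gamma> * det (mat D D (\<lambda>(i, j). B k i j))"
      unfolding ell_basis_def \<gamma>_def using nz factor_bounds[OF D]
      by (intro det_rank_one_update) auto
    finally show ?case using Suc k by simp
  qed
  have "\<rho> ^ D \<le> \<bar>det (mat D D (\<lambda>(i, j). B T i j))\<bar> * fact D"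
    using all[of _ \<rho> T] all[of _ "- \<rho>" T] by (intro abs_det_ge_of_contains_cross[OF \<rho>]) auto
  also have "\<bar>det (mat D D (\<lambda>(i, j). B T i j))\<bar> = R ^ D * \<gamma> ^ T"
    using dets[of T] R0 \<gamma> by simp
  \<comment> \<open>With \<open>fact D\<close> below D^D everything but the exponential is a D-th
    power, so after taking logarithms only ln (R D / \<rho>) remains.\<close>
  also have "R ^ D * \<gamma> ^ T * fact D \<le> R ^ D * exp (- 3 / (32 * real D ^ 3)) ^ T * real D ^ D"
    using R0 \<gamma> fact_le_power[of D, where 'a = real] by (intro mult_mono power_mono) auto
  also have "\<dots> = (R * real D) ^ D * exp (- 3 * real T / (32 * real D ^ 3))"
    by (simp add: power_mult_distrib exp_of_nat_mult[symmetric] mult_ac)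
  finally have "\<rho> ^ D \<le> (R * real D) ^ D * exp (- 3 * real T / (32 * real D ^ 3))" .
  then have "ln (\<rho> ^ D) \<le> ln ((R * real D) ^ D * exp (- 3 * real T / (32 * real D ^ 3)))"
    using \<rho> by (intro ln_mono) auto
  also have "\<dots> = real D * ln (R * real D) - 3 * real T / (32 * real D ^ 3)"
    using R0 D0 by (simp add: ln_mult ln_realpow)
  finally have "real D * ln \<rho> \<le> real D * ln (R * real D) - 3 * real T / (32 * real D ^ 3)"
    using \<rho> by (simp add: ln_realpow)
  then have "3 * real T / (32 * real D ^ 3) \<le> real D * ln (R * real D / \<rho>)"
    using R0 D0 \<rho> by (simp add: ln_div algebra_simps)
  then have "3 * real T \<le> real D * ln (R * real D / \<rho>) * (32 * real D ^ 3)"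
    using D0 by (simp add: divide_le_eq)
  also have "\<dots> = 32 * real D ^ 4 * ln (R * real D / \<rho>)"
    by (simp add: eval_nat_numeral)
  finally show False using T by simp
qed

section \<open>Logistic loss and its harmonic surrogate\<close>

definition logistic_loss :: "real \<Rightarrow> real" where
  "logistic_loss t = ln (1 + exp (- t))"

text \<open>
  The machine has no logarithm.  Since \<open>logistic_loss t\<close> is the maximum of \<open>H p - p * t\<close> over \<open>p\<close>, with
  \<open>H\<close> the binary entropy, \<open>n * logistic_loss t\<close> is close to the maximum over \<open>p = l / n\<close> of lines
  in which \<open>harm k\<close> stands for \<open>ln k\<close>.
\<close>
definition harm_line :: "nat \<Rightarrow> nat \<Rightarrow> real \<Rightarrow> real" where
  "harm_line n l t = real n * harm n - real l * harm l - (real n - real l) * harm (n - l) - real l * t"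

definition harm_loss :: "nat \<Rightarrow> real \<Rightarrow> real" where
  "harm_loss n t = Max ((\<lambda>l. harm_line n l t) ` {..n})"

lemma harm_line_le_loss: "l \<le> n \<Longrightarrow> harm_line n l t \<le> harm_loss n t"
  unfolding harm_loss_def by (intro Max_ge) auto

lemma harm_loss_le: "(\<And>l. l \<le> n \<Longrightarrow> harm_line n l t \<le> x) \<Longrightarrow> harm_loss n t \<le> x"
  unfolding harm_loss_def by (subst Max_le_iff) auto

text \<open>All lines have slopes between -n and 0, so the surrogate is Lipschitz with constant
  n.\<close>

lemma harm_loss_shift_le: "harm_loss n (t + s) \<le> harm_loss n t + real n * \<bar>s\<bar>"
proof (rule harm_loss_le)
  fix l assume l: "l \<le> n"
  have "harm_line n l (t + s) = harm_line n l t - real l * s"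
    by (simp add: harm_line_def algebra_simps)
  also have "- (real l * s) \<le> real n * \<bar>s\<bar>"
  proof -
    have "- (real l * s) \<le> real l * \<bar>s\<bar>" by (simp add: abs_if)
    also have "\<dots> \<le> real n * \<bar>s\<bar>" using l by (intro mult_right_mono) auto
    finally show ?thesis .
  qed
  then have "harm_line n l t - real l * s \<le> harm_line n l t + real n * \<bar>s\<bar>" by simp
  also have "\<dots> \<le> harm_loss n t + real n * \<bar>s\<bar>" using harm_line_le_loss[OF l] by simp
  finally show "harm_line n l (t + s) \<le> harm_loss n t + real n * \<bar>s\<bar>" .
qed

text \<open>Allows the record of the best loss to start at n^3, an upper bound for n examples at
  weight 0, with no evaluation.\<close>

lemma harm_loss_zero_le: "harm_loss n 0 \<le> real n * real n"
proof (rule harm_loss_le)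
  fix l assume "l \<le> n"
  have h: "harm n \<le> real n"
  proof (induction n)
    case (Suc n)
    have "inverse (real (Suc n)) \<le> 1" by (simp add: inverse_eq_divide)
    with Suc show ?case by (simp add: harm_Suc)
  qed (simp add: harm_def)
  have "0 \<le> real l * harm l" "0 \<le> (real n - real l) * harm (n - l)"
    using \<open>l \<le> n\<close> by (auto intro!: mult_nonneg_nonneg harm_nonneg)
  moreover have "real n * harm n \<le> real n * real n" using h by (intro mult_left_mono) auto
  ultimately show "harm_line n l 0 \<le> real n * real n" by (simp add: harm_line_def)
qed

section \<open>Comparison of harmonic numbers, entropy and logistic loss\<close>

lemma harm_minus_ln_bounds:
  assumes "1 \<le> k"
  shows "euler_mascheroni \<le> harm k - ln (real k)" "harm k - ln (real k) \<le> euler_mascheroni + 1 / real k"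
proof -
  show "euler_mascheroni \<le> harm k - ln (real k)"
  proof (rule LIMSEQ_le_const2[OF euler_mascheroni_LIMSEQ])
    show "\<exists>N. \<forall>n\<ge>N. harm n - ln (real n) \<le> harm k - ln (real k)"
      using assms euler_mascheroni_sequence_decreasing[of k] by force
  qed
  have k: "0 < real k" using assms by simp
  have "harm k - ln (real (Suc k)) \<le> euler_mascheroni"
    using euler_mascheroni_bounds[OF assms] by (auto intro: order_trans[rotated])
  moreover have "ln (real (Suc k)) - ln (real k) \<le> 1 / real k"
  proof -
    have "ln (real (Suc k) / real k) \<le> real (Suc k) / real k - 1"
      using k by (intro ln_le_minus_one) simp
    then show ?thesis using k by (simp add: ln_div field_simps)
  qed
  ultimately show "harm k - ln (real k) \<le> euler_mascheroni + 1 / real k" by simp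
qed

text \<open>The error of order 1 / k in the harmonic number is harmless once multiplied by
  k.\<close>

lemma harm_near_ln:
  "\<bar>real k * harm k - real k * (ln (real k) + euler_mascheroni)\<bar> \<le> 1"
proof (cases "k = 0")
  case False
  then have k: "1 \<le> k" by simp
  have "0 \<le> real k * (harm k - ln (real k) - euler_mascheroni)"
    using harm_minus_ln_bounds[OF k] by (intro mult_nonneg_nonneg) auto
  moreover have "real k * (harm k - ln (real k) - euler_mascheroni) \<le> real k * (1 / real k)"
    using harm_minus_ln_bounds[OF k] by (intro mult_left_mono) auto
  ultimately show ?thesis using False by (simp add: algebra_simps abs_le_iff)
qed simp

text \<open>n H(l / n) - l t with the binary entropy H; the value of ln at 0 is irrelevant, as its
  factor is 0.\<close>

definition entropy_line :: "nat \<Rightarrow> nat \<Rightarrow> real \<Rightarrow> real" where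
  "entropy_line n l t = real n * ln (real n) - real l * ln (real l) - real (n - l) * ln (real (n - l)) - real l * t"

text \<open>Euler's constant cancels because n = l + (n - l); three errors of at most 1 are
  left.\<close>

lemma harm_line_near_entropy_line:
  assumes "l \<le> n"
  shows "\<bar>harm_line n l t - entropy_line n l t\<bar> \<le> 3"
  using harm_near_ln[of n] harm_near_ln[of l] harm_near_ln[of "n - l"] assms
  by (simp add: harm_line_def entropy_line_def of_nat_diff algebra_simps abs_le_iff)

text \<open>Gibbs' inequality between the frequencies l / n, (n - l) / n and the label probabilities
  \<open>b1\<close>, \<open>b2\<close> of the logistic model at margin t.\<close>

lemma entropy_line_le_logistic_loss:
  assumes l: "l \<le> n"
  shows "entropy_line n l t \<le> real n * logistic_loss t"
proof (cases "n = 0")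
  case False
  define r where "r = 1 / (1 + exp (- t))"
  have e: "0 < exp (- t)" by simp
  then have pos: "0 < 1 + exp (- t)" by linarith
  have summand: "- (real a * ln (real a)) + real a * ln (real n) \<le> real n * b - real a - real a * ln b"
    if "0 < b" for a :: nat and b :: real
  proof (cases "a = 0")
    case True
    then show ?thesis using that by simp
  next
    case False
    have "ln (real n * b / real a) \<le> real n * b / real a - 1"
      using False \<open>n \<noteq> 0\<close> that by (intro ln_le_minus_one) simp
    then have "real a * (ln (real n) + ln b - ln (real a)) \<le> real a * (real n * b / real a - 1)"
      using False \<open>n \<noteq> 0\<close> that by (intro mult_left_mono) (auto simp: ln_mult ln_div)
    also have "\<dots> = real n * b - real a" using False by (simp add: algebra_simps)
    finally show ?thesis by (simp add: algebra_simps)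
  qed
  define b1 b2 where "b1 = exp (- t) / (1 + exp (- t))" and "b2 = 1 / (1 + exp (- t))"
  have b: "0 < b1" "0 < b2" "b1 + b2 = 1"
    using pos by (auto simp: b1_def b2_def add_divide_distrib[symmetric])
  have ln: "ln b1 = - t - logistic_loss t" "ln b2 = - logistic_loss t"
    using pos by (auto simp: b1_def b2_def logistic_loss_def ln_div)
  have "real n * b1 + real n * b2 = real n" using b by (metis distrib_left mult.right_neutral)
  then show ?thesis
    using summand[OF b(1), of l] summand[OF b(2), of "n - l"] l unfolding ln
    by (simp add: entropy_line_def of_nat_diff algebra_simps)
qed (use l in \<open>simp add: entropy_line_def\<close>)

text \<open>A single term of the binomial distribution with success probability l / n is at most
  1.\<close>

lemma ln_binomial_le_entropy_line:
  assumes l: "l \<le> n"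
  shows "ln (real (n choose l)) - real l * t \<le> entropy_line n l t"
proof (cases "n = 0")
  case False
  define p where "p = real l / real n"
  have summand: "real (n choose l) * (p ^ l * (1 - p) ^ (n - l)) \<le> 1"
  proof -
    have p: "0 \<le> p" "0 \<le> 1 - p" using l False by (auto simp: p_def)
    have "real (n choose l) * p ^ l * (1 - p) ^ (n - l) \<le> (\<Sum>k\<le>n. real (n choose k) * p ^ k * (1 - p) ^ (n - k))"
      using l p by (intro member_le_sum[where f = "\<lambda>k. real (n choose k) * p ^ k * (1 - p) ^ (n - k)"]) auto
    also have "\<dots> = (p + (1 - p)) ^ n" by (rule binomial_ring[symmetric])
    finally show ?thesis by (simp add: mult.assoc)
  qed
  have "0 < n choose l" using l by (simp add: zero_less_binomial)
  have lnpow: "ln ((real k / real n) ^ k) = real k * ln (real k) - real k * ln (real n) \<and> 0 < (real k / real n) ^ k" for k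
    using False by (cases "k = 0") (auto simp: ln_realpow ln_div right_diff_distrib)
  have q: "1 - p = real (n - l) / real n" using l False by (simp add: p_def of_nat_diff diff_divide_distrib)
  have lnp: "ln (p ^ l) = real l * ln (real l) - real l * ln (real n)" and ppos: "0 < p ^ l"
    using lnpow[of l] by (simp_all only: p_def)
  have lnq: "ln ((1 - p) ^ (n - l)) = real (n - l) * ln (real (n - l)) - real (n - l) * ln (real n)"
    and qpos: "0 < (1 - p) ^ (n - l)"
    using lnpow[of "n - l"] by (simp_all only: q)
  have "ln (real (n choose l) * (p ^ l * (1 - p) ^ (n - l))) \<le> ln 1"
    using summand ppos qpos \<open>0 < n choose l\<close> by (intro ln_mono) auto
  then have "ln (real (n choose l)) + (ln (p ^ l) + ln ((1 - p) ^ (n - l))) \<le> 0"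
    using ppos qpos \<open>0 < n choose l\<close> by (simp only: ln_mult_pos mult_pos_pos of_nat_0_less_iff ln_one)
  then show ?thesis using l unfolding lnp lnq
    by (simp add: entropy_line_def of_nat_diff algebra_simps)
qed (use l in \<open>simp add: entropy_line_def\<close>)

lemma harm_loss_upper: "harm_loss n t \<le> real n * logistic_loss t + 3"
proof (rule harm_loss_le)
  fix l assume "l \<le> n"
  then show "harm_line n l t \<le> real n * logistic_loss t + 3"
    using harm_line_near_entropy_line[of l n t] entropy_line_le_logistic_loss[of l n t] by linarith
qed

text \<open>The n-th power of 1 + exp (-t) is a sum of n + 1 binomial terms, each at most the
  exponential of the largest line up to the error 3. Restricting the slopes to multiples of 1 / n
  therefore costs ln (n + 1).\<close>

lemma harm_loss_lower: "real n * logistic_loss t \<le> harm_loss n t + 3 + ln (real n + 1)"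
proof -
  define m where "m = harm_loss n t + 3"
  have "(1 + exp (- t)) ^ n = (\<Sum>l\<le>n. real (n choose l) * exp (- t) ^ l)"
    by (subst add.commute, subst binomial_ring) simp
  also have "\<dots> \<le> (\<Sum>l\<le>n. exp m)"
  proof (rule sum_mono)
    fix l assume "l \<in> {..n}"
    then have l: "l \<le> n" by simp
    have "0 < n choose l" using l by (simp add: zero_less_binomial)
    then have "real (n choose l) * exp (- t) ^ l = exp (ln (real (n choose l)) - real l * t)"
      by (simp add: exp_diff exp_of_nat_mult[symmetric] exp_minus field_simps)
    also have "\<dots> \<le> exp m"
      using ln_binomial_le_entropy_line[OF l, of t] harm_line_near_entropy_line[OF l, of t]
        harm_line_le_loss[OF l, of t] by (simp add: m_def)
    finally show "real (n choose l) * exp (- t) ^ l \<le> exp m" .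
  qed
  also have "\<dots> = (real n + 1) * exp m" by simp
  finally have "ln ((1 + exp (- t)) ^ n) \<le> ln ((real n + 1) * exp m)"
    by (intro ln_mono zero_less_power add_pos_pos) auto
  then show ?thesis by (simp add: ln_realpow ln_mult logistic_loss_def m_def add_pos_pos)
qed

section \<open>Traces of halfspaces\<close>

text \<open>Gaussian elimination: a vector p with nonzero last coordinate serves as pivot and clears
  that coordinate in all others.\<close>

lemma linear_dependence:
  fixes z :: "'i \<Rightarrow> nat \<Rightarrow> real"
  assumes "finite I" "D < card I"
  shows "\<exists>c. (\<exists>i\<in>I. c i \<noteq> 0) \<and> (\<forall>j<D. (\<Sum>i\<in>I. c i * z i j) = 0)"
  using assms
proof (induction D arbitrary: I z)
  case 0
  then obtain i where "i \<in> I" by fastforce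
  then show ?case by (intro exI[of _ "\<lambda>_. 1"]) auto
next
  case (Suc D)
  show ?case
  proof (cases "\<forall>i\<in>I. z i D = 0")
    case True
    obtain c where c: "\<exists>i\<in>I. c i \<noteq> 0" "\<forall>j<D. (\<Sum>i\<in>I. c i * z i j) = 0"
      using Suc.IH[OF Suc.prems(1), of z] Suc.prems(2) by auto
    have "(\<Sum>i\<in>I. c i * z i j) = 0" if "j < Suc D" for j
      using c(2) True that by (cases "j = D") (auto intro: sum.neutral)
    with c(1) show ?thesis by blast
  next
    case False
    then obtain p where p: "p \<in> I" "z p D \<noteq> 0" by auto
    have fin: "finite (I - {p})" and card: "D < card (I - {p})"
      using Suc.prems p by auto
    obtain c where c: "\<exists>i\<in>I - {p}. c i \<noteq> 0"
        "\<forall>j<D. (\<Sum>i\<in>I - {p}. c i * (z i j - z i D / z p D * z p j)) = 0"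
      using Suc.IH[OF fin card, of "\<lambda>i j. z i j - z i D / z p D * z p j"] by blast
    \<comment> \<open>The coefficient of the pivot collects the multiples of it that were subtracted
      from the other vectors.\<close>
    define s where "s = (\<Sum>i\<in>I - {p}. c i * z i D / z p D)"
    define c' where "c' = c(p := - s)"
    have "(\<Sum>i\<in>I. c' i * z i j) = 0" if j: "j < Suc D" for j
    proof -
      have "(\<Sum>i\<in>I. c' i * z i j) = c' p * z p j + (\<Sum>i\<in>I - {p}. c' i * z i j)"
        by (rule sum.remove[OF Suc.prems(1) p(1)])
      also have "(\<Sum>i\<in>I - {p}. c' i * z i j) = (\<Sum>i\<in>I - {p}. c i * z i j)"
        by (intro sum.cong) (auto simp: c'_def)
      also have "c' p * z p j + \<dots> = (\<Sum>i\<in>I - {p}. c i * (z i j - z i D / z p D * z p j))"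
        by (simp add: c'_def s_def right_diff_distrib sum_subtractf sum_distrib_left sum_distrib_right mult_ac)
      also have "\<dots> = 0"
      proof (cases "j = D")
        case True
        then show ?thesis using p by simp
      next
        case False
        then show ?thesis using c(2) j by simp
      qed
      finally show ?thesis .
    qed
    moreover have "\<exists>i\<in>I. c' i \<noteq> 0" using c(1) by (auto simp: c'_def)
    ultimately show ?thesis by blast
  qed
qed

section \<open>The Sauer-Shelah lemma and the shatter dimension of halfspaces\<close>

definition shatters :: "'a set set \<Rightarrow> 'a set \<Rightarrow> bool" where
  "shatters \<F> Y \<longleftrightarrow> (\<forall>S\<subseteq>Y. \<exists>A\<in>\<F>. A \<inter> Y = S)"

text \<open>Pajor's form of the Sauer-Shelah lemma. A point x splits the family into A, its members
  with x removed, and B, the members that occur both with and without x. Sets shattered by A are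
  shattered by the family, and those shattered by B remain so after x is added.\<close>

lemma card_le_card_shattered:
  assumes "finite X" "\<F> \<subseteq> Pow X"
  shows "card \<F> \<le> card {Y. Y \<subseteq> X \<and> shatters \<F> Y}"
  using assms
proof (induction X arbitrary: \<F> rule: finite_induct)
  case empty
  show ?case
  proof (cases "\<F> = {}")
    case False
    then have "\<F> = {{}}" using empty by auto
    moreover have "{Y. Y \<subseteq> {} \<and> shatters {{}} Y} = {{} :: 'a set}" by (auto simp: shatters_def)
    ultimately show ?thesis by (simp only:)
  qed simp
next
  case (insert x X)
  define A where "A = (\<lambda>S. S - {x}) ` \<F>"
  define B where "B = {S. x \<notin> S \<and> S \<in> \<F> \<and> insert x S \<in> \<F>}"
  have fin: "finite \<F>" using insert by (meson finite_insert finite_Pow_iff finite_subset)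
  have AX: "A \<subseteq> Pow X" and BX: "B \<subseteq> Pow X" using insert.prems insert.hyps by (auto simp: A_def B_def)
  have finAB: "finite A" "finite B" using AX BX insert.hyps by (meson finite_Pow_iff finite_subset)+
  have card: "card \<F> = card A + card B"
  proof -
    define F0 F1 where "F0 = {S\<in>\<F>. x \<notin> S}" and "F1 = {S\<in>\<F>. x \<in> S}"
    have "card \<F> = card F0 + card F1"
      using fin by (subst card_Un_disjoint[symmetric]) (auto simp: F0_def F1_def intro: arg_cong[of _ _ card])
    also have "card F1 = card ((\<lambda>S. S - {x}) ` F1)"
      by (rule card_image[symmetric]) (auto simp: inj_on_def F1_def)
    also have "card F0 + card ((\<lambda>S. S - {x}) ` F1) = card (F0 \<union> (\<lambda>S. S - {x}) ` F1) + card (F0 \<inter> (\<lambda>S. S - {x}) ` F1)"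
      using fin by (intro card_Un_Int) (auto simp: F0_def F1_def)
    also have "F0 \<union> (\<lambda>S. S - {x}) ` F1 = A"
      by (auto simp: A_def F0_def F1_def image_iff)
    also have "F0 \<inter> (\<lambda>S. S - {x}) ` F1 = B"
    proof (intro Set.set_eqI iffI)
      fix S assume "S \<in> F0 \<inter> (\<lambda>S. S - {x}) ` F1"
      then obtain S' where "S \<in> \<F>" "x \<notin> S" "S' \<in> \<F>" "x \<in> S'" "S = S' - {x}"
        by (auto simp: F0_def F1_def)
      moreover from this have "insert x S = S'" by auto
      ultimately show "S \<in> B" by (simp add: B_def)
    next
      fix S assume "S \<in> B"
      then have "S \<in> \<F>" "x \<notin> S" "insert x S \<in> \<F>" "S = insert x S - {x}" by (auto simp: B_def)
      then show "S \<in> F0 \<inter> (\<lambda>S. S - {x}) ` F1" unfolding F0_def F1_def by blast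
    qed
    finally show ?thesis .
  qed
  define SA SB where "SA = {Y. Y \<subseteq> X \<and> shatters A Y}" and "SB = insert x ` {Y. Y \<subseteq> X \<and> shatters B Y}"
  have finX: "finite {Y. Y \<subseteq> X \<and> P Y}" for P
    using insert.hyps by (auto intro: finite_subset[of _ "Pow X"])
  have "card A + card B \<le> card SA + card SB"
  proof (intro add_mono)
    show "card A \<le> card SA" unfolding SA_def by (rule insert.IH[OF AX])
    have "card SB = card {Y. Y \<subseteq> X \<and> shatters B Y}"
      unfolding SB_def using insert.hyps by (intro card_image) (auto simp: inj_on_def)
    then show "card B \<le> card SB" using insert.IH[OF BX] by simp
  qed
  also have "\<dots> = card (SA \<union> SB)"
    using insert.hyps finX by (intro card_Un_disjoint[symmetric]) (auto simp: SA_def SB_def)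
  also have "\<dots> \<le> card {Y. Y \<subseteq> insert x X \<and> shatters \<F> Y}"
  proof (rule card_mono)
    show "finite {Y. Y \<subseteq> insert x X \<and> shatters \<F> Y}"
      using insert.hyps by (auto intro: finite_subset[of _ "Pow (insert x X)"])
    show "SA \<union> SB \<subseteq> {Y. Y \<subseteq> insert x X \<and> shatters \<F> Y}"
    proof
      fix Y assume "Y \<in> SA \<union> SB"
      then show "Y \<in> {Y. Y \<subseteq> insert x X \<and> shatters \<F> Y}"
      proof
        assume "Y \<in> SA"
        then have Y: "Y \<subseteq> X" "shatters A Y" by (auto simp: SA_def)
        then have "x \<notin> Y" using insert.hyps by auto
        have "\<exists>S\<in>\<F>. S \<inter> Y = S'" if "S' \<subseteq> Y" for S'
        proof -
          obtain S where "S \<in> \<F>" "(S - {x}) \<inter> Y = S'"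
            using Y(2) \<open>S' \<subseteq> Y\<close> unfolding shatters_def A_def by auto
          then show ?thesis using \<open>x \<notin> Y\<close> by (intro bexI[of _ S]) auto
        qed
        then show ?thesis using Y(1) by (auto simp: shatters_def)
      next
        assume "Y \<in> SB"
        then obtain Y' where Y: "Y = insert x Y'" "Y' \<subseteq> X" "shatters B Y'" by (auto simp: SB_def)
        then have "x \<notin> Y'" using insert.hyps by auto
        have "\<exists>S\<in>\<F>. S \<inter> Y = S'" if S': "S' \<subseteq> Y" for S'
        proof -
          have "S' - {x} \<subseteq> Y'" using S' Y by auto
          then obtain S where S: "S \<in> B" "S \<inter> Y' = S' - {x}"
            using Y(3) unfolding shatters_def by blast
          show ?thesis
          proof (cases "x \<in> S'")
            case True
            then show ?thesis using S S' Y \<open>x \<notin> Y'\<close>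
              by (intro bexI[of _ "insert x S"]) (auto simp: B_def)
          next
            case False
            then show ?thesis using S S' Y \<open>x \<notin> Y'\<close>
              by (intro bexI[of _ S]) (auto simp: B_def)
          qed
        qed
        then show ?thesis using Y by (auto simp: shatters_def)
      qed
    qed
  qed
  finally show ?case using card by simp
qed

text \<open>A subset with at most k elements is the range of a list of length k padded with
  \<open>None\<close>; this gives a closed form instead of a sum of binomial coefficients.\<close>

lemma card_small_subsets_le:
  assumes "finite X"
  shows "card {Y. Y \<subseteq> X \<and> card Y \<le> k} \<le> (card X + 1) ^ k"
proof -
  define G where "G = {..<k} \<rightarrow>\<^sub>E insert None (Some ` X)"
  have fG: "finite G" using assms unfolding G_def by (intro finite_PiE) auto
  have "{Y. Y \<subseteq> X \<and> card Y \<le> k} \<subseteq> (\<lambda>g. {x. \<exists>i<k. g i = Some x}) ` G"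
  proof
    fix Y assume "Y \<in> {Y. Y \<subseteq> X \<and> card Y \<le> k}"
    then have Y: "Y \<subseteq> X" "card Y \<le> k" by auto
    then have "finite Y" using assms finite_subset by auto
    then obtain e where e: "bij_betw e {0..<card Y} Y" using ex_bij_betw_nat_finite by blast
    define g where "g = (\<lambda>i\<in>{..<k}. if i < card Y then Some (e i) else None)"
    have "e i \<in> X" if "i < card Y" for i
      using e Y(1) that by (auto simp: bij_betw_def)
    then have "g \<in> G" by (auto simp: G_def g_def)
    moreover have "Y = {x. \<exists>i<k. g i = Some x}"
    proof (intro Set.set_eqI iffI)
      fix x assume "x \<in> Y"
      then obtain i where "i < card Y" "e i = x"
        using bij_betw_imp_surj_on[OF e] by (metis atLeastLessThan_iff imageE)
      then show "x \<in> {x. \<exists>i<k. g i = Some x}" using Y(2) by (auto simp: g_def intro!: exI[of _ i])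
    next
      fix x assume "x \<in> {x. \<exists>i<k. g i = Some x}"
      then obtain i where "i < card Y" "e i = x" by (auto simp: g_def split: if_splits)
      then show "x \<in> Y" using e by (auto simp: bij_betw_def)
    qed
    ultimately show "Y \<in> (\<lambda>g. {x. \<exists>i<k. g i = Some x}) ` G" by blast
  qed
  then have "card {Y. Y \<subseteq> X \<and> card Y \<le> k} \<le> card G"
    using fG by (meson card_image_le card_mono finite_imageI order_trans)
  also have "card G = (card X + 1) ^ k"
    using assms by (simp add: G_def card_PiE card_insert_if card_image)
  finally show ?thesis .
qed

text \<open>Affine halfspaces in dimension \<open>D\<close> are linear ones in dimension \<open>D + 1\<close>.\<close>
definition halfspace_traces :: "nat \<Rightarrow> 'i set \<Rightarrow> ('i \<Rightarrow> nat \<Rightarrow> real) \<Rightarrow> 'i set set" where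
  "halfspace_traces D X z = {{i\<in>X. (\<Sum>j<D. v j * z i j) < \<theta>} | v \<theta>. True}"

text \<open>D + 2 points are affinely dependent. A halfspace that cuts out exactly the points with
  positive coefficient makes every term coefficient times slack nonnegative and one of them
  positive, although the terms sum to 0.\<close>

lemma card_halfspace_traces:
  assumes X: "finite X"
  shows "card (halfspace_traces D X z) \<le> (card X + 1) ^ (D + 1)"
proof -
  let ?F = "halfspace_traces D X z"
  have "card Y \<le> D + 1" if Y: "Y \<subseteq> X" "shatters ?F Y" for Y
  proof (rule ccontr)
    assume "\<not> card Y \<le> D + 1"
    moreover have fY: "finite Y" using Y X finite_subset by auto
    \<comment> \<open>The additional coordinate 1 turns a linear dependence into an affine
      one.\<close>
    ultimately obtain c0 where c0: "\<exists>i\<in>Y. c0 i \<noteq> 0"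
        "\<forall>j<D+1. (\<Sum>i\<in>Y. c0 i * (if j < D then z i j else 1)) = 0"
      using linear_dependence[OF fY, of "D + 1" "\<lambda>i j. if j < D then z i j else 1"] by auto
    \<comment> \<open>A nontrivial dependence may have only nonpositive coefficients; flipping its
      sign provides a positive one.\<close>
    define \<sigma> :: real where "\<sigma> = (if \<exists>i\<in>Y. c0 i > 0 then 1 else -1)"
    define c where "c i = \<sigma> * c0 i" for i
    have pos: "\<exists>i\<in>Y. c i > 0"
    proof (cases "\<exists>i\<in>Y. c0 i > 0")
      case False
      with c0(1) obtain i where "i \<in> Y" "c0 i < 0" by (meson linorder_neqE_linordered_idom)
      then show ?thesis using False by (auto simp: c_def \<sigma>_def)
    qed (auto simp: c_def \<sigma>_def)
    have lin: "(\<Sum>i\<in>Y. c i * z i j) = 0" if "j < D" for j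
      using c0(2)[rule_format, of j] that by (simp add: c_def mult.assoc sum_distrib_left[symmetric])
    have const: "(\<Sum>i\<in>Y. c i) = 0"
      using c0(2)[rule_format, of D] by (simp add: c_def sum_distrib_left[symmetric])
    obtain S where S: "S \<in> ?F" "S \<inter> Y = {i\<in>Y. c i > 0}"
      using Y(2) unfolding shatters_def by (metis (no_types, lifting) mem_Collect_eq subsetI)
    then obtain v \<theta> where S_eq: "S = {i\<in>X. (\<Sum>j<D. v j * z i j) < \<theta>}"
      by (auto simp: halfspace_traces_def)
    have iff: "(\<Sum>j<D. v j * z i j) < \<theta> \<longleftrightarrow> c i > 0" if "i \<in> Y" for i
      using S that Y(1) unfolding S_eq by blast
    have "(\<Sum>i\<in>Y. c i * (\<theta> - (\<Sum>j<D. v j * z i j)))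
        = (\<Sum>i\<in>Y. c i) * \<theta> - (\<Sum>i\<in>Y. \<Sum>j<D. v j * (c i * z i j))"
      by (simp add: right_diff_distrib sum_subtractf sum_distrib_right sum_distrib_left mult_ac)
    also have "(\<Sum>i\<in>Y. \<Sum>j<D. v j * (c i * z i j)) = (\<Sum>j<D. v j * (\<Sum>i\<in>Y. c i * z i j))"
      by (subst sum.swap) (simp add: sum_distrib_left)
    also have "\<dots> = 0" by (simp add: lin)
    finally have "(\<Sum>i\<in>Y. c i * (\<theta> - (\<Sum>j<D. v j * z i j))) = 0" using const by simp
    moreover obtain p where p: "p \<in> Y" "c p > 0" using pos by auto
    then have "0 < (\<Sum>i\<in>Y. c i * (\<theta> - (\<Sum>j<D. v j * z i j)))"
    proof (intro sum_pos2[OF fY, of p])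
      show "0 < c p * (\<theta> - (\<Sum>j<D. v j * z p j))" using iff[OF p(1)] p(2) by simp
      fix i assume "i \<in> Y"
      then show "0 \<le> c i * (\<theta> - (\<Sum>j<D. v j * z i j))"
        using iff[of i] by (cases "c i > 0") (auto intro: mult_nonpos_nonpos)
    qed
    ultimately show False by simp
  qed
  then have "{Y. Y \<subseteq> X \<and> shatters ?F Y} \<subseteq> {Y. Y \<subseteq> X \<and> card Y \<le> D + 1}" by auto
  then have "card {Y. Y \<subseteq> X \<and> shatters ?F Y} \<le> card {Y. Y \<subseteq> X \<and> card Y \<le> D + 1}"
    using X by (intro card_mono) (auto intro: finite_subset[of _ "Pow X"])
  also have "\<dots> \<le> (card X + 1) ^ (D + 1)" by (rule card_small_subsets_le[OF X])
  finally have "card {Y. Y \<subseteq> X \<and> shatters ?F Y} \<le> (card X + 1) ^ (D + 1)" .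
  moreover have "?F \<subseteq> Pow X" by (auto simp: halfspace_traces_def)
  ultimately show ?thesis using card_le_card_shattered[OF X] by (meson order_trans)
qed

section \<open>Uniform deviation\<close>

text \<open>cosh is the moment generating function of a fair sign. The bound is the analytic core of
  Hoeffding's lemma at probability 1 / 2 and interval length 2 y.\<close>

lemma cosh_le_exp_half_square: "cosh (x::real) \<le> exp (x\<^sup>2 / 2)"
proof -
  have *: "cosh y \<le> exp (y\<^sup>2 / 2)" if "0 \<le> y" for y :: real
  proof -
    have pos: "0 < 1 + exp (2 * y)" by (simp add: add_pos_pos)
    have eq: "1 + 1 / 2 * (exp (2 * y) - 1) = (1 + exp (2 * y)) / 2" by (simp add: field_simps)
    have "- (2 * y) * (1 / 2) + ln (1 + 1 / 2 * (exp (2 * y) - 1)) \<le> (2 * y)\<^sup>2 / 8"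
      using that by (intro Hoeffdings_lemma_aux) auto
    then have "ln ((1 + exp (2 * y)) / 2) \<le> y\<^sup>2 / 2 + y"
      unfolding eq by (simp add: power2_eq_square)
    then have "exp (ln ((1 + exp (2 * y)) / 2)) \<le> exp (y\<^sup>2 / 2 + y)" by simp
    then have "(1 + exp (2 * y)) / 2 \<le> exp (y\<^sup>2 / 2 + y)" using pos by (simp only: exp_ln half_gt_zero)
    then have "exp (- y) * ((1 + exp (2 * y)) / 2) \<le> exp (- y) * exp (y\<^sup>2 / 2 + y)"
      by (intro mult_left_mono) auto
    also have "\<dots> = exp (y\<^sup>2 / 2)" by (simp add: exp_add[symmetric])
    also have "exp (- y) * ((1 + exp (2 * y)) / 2) = cosh y"
      by (simp add: cosh_field_def distrib_left exp_add[symmetric])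
    finally show ?thesis .
  qed
  show ?thesis using *[of "\<bar>x\<bar>"] by (simp add: cosh_real_abs)
qed

text \<open>A sign vector is encoded by the set of its negative indices, so that a Rademacher
  average becomes a finite sum over a power set.\<close>

definition rsign :: "'i set \<Rightarrow> 'i \<Rightarrow> real" where
  "rsign S i = (if i \<in> S then -1 else 1)"

lemma sum_exp_rademacher_le:
  assumes I: "finite I" and v: "\<And>i. i \<in> I \<Longrightarrow> \<bar>v i\<bar> \<le> 1"
  shows "(\<Sum>S\<in>Pow I. exp (\<eta> * (\<Sum>i\<in>I. rsign S i * v i))) \<le> 2 ^ card I * exp (\<eta>\<^sup>2 * real (card I) / 2)"
proof -
  have "(\<Sum>S\<in>Pow I. exp (\<eta> * (\<Sum>i\<in>I. rsign S i * v i)))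
      = (\<Sum>S\<in>Pow I. (\<Prod>i\<in>S. exp (- (\<eta> * v i))) * (\<Prod>i\<in>I - S. exp (\<eta> * v i)))"
  proof (intro sum.cong refl)
    fix S assume "S \<in> Pow I"
    then have S: "S \<subseteq> I" by simp
    have "exp (\<eta> * (\<Sum>i\<in>I. rsign S i * v i)) = (\<Prod>i\<in>I. exp (\<eta> * (rsign S i * v i)))"
      using I by (simp add: sum_distrib_left exp_sum)
    also have "\<dots> = (\<Prod>i\<in>I - S. exp (\<eta> * (rsign S i * v i))) * (\<Prod>i\<in>S. exp (\<eta> * (rsign S i * v i)))"
      by (rule prod.subset_diff[OF S I])
    also have "\<dots> = (\<Prod>i\<in>S. exp (- (\<eta> * v i))) * (\<Prod>i\<in>I - S. exp (\<eta> * v i))"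
      by (simp add: rsign_def mult.commute)
    finally show "exp (\<eta> * (\<Sum>i\<in>I. rsign S i * v i))
        = (\<Prod>i\<in>S. exp (- (\<eta> * v i))) * (\<Prod>i\<in>I - S. exp (\<eta> * v i))" .
  qed
  \<comment> \<open>Independence of the signs: expanding the product over coordinates yields one
    term for each sign vector.\<close>
  also have "\<dots> = (\<Prod>i\<in>I. exp (- (\<eta> * v i)) + exp (\<eta> * v i))"
    by (rule prod_add[OF I, symmetric])
  also have "\<dots> \<le> (\<Prod>i\<in>I. 2 * exp (\<eta>\<^sup>2 / 2))"
  proof (rule prod_mono, intro conjI)
    fix i assume i: "i \<in> I"
    show "0 \<le> exp (- (\<eta> * v i)) + exp (\<eta> * v i)" by (simp add: add_nonneg_nonneg)
    have "exp (- (\<eta> * v i)) + exp (\<eta> * v i) = 2 * cosh (\<eta> * v i)"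
      by (simp add: cosh_field_def)
    also have "\<dots> \<le> 2 * exp ((\<eta> * v i)\<^sup>2 / 2)"
      using cosh_le_exp_half_square by simp
    also have "\<dots> \<le> 2 * exp (\<eta>\<^sup>2 / 2)"
      using v[OF i] by (simp add: power_mult_distrib mult_left_le abs_square_le_1)
    finally show "exp (- (\<eta> * v i)) + exp (\<eta> * v i) \<le> 2 * exp (\<eta>\<^sup>2 / 2)" .
  qed
  also have "\<dots> = 2 ^ card I * exp (\<eta>\<^sup>2 * real (card I) / 2)"
    by (simp add: power_mult_distrib exp_of_nat_mult[symmetric] mult_ac)
  finally show ?thesis .
qed

text \<open>The inequality \<open>1 + x \<le> exp x\<close> replaces Jensen's inequality in the usual proof.\<close>
lemma massart:
  fixes v :: "'a \<Rightarrow> 'i \<Rightarrow> real"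
  assumes I: "finite I" and T: "finite T" "T \<noteq> {}" and \<eta>: "0 < \<eta>"
    and v: "\<And>A i. A \<in> T \<Longrightarrow> i \<in> I \<Longrightarrow> \<bar>v A i\<bar> \<le> 1"
  shows "(\<Sum>S\<in>Pow I. Max ((\<lambda>A. \<Sum>i\<in>I. rsign S i * v A i) ` T)) / 2 ^ card I
    \<le> (ln (real (card T)) + \<eta>\<^sup>2 * real (card I) / 2) / \<eta>"
proof -
  define m where "m S = Max ((\<lambda>A. \<Sum>i\<in>I. rsign S i * v A i) ` T)" for S
  define N a where "N = real (card T)" and "a = ln N + \<eta>\<^sup>2 * real (card I) / 2"
  have N: "0 < N" using T by (simp add: N_def card_gt_0_iff)
  have exp_m: "exp (\<eta> * m S) \<le> (\<Sum>A\<in>T. exp (\<eta> * (\<Sum>i\<in>I. rsign S i * v A i)))" for S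
  proof -
    have "m S \<in> (\<lambda>A. \<Sum>i\<in>I. rsign S i * v A i) ` T"
      unfolding m_def using T by (intro Max_in) auto
    then obtain A where A: "A \<in> T" "m S = (\<Sum>i\<in>I. rsign S i * v A i)" by auto
    then have "exp (\<eta> * m S) = exp (\<eta> * (\<Sum>i\<in>I. rsign S i * v A i))" by simp
    also have "\<dots> \<le> (\<Sum>A\<in>T. exp (\<eta> * (\<Sum>i\<in>I. rsign S i * v A i)))"
      using T A(1) by (intro member_le_sum) auto
    finally show ?thesis .
  qed
  have "(\<Sum>S\<in>Pow I. exp (\<eta> * m S)) \<le> (\<Sum>S\<in>Pow I. \<Sum>A\<in>T. exp (\<eta> * (\<Sum>i\<in>I. rsign S i * v A i)))"
    by (intro sum_mono exp_m)
  also have "\<dots> = (\<Sum>A\<in>T. \<Sum>S\<in>Pow I. exp (\<eta> * (\<Sum>i\<in>I. rsign S i * v A i)))"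
    by (rule sum.swap)
  also have "\<dots> \<le> (\<Sum>A\<in>T. 2 ^ card I * exp (\<eta>\<^sup>2 * real (card I) / 2))"
    using v by (intro sum_mono sum_exp_rademacher_le I) auto
  also have "\<dots> = 2 ^ card I * exp a"
    using N by (simp add: N_def[symmetric] a_def exp_add)
  finally have sum_exp: "(\<Sum>S\<in>Pow I. exp (\<eta> * m S)) \<le> 2 ^ card I * exp a" .
  have "\<eta> * (\<Sum>S\<in>Pow I. m S) = (\<Sum>S\<in>Pow I. \<eta> * m S)" by (simp add: sum_distrib_left)
  \<comment> \<open>The tangent of exp at a bounds \<open>\<eta> * m S\<close>. By the choice of a
    the terms \<open>exp (\<eta> * m S) * exp (- a)\<close> have average at most 1, which cancels
    the -1.\<close>
  also have "\<dots> \<le> (\<Sum>S\<in>Pow I. a - 1 + exp (\<eta> * m S) * exp (- a))"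
  proof (rule sum_mono)
    fix S
    have "\<eta> * m S - a + 1 \<le> exp (\<eta> * m S - a)" by (metis add.commute exp_ge_add_one_self)
    then show "\<eta> * m S \<le> a - 1 + exp (\<eta> * m S) * exp (- a)"
      by (simp add: exp_add[symmetric])
  qed
  also have "\<dots> = 2 ^ card I * (a - 1) + (\<Sum>S\<in>Pow I. exp (\<eta> * m S)) * exp (- a)"
    using I by (simp add: sum.distrib card_Pow sum_distrib_right)
  also have "\<dots> \<le> 2 ^ card I * (a - 1) + (2 ^ card I * exp a) * exp (- a)"
    using sum_exp by (intro add_left_mono mult_right_mono) auto
  also have "\<dots> = 2 ^ card I * a"
    by (simp add: mult.assoc exp_add[symmetric] algebra_simps)
  finally show ?thesis
    using \<eta> by (simp add: m_def a_def N_def field_simps)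
qed

text \<open>f i is the integral over s >= 0 of the indicator of s < f i. A signed sum of f is thus
  an integral of signed sums of level set indicators, in which only thresholds below L
  contribute.\<close>

lemma layer_cake_le:
  fixes f :: "'i \<Rightarrow> real"
  assumes I: "finite I" and f: "\<And>i. i \<in> I \<Longrightarrow> 0 \<le> f i \<and> f i \<le> L" and "0 \<le> L"
    and le: "\<And>s. (\<Sum>i\<in>I. c i * (if s < f i then 1 else 0)) \<le> m"
  shows "(\<Sum>i\<in>I. c i * f i) \<le> L * m"
proof -
  have ind: "(\<integral>s. indicator {0..<x} s \<partial>lborel) = x" "integrable lborel (indicator {0..<x} :: real \<Rightarrow> real)"
    if "0 \<le> x" for x :: real
    using that by auto
  have "(\<Sum>i\<in>I. c i * f i) = (\<Sum>i\<in>I. c i * (\<integral>s. indicator {0..<f i} s \<partial>lborel))"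
    using f ind by (intro sum.cong) auto
  also have "\<dots> = (\<integral>s. (\<Sum>i\<in>I. c i * indicator {0..<f i} s) \<partial>lborel)"
    using f ind by (subst Bochner_Integration.integral_sum) auto
  also have "\<dots> \<le> (\<integral>s. m * indicator {0..<L} s \<partial>lborel)"
  proof (rule integral_mono)
    show "integrable lborel (\<lambda>s. \<Sum>i\<in>I. c i * indicator {0..<f i} s)"
      using f ind by (intro Bochner_Integration.integrable_sum integrable_mult_right) auto
    show "integrable lborel (\<lambda>s. m * indicator {0..<L} s)"
      using ind[OF \<open>0 \<le> L\<close>] by (intro integrable_mult_right) auto
    fix s :: real
    show "(\<Sum>i\<in>I. c i * indicator {0..<f i} s) \<le> m * indicator {0..<L} s"
    proof (cases "s \<in> {0..<L}")
      case True
      have "(\<Sum>i\<in>I. c i * indicator {0..<f i} s) = (\<Sum>i\<in>I. c i * (if s < f i then 1 else 0))"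
        using True by (intro sum.cong) (auto simp: indicator_def)
      then show ?thesis using le[of s] True by simp
    next
      case False
      then have "(\<Sum>i\<in>I. c i * indicator {0..<f i} s) = 0"
        using f by (intro sum.neutral) (force simp: indicator_def)
      then show ?thesis using False by simp
    qed
  qed
  also have "\<dots> = L * m" using ind[OF \<open>0 \<le> L\<close>] by simp
  finally show ?thesis .
qed

text \<open>
  By the layer cake formula \<open>G w\<close> is a mixture of the indicators of its upper level sets, to whose
  traces Massart's lemma applies.
\<close>
lemma rademacher_le:
  fixes G :: "'w \<Rightarrow> 'a \<Rightarrow> real" and \<zeta> :: "nat \<Rightarrow> 'a"
  assumes W: "finite W" "W \<noteq> {}" and \<eta>: "0 < \<eta>" and L: "0 \<le> L"
    and G: "\<And>w x. w \<in> W \<Longrightarrow> 0 \<le> G w x \<and> G w x \<le> L"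
    and traces: "card {{i\<in>{..<2 * n}. s < G w (\<zeta> i)} | w s. w \<in> W} \<le> (2 * n + 1) ^ k"
  shows "(\<Sum>S\<in>Pow {..<n}. Max ((\<lambda>w. \<Sum>i<n. rsign S i * (G w (\<zeta> (n + i)) - G w (\<zeta> i))) ` W)) / 2 ^ n
    \<le> L * ((real k * ln (2 * real n + 1) + \<eta>\<^sup>2 * real n / 2) / \<eta>)"
proof -
  define T where "T = {{i\<in>{..<2 * n}. s < G w (\<zeta> i)} | w s. w \<in> W}"
  \<comment> \<open>The difference between the ghost half and the sample half of a trace, with
    values in -1, 0, 1 as Massart's lemma requires.\<close>
  define v :: "nat set \<Rightarrow> nat \<Rightarrow> real" where "v A i = indicator A (n + i) - indicator A i" for A i
  define m where "m S = Max ((\<lambda>A. \<Sum>i<n. rsign S i * v A i) ` T)" for S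
  have T: "finite T" unfolding T_def by (rule finite_subset[of _ "Pow {..<2 * n}"]) auto
  obtain w0 where w0: "w0 \<in> W" using W by auto
  have "{} = {i\<in>{..<2 * n}. L < G w0 (\<zeta> i)}" using G[OF w0] by (auto simp: not_less)
  then have T0: "{} \<in> T" using w0 by (auto simp: T_def)
  then have "T \<noteq> {}" by auto
  have cardT: "0 < card T" using T \<open>T \<noteq> {}\<close> by (simp add: card_gt_0_iff)
  have le_m: "(\<Sum>i<n. rsign S i * v A i) \<le> m S" if "A \<in> T" for A S
    unfolding m_def using T that by (intro Max_ge) auto
  have *: "(\<Sum>i<n. rsign S i * (G w (\<zeta> (n + i)) - G w (\<zeta> i))) \<le> L * m S" if w: "w \<in> W" for S w
  proof -
    \<comment> \<open>The signs spread over the double sample: minus on the sample, plus on the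
      ghost sample, both flipped on S.\<close>
    define c where "c i = (if i < n then - rsign S i else rsign S (i - n))" for i
    have split: "(\<Sum>i<2 * n. c i * f i) = (\<Sum>i<n. rsign S i * (f (n + i) - f i))" for f
    proof -
      have "(\<Sum>i<2 * n. c i * f i) = (\<Sum>i<n. c i * f i) + (\<Sum>i=n..<n + n. c i * f i)"
        by (simp add: lessThan_atLeast0 sum.atLeastLessThan_concat mult_2)
      also have "(\<Sum>i=n..<n + n. c i * f i) = (\<Sum>i<n. c (n + i) * f (n + i))"
        using sum.shift_bounds_nat_ivl[of "\<lambda>i. c i * f i" 0 n n] by (simp add: lessThan_atLeast0 add.commute)
      finally show ?thesis
        by (simp add: c_def sum.distrib[symmetric] algebra_simps)
    qed
    have "(\<Sum>i<2 * n. c i * G w (\<zeta> i)) \<le> L * m S"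
    proof (rule layer_cake_le)
      fix s
      let ?A = "{i\<in>{..<2 * n}. s < G w (\<zeta> i)}"
      have "(\<Sum>i<2 * n. c i * (if s < G w (\<zeta> i) then 1 else 0)) = (\<Sum>i<2 * n. c i * indicator ?A i)"
        by (intro sum.cong) (auto simp: indicator_def)
      also have "\<dots> = (\<Sum>i<n. rsign S i * v ?A i)"
        unfolding v_def by (rule split)
      also have "\<dots> \<le> m S" using w by (intro le_m) (auto simp: T_def)
      finally show "(\<Sum>i<2 * n. c i * (if s < G w (\<zeta> i) then 1 else 0)) \<le> m S" .
    qed (use G[OF w] L in auto)
    then show ?thesis by (simp add: split)
  qed
  have "(\<Sum>S\<in>Pow {..<n}. Max ((\<lambda>w. \<Sum>i<n. rsign S i * (G w (\<zeta> (n + i)) - G w (\<zeta> i))) ` W))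
      \<le> (\<Sum>S\<in>Pow {..<n}. L * m S)"
    using W * by (intro sum_mono) auto
  also have "\<dots> = L * (\<Sum>S\<in>Pow {..<n}. m S)" by (simp add: sum_distrib_left)
  finally have "(\<Sum>S\<in>Pow {..<n}. Max ((\<lambda>w. \<Sum>i<n. rsign S i * (G w (\<zeta> (n + i)) - G w (\<zeta> i))) ` W)) / 2 ^ n
      \<le> L * ((\<Sum>S\<in>Pow {..<n}. m S) / 2 ^ n)"
    by (simp add: divide_right_mono)
  also have "(\<Sum>S\<in>Pow {..<n}. m S) / 2 ^ n \<le> (ln (real (card T)) + \<eta>\<^sup>2 * real n / 2) / \<eta>"
    using massart[of "{..<n}" T \<eta> v] T \<open>T \<noteq> {}\<close> \<eta> by (auto simp: m_def v_def indicator_def)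
  also have "\<dots> \<le> (real k * ln (2 * real n + 1) + \<eta>\<^sup>2 * real n / 2) / \<eta>"
  proof -
    have "real (card T) \<le> real ((2 * n + 1) ^ k)"
      using traces by (simp only: T_def of_nat_le_iff)
    then have "ln (real (card T)) \<le> ln (real ((2 * n + 1) ^ k))"
      using cardT by (intro ln_mono) auto
    also have "\<dots> = real k * ln (2 * real n + 1)" by (simp add: ln_realpow add.commute)
    finally show ?thesis using \<eta> by (intro divide_right_mono) auto
  qed
  finally show ?thesis using L by (simp add: mult_left_mono)
qed

section \<open>Symmetrization with a ghost sample\<close>

context sequence_space
begin

lemma integral_component:
  fixes f :: "_ \<Rightarrow> real"
  assumes [measurable]: "f \<in> borel_measurable M"
  shows "(\<integral>\<omega>. f (\<omega> i) \<partial>S) = (\<integral>x. f x \<partial>M)"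
proof -
  have "(\<integral>x. f x \<partial>M) = (\<integral>x. f x \<partial>distr S M (\<lambda>\<omega>. \<omega> i))"
    by (subst distr_PiM_component) (auto intro: prob_space)
  also have "\<dots> = (\<integral>\<omega>. f (\<omega> i) \<partial>S)" by (subst integral_distr) auto
  finally show ?thesis by simp
qed

text \<open>Exchanging entries of the sample with entries of the ghost sample is such a
  reindexing.\<close>

lemma integral_reindex:
  fixes f :: "_ \<Rightarrow> real"
  assumes [measurable]: "f \<in> borel_measurable S" and "inj t"
  shows "(\<integral>\<omega>. f (\<lambda>i. \<omega> (t i)) \<partial>S) = (\<integral>\<omega>. f \<omega> \<partial>S)"
proof -
  have "distr S S (\<lambda>\<omega>. \<lambda>i\<in>UNIV. \<omega> (t i)) = S"
    using distr_PiM_reindex[of UNIV "\<lambda>_. M" t UNIV] assms(2) prob_space by simp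
  moreover have "(\<lambda>\<omega> :: nat \<Rightarrow> 'a. \<lambda>i\<in>UNIV. \<omega> (t i)) = (\<lambda>\<omega>. \<lambda>i. \<omega> (t i))" by (simp add: restrict_def)
  ultimately have "(\<integral>\<omega>. f \<omega> \<partial>S) = (\<integral>\<omega>. f \<omega> \<partial>distr S S (\<lambda>\<omega>. \<lambda>i. \<omega> (t i)))" by simp
  also have "\<dots> = (\<integral>\<omega>. f (\<lambda>i. \<omega> (t i)) \<partial>S)"
    by (subst integral_distr) (auto intro!: measurable_PiM_single' simp: space_PiM PiE_iff)
  finally show ?thesis by simp
qed

theorem symmetrization:
  fixes G :: "'w \<Rightarrow> 'a \<Rightarrow> real"
  assumes W: "finite W" "W \<noteq> {}" and \<eta>: "0 < \<eta>" and L: "0 \<le> L" and n: "1 \<le> n"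
    and [measurable]: "\<And>w. G w \<in> borel_measurable M"
    and G: "\<And>w x. 0 \<le> G w x \<and> G w x \<le> L"
    and traces: "\<And>\<zeta> :: nat \<Rightarrow> 'a. card {{i\<in>{..<2 * n}. s < G w (\<zeta> i)} | w s. w \<in> W} \<le> (2 * n + 1) ^ k"
  shows "(\<integral>\<omega>. Max ((\<lambda>w. (\<integral>x. G w x \<partial>M) - (\<Sum>i<n. G w (\<omega> i)) / real n) ` W) \<partial>S)
    \<le> L * ((real k * ln (2 * real n + 1) / (\<eta> * real n) + \<eta> / 2))"
proof -
  \<comment> \<open>Entries n to 2 n - 1 of the same sequence play the ghost sample; J is the
    largest difference of the two averages after the pairs in S' are exchanged.\<close>
  define J where "J \<omega> S' = Max ((\<lambda>w. (\<Sum>i<n. rsign S' i * (G w (\<omega> (n + i)) - G w (\<omega> i))) / real n) ` W)" for \<omega> S'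
  have J_meas[measurable]: "(\<lambda>\<omega>. J \<omega> S') \<in> borel_measurable S" for S'
    unfolding J_def using W by measurable
  have Max_abs: "\<bar>Max (f ` W)\<bar> \<le> b" if "\<And>w. w \<in> W \<Longrightarrow> \<bar>f w\<bar> \<le> b" for f :: "'w \<Rightarrow> real" and b
  proof -
    have "Max (f ` W) \<in> f ` W" using W by (intro Max_in) auto
    then show ?thesis using that by auto
  qed
  have avg: "\<bar>(\<Sum>i<n. f i) / real n\<bar> \<le> b" if "\<And>i. i < n \<Longrightarrow> \<bar>f i\<bar> \<le> b" for f b
  proof -
    have "\<bar>\<Sum>i<n. f i\<bar> \<le> (\<Sum>i<n. b)" using that by (intro order_trans[OF sum_abs] sum_mono) auto
    then show ?thesis using n by (simp add: divide_le_eq mult.commute)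
  qed
  have J_bound: "\<bar>J \<omega> S'\<bar> \<le> L" for \<omega> S'
    unfolding J_def
  proof (intro Max_abs avg)
    fix w i
    show "\<bar>rsign S' i * (G w (\<omega> (n + i)) - G w (\<omega> i))\<bar> \<le> L"
      using G[of w "\<omega> (n + i)"] G[of w "\<omega> i"] by (auto simp: rsign_def abs_le_iff)
  qed
  have J_int: "integrable S (\<lambda>\<omega>. J \<omega> S')" for S'
    using J_bound by (intro P.integrable_const_bound[where B = L]) auto
  have EG: "\<bar>\<integral>x. G w x \<partial>M\<bar> \<le> L" for w
  proof -
    have "0 \<le> (\<integral>x. G w x \<partial>M)" using G by simp
    moreover have "(\<integral>x. G w x \<partial>M) \<le> L" using G L
      by (intro prob_space.integral_le_const[OF prob_space]
          finite_measure.integrable_const_bound[OF prob_space.finite_measure[OF prob_space], where B = L]) auto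
    ultimately show ?thesis by simp
  qed
  have avgG: "0 \<le> (\<Sum>i<n. G w (f i)) / real n" "(\<Sum>i<n. G w (f i)) / real n \<le> L" for w f
  proof -
    show "0 \<le> (\<Sum>i<n. G w (f i)) / real n" using G by (intro divide_nonneg_nonneg sum_nonneg) auto
    have "\<bar>(\<Sum>i<n. G w (f i)) / real n\<bar> \<le> L" using G by (intro avg) auto
    then show "(\<Sum>i<n. G w (f i)) / real n \<le> L" by (rule order_trans[OF abs_ge_self])
  qed
  have E_avg: "(\<integral>\<omega>. (\<Sum>i<n. G w (\<omega> i)) / real n \<partial>S) = (\<integral>x. G w x \<partial>M)" for w
  proof -
    have "(\<integral>\<omega>. (\<Sum>i<n. G w (\<omega> i)) \<partial>S) = (\<Sum>i<n. (\<integral>\<omega>. G w (\<omega> i) \<partial>S))"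
      using G by (intro Bochner_Integration.integral_sum P.integrable_const_bound[where B = L]) auto
    also have "\<dots> = real n * (\<integral>x. G w x \<partial>M)" by (simp add: integral_component)
    finally show ?thesis using n by simp
  qed
  define H where "H \<omega> \<omega>' = Max ((\<lambda>w. (\<Sum>i<n. G w (\<omega>' i)) / real n - (\<Sum>i<n. G w (\<omega> i)) / real n) ` W)" for \<omega> \<omega>'
  have H_meas[measurable]: "(\<lambda>(\<omega>, \<omega>'). H \<omega> \<omega>') \<in> borel_measurable (S \<Otimes>\<^sub>M S)"
    unfolding H_def split_beta' using W by measurable
  have H_bound: "\<bar>H \<omega> \<omega>'\<bar> \<le> L" for \<omega> \<omega>'
    unfolding H_def
  proof (intro Max_abs)
    fix w
    show "\<bar>(\<Sum>i<n. G w (\<omega>' i)) / real n - (\<Sum>i<n. G w (\<omega> i)) / real n\<bar> \<le> L"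
      using avgG[of w \<omega>] avgG[of w \<omega>'] by (auto simp: abs_le_iff)
  qed
  interpret SS: pair_prob_space S S ..
  \<comment> \<open>The population mean is the mean of a ghost average, and a maximum of means is at
    most the mean of the maximum.\<close>
  have "(\<integral>\<omega>. Max ((\<lambda>w. (\<integral>x. G w x \<partial>M) - (\<Sum>i<n. G w (\<omega> i)) / real n) ` W) \<partial>S)
      \<le> (\<integral>\<omega>. (\<integral>\<omega>'. H \<omega> \<omega>' \<partial>S) \<partial>S)"
  proof (rule integral_mono)
    show "integrable S (\<lambda>\<omega>. Max ((\<lambda>w. (\<integral>x. G w x \<partial>M) - (\<Sum>i<n. G w (\<omega> i)) / real n) ` W))"
    proof (rule P.integrable_const_bound[where B = "2 * L"])
      show "AE \<omega> in S. norm (Max ((\<lambda>w. (\<integral>x. G w x \<partial>M) - (\<Sum>i<n. G w (\<omega> i)) / real n) ` W)) \<le> 2 * L"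
      proof (intro AE_I2, unfold real_norm_def, intro Max_abs)
        fix \<omega> w
        show "\<bar>(\<integral>x. G w x \<partial>M) - (\<Sum>i<n. G w (\<omega> i)) / real n\<bar> \<le> 2 * L"
          using avgG[of w \<omega>] EG[of w] by (auto simp: abs_le_iff)
      qed
      show "(\<lambda>\<omega>. Max ((\<lambda>w. (\<integral>x. G w x \<partial>M) - (\<Sum>i<n. G w (\<omega> i)) / real n) ` W)) \<in> borel_measurable S"
        using W by measurable
    qed
    show "integrable S (\<lambda>\<omega>. \<integral>\<omega>'. H \<omega> \<omega>' \<partial>S)"
      using H_bound by (intro SS.integrable_fst SS.P.integrable_const_bound[where B = L]) auto
    fix \<omega> assume [measurable]: "\<omega> \<in> space S"
    have H_int: "integrable S (\<lambda>\<omega>'. H \<omega> \<omega>')"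
      using H_bound by (intro P.integrable_const_bound[where B = L]) auto
    show "Max ((\<lambda>w. (\<integral>x. G w x \<partial>M) - (\<Sum>i<n. G w (\<omega> i)) / real n) ` W) \<le> (\<integral>\<omega>'. H \<omega> \<omega>' \<partial>S)"
    proof (subst Max_le_iff)
      show "\<forall>a\<in>(\<lambda>w. (\<integral>x. G w x \<partial>M) - (\<Sum>i<n. G w (\<omega> i)) / real n) ` W. a \<le> (\<integral>\<omega>'. H \<omega> \<omega>' \<partial>S)"
      proof safe
        fix w assume w: "w \<in> W"
        have int: "integrable S (\<lambda>\<omega>'. (\<Sum>i<n. G w (\<omega>' i)) / real n)"
          using avgG by (intro P.integrable_const_bound[where B = L]) (simp_all add: abs_of_nonneg del: abs_divide)
        have "(\<integral>x. G w x \<partial>M) - (\<Sum>i<n. G w (\<omega> i)) / real n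
            = (\<integral>\<omega>'. (\<Sum>i<n. G w (\<omega>' i)) / real n - (\<Sum>i<n. G w (\<omega> i)) / real n \<partial>S)"
          using int by (subst Bochner_Integration.integral_diff) (use E_avg[of w] in \<open>auto simp: P.prob_space\<close>)
        also have "\<dots> \<le> (\<integral>\<omega>'. H \<omega> \<omega>' \<partial>S)"
          using int w W by (intro integral_mono H_int) (auto simp: H_def intro!: Max_ge)
        finally show "(\<integral>x. G w x \<partial>M) - (\<Sum>i<n. G w (\<omega> i)) / real n \<le> (\<integral>\<omega>'. H \<omega> \<omega>' \<partial>S)" .
      qed
    qed (use W in auto)
  qed
  also have "\<dots> = (\<integral>z. H (fst z) (snd z) \<partial>(S \<Otimes>\<^sub>M S))"
    using H_bound by (subst SS.integral_fst) (auto simp: split_beta' intro!: SS.P.integrable_const_bound[where B = L])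
  \<comment> \<open>\<open>comb_seq\<close> puts the independent ghost sequence behind the first n
    entries; the joint law is again that of one sequence of independent examples.\<close>
  also have "\<dots> = (\<integral>z. J (comb_seq n (fst z) (snd z)) {} \<partial>(S \<Otimes>\<^sub>M S))"
  proof -
    have "H \<omega> \<omega>' = J (comb_seq n \<omega> \<omega>') {}" for \<omega> \<omega>'
      by (simp add: H_def J_def rsign_def sum_subtractf diff_divide_distrib comb_seq_def)
    then show ?thesis by simp
  qed
  also have "\<dots> = (\<integral>\<omega>. J \<omega> {} \<partial>distr (S \<Otimes>\<^sub>M S) S (\<lambda>(\<omega>, \<omega>'). comb_seq n \<omega> \<omega>'))"
    by (subst integral_distr) (auto simp: split_beta')
  also have "\<dots> = (\<integral>\<omega>. J \<omega> {} \<partial>S)" by (simp only: PiM_comb_seq)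
  finally have 1: "(\<integral>\<omega>. Max ((\<lambda>w. (\<integral>x. G w x \<partial>M) - (\<Sum>i<n. G w (\<omega> i)) / real n) ` W) \<partial>S)
      \<le> (\<integral>\<omega>. J \<omega> {} \<partial>S)" .
  have swap: "(\<integral>\<omega>. J \<omega> S' \<partial>S) = (\<integral>\<omega>. J \<omega> {} \<partial>S)" if "S' \<subseteq> {..<n}" for S'
  proof -
    \<comment> \<open>The involution that swaps i and n + i exactly for i in S', which has the
      effect of the signs.\<close>
    define t where "t i = (if i \<in> S' then n + i else if n \<le> i \<and> i - n \<in> S' then i - n else i)" for i
    have "t (t i) = i" for i using that by (auto simp: t_def)
    then have "inj t" by (metis injI)
    have "J \<omega> S' = J (\<lambda>i. \<omega> (t i)) {}" for \<omega>
    proof -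
      have "rsign S' i * (G w (\<omega> (n + i)) - G w (\<omega> i)) = rsign {} i * (G w (\<omega> (t (n + i))) - G w (\<omega> (t i)))"
        if i: "i < n" for w i
        using \<open>S' \<subseteq> {..<n}\<close> i by (auto simp: rsign_def t_def)
      then show ?thesis by (simp add: J_def)
    qed
    then have "(\<integral>\<omega>. J \<omega> S' \<partial>S) = (\<integral>\<omega>. J (\<lambda>i. \<omega> (t i)) {} \<partial>S)" by simp
    also have "\<dots> = (\<integral>\<omega>. J \<omega> {} \<partial>S)" by (intro integral_reindex \<open>inj t\<close>) simp
    finally show ?thesis .
  qed
  have "(\<integral>\<omega>. J \<omega> {} \<partial>S) = (\<Sum>S'\<in>Pow {..<n}. (\<integral>\<omega>. J \<omega> S' \<partial>S)) / 2 ^ n"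
  proof -
    have "(\<Sum>S'\<in>Pow {..<n}. (\<integral>\<omega>. J \<omega> S' \<partial>S)) = (\<Sum>S'\<in>Pow {..<n}. (\<integral>\<omega>. J \<omega> {} \<partial>S))"
      by (intro sum.cong refl swap) auto
    then show ?thesis by (simp add: card_Pow)
  qed
  also have "\<dots> = (\<integral>\<omega>. (\<Sum>S'\<in>Pow {..<n}. J \<omega> S') / 2 ^ n \<partial>S)"
    using J_int by (simp add: Bochner_Integration.integral_sum)
  also have "\<dots> \<le> (\<integral>\<omega>. L * ((real k * ln (2 * real n + 1) / (\<eta> * real n) + \<eta> / 2)) \<partial>S)"
  proof (rule integral_mono)
    show "integrable S (\<lambda>\<omega>. (\<Sum>S'\<in>Pow {..<n}. J \<omega> S') / 2 ^ n)"
      using J_int by (intro integrable_divide Bochner_Integration.integrable_sum) auto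
    fix \<omega>
    have "J \<omega> S' = Max ((\<lambda>w. \<Sum>i<n. rsign S' i * (G w (\<omega> (n + i)) - G w (\<omega> i))) ` W) / real n" for S'
    proof -
      have "mono (\<lambda>x. x / real n)" by (auto intro!: monoI divide_right_mono)
      from mono_Max_commute[OF this, of "(\<lambda>w. \<Sum>i<n. rsign S' i * (G w (\<omega> (n + i)) - G w (\<omega> i))) ` W"] W
      show ?thesis by (simp add: J_def image_image)
    qed
    then have "(\<Sum>S'\<in>Pow {..<n}. J \<omega> S') / 2 ^ n
      = ((\<Sum>S'\<in>Pow {..<n}. Max ((\<lambda>w. \<Sum>i<n. rsign S' i * (G w (\<omega> (n + i)) - G w (\<omega> i))) ` W)) / 2 ^ n) / real n"
      by (simp add: sum_divide_distrib[symmetric])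
    also have "\<dots> \<le> (L * ((real k * ln (2 * real n + 1) + \<eta>\<^sup>2 * real n / 2) / \<eta>)) / real n"
      using G by (intro divide_right_mono rademacher_le W \<eta> L traces) auto
    also have "\<dots> = L * ((real k * ln (2 * real n + 1) / (\<eta> * real n) + \<eta> / 2))"
      using n \<eta> by (simp add: field_simps power2_eq_square)
    finally show "(\<Sum>S'\<in>Pow {..<n}. J \<omega> S') / 2 ^ n \<le> L * ((real k * ln (2 * real n + 1) / (\<eta> * real n) + \<eta> / 2))" .
  qed simp
  also have "\<dots> = L * ((real k * ln (2 * real n + 1) / (\<eta> * real n) + \<eta> / 2))"
    by (simp add: P.prob_space)
  finally show ?thesis using 1 by linarith
qed

end

section \<open>Chebyshev's inequality for averages and uniform deviation over countable
  classes\<close>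

context sequence_space
begin

lemma indep_components: "P.indep_vars (\<lambda>_. M) (\<lambda>i \<omega>. \<omega> i) (UNIV :: nat set)"
proof (subst P.indep_vars_iff_distr_eq_PiM')
  have "distr S M (\<lambda>\<omega>. \<omega> i) = M" for i
    by (rule distr_PiM_component) (auto intro: prob_space)
  moreover have "distr S S (\<lambda>\<omega>. \<omega>) = S" by (rule distr_id2) simp
  ultimately show "distr S S (\<lambda>x. \<lambda>i\<in>UNIV. x i) = (\<Pi>\<^sub>M i\<in>UNIV. distr S M (\<lambda>\<omega>. \<omega> i))"
    by (simp add: restrict_def)
qed auto

lemma integral_mult_components:
  fixes f :: "'a \<Rightarrow> real"
  assumes int: "integrable M f" and "i \<noteq> j"
  shows "(\<integral>\<omega>. f (\<omega> i) * f (\<omega> j) \<partial>S) = (\<integral>x. f x \<partial>M)\<^sup>2"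
    and "integrable S (\<lambda>\<omega>. f (\<omega> i) * f (\<omega> j))"
proof -
  have [measurable]: "f \<in> borel_measurable M" using int by auto
  have indep: "P.indep_vars (\<lambda>_. borel) (\<lambda>i \<omega>. f (\<omega> i)) {i, j}"
    by (rule P.indep_vars_compose2[OF P.indep_vars_subset[OF indep_components]]) auto
  have int': "integrable S (\<lambda>\<omega>. f (\<omega> k))" for k
  proof -
    have "integrable (distr S M (\<lambda>\<omega>. \<omega> k)) f"
      by (subst distr_PiM_component) (auto intro: prob_space int)
    then show ?thesis by (subst (asm) integrable_distr_eq) auto
  qed
  show "(\<integral>\<omega>. f (\<omega> i) * f (\<omega> j) \<partial>S) = (\<integral>x. f x \<partial>M)\<^sup>2"
    using P.indep_vars_lebesgue_integral[OF _ indep] int' assms(2)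
    by (simp add: integral_component power2_eq_square)
  show "integrable S (\<lambda>\<omega>. f (\<omega> i) * f (\<omega> j))"
    using P.indep_vars_integrable[OF _ indep] int' assms(2) by simp
qed

text \<open>The raw second moment stands in for the variance, which it dominates; it is the quantity
  that \<open>logistic_moments\<close> controls.\<close>

lemma chebyshev_average:
  fixes f :: "'a \<Rightarrow> real"
  assumes int: "integrable M f" "integrable M (\<lambda>x. (f x)\<^sup>2)" and n: "1 \<le> n" and a: "0 < a"
  shows "P.prob {\<omega> \<in> space S. a < (\<Sum>i<n. f (\<omega> i)) / real n - (\<integral>x. f x \<partial>M)}
    \<le> (\<integral>x. (f x)\<^sup>2 \<partial>M) / (real n * a\<^sup>2)"
proof -
  define \<mu> where "\<mu> = (\<integral>x. f x \<partial>M)"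
  define g where "g x = f x - \<mu>" for x
  interpret M: prob_space M by (rule prob_space)
  have [measurable]: "f \<in> borel_measurable M" using int by auto
  have [measurable]: "g \<in> borel_measurable M" unfolding g_def by measurable
  have gint: "integrable M g" "(\<integral>x. g x \<partial>M) = 0"
  proof -
    show "integrable M g"
      unfolding g_def by (intro Bochner_Integration.integrable_diff int M.integrable_const)
    show "(\<integral>x. g x \<partial>M) = 0"
      unfolding g_def using int by (subst Bochner_Integration.integral_diff) (auto simp: \<mu>_def M.prob_space)
  qed
  have gsq: "(\<lambda>x. (g x)\<^sup>2) = (\<lambda>x. (f x)\<^sup>2 - 2 * \<mu> * f x + \<mu>\<^sup>2)"
    by (auto simp: g_def power2_eq_square algebra_simps)
  have g2: "integrable M (\<lambda>x. (g x)\<^sup>2)" "(\<integral>x. (g x)\<^sup>2 \<partial>M) = (\<integral>x. (f x)\<^sup>2 \<partial>M) - \<mu>\<^sup>2"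
  proof -
    show "integrable M (\<lambda>x. (g x)\<^sup>2)"
      unfolding gsq using int by (intro Bochner_Integration.integrable_add
        Bochner_Integration.integrable_diff integrable_mult_right M.integrable_const)
    have "(\<integral>x. (f x)\<^sup>2 - 2 * \<mu> * f x + \<mu>\<^sup>2 \<partial>M) = (\<integral>x. (f x)\<^sup>2 \<partial>M) - 2 * \<mu> * \<mu> + \<mu>\<^sup>2"
      using int by (simp add: M.prob_space \<mu>_def)
    then show "(\<integral>x. (g x)\<^sup>2 \<partial>M) = (\<integral>x. (f x)\<^sup>2 \<partial>M) - \<mu>\<^sup>2"
      unfolding gsq by (simp add: power2_eq_square)
  qed
  have prod: "integrable S (\<lambda>\<omega>. g (\<omega> i) * g (\<omega> j))"
    "(\<integral>\<omega>. g (\<omega> i) * g (\<omega> j) \<partial>S) = (if i = j then \<integral>x. (g x)\<^sup>2 \<partial>M else 0)" for i j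
  proof -
    show "integrable S (\<lambda>\<omega>. g (\<omega> i) * g (\<omega> j))"
    proof (cases "i = j")
      case True
      have "integrable (distr S M (\<lambda>\<omega>. \<omega> i)) (\<lambda>x. (g x)\<^sup>2)"
        by (subst distr_PiM_component) (auto intro: prob_space g2)
      then have "integrable S (\<lambda>\<omega>. (g (\<omega> i))\<^sup>2)" by (subst (asm) integrable_distr_eq) auto
      then show ?thesis using True by (simp add: power2_eq_square)
    qed (rule integral_mult_components[OF gint(1)])
    show "(\<integral>\<omega>. g (\<omega> i) * g (\<omega> j) \<partial>S) = (if i = j then \<integral>x. (g x)\<^sup>2 \<partial>M else 0)"
      using integral_mult_components(1)[OF gint(1), of i j] gint(2) integral_component[of "\<lambda>x. (g x)\<^sup>2" i]
      by (auto simp: power2_eq_square)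
  qed
  have sq: "(\<Sum>i<n. g (\<omega> i))\<^sup>2 = (\<Sum>i<n. \<Sum>j<n. g (\<omega> i) * g (\<omega> j))" for \<omega>
    by (simp add: power2_eq_square sum_product)
  have int_sq: "integrable S (\<lambda>\<omega>. (\<Sum>i<n. g (\<omega> i))\<^sup>2)"
    unfolding sq using prod by (intro Bochner_Integration.integrable_sum) auto
  have "(\<integral>\<omega>. (\<Sum>i<n. g (\<omega> i))\<^sup>2 \<partial>S) = (\<Sum>i<n. \<Sum>j<n. if i = j then \<integral>x. (g x)\<^sup>2 \<partial>M else 0)"
    unfolding sq using prod by (simp add: Bochner_Integration.integral_sum)
  also have "\<dots> = real n * (\<integral>x. (g x)\<^sup>2 \<partial>M)" by simp
  also have "\<dots> \<le> real n * (\<integral>x. (f x)\<^sup>2 \<partial>M)" by (intro mult_left_mono) (auto simp: g2)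
  finally have second: "(\<integral>\<omega>. (\<Sum>i<n. g (\<omega> i))\<^sup>2 \<partial>S) \<le> real n * (\<integral>x. (f x)\<^sup>2 \<partial>M)" .
  have "P.prob {\<omega> \<in> space S. a < (\<Sum>i<n. f (\<omega> i)) / real n - \<mu>}
      \<le> P.prob {\<omega> \<in> space S. (real n * a)\<^sup>2 \<le> (\<Sum>i<n. g (\<omega> i))\<^sup>2}"
  proof (rule P.finite_measure_mono)
    show "{\<omega> \<in> space S. a < (\<Sum>i<n. f (\<omega> i)) / real n - \<mu>}
      \<subseteq> {\<omega> \<in> space S. (real n * a)\<^sup>2 \<le> (\<Sum>i<n. g (\<omega> i))\<^sup>2}"
    proof safe
      fix \<omega> assume "a < (\<Sum>i<n. f (\<omega> i)) / real n - \<mu>"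
      then have "real n * a \<le> real n * ((\<Sum>i<n. f (\<omega> i)) / real n - \<mu>)"
        by (intro mult_left_mono) auto
      also have "\<dots> = (\<Sum>i<n. g (\<omega> i))" using n by (simp add: g_def sum_subtractf algebra_simps)
      finally show "(real n * a)\<^sup>2 \<le> (\<Sum>i<n. g (\<omega> i))\<^sup>2"
        using a by (intro power_mono) auto
    qed
  qed measurable
  also have "\<dots> \<le> (\<integral>\<omega>. (\<Sum>i<n. g (\<omega> i))\<^sup>2 \<partial>S) / (real n * a)\<^sup>2"
    using a n by (intro integral_Markov_inequality_measure[where A = "{}"] int_sq) auto
  also have "\<dots> \<le> (real n * (\<integral>x. (f x)\<^sup>2 \<partial>M)) / (real n * a)\<^sup>2"
    using second by (intro divide_right_mono) auto
  also have "\<dots> = (\<integral>x. (f x)\<^sup>2 \<partial>M) / (real n * a\<^sup>2)"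
    using n by (simp add: power2_eq_square)
  finally show ?thesis by (simp add: \<mu>_def)
qed

text \<open>Adding the zero function to the class makes the supremum nonnegative and does not create new traces.\<close>
theorem uniform_deviation:
  fixes G :: "'w \<Rightarrow> 'a \<Rightarrow> real"
  assumes W: "countable W" "W \<noteq> {}" and \<eta>: "0 < \<eta>" and L: "0 \<le> L" and n: "1 \<le> n" and \<Delta>: "0 < \<Delta>"
    and [measurable]: "\<And>w. G w \<in> borel_measurable M"
    and G: "\<And>w x. 0 \<le> G w x \<and> G w x \<le> L"
    and traces: "\<And>\<zeta> :: nat \<Rightarrow> 'a. card {{i\<in>{..<2 * n}. s < G w (\<zeta> i)} | w s. w \<in> W} \<le> (2 * n + 1) ^ k"
  shows "P.prob {\<omega> \<in> space S. \<exists>w\<in>W. \<Delta> < (\<integral>x. G w x \<partial>M) - (\<Sum>i<n. G w (\<omega> i)) / real n}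
    \<le> L * ((real k * ln (2 * real n + 1) / (\<eta> * real n) + \<eta> / 2)) / \<Delta>"
proof -
  define B where "B = L * ((real k * ln (2 * real n + 1) / (\<eta> * real n) + \<eta> / 2))"
  define dev where "dev w \<omega> = (\<integral>x. G w x \<partial>M) - (\<Sum>i<n. G w (\<omega> i)) / real n" for w \<omega>
  define G' where "G' w = (case w of None \<Rightarrow> (\<lambda>_. 0) | Some w \<Rightarrow> G w)" for w
  have G'_simps[simp]: "G' None = (\<lambda>_. 0)" "G' (Some w) = G w" for w by (auto simp: G'_def)
  have G'_meas[measurable]: "G' w \<in> borel_measurable M" for w by (cases w) auto
  have G'_bnd: "0 \<le> G' w x \<and> G' w x \<le> L" for w x using G L by (cases w) auto
  define dev' where "dev' w \<omega> = (\<integral>x. G' w x \<partial>M) - (\<Sum>i<n. G' w (\<omega> i)) / real n" for w \<omega>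
  have dev'_simps: "dev' None \<omega> = 0" "dev' (Some w) \<omega> = dev w \<omega>" for w \<omega>
    by (auto simp: dev_def dev'_def)
  have [measurable]: "dev w \<in> borel_measurable S" "dev' w' \<in> borel_measurable S" for w w'
    unfolding dev_def dev'_def by measurable
  have fin: "P.prob {\<omega> \<in> space S. \<exists>w\<in>V. \<Delta> < dev w \<omega>} \<le> B / \<Delta>" if V: "finite V" "V \<subseteq> W" for V
  proof -
    define V' where "V' = insert None (Some ` V)"
    have V': "finite V'" "V' \<noteq> {}" using V by (auto simp: V'_def)
    have tr: "card {{i\<in>{..<2 * n}. s < G' w (\<zeta> i)} | w s. w \<in> V'} \<le> (2 * n + 1) ^ k" for \<zeta> :: "nat \<Rightarrow> 'a"
    proof -
      obtain w0 where w0: "w0 \<in> W" using W by auto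
      have "{{i\<in>{..<2 * n}. s < G' w (\<zeta> i)} | w s. w \<in> V'} \<subseteq> {{i\<in>{..<2 * n}. s < G w (\<zeta> i)} | w s. w \<in> W}"
      proof safe
        fix w s assume "w \<in> V'"
        show "\<exists>w' s'. {i\<in>{..<2 * n}. s < G' w (\<zeta> i)} = {i\<in>{..<2 * n}. s' < G w' (\<zeta> i)} \<and> w' \<in> W"
        \<comment> \<open>The zero function leaves only the full trace, at negative thresholds, and
          the empty one. Every member of the class has both, at s and at L respectively.\<close>
        proof (cases w)
          case None
          show ?thesis
          proof (cases "s < 0")
            case True
            have "s < G w0 x" for x using G[of w0 x] True by linarith
            then have "{i\<in>{..<2 * n}. s < G' w (\<zeta> i)} = {i\<in>{..<2 * n}. s < G w0 (\<zeta> i)}"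
              using None True by simp
            then show ?thesis using w0 by blast
          next
            case False
            have "\<not> L < G w0 x" for x using G[of w0 x] by linarith
            then have "{i\<in>{..<2 * n}. s < G' w (\<zeta> i)} = {i\<in>{..<2 * n}. L < G w0 (\<zeta> i)}"
              using None False by simp
            then show ?thesis using w0 by blast
          qed
        next
          case (Some w')
          then show ?thesis using \<open>w \<in> V'\<close> V by (auto simp: V'_def)
        qed
      qed
      moreover have "finite {{i\<in>{..<2 * n}. s < G w (\<zeta> i)} | w s. w \<in> W}"
        by (rule finite_subset[of _ "Pow {..<2 * n}"]) auto
      ultimately show ?thesis by (intro order_trans[OF card_mono traces[of \<zeta>]])
    qed
    have abs_dev': "\<bar>dev' w \<omega>\<bar> \<le> 2 * L" for w \<omega>
    proof -
      interpret M: prob_space M by (rule prob_space)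
      have "0 \<le> (\<integral>x. G' w x \<partial>M)" using G'_bnd by simp
      moreover have "(\<integral>x. G' w x \<partial>M) \<le> L" using G'_bnd
        by (intro M.integral_le_const M.integrable_const_bound[where B = L]) auto
      moreover have "0 \<le> (\<Sum>i<n. G' w (\<omega> i)) / real n"
        using G'_bnd by (intro divide_nonneg_nonneg sum_nonneg) auto
      moreover have "(\<Sum>i<n. G' w (\<omega> i)) \<le> (\<Sum>i<n. L)" using G'_bnd by (intro sum_mono) auto
      then have "(\<Sum>i<n. G' w (\<omega> i)) / real n \<le> L" using n by (simp add: divide_le_eq mult.commute)
      ultimately show ?thesis unfolding dev'_def by linarith
    qed
    have int: "integrable S (\<lambda>\<omega>. Max ((\<lambda>w. dev' w \<omega>) ` V'))"
    proof (rule P.integrable_const_bound[where B = "2 * L"])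
      show "AE \<omega> in S. norm (Max ((\<lambda>w. dev' w \<omega>) ` V')) \<le> 2 * L"
      proof (intro AE_I2)
        fix \<omega>
        have "Max ((\<lambda>w. dev' w \<omega>) ` V') \<in> (\<lambda>w. dev' w \<omega>) ` V'" using V' by (intro Max_in) auto
        then show "norm (Max ((\<lambda>w. dev' w \<omega>) ` V')) \<le> 2 * L" using abs_dev' by auto
      qed
      show "(\<lambda>\<omega>. Max ((\<lambda>w. dev' w \<omega>) ` V')) \<in> borel_measurable S" using V' by measurable
    qed
    have Max_ge: "dev' w \<omega> \<le> Max ((\<lambda>w. dev' w \<omega>) ` V')" if "w \<in> V'" for w \<omega>
      using V' that by (intro Max_ge) auto
    have "P.prob {\<omega> \<in> space S. \<exists>w\<in>V. \<Delta> < dev w \<omega>} \<le> P.prob {\<omega> \<in> space S. \<Delta> \<le> Max ((\<lambda>w. dev' w \<omega>) ` V')}"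
    proof (rule P.finite_measure_mono)
      show "{\<omega> \<in> space S. \<exists>w\<in>V. \<Delta> < dev w \<omega>} \<subseteq> {\<omega> \<in> space S. \<Delta> \<le> Max ((\<lambda>w. dev' w \<omega>) ` V')}"
      proof safe
        fix \<omega> w assume "w \<in> V" "\<Delta> < dev w \<omega>"
        then show "\<Delta> \<le> Max ((\<lambda>w. dev' w \<omega>) ` V')"
          using Max_ge[of "Some w" \<omega>] by (auto simp: V'_def dev'_simps)
      qed
      show "{\<omega> \<in> space S. \<Delta> \<le> Max ((\<lambda>w. dev' w \<omega>) ` V')} \<in> sets S" using int by measurable
    qed
    also have "\<dots> \<le> (\<integral>\<omega>. Max ((\<lambda>w. dev' w \<omega>) ` V') \<partial>S) / \<Delta>"
    proof (intro integral_Markov_inequality_measure[where A = "{}"] int AE_I2 \<Delta>)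
      fix \<omega> show "0 \<le> Max ((\<lambda>w. dev' w \<omega>) ` V')"
        using Max_ge[of None \<omega>] by (auto simp: V'_def dev'_simps)
    qed simp
    also have "\<dots> \<le> B / \<Delta>"
      unfolding B_def dev'_def using \<Delta>
      by (intro divide_right_mono symmetrization V' \<eta> L n G'_meas G'_bnd tr) auto
    finally show ?thesis .
  qed
  \<comment> \<open>The bound does not depend on the number of functions, so it passes to the
    countable class along increasing finite subclasses.\<close>
  define V where "V m = from_nat_into W ` {..m}" for m :: nat
  define A where "A m = {\<omega> \<in> space S. \<exists>w\<in>V m. \<Delta> < dev w \<omega>}" for m
  have VW: "finite (V m)" "V m \<subseteq> W" for m using from_nat_into[OF W(2)] by (auto simp: V_def)
  have A_sets: "range A \<subseteq> P.events"
    unfolding A_def using VW by (auto intro!: sets.sets_Collect_finite_Ex)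
  have "(\<lambda>m. P.prob (A m)) \<longlonglongrightarrow> P.prob (\<Union>m. A m)"
    by (rule P.finite_Lim_measure_incseq[OF A_sets]) (force simp: incseq_def A_def V_def)
  moreover have "P.prob (A m) \<le> B / \<Delta>" for m unfolding A_def by (rule fin[OF VW])
  ultimately have "P.prob (\<Union>m. A m) \<le> B / \<Delta>" by (intro LIMSEQ_le_const2) auto
  also have "(\<Union>m. A m) = {\<omega> \<in> space S. \<exists>w\<in>W. \<Delta> < dev w \<omega>}"
  proof safe
    fix \<omega> w assume "\<omega> \<in> space S" "w \<in> W" "\<Delta> < dev w \<omega>"
    then have "\<omega> \<in> A (to_nat_on W w)" using W by (auto simp: A_def V_def intro!: bexI[of _ "to_nat_on W w"])
    then show "\<omega> \<in> (\<Union>m. A m)" by blast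
  qed (use VW in \<open>auto simp: A_def\<close>)
  finally show ?thesis by (simp add: B_def dev_def)
qed

end

section \<open>Bounded likelihoods\<close>

text \<open>The conditional probability of the label 1 at score t.\<close>

definition lik :: "real \<Rightarrow> real" where
  "lik t = 1 / (1 + exp (- t))"

lemma lik_pos: "0 < lik t" and lik_less_1: "lik t < 1" and lik_minus: "lik (- t) = 1 - lik t"
  and logistic_loss_lik: "logistic_loss t = - ln (lik t)" and sig_lik: "sig t = 2 * lik t - 1"
proof -
  have pos: "0 < 1 + exp (- t)" "0 < 1 + exp t" by (simp_all add: add_pos_pos)
  show "0 < lik t" "lik t < 1" using pos by (auto simp: lik_def)
  show "lik (- t) = 1 - lik t" using pos by (simp add: lik_def exp_minus field_simps)
  show "logistic_loss t = - ln (lik t)" using pos by (simp add: lik_def logistic_loss_def ln_div)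
  show "sig t = 2 * lik t - 1" using pos by (simp add: lik_def sig_def field_simps)
qed

lemma lik_mono: "s \<le> t \<Longrightarrow> lik s \<le> lik t"
  unfolding lik_def by (intro divide_left_mono) (auto simp: add_pos_pos)

lemma continuous_lik: "isCont lik t"
  unfolding lik_def
proof (intro continuous_intros)
  have "0 < 1 + exp (- t)" by (simp add: add_pos_pos)
  then show "1 + exp (- t) \<noteq> 0" by simp
qed

lemma lik_measurable[measurable]: "lik \<in> borel_measurable borel"
  unfolding lik_def by measurable

text \<open>A mixture of the prediction with a fair coin of weight 2 e. It commutes with the
  exchange of p and 1 - p, so the resulting loss is a log loss for both labels.\<close>

definition smooth :: "real \<Rightarrow> real \<Rightarrow> real" where
  "smooth e p = (1 - 2 * e) * p + e"

lemma smooth_bounds: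
  assumes "0 < e" "e < 1 / 2" "0 < p" "p < 1"
  shows "e \<le> smooth e p" "smooth e p < 1" "0 < smooth e p"
proof -
  have "0 \<le> (1 - 2 * e) * p" using assms by (intro mult_nonneg_nonneg) auto
  then show "e \<le> smooth e p" by (simp add: smooth_def)
  then show "0 < smooth e p" using assms(1) by linarith
  define x where "x = (1 - 2 * e) * p"
  have "x \<le> (1 - 2 * e) * 1" unfolding x_def using assms by (intro mult_left_mono) auto
  then have "x + e < 1" using assms(1) by simp
  then show "smooth e p < 1" by (simp add: smooth_def x_def)
qed

definition smooth_loss :: "real \<Rightarrow> real \<Rightarrow> real" where
  "smooth_loss e t = - ln (smooth e (lik t))"

lemma smooth_loss_bounds:
  assumes "0 < e" "e < 1 / 2"
  shows "0 \<le> smooth_loss e t" "smooth_loss e t \<le> - ln e"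
proof -
  note b = smooth_bounds[OF assms lik_pos[of t] lik_less_1]
  show "0 \<le> smooth_loss e t" using b by (simp add: smooth_loss_def)
  have "ln e \<le> ln (smooth e (lik t))" using b assms by (intro ln_mono) auto
  then show "smooth_loss e t \<le> - ln e" by (simp add: smooth_loss_def)
qed

lemma smooth_loss_antimono:
  assumes "0 < e" "e < 1 / 2" "s \<le> t"
  shows "smooth_loss e t \<le> smooth_loss e s"
proof -
  have "smooth e (lik s) \<le> smooth e (lik t)"
    using lik_mono[OF assms(3)] assms by (simp add: smooth_def mult_left_mono)
  then show ?thesis
    using smooth_bounds(3)[OF assms(1,2) lik_pos lik_less_1] by (simp add: smooth_loss_def)
qed

text \<open>Dropping the summand e of \<open>smooth\<close> scales the likelihood by 1 - 2 e. Only
  this direction matters, since smoothing is used for upper bounds on the learned weights.\<close>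

lemma smooth_loss_le_logistic_loss:
  assumes "0 < e" "e < 1 / 2"
  shows "smooth_loss e t \<le> logistic_loss t - ln (1 - 2 * e)"
proof -
  have "ln ((1 - 2 * e) * lik t) \<le> ln (smooth e (lik t))"
    using assms lik_pos[of t] by (intro ln_mono) (auto simp: smooth_def)
  also have "ln ((1 - 2 * e) * lik t) = ln (1 - 2 * e) + ln (lik t)"
    using assms lik_pos[of t] by (simp add: ln_mult)
  finally show ?thesis by (simp add: smooth_loss_def logistic_loss_lik)
qed

lemma continuous_smooth_loss:
  assumes "0 < e" "e < 1 / 2"
  shows "isCont (smooth_loss e) t"
  unfolding smooth_loss_def smooth_def
  using continuous_lik smooth_bounds(3)[OF assms lik_pos lik_less_1, of t]
  by (intro continuous_intros) (auto simp: smooth_def)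

lemma smooth_loss_measurable[measurable]: "smooth_loss e \<in> borel_measurable borel"
  unfolding smooth_loss_def smooth_def by measurable

section \<open>Margins as linear forms and divergence inequalities\<close>

definition signed_features :: "nat \<Rightarrow> example \<Rightarrow> nat \<Rightarrow> real" where
  "signed_features d z j = (if j < d then snd z * fst z j else snd z)"

text \<open>The label is multiplied into the features and the bias is the weight of an additional
  coordinate, so that affine classification in dimension d is homogeneous in dimension d +
  1.\<close>

definition margin :: "nat \<Rightarrow> (nat \<Rightarrow> real) \<Rightarrow> example \<Rightarrow> real" where
  "margin d v z = (\<Sum>j<Suc d. v j * signed_features d z j)"

lemma margin_affine_form: "margin d v z = snd z * affine_form d v (v d) (fst z)"
  by (simp add: margin_def signed_features_def affine_form_def distrib_left sum_distrib_left mult_ac)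

lemma affine_form_upd: "affine_form d (w(d := \<tau>)) ((w(d := \<tau>)) d) x = affine_form d w \<tau> x"
  by (simp add: affine_form_def)

text \<open>The loss decreases in the margin, so an upper level set is a lower set of margins. These
  are linear forms in d + 1 coordinates, whose halfspaces shatter at most d + 2 points.\<close>

lemma smooth_loss_traces:
  assumes e: "0 < e" "e < 1 / 2"
  shows "card {{i\<in>{..<m}. s < smooth_loss e (margin d v (\<zeta> i))} | v s. v \<in> V}
    \<le> (m + 1) ^ (d + 2)"
proof -
  let ?z = "\<lambda>i. signed_features d (\<zeta> i)"
  have "{{i\<in>{..<m}. s < smooth_loss e (margin d v (\<zeta> i))} | v s. v \<in> V} \<subseteq> halfspace_traces (Suc d) {..<m} ?z"
  proof safe
    fix v s
    define A where "A = {i\<in>{..<m}. s < smooth_loss e (margin d v (\<zeta> i))}"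
    \<comment> \<open>The smallest margin outside A, which is attained, so that the strict
      inequality selects A; if nothing is outside, any number above all margins.\<close>
    define \<theta> where "\<theta> = (if {..<m} - A = {} then Max (insert 0 ((\<lambda>i. margin d v (\<zeta> i)) ` {..<m})) + 1
      else Min ((\<lambda>i. margin d v (\<zeta> i)) ` ({..<m} - A)))"
    have "i \<in> A \<longleftrightarrow> margin d v (\<zeta> i) < \<theta>" if i: "i < m" for i
    proof (cases "{..<m} - A = {}")
      case True
      have "margin d v (\<zeta> i) \<le> Max (insert 0 ((\<lambda>i. margin d v (\<zeta> i)) ` {..<m}))"
        using i by (intro Max_ge) auto
      then have "margin d v (\<zeta> i) < \<theta>" using True by (simp add: \<theta>_def)
      then show ?thesis using True i by auto
    next
      case False
      then have \<theta>: "\<theta> = Min ((\<lambda>i. margin d v (\<zeta> i)) ` ({..<m} - A))" by (simp add: \<theta>_def)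
      have "\<theta> \<in> (\<lambda>i. margin d v (\<zeta> i)) ` ({..<m} - A)"
        unfolding \<theta> using False by (intro Min_in) auto
      then obtain k where k: "k < m" "k \<notin> A" "\<theta> = margin d v (\<zeta> k)" by auto
      show ?thesis
      proof
        assume iA: "i \<in> A"
        show "margin d v (\<zeta> i) < \<theta>"
        proof (rule ccontr)
          assume "\<not> margin d v (\<zeta> i) < \<theta>"
          then have "smooth_loss e (margin d v (\<zeta> i)) \<le> smooth_loss e (margin d v (\<zeta> k))"
            using k by (intro smooth_loss_antimono e) auto
          then have "k \<in> A" using iA k by (auto simp: A_def)
          then show False using k by simp
        qed
      next
        assume "margin d v (\<zeta> i) < \<theta>"
        moreover have "\<theta> \<le> margin d v (\<zeta> i)" if "i \<notin> A"
          unfolding \<theta> using i that by (intro Min_le) auto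
        ultimately show "i \<in> A" by force
      qed
    qed
    then have "A = {i\<in>{..<m}. (\<Sum>j<Suc d. v j * ?z i j) < \<theta>}"
      by (auto simp: A_def margin_def)
    then show "{i\<in>{..<m}. s < smooth_loss e (margin d v (\<zeta> i))} \<in> halfspace_traces (Suc d) {..<m} ?z"
      unfolding A_def[symmetric] halfspace_traces_def by blast
  qed
  moreover have "finite (halfspace_traces (Suc d) {..<m} ?z)"
    by (rule finite_subset[of _ "Pow {..<m}"]) (auto simp: halfspace_traces_def)
  moreover have "card (halfspace_traces (Suc d) {..<m} ?z) \<le> (m + 1) ^ (d + 2)"
    using card_halfspace_traces[of "{..<m}" "Suc d" ?z] by simp
  ultimately show ?thesis by (meson card_mono order_trans)
qed

text \<open>Via the Hellinger distance.\<close>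
lemma binary_pinsker:
  fixes p q :: real
  assumes p: "0 < p" "p < 1" and q: "0 < q" "q < 1"
  shows "(p - q)\<^sup>2 / 2 \<le> p * (ln p - ln q) + (1 - p) * (ln (1 - p) - ln (1 - q))"
proof -
  \<comment> \<open>The bound for one of the two outcomes; adding both cancels the linear terms p -
    q.\<close>
  have one: "p - q + (p - q)\<^sup>2 / 4 \<le> p * (ln p - ln q)" if p: "0 < p" "p < 1" and q: "0 < q" "q < 1" for p q :: real
  proof -
    define a b where "a = sqrt p" and "b = sqrt q"
    have a: "0 < a" "a < 1" "p = a\<^sup>2" and b: "0 < b" "b < 1" "q = b\<^sup>2"
      using p q by (auto simp: a_def b_def)
    have "ln (b / a) \<le> b / a - 1" using a b by (intro ln_le_minus_one) simp
    then have "2 * a\<^sup>2 * (1 - b / a) \<le> 2 * a\<^sup>2 * (ln a - ln b)"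
      using a b by (intro mult_left_mono) (auto simp: ln_div)
    also have "2 * a\<^sup>2 * (1 - b / a) = a\<^sup>2 - b\<^sup>2 + (a - b)\<^sup>2"
      using a by (simp add: field_simps power2_eq_square)
    finally have 1: "p - q + (a - b)\<^sup>2 \<le> p * (ln p - ln q)"
      using a b by (simp add: ln_realpow algebra_simps)
    have "(p - q)\<^sup>2 = (a + b)\<^sup>2 * (a - b)\<^sup>2"
      using a b by (simp add: power2_eq_square algebra_simps)
    also have "\<dots> \<le> 2\<^sup>2 * (a - b)\<^sup>2" using a b by (intro mult_right_mono power_mono) auto
    finally show ?thesis using 1 by simp
  qed
  have "((1 - p) - (1 - q))\<^sup>2 = (p - q)\<^sup>2" by (simp add: power2_eq_square algebra_simps)
  then show ?thesis using one[OF p q] one[of "1 - p" "1 - q"] p q by simp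
qed

text \<open>Bounds the contribution of an outcome of probability p to the second moment of its own
  log loss: with a = sqrt p the left side is 4 (a ln a)^2.\<close>

lemma mult_ln_square_le:
  fixes p :: real
  assumes "0 < p" "p < 1"
  shows "p * (ln p)\<^sup>2 \<le> 4"
proof -
  define a where "a = sqrt p"
  have a: "0 < a" "a < 1" "p = a\<^sup>2" using assms by (auto simp: a_def)
  have "ln (1 / a) \<le> 1 / a - 1" using a by (intro ln_le_minus_one) simp
  then have "a * (- ln a) \<le> a * (1 / a - 1)" using a by (intro mult_left_mono) (auto simp: ln_div)
  also have "\<dots> \<le> 1" using a by (simp add: right_diff_distrib)
  finally have "a * (- ln a) \<le> 1" .
  moreover have "0 \<le> a * (- ln a)" using a by (intro mult_nonneg_nonneg) auto
  ultimately have "(a * (- ln a))\<^sup>2 \<le> 1\<^sup>2" by (intro power_mono) auto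
  then show ?thesis using a by (simp add: ln_realpow power_mult_distrib)
qed

section \<open>Excess loss and squared error\<close>

lemma signed_features_measurable:
  assumes "j < Suc d"
  shows "(\<lambda>z. signed_features d z j) \<in> borel_measurable (example_space d)"
proof -
  have [measurable]: "snd \<in> borel_measurable (example_space d)"
    unfolding example_space_def by (rule measurable_compose[OF measurable_snd]) simp
  have "(\<lambda>z. fst z j) \<in> borel_measurable (example_space d)" if "j < d"
    using that unfolding example_space_def feature_space_def
    by (intro measurable_compose[OF measurable_fst] measurable_component_singleton) auto
  then show ?thesis by (cases "j < d") (auto simp: signed_features_def)
qed

lemma margin_measurable: "margin d v \<in> borel_measurable (example_space d)"
  unfolding margin_def using signed_features_measurable
  by (intro borel_measurable_sum borel_measurable_times borel_measurable_const) auto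

lemma affine_form_measurable: "affine_form d v \<theta> \<in> borel_measurable (feature_space d)"
  unfolding affine_form_def feature_space_def by measurable

locale sigmoid_learning =
  fixes d :: nat and w_max :: real and D :: "example measure" and w :: "nat \<Rightarrow> real" and \<tau> :: real
  assumes model: "sigmoid_model d w_max D w \<tau>"
begin

lemma prob_D: "prob_space D" and sets_D: "sets D = sets (example_space d)"
  and norm_D: "AE z in D. L2_set (fst z) {..<d} \<le> sqrt (real d)"
  and cond_D: "AE z in D. real_cond_exp D (feature_algebra d D) snd z = sig (affine_form d w \<tau> (fst z))"
  and w_bound: "L2_set w {..<d} + \<bar>\<tau>\<bar> \<le> w_max"
  using model by (auto simp: sigmoid_model_def split_beta')

sublocale prob_space D by (rule prob_D)

sublocale seq: sequence_space D by standard

lemma space_D: "space D = space (feature_space d) \<times> {-1, 1}"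
  using sets_eq_imp_space_eq[OF sets_D] by (simp add: example_space_def space_pair_measure)

lemma snd_cases: "z \<in> space D \<Longrightarrow> snd z = 1 \<or> snd z = -1"
  unfolding space_D by auto

lemma snd_meas[measurable]: "snd \<in> borel_measurable D"
  unfolding measurable_cong_sets[OF sets_D refl] example_space_def
  by (rule measurable_compose[OF measurable_snd]) simp

lemma fst_meas[measurable]: "fst \<in> measurable D (feature_space d)"
  unfolding measurable_cong_sets[OF sets_D refl] example_space_def by (rule measurable_fst)

lemma margin_meas[measurable]: "margin d v \<in> borel_measurable D"
  unfolding measurable_cong_sets[OF sets_D refl] by (rule margin_measurable)

lemma feature_meas: "h \<in> borel_measurable (feature_space d) \<Longrightarrow> (\<lambda>z. h (fst z)) \<in> borel_measurable D"
  by (rule measurable_compose[OF fst_meas])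

definition score :: "example \<Rightarrow> real" where
  "score z = affine_form d w \<tau> (fst z)"

definition w_star :: "nat \<Rightarrow> real" where "w_star = w(d := \<tau>)"

lemma margin_w_star: "margin d w_star z = snd z * score z"
  unfolding w_star_def margin_affine_form affine_form_upd score_def by simp

lemma score_meas[measurable]: "score \<in> borel_measurable D"
  unfolding score_def by (intro feature_meas affine_form_measurable)

lemma integral_label:
  assumes h[measurable]: "h \<in> borel_measurable (feature_space d)" and int: "integrable D (\<lambda>z. h (fst z))"
  shows "(\<integral>z. snd z * h (fst z) \<partial>D) = (\<integral>z. sig (score z) * h (fst z) \<partial>D)"
    and "integrable D (\<lambda>z. snd z * h (fst z))"
proof -
  interpret sub: finite_measure_subalgebra D "feature_algebra d D"
    by standard (rule subalgebra_feature_algebra[OF sets_D])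
  have hD[measurable]: "(\<lambda>z. h (fst z)) \<in> borel_measurable D" by (rule feature_meas[OF h])
  have hF: "(\<lambda>z. h (fst z)) \<in> borel_measurable (feature_algebra d D)"
    unfolding feature_algebra_def
    by (rule measurable_compose[OF measurable_vimage_algebra1 h]) (use fst_meas in \<open>auto simp: measurable_def\<close>)
  show int1: "integrable D (\<lambda>z. snd z * h (fst z))"
  proof (rule Bochner_Integration.integrable_bound[OF int])
    show "AE z in D. norm (snd z * h (fst z)) \<le> norm (h (fst z))"
    proof (intro AE_I2)
      fix z assume "z \<in> space D"
      then have "\<bar>snd z\<bar> = 1" using snd_cases[of z] by auto
      then show "norm (snd z * h (fst z)) \<le> norm (h (fst z))" by (simp add: abs_mult)
    qed
  qed measurable
  then have int2: "integrable D (\<lambda>z. h (fst z) * snd z)" by (simp add: mult.commute)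
  have "(\<integral>z. snd z * h (fst z) \<partial>D) = (\<integral>z. h (fst z) * snd z \<partial>D)" by (simp add: mult.commute)
  also have "\<dots> = (\<integral>z. h (fst z) * real_cond_exp D (feature_algebra d D) snd z \<partial>D)"
    by (rule sub.real_cond_exp_intg(2)[OF int2 hF, symmetric]) simp
  also have "\<dots> = (\<integral>z. sig (score z) * h (fst z) \<partial>D)"
  proof (rule integral_cong_AE)
    show "AE z in D. h (fst z) * real_cond_exp D (feature_algebra d D) snd z = sig (score z) * h (fst z)"
      using cond_D by eventually_elim (simp add: score_def)
    show "(\<lambda>z. h (fst z) * real_cond_exp D (feature_algebra d D) snd z) \<in> borel_measurable D"
      by (intro borel_measurable_times hD borel_measurable_cond_exp2)
    show "(\<lambda>z. sig (score z) * h (fst z)) \<in> borel_measurable D"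
      unfolding sig_lik by measurable
  qed
  finally show "(\<integral>z. snd z * h (fst z) \<partial>D) = (\<integral>z. sig (score z) * h (fst z) \<partial>D)" .
qed

text \<open>Conditionally on the features the label is a coin with bias
  \<open>lik (score z)\<close>, so the label can be averaged out of any expectation.\<close>

lemma expectation_label:
  assumes h1: "h1 \<in> borel_measurable (feature_space d)" "integrable D (\<lambda>z. h1 (fst z))"
    and h2: "h2 \<in> borel_measurable (feature_space d)" "integrable D (\<lambda>z. h2 (fst z))"
    and F: "\<And>z. z \<in> space D \<Longrightarrow> F z = (if snd z = 1 then h1 (fst z) else h2 (fst z))"
  shows "(\<integral>z. F z \<partial>D) = (\<integral>z. lik (score z) * h1 (fst z) + (1 - lik (score z)) * h2 (fst z) \<partial>D)"
    and "integrable D F"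
    and "integrable D (\<lambda>z. lik (score z) * h1 (fst z) + (1 - lik (score z)) * h2 (fst z))"
proof -
  \<comment> \<open>For labels 1 and -1 the case distinction is the half sum plus the label times
    the half difference g, so only an expectation linear in the label has to be evaluated.\<close>
  define g where "g x = (h1 x - h2 x) / 2" for x
  have g: "g \<in> borel_measurable (feature_space d)" "integrable D (\<lambda>z. g (fst z))"
    unfolding g_def using h1 h2 by auto
  have F_eq: "F z = (h1 (fst z) + h2 (fst z)) / 2 + snd z * g (fst z)" if "z \<in> space D" for z
    using F[OF that] snd_cases[OF that] by (auto simp: g_def field_simps)
  note lab = integral_label[OF g]
  have int: "integrable D (\<lambda>z. (h1 (fst z) + h2 (fst z)) / 2)" using h1 h2 by auto
  show "integrable D F"
    using Bochner_Integration.integrable_add[OF int lab(2)] F_eq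
    by (subst Bochner_Integration.integrable_cong[OF refl F_eq]) auto
  have sig_int: "integrable D (\<lambda>z. sig (score z) * g (fst z))"
  proof (rule Bochner_Integration.integrable_bound[OF g(2)])
    show "(\<lambda>z. sig (score z) * g (fst z)) \<in> borel_measurable D"
      unfolding sig_lik using feature_meas[OF g(1)] by measurable
    have "\<bar>sig t\<bar> \<le> 1" for t using lik_pos[of t] lik_less_1[of t] by (simp add: sig_lik abs_le_iff)
    then show "AE z in D. norm (sig (score z) * g (fst z)) \<le> norm (g (fst z))"
      by (intro AE_I2) (simp add: abs_mult mult_left_le_one_le)
  qed
  have eq: "lik (score z) * h1 (fst z) + (1 - lik (score z)) * h2 (fst z)
      = (h1 (fst z) + h2 (fst z)) / 2 + sig (score z) * g (fst z)" for z
    by (simp add: sig_lik g_def field_simps)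
  show "integrable D (\<lambda>z. lik (score z) * h1 (fst z) + (1 - lik (score z)) * h2 (fst z))"
    unfolding eq using int sig_int by (rule Bochner_Integration.integrable_add)
  have "(\<integral>z. F z \<partial>D) = (\<integral>z. (h1 (fst z) + h2 (fst z)) / 2 + snd z * g (fst z) \<partial>D)"
    by (intro Bochner_Integration.integral_cong refl F_eq)
  also have "\<dots> = (\<integral>z. (h1 (fst z) + h2 (fst z)) / 2 + sig (score z) * g (fst z) \<partial>D)"
    using lab(1) by (simp only: Bochner_Integration.integral_add[OF int lab(2)] Bochner_Integration.integral_add[OF int sig_int])
  finally show "(\<integral>z. F z \<partial>D) = (\<integral>z. lik (score z) * h1 (fst z) + (1 - lik (score z)) * h2 (fst z) \<partial>D)"
    unfolding eq .
qed

lemma w_max_nonneg: "0 \<le> w_max"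
  using w_bound L2_set_nonneg[of w "{..<d}"] by linarith

text \<open>Serves integrability only; the size of the bound does not enter the sample
  bound.\<close>

lemma score_bounded: "AE z in D. \<bar>score z\<bar> \<le> w_max * (sqrt (real d) + 1)"
  using norm_D
proof eventually_elim
  case (elim z)
  have "\<bar>\<Sum>i<d. w i * fst z i\<bar> \<le> (\<Sum>i<d. \<bar>w i\<bar> * \<bar>fst z i\<bar>)"
    using sum_abs[of "\<lambda>i. w i * fst z i" "{..<d}"] by (simp add: abs_mult)
  also have "\<dots> \<le> L2_set w {..<d} * L2_set (fst z) {..<d}" by (rule L2_set_mult_ineq)
  also have "\<dots> \<le> w_max * sqrt (real d)"
    using w_bound elim w_max_nonneg by (intro mult_mono) (auto simp: L2_set_nonneg)
  finally have "\<bar>score z\<bar> \<le> w_max * sqrt (real d) + \<bar>\<tau>\<bar>" by (simp add: score_def affine_form_def)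
  moreover have "\<bar>\<tau>\<bar> \<le> w_max" using w_bound L2_set_nonneg[of w "{..<d}"] by linarith
  ultimately show ?case by (simp add: distrib_left)
qed

lemma integrable_feature_bounded:
  fixes g :: "real \<Rightarrow> real"
  assumes g: "g \<in> borel_measurable borel" and bound: "\<And>t K. \<bar>t\<bar> \<le> K \<Longrightarrow> \<bar>g t\<bar> \<le> B K"
  shows "(\<lambda>x. g (affine_form d w \<tau> x)) \<in> borel_measurable (feature_space d)"
    "integrable D (\<lambda>z. g (affine_form d w \<tau> (fst z)))"
proof -
  show 1: "(\<lambda>x. g (affine_form d w \<tau> x)) \<in> borel_measurable (feature_space d)"
    by (rule measurable_compose[OF affine_form_measurable g])
  show "integrable D (\<lambda>z. g (affine_form d w \<tau> (fst z)))"
  proof (rule integrable_const_bound[where B = "B (w_max * (sqrt (real d) + 1))"])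
    show "AE z in D. norm (g (affine_form d w \<tau> (fst z))) \<le> B (w_max * (sqrt (real d) + 1))"
      using score_bounded by eventually_elim (auto simp: score_def intro: bound)
  qed (rule feature_meas[OF 1])
qed

lemma neg_ln_lik_bounds:
  assumes "\<bar>t\<bar> \<le> K"
  shows "0 \<le> - ln (lik t)" "- ln (lik t) \<le> K + 1"
proof -
  have pos: "0 < 1 + exp (- t)" by (simp add: add_pos_pos)
  show "0 \<le> - ln (lik t)" using lik_pos[of t] lik_less_1[of t] by simp
  have "1 + exp (- t) \<le> exp K + exp K" using assms by (intro add_mono) auto
  also have "\<dots> = 2 * exp K" by simp
  also have "\<dots> \<le> exp 1 * exp K" using exp_ge_add_one_self[of "1 :: real"] by (intro mult_right_mono) auto
  also have "\<dots> = exp (K + 1)" by (simp add: exp_add mult.commute)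
  finally have "ln (1 + exp (- t)) \<le> K + 1" using pos by (simp add: ln_le_cancel_iff[symmetric] del: ln_le_cancel_iff)
  then show "- ln (lik t) \<le> K + 1" using pos by (simp add: lik_def ln_div)
qed

text \<open>After averaging out the label the second moment is the mean of p (ln p)^2 + (1 - p) (ln
  (1 - p))^2, where each summand is at most 4: a large loss of the true model is rare in
  proportion.\<close>

lemma logistic_moments:
  shows "integrable D (\<lambda>z. logistic_loss (margin d w_star z))"
    and "integrable D (\<lambda>z. (logistic_loss (margin d w_star z))\<^sup>2)"
    and "(\<integral>z. (logistic_loss (margin d w_star z))\<^sup>2 \<partial>D) \<le> 8"
    and "(\<integral>z. logistic_loss (margin d w_star z) \<partial>D)
      = (\<integral>z. lik (score z) * - ln (lik (score z)) + (1 - lik (score z)) * - ln (1 - lik (score z)) \<partial>D)"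
    and "integrable D (\<lambda>z. lik (score z) * - ln (lik (score z)) + (1 - lik (score z)) * - ln (1 - lik (score z)))"
proof -
  have cases: "logistic_loss (margin d w_star z) = (if snd z = 1 then - ln (lik (affine_form d w \<tau> (fst z))) else - ln (lik (- affine_form d w \<tau> (fst z))))"
    if "z \<in> space D" for z
    using snd_cases[OF that] by (auto simp: margin_w_star logistic_loss_lik score_def)
  have b1: "\<bar>- ln (lik t)\<bar> \<le> K + 1" "\<bar>- ln (lik (- t))\<bar> \<le> K + 1" if "\<bar>t\<bar> \<le> K" for t K
    using neg_ln_lik_bounds[OF that] neg_ln_lik_bounds[of "- t" K] that by auto
  have b2: "\<bar>(- ln (lik t))\<^sup>2\<bar> \<le> (K + 1)\<^sup>2" "\<bar>(- ln (lik (- t)))\<^sup>2\<bar> \<le> (K + 1)\<^sup>2" if "\<bar>t\<bar> \<le> K" for t K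
    using power_mono[OF b1(1)[OF that], of 2] power_mono[OF b1(2)[OF that], of 2] by auto
  have m: "(\<lambda>t. - ln (lik t)) \<in> borel_measurable borel" "(\<lambda>t. - ln (lik (- t))) \<in> borel_measurable borel"
    "(\<lambda>t. (- ln (lik t))\<^sup>2) \<in> borel_measurable borel" "(\<lambda>t. (- ln (lik (- t)))\<^sup>2) \<in> borel_measurable borel"
    by measurable
  note i1 = integrable_feature_bounded[OF m(1), where B = "\<lambda>K. K + 1", OF b1(1)]
    and i2 = integrable_feature_bounded[OF m(2), where B = "\<lambda>K. K + 1", OF b1(2)]
    and i3 = integrable_feature_bounded[OF m(3), where B = "\<lambda>K. (K + 1)\<^sup>2", OF b2(1)]
    and i4 = integrable_feature_bounded[OF m(4), where B = "\<lambda>K. (K + 1)\<^sup>2", OF b2(2)]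
  note e1 = expectation_label[OF i1 i2 cases]
  show "integrable D (\<lambda>z. logistic_loss (margin d w_star z))" by (rule e1(2))
  show "(\<integral>z. logistic_loss (margin d w_star z) \<partial>D)
      = (\<integral>z. lik (score z) * - ln (lik (score z)) + (1 - lik (score z)) * - ln (1 - lik (score z)) \<partial>D)"
    using e1(1) by (simp add: lik_minus score_def)
  show "integrable D (\<lambda>z. lik (score z) * - ln (lik (score z)) + (1 - lik (score z)) * - ln (1 - lik (score z)))"
    using e1(3) by (simp add: lik_minus score_def)
  have cases2: "(logistic_loss (margin d w_star z))\<^sup>2 = (if snd z = 1 then (- ln (lik (affine_form d w \<tau> (fst z))))\<^sup>2 else (- ln (lik (- affine_form d w \<tau> (fst z))))\<^sup>2)"
    if "z \<in> space D" for z
    using cases[OF that] by simp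
  note e2 = expectation_label[OF i3 i4 cases2]
  show "integrable D (\<lambda>z. (logistic_loss (margin d w_star z))\<^sup>2)" by (rule e2(2))
  have "(\<integral>z. (logistic_loss (margin d w_star z))\<^sup>2 \<partial>D) = (\<integral>z. lik (score z) * (- ln (lik (affine_form d w \<tau> (fst z))))\<^sup>2
      + (1 - lik (score z)) * (- ln (lik (- affine_form d w \<tau> (fst z))))\<^sup>2 \<partial>D)"
    by (rule e2(1))
  also have "\<dots> \<le> 8"
  proof (rule integral_le_const)
    show "integrable D (\<lambda>z. lik (score z) * (- ln (lik (affine_form d w \<tau> (fst z))))\<^sup>2
      + (1 - lik (score z)) * (- ln (lik (- affine_form d w \<tau> (fst z))))\<^sup>2)"
      by (rule e2(3))
  next
    show "AE z in D. lik (score z) * (- ln (lik (affine_form d w \<tau> (fst z))))\<^sup>2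
      + (1 - lik (score z)) * (- ln (lik (- affine_form d w \<tau> (fst z))))\<^sup>2 \<le> 8"
    proof (intro AE_I2)
    fix z
    show "lik (score z) * (- ln (lik (affine_form d w \<tau> (fst z))))\<^sup>2
      + (1 - lik (score z)) * (- ln (lik (- affine_form d w \<tau> (fst z))))\<^sup>2 \<le> 8"
      using mult_ln_square_le[OF lik_pos lik_less_1, of "score z"]
        mult_ln_square_le[OF lik_pos lik_less_1, of "- score z"]
      by (simp add: score_def lik_minus)
    qed
  qed
  finally show "(\<integral>z. (logistic_loss (margin d w_star z))\<^sup>2 \<partial>D) \<le> 8" .
qed

text \<open>The excess smoothed log loss is an expected relative entropy.\<close>
lemma sq_error_le_excess:
  assumes e: "0 < e" "e < 1 / 2"
  shows "sq_error d D w \<tau> v (v d) \<le> 16 * ((\<integral>z. smooth_loss e (margin d v z) \<partial>D)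
    - (\<integral>z. logistic_loss (margin d w_star z) \<partial>D)) + 8 * e\<^sup>2"
proof -
  define t where "t z = affine_form d v (v d) (fst z)" for z :: example
  define p where "p z = lik (score z)" for z
  define q where "q z = smooth e (lik (t z))" for z
  have [measurable]: "t \<in> borel_measurable D" unfolding t_def by (intro feature_meas affine_form_measurable)
  have [measurable]: "p \<in> borel_measurable D" unfolding p_def by measurable
  have [measurable]: "q \<in> borel_measurable D" unfolding q_def smooth_def by measurable
  have p: "0 < p z" "p z < 1" for z using lik_pos lik_less_1 by (auto simp: p_def)
  have q: "0 < q z" "q z < 1" for z using smooth_bounds[OF e lik_pos[of "t z"] lik_less_1] by (auto simp: q_def)
  have smooth_minus: "smooth e (lik (- s)) = 1 - smooth e (lik s)" for s
    by (simp add: lik_minus smooth_def algebra_simps)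
  have m1: "(\<lambda>x. smooth_loss e (affine_form d v (v d) x)) \<in> borel_measurable (feature_space d)"
    "(\<lambda>x. smooth_loss e (- affine_form d v (v d) x)) \<in> borel_measurable (feature_space d)"
    by (rule measurable_compose[OF affine_form_measurable], measurable)+
  have int: "integrable D (\<lambda>z. smooth_loss e (affine_form d v (v d) (fst z)))"
    "integrable D (\<lambda>z. smooth_loss e (- affine_form d v (v d) (fst z)))"
    using smooth_loss_bounds[OF e] feature_meas[OF m1(1)] feature_meas[OF m1(2)]
    by (auto intro!: integrable_const_bound[where B = "- ln e"] AE_I2 simp: abs_le_iff order_trans[of _ 0])
  have cases: "smooth_loss e (margin d v z) = (if snd z = 1 then smooth_loss e (affine_form d v (v d) (fst z))
      else smooth_loss e (- affine_form d v (v d) (fst z)))" if "z \<in> space D" for z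
    using snd_cases[OF that] by (auto simp: margin_affine_form)
  note el = expectation_label[OF m1(1) int(1) m1(2) int(2) cases]
  have EG: "(\<integral>z. smooth_loss e (margin d v z) \<partial>D) = (\<integral>z. p z * - ln (q z) + (1 - p z) * - ln (1 - q z) \<partial>D)"
    and EG_int: "integrable D (\<lambda>z. p z * - ln (q z) + (1 - p z) * - ln (1 - q z))"
    using el(1,3) by (simp_all add: smooth_loss_def smooth_minus p_def q_def t_def)
  have sqint: "integrable D (\<lambda>z. (p z - q z)\<^sup>2)"
  proof (rule integrable_const_bound[where B = 1])
    show "AE z in D. norm ((p z - q z)\<^sup>2) \<le> 1"
    proof (intro AE_I2)
      fix z
      show "norm ((p z - q z)\<^sup>2) \<le> 1"
        using p[of z] q[of z] by (auto simp: abs_square_le_1)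
    qed
  qed measurable
  have KL: "(\<integral>z. (p z - q z)\<^sup>2 / 2 \<partial>D)
      \<le> (\<integral>z. smooth_loss e (margin d v z) \<partial>D) - (\<integral>z. logistic_loss (margin d w_star z) \<partial>D)"
  proof -
    note lm = logistic_moments(4,5)[folded p_def]
    have "(\<integral>z. (p z - q z)\<^sup>2 / 2 \<partial>D) \<le> (\<integral>z. (p z * - ln (q z) + (1 - p z) * - ln (1 - q z))
        - (p z * - ln (p z) + (1 - p z) * - ln (1 - p z)) \<partial>D)"
    proof (rule integral_mono)
      show "integrable D (\<lambda>z. (p z - q z)\<^sup>2 / 2)" using sqint by simp
      show "integrable D (\<lambda>z. (p z * - ln (q z) + (1 - p z) * - ln (1 - q z)) - (p z * - ln (p z) + (1 - p z) * - ln (1 - p z)))"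
        by (rule Bochner_Integration.integrable_diff[OF EG_int lm(2)])
      fix z
      show "(p z - q z)\<^sup>2 / 2 \<le> (p z * - ln (q z) + (1 - p z) * - ln (1 - q z)) - (p z * - ln (p z) + (1 - p z) * - ln (1 - p z))"
        using binary_pinsker[OF p q, of z z] by (simp add: algebra_simps)
    qed
    also have "\<dots> = (\<integral>z. smooth_loss e (margin d v z) \<partial>D) - (\<integral>z. logistic_loss (margin d w_star z) \<partial>D)"
      unfolding Bochner_Integration.integral_diff[OF EG_int lm(2)] EG lm(1) ..
    finally show ?thesis .
  qed
  have "sq_error d D w \<tau> v (v d) = (\<integral>z. (sig (score z) - sig (t z))\<^sup>2 \<partial>D)"
    by (simp add: sq_error_def score_def t_def)
  also have "\<dots> \<le> (\<integral>z. 16 * ((p z - q z)\<^sup>2 / 2) + 8 * e\<^sup>2 \<partial>D)"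
  proof (rule integral_mono)
    \<comment> \<open>Passing from \<open>sig\<close> to \<open>lik\<close> gives a factor 4.
      Squeezing moves a prediction by at most e, so (p - r)^2 <= 2 (p - q)^2 + 2 e^2.\<close>
    have pt: "(sig (score z) - sig (t z))\<^sup>2 \<le> 16 * ((p z - q z)\<^sup>2 / 2) + 8 * e\<^sup>2" for z
    proof -
      define r where "r = lik (t z)"
      have r: "0 < r" "r < 1" using lik_pos lik_less_1 by (auto simp: r_def)
      have "\<bar>q z - r\<bar> \<le> e"
      proof -
        have "q z - r = e * (1 - 2 * r)" by (simp add: q_def r_def smooth_def algebra_simps)
        moreover have "\<bar>1 - 2 * r\<bar> \<le> 1" using r by (simp add: abs_le_iff)
        ultimately show ?thesis using e by (simp add: abs_mult mult_left_le)
      qed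
      then have "(q z - r)\<^sup>2 \<le> e\<^sup>2" by (metis abs_ge_zero power2_abs power_mono)
      moreover have "(p z - r)\<^sup>2 \<le> 2 * (p z - q z)\<^sup>2 + 2 * (q z - r)\<^sup>2"
      proof -
        have "0 \<le> ((p z - q z) - (q z - r))\<^sup>2" by simp
        then show ?thesis by (simp add: power2_eq_square algebra_simps)
      qed
      moreover have "(sig (score z) - sig (t z))\<^sup>2 = 4 * (p z - r)\<^sup>2"
        by (simp add: sig_lik p_def r_def power2_eq_square algebra_simps)
      ultimately show ?thesis by simp
    qed
    then show "(sig (score z) - sig (t z))\<^sup>2 \<le> 16 * ((p z - q z)\<^sup>2 / 2) + 8 * e\<^sup>2" for z .
    show int: "integrable D (\<lambda>z. 16 * ((p z - q z)\<^sup>2 / 2) + 8 * e\<^sup>2)"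
      using sqint by (intro Bochner_Integration.integrable_add integrable_mult_right integrable_divide) auto
    show "integrable D (\<lambda>z. (sig (score z) - sig (t z))\<^sup>2)"
    proof (rule Bochner_Integration.integrable_bound[OF int])
      show "(\<lambda>z. (sig (score z) - sig (t z))\<^sup>2) \<in> borel_measurable D" unfolding sig_lik by measurable
      show "AE z in D. norm ((sig (score z) - sig (t z))\<^sup>2) \<le> norm (16 * ((p z - q z)\<^sup>2 / 2) + 8 * e\<^sup>2)"
        using pt by (intro AE_I2) (auto simp: abs_of_nonneg intro: order_trans)
    qed
  qed
  also have "\<dots> = 16 * (\<integral>z. (p z - q z)\<^sup>2 / 2 \<partial>D) + 8 * e\<^sup>2"
    using sqint by (subst Bochner_Integration.integral_add) (auto simp: prob_space)
  finally show ?thesis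
    by (rule order_trans) (intro add_right_mono mult_left_mono KL; simp)
qed

text \<open>The hypotheses \<open>unif\<close> and \<open>cheb\<close> are the failure probabilities
  of the uniform and of the Chebyshev bound, 1 / 200 each; the norm bound fails on a null
  set.\<close>

lemma good_event:
  assumes e: "0 < e" "e < 1 / 2" and n: "1 \<le> n" and \<Delta>: "0 < \<Delta>" and \<eta>: "0 < \<eta>"
    and unif: "- ln e * ((real (d + 2) * ln (2 * real n + 1) / (\<eta> * real n) + \<eta> / 2)) / \<Delta> \<le> 1 / 200"
    and cheb: "8 / (real n * \<Delta>\<^sup>2) \<le> 1 / 200"
  shows "\<exists>A\<in>sets (PiM (UNIV :: nat set) (\<lambda>_. D)). 99 / 100 \<le> measure (PiM (UNIV :: nat set) (\<lambda>_. D)) A \<and> (\<forall>\<omega>\<in>A.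
     (\<forall>v. (\<integral>z. smooth_loss e (margin d v z) \<partial>D) \<le> (\<Sum>i<n. smooth_loss e (margin d v (\<omega> i))) / real n + \<Delta>) \<and>
     (\<Sum>i<n. logistic_loss (margin d w_star (\<omega> i))) / real n \<le> (\<integral>z. logistic_loss (margin d w_star z) \<partial>D) + \<Delta> \<and>
     (\<forall>i<n. L2_set (fst (\<omega> i)) {..<d} \<le> sqrt (real d) \<and> (snd (\<omega> i) = 1 \<or> snd (\<omega> i) = -1)))"
proof -
  let ?S = "PiM (UNIV :: nat set) (\<lambda>_. D)"
  define G where "G v z = smooth_loss e (margin d v z)" for v z
  define L where "L = - ln e"
  have L: "0 \<le> L" using e by (simp add: L_def)
  \<comment> \<open>Rational weight vectors of finite support: a countable class, for which the
    exceptional event is measurable.\<close>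
  define Q where "Q = range (\<lambda>qs :: rat list. (\<lambda>j. if j < length qs then of_rat (qs ! j) else 0 :: real))"
  have Q: "countable Q" "Q \<noteq> {}" by (auto simp: Q_def)
  have [measurable]: "G v \<in> borel_measurable D" for v unfolding G_def by measurable
  have G_bnd: "0 \<le> G v z \<and> G v z \<le> L" for v z using smooth_loss_bounds[OF e] by (auto simp: G_def L_def)
  define B1 where "B1 = {\<omega> \<in> space ?S. \<exists>v\<in>Q. \<Delta> < (\<integral>z. G v z \<partial>D) - (\<Sum>i<n. G v (\<omega> i)) / real n}"
  define B2 where "B2 = {\<omega> \<in> space ?S. \<Delta> < (\<Sum>i<n. logistic_loss (margin d w_star (\<omega> i))) / real n
      - (\<integral>z. logistic_loss (margin d w_star z) \<partial>D)}"
  \<comment> \<open>The norm bound of the model holds almost everywhere only, whereas the labels are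
    1 or -1 on the whole space.\<close>
  define B3 where "B3 = {\<omega> \<in> space ?S. \<exists>i<n. \<not> L2_set (fst (\<omega> i)) {..<d} \<le> sqrt (real d)}"
  have [measurable]: "(\<lambda>z. L2_set (fst z) {..<d}) \<in> borel_measurable D"
  proof (rule feature_meas)
    show "(\<lambda>x. L2_set x {..<d}) \<in> borel_measurable (feature_space d)"
      unfolding L2_set_def feature_space_def by measurable
  qed
  have [measurable]: "logistic_loss \<in> borel_measurable borel" unfolding logistic_loss_def by measurable
  have P1: "measure ?S B1 \<le> 1 / 200"
  proof -
    have "measure ?S B1 \<le> L * ((real (d + 2) * ln (2 * real n + 1) / (\<eta> * real n) + \<eta> / 2)) / \<Delta>"
      unfolding B1_def
    proof (rule seq.uniform_deviation[OF Q \<eta> L n \<Delta>])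
      fix \<zeta> :: "nat \<Rightarrow> example"
      show "card {{i\<in>{..<2 * n}. s < G v (\<zeta> i)} | v s. v \<in> Q} \<le> (2 * n + 1) ^ (d + 2)"
        unfolding G_def by (rule smooth_loss_traces[OF e])
    qed (use G_bnd in auto)
    then show ?thesis using unif[folded L_def] by (rule order_trans)
  qed
  have P2: "measure ?S B2 \<le> 1 / 200"
  proof -
    have "measure ?S B2 \<le> (\<integral>z. (logistic_loss (margin d w_star z))\<^sup>2 \<partial>D) / (real n * \<Delta>\<^sup>2)"
      unfolding B2_def by (rule seq.chebyshev_average[OF logistic_moments(1,2) n \<Delta>])
    also have "\<dots> \<le> 8 / (real n * \<Delta>\<^sup>2)" using logistic_moments(3) by (intro divide_right_mono) auto
    finally show ?thesis using cheb by simp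
  qed
  have P3: "measure ?S B3 = 0"
  proof -
    have "AE \<omega> in ?S. \<forall>i<n. L2_set (fst (\<omega> i)) {..<d} \<le> sqrt (real d)"
    proof -
      have "AE \<omega> in ?S. L2_set (fst (\<omega> i)) {..<d} \<le> sqrt (real d)" for i
        by (rule AE_PiM_component[where P = "\<lambda>z. L2_set (fst z) {..<d} \<le> sqrt (real d)" and M = "\<lambda>_. D"])
          (auto intro: prob_D norm_D)
      then show ?thesis by (simp add: AE_all_countable)
    qed
    then have "AE \<omega> in ?S. \<omega> \<notin> B3" by eventually_elim (auto simp: B3_def)
    then show ?thesis by (rule seq.P.prob_eq_0[THEN iffD2, rotated]) (simp add: B3_def)
  qed
  have B_sets[measurable]: "B1 \<in> sets ?S" "B2 \<in> sets ?S" "B3 \<in> sets ?S"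
    unfolding B1_def B2_def B3_def using Q(1) by measurable
  define A where "A = space ?S - (B1 \<union> B2 \<union> B3)"
  have "measure ?S (B1 \<union> B2 \<union> B3) \<le> measure ?S B1 + measure ?S B2 + measure ?S B3"
    using measure_Un_le[of "B1 \<union> B2" ?S B3] measure_Un_le[of B1 ?S B2] B_sets
    by auto
  then have prob_A: "99 / 100 \<le> measure ?S A"
    unfolding A_def using P1 P2 P3 B_sets by (subst seq.P.prob_compl) auto
  have sets_A: "A \<in> sets ?S" unfolding A_def by measurable
  have good: "(\<forall>v. (\<integral>z. G v z \<partial>D) \<le> (\<Sum>i<n. G v (\<omega> i)) / real n + \<Delta>) \<and>
     (\<Sum>i<n. logistic_loss (margin d w_star (\<omega> i))) / real n \<le> (\<integral>z. logistic_loss (margin d w_star z) \<partial>D) + \<Delta> \<and>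
     (\<forall>i<n. L2_set (fst (\<omega> i)) {..<d} \<le> sqrt (real d) \<and> (snd (\<omega> i) = 1 \<or> snd (\<omega> i) = -1))" if \<omega>: "\<omega> \<in> A" for \<omega>
  proof (intro conjI allI impI)
    have sp: "\<omega> \<in> space ?S" "\<And>i. \<omega> i \<in> space D" using \<omega> by (auto simp: A_def space_PiM)
    show "(\<Sum>i<n. logistic_loss (margin d w_star (\<omega> i))) / real n \<le> (\<integral>z. logistic_loss (margin d w_star z) \<partial>D) + \<Delta>"
      using \<omega> by (auto simp: A_def B2_def not_less)
    show "L2_set (fst (\<omega> i)) {..<d} \<le> sqrt (real d)" if "i < n" for i using \<omega> that by (auto simp: A_def B3_def)
    show "snd (\<omega> i) = 1 \<or> snd (\<omega> i) = -1" for i by (rule snd_cases[OF sp(2)])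
    have rat: "(\<integral>z. G v z \<partial>D) \<le> (\<Sum>i<n. G v (\<omega> i)) / real n + \<Delta>" if "v \<in> Q" for v
      using \<omega> that by (force simp: A_def B1_def not_less)
    fix v :: "nat \<Rightarrow> real"
    have "\<exists>q :: nat \<Rightarrow> rat. (\<lambda>k. of_rat (q k) :: real) \<longlonglongrightarrow> x" for x :: real
    proof -
      have "\<exists>q. \<bar>of_rat q - x\<bar> < 1 / real (Suc k)" for k
      proof -
        obtain q where "x - 1 / real (Suc k) < of_rat q" "of_rat q < x + 1 / real (Suc k)"
          using of_rat_dense[of "x - 1 / real (Suc k)" "x + 1 / real (Suc k)"] by auto
        then show ?thesis by (intro exI[of _ q]) (auto simp: abs_less_iff)
      qed
      then obtain q :: "nat \<Rightarrow> rat" where q: "\<And>k. \<bar>of_rat (q k) - x\<bar> < 1 / real (Suc k)" by metis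
      have "(\<lambda>k. of_rat (q k) - x) \<longlonglongrightarrow> 0"
        using q by (intro Lim_null_comparison[OF _ LIMSEQ_Suc[OF lim_1_over_n]] always_eventually) (auto intro: less_imp_le)
      then show ?thesis by (intro exI[of _ q]) (simp add: LIM_zero_iff)
    qed
    then have "\<forall>j. \<exists>q :: nat \<Rightarrow> rat. (\<lambda>k. of_rat (q k) :: real) \<longlonglongrightarrow> v j" by blast
    from choice[OF this] obtain r :: "nat \<Rightarrow> nat \<Rightarrow> rat"
      where r: "\<And>j. (\<lambda>k. of_rat (r j k) :: real) \<longlonglongrightarrow> v j" by blast
    \<comment> \<open>Margins read the coordinates up to d only, so truncated rational
      approximations suffice. Both sides converge, the integral by dominated convergence with bound
      L.\<close>
    define u where "u k = (\<lambda>j. if j < length (map (\<lambda>j. r j k) [0..<Suc d]) then of_rat (map (\<lambda>j. r j k) [0..<Suc d] ! j) else 0 :: real)" for k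
    have u: "u k \<in> Q" for k unfolding u_def Q_def by (rule rangeI)
    have u_eq: "u k j = of_rat (r j k)" if "j < Suc d" for k j using that by (simp add: u_def del: upt_Suc)
    have marg: "(\<lambda>k. margin d (u k) z) \<longlonglongrightarrow> margin d v z" for z
      unfolding margin_def using r by (intro tendsto_sum tendsto_mult tendsto_const) (auto simp: u_eq)
    have Glim: "(\<lambda>k. G (u k) z) \<longlonglongrightarrow> G v z" for z
      unfolding G_def by (rule isCont_tendsto_compose[OF continuous_smooth_loss[OF e] marg])
    have EGlim: "(\<lambda>k. \<integral>z. G (u k) z \<partial>D) \<longlonglongrightarrow> (\<integral>z. G v z \<partial>D)"
    proof (rule integral_dominated_convergence[where w = "\<lambda>_. L"])
      show "AE z in D. norm (G (u k) z) \<le> L" for k using G_bnd by (intro AE_I2) (auto simp: abs_le_iff intro: order_trans[of _ 0])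
    qed (use Glim in auto)
    have "(\<lambda>k. (\<Sum>i<n. G (u k) (\<omega> i)) / real n + \<Delta>) \<longlonglongrightarrow> (\<Sum>i<n. G v (\<omega> i)) / real n + \<Delta>"
      using n by (intro tendsto_add tendsto_divide tendsto_sum tendsto_const Glim) auto
    then show "(\<integral>z. G v z \<partial>D) \<le> (\<Sum>i<n. G v (\<omega> i)) / real n + \<Delta>"
      by (rule LIMSEQ_le[OF EGlim]) (use rat[OF u] in auto)
  qed
  show ?thesis
  proof (rule bexI[OF _ sets_A], rule conjI[OF prob_A], rule ballI)
    fix \<omega> assume "\<omega> \<in> A"
    from good[OF this] show "(\<forall>v. (\<integral>z. smooth_loss e (margin d v z) \<partial>D) \<le> (\<Sum>i<n. smooth_loss e (margin d v (\<omega> i))) / real n + \<Delta>) \<and>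
     (\<Sum>i<n. logistic_loss (margin d w_star (\<omega> i))) / real n \<le> (\<integral>z. logistic_loss (margin d w_star z) \<partial>D) + \<Delta> \<and>
     (\<forall>i<n. L2_set (fst (\<omega> i)) {..<d} \<le> sqrt (real d) \<and> (snd (\<omega> i) = 1 \<or> snd (\<omega> i) = -1))"
      unfolding G_def .
  qed
qed

end

section \<open>Empirical minimisation\<close>

definition total_loss :: "nat \<Rightarrow> nat \<Rightarrow> (nat \<Rightarrow> nat \<Rightarrow> real) \<Rightarrow> (nat \<Rightarrow> real) \<Rightarrow> real" where
  "total_loss D n Z u = (\<Sum>i<n. harm_loss n (\<Sum>j<D. u j * Z i j))"

lemma total_loss_cong: "(\<And>j. j < D \<Longrightarrow> u j = v j) \<Longrightarrow> total_loss D n Z u = total_loss D n Z v"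
  unfolding total_loss_def by (intro sum.cong arg_cong[where f = "harm_loss n"]) auto

text \<open>Controls the loss at the perturbed competitors
  \<open>w \<plusminus> \<rho> e\<^sub>j\<close> demanded by the ellipsoid method.\<close>

lemma total_loss_shift_le:
  assumes j: "j < D" and Z: "\<And>i. i < n \<Longrightarrow> \<bar>Z i j\<bar> \<le> b"
  shows "total_loss D n Z (u(j := u j + \<sigma>)) \<le> total_loss D n Z u + real n * (real n * (\<bar>\<sigma>\<bar> * b))"
proof -
  have "total_loss D n Z (u(j := u j + \<sigma>)) \<le> (\<Sum>i<n. harm_loss n (\<Sum>j<D. u j * Z i j) + real n * (\<bar>\<sigma>\<bar> * b))"
    unfolding total_loss_def
  proof (rule sum_mono)
    fix i assume "i \<in> {..<n}"
    then have i: "i < n" by simp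
    have "(\<Sum>k<D. (u(j := u j + \<sigma>)) k * Z i k) = (\<Sum>k<D. u k * Z i k + (if k = j then \<sigma> * Z i j else 0))"
      by (intro sum.cong) (auto simp: algebra_simps)
    also have "\<dots> = (\<Sum>k<D. u k * Z i k) + \<sigma> * Z i j" using j by (simp add: sum.distrib)
    finally have "harm_loss n (\<Sum>k<D. (u(j := u j + \<sigma>)) k * Z i k)
        \<le> harm_loss n (\<Sum>k<D. u k * Z i k) + real n * \<bar>\<sigma> * Z i j\<bar>"
      using harm_loss_shift_le by simp
    also have "\<bar>\<sigma> * Z i j\<bar> \<le> \<bar>\<sigma>\<bar> * b" using Z[OF i] by (simp add: abs_mult mult_left_mono)
    finally show "harm_loss n (\<Sum>k<D. (u(j := u j + \<sigma>)) k * Z i k)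
        \<le> harm_loss n (\<Sum>k<D. u k * Z i k) + real n * (\<bar>\<sigma>\<bar> * b)"
      by (simp add: mult_left_mono)
  qed
  also have "\<dots> = total_loss D n Z u + real n * (real n * (\<bar>\<sigma>\<bar> * b))"
    by (simp add: total_loss_def sum.distrib)
  finally show ?thesis .
qed

text \<open>A line that is maximal at c lies below the surrogate everywhere, and its slope in the
  margin is \<open>- l i\<close>.\<close>

lemma total_loss_subgradient:
  assumes l: "\<And>i. i < n \<Longrightarrow> l i \<le> n \<and> harm_line n (l i) (\<Sum>j<D. c j * Z i j) = harm_loss n (\<Sum>j<D. c j * Z i j)"
  shows "total_loss D n Z c + (\<Sum>j<D. (- (\<Sum>i<n. real (l i) * Z i j)) * (u j - c j)) \<le> total_loss D n Z u"
proof -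
  have "(\<Sum>j<D. (- (\<Sum>i<n. real (l i) * Z i j)) * (u j - c j))
      = (\<Sum>j<D. \<Sum>i<n. - (real (l i) * Z i j * (u j - c j)))"
    by (simp add: sum_distrib_right sum_negf)
  also have "\<dots> = (\<Sum>i<n. \<Sum>j<D. - (real (l i) * Z i j * (u j - c j)))" by (rule sum.swap)
  also have "\<dots> = (\<Sum>i<n. - (real (l i) * ((\<Sum>j<D. u j * Z i j) - (\<Sum>j<D. c j * Z i j))))"
    by (simp only: sum_negf sum_subtractf[symmetric] sum_distrib_left) (simp add: algebra_simps)
  finally have eq: "(\<Sum>j<D. (- (\<Sum>i<n. real (l i) * Z i j)) * (u j - c j))
      = (\<Sum>i<n. - (real (l i) * ((\<Sum>j<D. u j * Z i j) - (\<Sum>j<D. c j * Z i j))))" .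
  show ?thesis unfolding eq total_loss_def sum.distrib[symmetric]
  proof (rule sum_mono)
    fix i assume "i \<in> {..<n}"
    then have i: "i < n" by simp
    have "harm_line n (l i) (\<Sum>j<D. u j * Z i j) \<le> harm_loss n (\<Sum>j<D. u j * Z i j)"
      using l[OF i] by (intro harm_line_le_loss) auto
    then show "harm_loss n (\<Sum>j<D. c j * Z i j) + - (real (l i) * ((\<Sum>j<D. u j * Z i j) - (\<Sum>j<D. c j * Z i j)))
        \<le> harm_loss n (\<Sum>j<D. u j * Z i j)"
      using l[OF i] by (simp add: harm_line_def algebra_simps)
  qed
qed

section \<open>Ellipsoid iterations with a record of the best iterate\<close>

record ell_state =
  center :: "nat \<Rightarrow> real"
  basis :: "nat \<Rightarrow> nat \<Rightarrow> real"
  best :: "nat \<Rightarrow> real"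
  best_val :: real

text \<open>A relation, because ties between maximal lines may be broken arbitrarily and entries
  from D on are left open. The record is kept because the ellipsoid method guarantees some good
  iterate, not a good last one.\<close>

definition ell_step :: "nat \<Rightarrow> nat \<Rightarrow> (nat \<Rightarrow> nat \<Rightarrow> real) \<Rightarrow> ell_state \<Rightarrow> ell_state \<Rightarrow> bool" where
  "ell_step D n Z s s' \<longleftrightarrow> (\<exists>l h.
     (\<forall>i<n. l i \<le> n \<and> harm_line n (l i) (\<Sum>j<D. center s j * Z i j) = harm_loss n (\<Sum>j<D. center s j * Z i j)) \<and>
     (\<forall>j<D. h j = (\<Sum>i<D. basis s i j * - (\<Sum>k<n. real (l k) * Z k i))) \<and>
     (\<forall>i<D. center s' i = ell_center D (center s) (basis s) h i) \<and>
     (\<forall>i<D. \<forall>j<D. basis s' i j = ell_basis D (basis s) h i j) \<and>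
     (if total_loss D n Z (center s) < best_val s
      then (\<forall>j<D. best s' j = center s j) \<and> best_val s' = total_loss D n Z (center s)
      else (\<forall>j<D. best s' j = best s j) \<and> best_val s' = best_val s))"

text \<open>The initial record belongs to weight 0 and is only an upper bound for its loss, see
  \<open>harm_loss_zero_le\<close>.\<close>

definition ell_start :: "nat \<Rightarrow> nat \<Rightarrow> real \<Rightarrow> ell_state \<Rightarrow> bool" where
  "ell_start D n R s \<longleftrightarrow> (\<forall>j<D. center s j = 0 \<and> best s j = 0) \<and>
     (\<forall>i<D. \<forall>j<D. basis s i j = (if i = j then R else 0)) \<and> best_val s = real n * real n * real n"

lemma ell_steps_near_optimal:
  assumes D: "1 \<le> D" and \<rho>: "0 < \<rho>" and R: "L2_set w {..<D} + \<rho> \<le> R"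
    and Z: "\<And>i j. i < n \<Longrightarrow> j < D \<Longrightarrow> \<bar>Z i j\<bar> \<le> b"
    and start: "ell_start D n R (s 0)" and step: "\<And>k. k < T \<Longrightarrow> ell_step D n Z (s k) (s (Suc k))"
    and T: "32 * real D ^ 4 * ln (R * real D / \<rho>) < 3 * real T"
  shows "total_loss D n Z (best (s T)) \<le> total_loss D n Z w + real n * (real n * (\<rho> * b))"
proof -
  let ?F = "total_loss D n Z"
  define P where "P k l h \<longleftrightarrow>
     (\<forall>i<n. l i \<le> n \<and> harm_line n (l i) (\<Sum>j<D. center (s k) j * Z i j) = harm_loss n (\<Sum>j<D. center (s k) j * Z i j)) \<and>
     (\<forall>j<D. h j = (\<Sum>i<D. basis (s k) i j * - (\<Sum>i'<n. real (l i') * Z i' i))) \<and>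
     (\<forall>i<D. center (s (Suc k)) i = ell_center D (center (s k)) (basis (s k)) h i) \<and>
     (\<forall>i<D. \<forall>j<D. basis (s (Suc k)) i j = ell_basis D (basis (s k)) h i j)" for k l h
  have "\<exists>p. k < T \<longrightarrow> P k (fst p) (snd p)" for k
  proof (cases "k < T")
    case True
    then obtain l h where "P k l h" using step[OF True] unfolding ell_step_def P_def by blast
    then show ?thesis by (intro exI[of _ "(l, h)"]) simp
  qed simp
  then have "\<forall>k. \<exists>p. k < T \<longrightarrow> P k (fst p) (snd p)" by blast
  from choice[OF this] obtain p where p: "\<And>k. k < T \<Longrightarrow> P k (fst (p k)) (snd (p k))" by blast
  define l h where "l k = fst (p k)" and "h k = snd (p k)" for k
  note lh = p[folded l_def h_def, unfolded P_def]
  define V where "V = ?F w + real n * (real n * (\<rho> * b))"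
  have "\<exists>k<T. ?F (center (s k)) \<le> V"
  proof (rule ellipsoid_method[OF D \<rho> R, where F = ?F and h = h and B = "\<lambda>k. basis (s k)" and c = "\<lambda>k. center (s k)"
      and g = "\<lambda>k j. - (\<Sum>i<n. real (l k i) * Z i j)"])
    show "?F (center (s k)) + (\<Sum>i<D. - (\<Sum>i'<n. real (l k i') * Z i' i) * (u i - center (s k) i)) \<le> ?F u"
      if "k < T" for k u
      by (rule total_loss_subgradient) (use lh[OF that] in blast)
    show "?F (w(j := w j + \<rho>)) \<le> V" if "j < D" for j
      using total_loss_shift_le[OF that, of n Z b w \<rho>] Z that \<rho> by (simp add: V_def)
    show "?F (w(j := w j - \<rho>)) \<le> V" if "j < D" for j
      using total_loss_shift_le[OF that, of n Z b w "- \<rho>"] Z that \<rho> by (simp add: V_def)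
  qed (use start T lh in \<open>auto simp: ell_start_def\<close>)
  then obtain k where k: "k < T" "?F (center (s k)) \<le> V" by blast
  have best: "?F (best (s i)) \<le> best_val (s i)" if "i \<le> T" for i
    using that
  proof (induction i)
    case 0
    have "?F (best (s 0)) = ?F (\<lambda>_. 0)" using start by (intro total_loss_cong) (auto simp: ell_start_def)
    also have "\<dots> \<le> (\<Sum>i<n. real n * real n)"
      unfolding total_loss_def using harm_loss_zero_le by (intro sum_mono) simp
    finally show ?case using start by (simp add: ell_start_def)
  next
    case (Suc i)
    then have "ell_step D n Z (s i) (s (Suc i))" by (intro step) simp
    then show ?case
      using Suc total_loss_cong[of D "best (s (Suc i))" "center (s i)" n Z]
        total_loss_cong[of D "best (s (Suc i))" "best (s i)" n Z]
      by (auto simp: ell_step_def split: if_splits)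
  qed
  have mono: "best_val (s (Suc i)) \<le> best_val (s i) \<and> best_val (s (Suc i)) \<le> ?F (center (s i))" if "i < T" for i
    using step[OF that] by (auto simp: ell_step_def split: if_splits)
  \<comment> \<open>The center of state k is compared with the record during step k, hence the bound
    holds from Suc k on and covers all k < T.\<close>
  have "best_val (s i) \<le> ?F (center (s k))" if "Suc k \<le> i" "i \<le> T" for i
    using that
  proof (induction i rule: dec_induct)
    case base
    then show ?case using mono[of k] by simp
  next
    case (step i)
    then show ?case using mono[of i] by simp
  qed
  from this[of T] k best[of T] show ?thesis by (simp add: V_def)
qed

text \<open>A power of two, so that logarithms of sample sizes reduce to multiples of ln 2. The
  strongest demand is that it exceed 21504000 * 358400 < 2^43, in the deviation bound.\<close>

definition sample_const :: real where "sample_const = 2 ^ 50"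

lemma sample_size_bounds:
  fixes \<epsilon> :: real
  assumes d: "1 \<le> d" and \<epsilon>: "0 < \<epsilon>" "\<epsilon> < 1" and m: "1 \<le> m" "real d / \<epsilon>\<^sup>2 \<le> 2 ^ m"
    and n: "sample_const * (real d * real m ^ 3) \<le> real n * \<epsilon>\<^sup>2"
      "real n * \<epsilon>\<^sup>2 \<le> sample_const * (real d * real m ^ 3) + \<epsilon>\<^sup>2"
  shows "1 \<le> n"
    and "- ln (\<epsilon> / 256) * ((real (d + 2) * ln (2 * real n + 1) / (\<epsilon> / (179200 * real m) * real n) + \<epsilon> / (179200 * real m) / 2)) / (\<epsilon> / 128) \<le> 1 / 200"
    and "8 / (real n * (\<epsilon> / 128)\<^sup>2) \<le> 1 / 200"
    and "(6 + ln (real n + 1)) / real n \<le> \<epsilon> / 256"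
proof -
  have d1: "1 \<le> real d" and m1: "1 \<le> real m" using d m by auto
  have e2: "0 < \<epsilon>\<^sup>2" "\<epsilon>\<^sup>2 \<le> 1" "\<epsilon>\<^sup>2 \<le> \<epsilon>" using \<epsilon> by (auto simp: power2_eq_square intro!: mult_le_one mult_left_le)
  have m3: "real m \<le> real m ^ 3" "1 \<le> real m ^ 3" using m1 by (auto simp: self_le_power one_le_power)
  have "1 * 1 \<le> real d * real m ^ 3" using d1 m3 by (intro mult_mono) auto
  then have Kn: "sample_const \<le> real n * \<epsilon>\<^sup>2"
    using n(1) by (simp add: sample_const_def)
  also have "\<dots> \<le> real n" using e2 by (simp add: mult_left_le)
  finally have nK: "sample_const \<le> real n" .
  then show n1: "1 \<le> n" by (simp add: sample_const_def)
  have n0: "0 < real n" using n1 by simp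
  have ln2: "ln (2 :: real) \<le> 7 / 10" using ln2_le_25_over_36 by simp
  have dn: "real d \<le> real n * \<epsilon>\<^sup>2 / (sample_const * real m ^ 3)"
  proof -
    have "0 < sample_const * real m ^ 3" using m1 by (simp add: sample_const_def)
    then show ?thesis using n(1) by (simp add: pos_le_divide_eq mult_ac)
  qed
  \<comment> \<open>Since 1 / \<epsilon> <= d / \<epsilon>^2 <= 2^m, one has 256 / \<epsilon> <=
    2^(8 + m), and 8 + m <= 9 m.\<close>
  have L: "- ln (\<epsilon> / 256) \<le> 7 * real m"
  proof -
    have "1 / \<epsilon> \<le> 1 / \<epsilon>\<^sup>2" by (intro divide_left_mono mult_pos_pos e2 \<epsilon>) simp
    also have "\<dots> \<le> real d / \<epsilon>\<^sup>2" using d1 by (intro divide_right_mono) auto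
    finally have "256 / \<epsilon> \<le> 2 ^ 8 * 2 ^ m" using m(2) by simp
    then have "ln (256 / \<epsilon>) \<le> ln (2 ^ (8 + m))" using \<epsilon> by (intro ln_mono) (auto simp: power_add)
    also have "\<dots> = (8 + real m) * ln 2" by (subst ln_realpow) auto
    also have "\<dots> \<le> (9 * real m) * (7 / 10)" using ln2 m1 by (intro mult_mono) auto
    also have "\<dots> \<le> 7 * real m" by simp
    finally show ?thesis using \<epsilon> by (simp add: ln_div)
  qed
  \<comment> \<open>n is polynomial in 2^m: one factor 2^m bounds d / \<epsilon>^2 and three bound
    m^3, hence the exponent 4 m.\<close>
  have lnn: "ln (2 * real n + 1) \<le> 40 * real m"
  proof -
    have m2: "real m \<le> 2 ^ m" by (metis of_nat_less_two_power less_imp_le)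
    have "real n \<le> sample_const * ((real d / \<epsilon>\<^sup>2) * real m ^ 3) + 1"
      using n(2) e2 by (simp add: field_simps)
    also have "\<dots> \<le> sample_const * (2 ^ m * (2 ^ m) ^ 3) + 1"
      using m(2) m2 by (intro add_right_mono mult_left_mono mult_mono power_mono) (auto simp: sample_const_def)
    finally have "2 * real n + 1 \<le> 2 * sample_const * 2 ^ (4 * m) + 3"
      by (simp add: power_mult[symmetric] power_add[symmetric] mult.commute)
    also have "\<dots> \<le> 2 ^ 53 * 2 ^ (4 * m)"
    proof -
      define X :: real where "X = 2 ^ (4 * m)"
      have "1 \<le> X" unfolding X_def by (rule one_le_power) simp
      then show ?thesis unfolding X_def[symmetric] by (simp add: sample_const_def)
    qed
    finally have "ln (2 * real n + 1) \<le> ln (2 ^ (53 + 4 * m))"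
      by (intro ln_mono) (auto simp: power_add)
    also have "\<dots> = (53 + 4 * real m) * ln 2" by (subst ln_realpow) auto
    also have "\<dots> \<le> (57 * real m) * (7 / 10)" using ln2 m1 by (intro mult_mono) auto
    also have "\<dots> \<le> 40 * real m" by simp
    finally show ?thesis .
  qed
  show "8 / (real n * (\<epsilon> / 128)\<^sup>2) \<le> 1 / 200"
  proof -
    have "8 / (real n * (\<epsilon> / 128)\<^sup>2) = 131072 / (real n * \<epsilon>\<^sup>2)" by (simp add: power_divide)
    also have "\<dots> \<le> 131072 / sample_const" using Kn by (intro divide_left_mono) (auto simp: sample_const_def)
    also have "\<dots> \<le> 1 / 200" by (simp add: sample_const_def)
    finally show ?thesis .
  qed
  show "(6 + ln (real n + 1)) / real n \<le> \<epsilon> / 256"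
  proof -
    have "ln (real n + 1) \<le> ln (2 * real n + 1)" using n0 by (intro ln_mono) auto
    then have "6 + ln (real n + 1) \<le> 46 * real m ^ 3" using lnn m1 m3 by linarith
    then have "(6 + ln (real n + 1)) / real n \<le> 46 * real m ^ 3 / real n" using n0 by (intro divide_right_mono) auto
    also have "\<dots> \<le> \<epsilon> / 256"
    proof -
      have "sample_const * real m ^ 3 * 1 \<le> sample_const * real m ^ 3 * real d"
        using d1 by (intro mult_left_mono) (auto simp: sample_const_def)
      also have "\<dots> \<le> real n * \<epsilon>\<^sup>2" using n(1) by (simp add: mult_ac)
      also have "\<dots> \<le> real n * \<epsilon>" using e2 by (intro mult_left_mono) auto
      finally have "sample_const * real m ^ 3 \<le> real n * \<epsilon>" by simp
      moreover have "46 * 256 * real m ^ 3 \<le> sample_const * real m ^ 3"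
        using m3 by (intro mult_right_mono) (auto simp: sample_const_def)
      ultimately have "46 * real m ^ 3 * 256 \<le> real n * \<epsilon>" by simp
      then show ?thesis using n0 by (simp add: field_simps)
    qed
    finally show ?thesis .
  qed
  \<comment> \<open>179200 = 7 * 128 * 200. With loss range at most 7 m and deviation \<epsilon> /
    128, a bracket of at most \<eta> gives failure probability exactly 1 / 200.\<close>
  define \<eta> where "\<eta> = \<epsilon> / (179200 * real m)"
  have \<eta>0: "0 < \<eta>" using \<epsilon> m1 by (simp add: \<eta>_def)
  have "real (d + 2) * ln (2 * real n + 1) \<le> (3 * real d) * (40 * real m)"
    using d1 lnn n0 by (intro mult_mono) auto
  also have "\<dots> \<le> (3 * (real n * \<epsilon>\<^sup>2 / (sample_const * real m ^ 3))) * (40 * real m)"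
    using dn by (intro mult_right_mono mult_left_mono) auto
  finally have "real (d + 2) * ln (2 * real n + 1) / (\<eta> * real n)
      \<le> (3 * (real n * \<epsilon>\<^sup>2 / (sample_const * real m ^ 3))) * (40 * real m) / (\<eta> * real n)"
    using \<eta>0 n0 by (intro divide_right_mono) auto
  \<comment> \<open>21504000 = 3 * 40 * 179200, from d + 2 <= 3 d and ln (2 n + 1) <= 40 m.\<close>
  also have "\<dots> = 21504000 * \<epsilon> / (sample_const * real m)"
    using \<epsilon> m1 n0 by (simp add: \<eta>_def field_simps power2_eq_square power3_eq_cube)
  also have "\<dots> \<le> \<epsilon> / (358400 * real m)"
    using \<epsilon> m1 by (simp add: sample_const_def field_simps)
  also have "\<dots> = \<eta> / 2" using m1 by (simp add: \<eta>_def)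
  finally have half: "real (d + 2) * ln (2 * real n + 1) / (\<eta> * real n) + \<eta> / 2 \<le> \<eta>"
    by (rule order_trans[OF add_right_mono]) simp
  have "- ln (\<epsilon> / 256) * (real (d + 2) * ln (2 * real n + 1) / (\<eta> * real n) + \<eta> / 2) / (\<epsilon> / 128)
      \<le> 7 * real m * \<eta> / (\<epsilon> / 128)"
    using L half \<epsilon> \<eta>0 n0 by (intro divide_right_mono mult_mono add_nonneg_nonneg) auto
  also have "\<dots> = 1 / 200" using \<epsilon> m1 by (simp add: \<eta>_def field_simps)
  finally show "- ln (\<epsilon> / 256) * ((real (d + 2) * ln (2 * real n + 1) / (\<epsilon> / (179200 * real m) * real n) + \<epsilon> / (179200 * real m) / 2)) / (\<epsilon> / 128) \<le> 1 / 200"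
    unfolding \<eta>_def .
qed

context sigmoid_learning
begin

lemma L2_set_w_star: "L2_set w_star {..<Suc d} \<le> w_max"
proof -
  have "L2_set w_star {..<Suc d} = sqrt (\<tau>\<^sup>2 + (\<Sum>i<d. (w i)\<^sup>2))"
    by (simp add: L2_set_def w_star_def add.commute)
  also have "\<dots> \<le> sqrt (\<tau>\<^sup>2) + sqrt (\<Sum>i<d. (w i)\<^sup>2)"
    by (rule sqrt_add_le_add_sqrt) (auto intro: sum_nonneg)
  also have "\<dots> \<le> w_max" using w_bound by (simp add: L2_set_def)
  finally show ?thesis .
qed

text \<open>The error budget in units e = \<epsilon> / 256: 2 for the uniform deviation, 4 for
  squeezing, 1 for the optimisation, 1 for the surrogate and 2 for Chebyshev. The excess is at most
  10 e, so the squared error is at most 160 e + 8 e, below 256 e.\<close>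

lemma near_optimal_sq_error:
  assumes d: "1 \<le> d" and \<epsilon>: "0 < \<epsilon>" "\<epsilon> < 1" and n: "1 \<le> n" "(6 + ln (real n + 1)) / real n \<le> \<epsilon> / 256"
    and unif: "\<And>v. (\<integral>z. smooth_loss (\<epsilon> / 256) (margin d v z) \<partial>D)
      \<le> (\<Sum>i<n. smooth_loss (\<epsilon> / 256) (margin d v (\<omega> i))) / real n + \<epsilon> / 128"
    and cheb: "(\<Sum>i<n. logistic_loss (margin d w_star (\<omega> i))) / real n
      \<le> (\<integral>z. logistic_loss (margin d w_star z) \<partial>D) + \<epsilon> / 128"
    and opt: "total_loss (Suc d) n (\<lambda>i. signed_features d (\<omega> i)) v
      \<le> total_loss (Suc d) n (\<lambda>i. signed_features d (\<omega> i)) w_star + real n * (real n * (\<epsilon> / 256))"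
  shows "sq_error d D w \<tau> v (v d) \<le> \<epsilon>"
proof -
  define e where "e = \<epsilon> / 256"
  have e: "0 < e" "e < 1 / 4" "e < 1 / 2" using \<epsilon> by (auto simp: e_def)
  have n0: "0 < real n" using n by simp
  have tl: "total_loss (Suc d) n (\<lambda>i. signed_features d (\<omega> i)) u = (\<Sum>i<n. harm_loss n (margin d u (\<omega> i)))" for u
    by (simp add: total_loss_def margin_def)
  define a where "a u = (\<Sum>i<n. logistic_loss (margin d u (\<omega> i))) / real n" for u
  have "(\<Sum>i<n. smooth_loss e (margin d v (\<omega> i))) \<le> (\<Sum>i<n. logistic_loss (margin d v (\<omega> i)) - ln (1 - 2 * e))"
    using e by (intro sum_mono smooth_loss_le_logistic_loss) auto
  then have "(\<Sum>i<n. smooth_loss e (margin d v (\<omega> i))) \<le> (\<Sum>i<n. logistic_loss (margin d v (\<omega> i))) - real n * ln (1 - 2 * e)"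
    by (simp add: sum_subtractf)
  then have "(\<Sum>i<n. smooth_loss e (margin d v (\<omega> i))) / real n \<le> a v - ln (1 - 2 * e)"
    using n0 by (simp add: a_def field_simps)
  moreover have "- ln (1 - 2 * e) \<le> 4 * e"
  proof -
    have "- (2 * e) - 2 * (2 * e)\<^sup>2 \<le> ln (1 - 2 * e)"
      using e by (intro ln_one_minus_pos_lower_bound) auto
    moreover have "2 * (2 * e)\<^sup>2 \<le> 2 * e" using e by (simp add: power2_eq_square)
    ultimately show ?thesis by simp
  qed
  \<comment> \<open>The surrogate is off by 3 + ln (n + 1) below and by 3 above, per example and
    scaled by n, which gives the term 6 + ln (n + 1).\<close>
  moreover have "a v \<le> a w_star + e + (6 + ln (real n + 1)) / real n"
  proof -
    have "real n * (\<Sum>i<n. logistic_loss (margin d v (\<omega> i)))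
        \<le> (\<Sum>i<n. harm_loss n (margin d v (\<omega> i)) + (3 + ln (real n + 1)))"
      unfolding sum_distrib_left using harm_loss_lower[of n] by (intro sum_mono) (simp add: add.assoc)
    also have "\<dots> = (\<Sum>i<n. harm_loss n (margin d v (\<omega> i))) + real n * (3 + ln (real n + 1))"
      by (simp add: sum.distrib)
    also have "(\<Sum>i<n. harm_loss n (margin d v (\<omega> i)))
        \<le> (\<Sum>i<n. harm_loss n (margin d w_star (\<omega> i))) + real n * (real n * e)"
      using opt unfolding tl e_def .
    also have "(\<Sum>i<n. harm_loss n (margin d w_star (\<omega> i)))
        \<le> (\<Sum>i<n. real n * logistic_loss (margin d w_star (\<omega> i)) + 3)"
      by (intro sum_mono harm_loss_upper)
    also have "\<dots> = real n * (\<Sum>i<n. logistic_loss (margin d w_star (\<omega> i))) + real n * 3"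
      by (simp add: sum.distrib sum_distrib_left)
    finally have "real n * (\<Sum>i<n. logistic_loss (margin d v (\<omega> i)))
        \<le> real n * (\<Sum>i<n. logistic_loss (margin d w_star (\<omega> i))) + real n * 3 + real n * (real n * e) + real n * (3 + ln (real n + 1))"
      by simp
    then have "real n * (\<Sum>i<n. logistic_loss (margin d v (\<omega> i)))
        \<le> real n * ((\<Sum>i<n. logistic_loss (margin d w_star (\<omega> i))) + real n * e + (6 + ln (real n + 1)))"
      by (simp add: algebra_simps)
    then have "(\<Sum>i<n. logistic_loss (margin d v (\<omega> i)))
        \<le> (\<Sum>i<n. logistic_loss (margin d w_star (\<omega> i))) + real n * e + (6 + ln (real n + 1))"
      using n0 by (simp only: mult_le_cancel_left_pos)
    then have "a v \<le> ((\<Sum>i<n. logistic_loss (margin d w_star (\<omega> i))) + real n * e + (6 + ln (real n + 1))) / real n"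
      unfolding a_def using n0 by (intro divide_right_mono) auto
    also have "\<dots> = a w_star + e + (6 + ln (real n + 1)) / real n"
      using n0 by (simp add: a_def add_divide_distrib)
    finally show ?thesis .
  qed
  ultimately have "(\<integral>z. smooth_loss e (margin d v z) \<partial>D) - (\<integral>z. logistic_loss (margin d w_star z) \<partial>D) \<le> 10 * e"
  proof -
    assume 1: "(\<Sum>i<n. smooth_loss e (margin d v (\<omega> i))) / real n \<le> a v - ln (1 - 2 * e)"
      "- ln (1 - 2 * e) \<le> 4 * e" "a v \<le> a w_star + e + (6 + ln (real n + 1)) / real n"
    have "(\<integral>z. smooth_loss e (margin d v z) \<partial>D) \<le> (\<Sum>i<n. smooth_loss e (margin d v (\<omega> i))) / real n + 2 * e"
      using unif[of v] by (simp add: e_def)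
    moreover have "a w_star \<le> (\<integral>z. logistic_loss (margin d w_star z) \<partial>D) + 2 * e"
      using cheb by (simp add: a_def e_def)
    moreover have "(6 + ln (real n + 1)) / real n \<le> e" using n(2) by (simp add: e_def)
    ultimately show ?thesis using 1 by linarith
  qed
  then have "sq_error d D w \<tau> v (v d) \<le> 16 * (10 * e) + 8 * e\<^sup>2"
    by (intro order_trans[OF sq_error_le_excess[OF e(1,3)]] add_right_mono mult_left_mono) auto
  also have "8 * e\<^sup>2 \<le> 8 * e" using e by (simp add: power2_eq_square)
  finally show ?thesis using \<epsilon> by (simp add: e_def)
qed

end

section \<open>Programs as transformers of memory arrays\<close>

type_synonym memory = "nat \<Rightarrow> nat \<Rightarrow> real"

text \<open>The real memory is viewed as 32 interleaved arrays: entry \<open>i\<close> of array \<open>k\<close> is cell \<open>32 * i + k\<close>.\<close>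

definition mk :: "(nat \<Rightarrow> nat) \<Rightarrow> memory \<Rightarrow> nat \<Rightarrow> ram_state" where
  "mk nm A dr = \<lparr>nmem = nm, rmem = (\<lambda>a. A (a mod 32) (a div 32)), drawn = dr\<rparr>"

lemma mk_simps[simp]: "nmem (mk nm A dr) = nm" "drawn (mk nm A dr) = dr"
  "rmem (mk nm A dr) a = A (a mod 32) (a div 32)"
  by (auto simp: mk_def)

lemma mk_nmem_upd: "(mk nm A dr)\<lparr>nmem := nm'\<rparr> = mk nm' A dr"
  by (simp add: mk_def)

definition double :: "nexp \<Rightarrow> nexp" where "double e = NAdd e e"

text \<open>Five doublings multiply by 32 without a product. Each doubling duplicates the
  expression, so the cost grows by the constant factor 32.\<close>

definition slot :: "nat \<Rightarrow> nexp \<Rightarrow> nexp" where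
  "slot k e = NAdd (double (double (double (double (double e))))) (NConst k)"

lemma nval_slot[simp]: "nval (slot k e) s = 32 * nval e s + k"
  by (simp add: slot_def double_def)

lemma ncost_slot[simp]: "ncost (slot k e) = 33 + 32 * ncost e"
  by (simp add: slot_def double_def)

definition var :: "nat \<Rightarrow> nexp" where "var x = NMem (NConst x)"

lemma var_simps[simp]: "nval (var x) s = nmem s x" "ncost (var x) = 2"
  by (auto simp: var_def)

definition rd :: "nat \<Rightarrow> nexp \<Rightarrow> rexp" where "rd k e = RMem (slot k e)"
definition wr :: "nat \<Rightarrow> nexp \<Rightarrow> rexp \<Rightarrow> com" where "wr k e r = RAssign (slot k e) r"

lemma slot_div_mod[simp]: "k < 32 \<Longrightarrow> (32 * i + k) mod 32 = k" "k < 32 \<Longrightarrow> (32 * i + k) div 32 = i" for i k :: nat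
  by auto

lemma rd_simps[simp]: "k < 32 \<Longrightarrow> rval (rd k e) (mk nm A dr) = A k (nval e (mk nm A dr))"
  "rcost (rd k e) = 34 + 32 * ncost e"
  by (auto simp: rd_def)

definition put :: "nat \<Rightarrow> nat \<Rightarrow> real \<Rightarrow> memory \<Rightarrow> memory" where
  "put k i v A = A(k := (A k)(i := v))"

lemma put_apply: "put k i v A k' j = (if k = k' \<and> i = j then v else A k' j)"
  by (auto simp: put_def)

lemma put_other[simp]: "k' \<noteq> k \<Longrightarrow> put k i v A k' = A k'"
  by (auto simp: put_def)

lemma put_same[simp]: "put k i v A k i = v"
  by (auto simp: put_def)

lemma put_same_other[simp]: "i \<noteq> j \<Longrightarrow> put k i v A k j = A k j"
  by (auto simp: put_def)

text \<open>Time is bounded from above instead of being computed, so that branches of different cost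
  and rounded loop bounds compose.\<close>

definition runs :: "nat \<Rightarrow> (nat \<Rightarrow> example) \<Rightarrow> com \<Rightarrow> nat \<Rightarrow> ram_state \<Rightarrow> ram_state \<Rightarrow> bool" where
  "runs d \<omega> c T s s' \<longleftrightarrow> (\<exists>t\<le>T. exec d \<omega> c s t s')"

lemma runs_mono: "runs d \<omega> c T s s' \<Longrightarrow> T \<le> T' \<Longrightarrow> runs d \<omega> c T' s s'"
  unfolding runs_def by (meson order_trans)

lemma runs_skip: "1 \<le> T \<Longrightarrow> runs d \<omega> Skip T s s"
  unfolding runs_def by (blast intro: exec.Skip)

lemma runs_seq: "runs d \<omega> c1 T1 s s1 \<Longrightarrow> runs d \<omega> c2 T2 s1 s2 \<Longrightarrow> T1 + T2 \<le> T \<Longrightarrow> runs d \<omega> (Seq c1 c2) T s s2"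
  unfolding runs_def by (meson add_mono exec.Seq order_trans)

lemma runs_if_true: "bval b s \<Longrightarrow> runs d \<omega> c1 T1 s s' \<Longrightarrow> 1 + bcost b + T1 \<le> T \<Longrightarrow> runs d \<omega> (If b c1 c2) T s s'"
  unfolding runs_def by (meson add_left_mono exec.IfTrue order_trans)

lemma runs_if_false: "\<not> bval b s \<Longrightarrow> runs d \<omega> c2 T1 s s' \<Longrightarrow> 1 + bcost b + T1 \<le> T \<Longrightarrow> runs d \<omega> (If b c1 c2) T s s'"
  unfolding runs_def by (meson add_left_mono exec.IfFalse order_trans)

lemma runs_wr:
  assumes "k < 32" "nval e (mk nm A dr) = i" "rval r (mk nm A dr) = v" "34 + 32 * ncost e + rcost r \<le> T"
  shows "runs d \<omega> (wr k e r) T (mk nm A dr) (mk nm (put k i v A) dr)"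
proof -
  have "(mk nm A dr)\<lparr>rmem := (rmem (mk nm A dr))(32 * i + k := v)\<rparr> = mk nm (put k i v A) dr"
  proof -
    have "((\<lambda>a. A (a mod 32) (a div 32))(32 * i + k := v)) = (\<lambda>a. put k i v A (a mod 32) (a div 32))"
    proof
      fix a :: nat
      have "a = 32 * (a div 32) + a mod 32" by simp
      then show "((\<lambda>a. A (a mod 32) (a div 32))(32 * i + k := v)) a = put k i v A (a mod 32) (a div 32)"
        using assms(1) by (auto simp: put_apply)
    qed
    then show ?thesis by (simp add: mk_def)
  qed
  then show ?thesis
    using exec.RAssign[of d \<omega> "slot k e" r "mk nm A dr"] assms unfolding runs_def wr_def
    by (intro exI[of _ "1 + ncost (slot k e) + rcost r"]) simp
qed

lemma runs_nassign:
  assumes "nval e s = v" "2 + ncost e \<le> T"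
  shows "runs d \<omega> (NAssign (NConst x) e) T s (s\<lparr>nmem := (nmem s)(x := v)\<rparr>)"
  using exec.NAssign[of d \<omega> "NConst x" e s] assms unfolding runs_def
  by (intro exI[of _ "1 + ncost (NConst x) + ncost e"]) simp

text \<open>The counter is reset at the end, so that a loop does not change the memory of natural numbers.\<close>
definition For :: "nat \<Rightarrow> nexp \<Rightarrow> com \<Rightarrow> com" where
  "For x e body = Seq
     (While (BNot (NLe e (var x))) (Seq body (NAssign (NConst x) (NAdd (var x) (NConst 1)))))
     (NAssign (NConst x) (NConst 0))"

text \<open>The general loop rule, in which the body may also write the natural number memory or
  draw examples; the invariant has to fix the counter and the loop bound.\<close>

lemma runs_for_state:
  assumes start: "I 0 s" and inv: "\<And>i s. I i s \<Longrightarrow> nmem s x = i \<and> nval e s = N"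
    and body: "\<And>i s. i < N \<Longrightarrow> I i s \<Longrightarrow>
      \<exists>s'. runs d \<omega> body Tb s s' \<and> nmem s' x = i \<and> I (Suc i) (s'\<lparr>nmem := (nmem s')(x := Suc i)\<rparr>)"
  shows "\<exists>s'. runs d \<omega> (For x e body) (N * (Tb + ncost e + 20) + ncost e + 20) s (s'\<lparr>nmem := (nmem s')(x := 0)\<rparr>) \<and> I N s'"
proof -
  let ?b = "BNot (NLe e (var x))"
  let ?w = "While ?b (Seq body (NAssign (NConst x) (NAdd (var x) (NConst 1))))"
  have "\<exists>s'. runs d \<omega> ?w ((N - i) * (Tb + ncost e + 20) + ncost e + 10) s s' \<and> I N s'" if "I i s" "i \<le> N" for i s
    using that
  proof (induction "N - i" arbitrary: i s)
    case 0
    then have i: "i = N" by simp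
    with 0 inv have "\<not> bval ?b s" by force
    then have "exec d \<omega> ?w s (1 + bcost ?b) s" by (rule exec.WhileFalse)
    then show ?case using 0 i unfolding runs_def by (intro exI[of _ s]) (auto intro!: exI[of _ "1 + bcost ?b"])
  next
    case (Suc r)
    then have i: "i < N" by simp
    have nm: "nmem s x = i" "nval e s = N" using inv[OF Suc.prems(1)] by auto
    then have b: "bval ?b s" using i by simp
    obtain s1 where s1: "runs d \<omega> body Tb s s1" "nmem s1 x = i" "I (Suc i) (s1\<lparr>nmem := (nmem s1)(x := Suc i)\<rparr>)"
      using body[OF i Suc.prems(1)] by blast
    let ?s2 = "s1\<lparr>nmem := (nmem s1)(x := Suc i)\<rparr>"
    have inc: "runs d \<omega> (NAssign (NConst x) (NAdd (var x) (NConst 1))) 6 s1 ?s2"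
      by (rule runs_nassign) (use s1 in auto)
    have "runs d \<omega> (Seq body (NAssign (NConst x) (NAdd (var x) (NConst 1)))) (Tb + 6) s ?s2"
      by (rule runs_seq[OF s1(1) inc]) simp
    then obtain t1 where t1: "t1 \<le> Tb + 6" "exec d \<omega> (Seq body (NAssign (NConst x) (NAdd (var x) (NConst 1)))) s t1 ?s2"
      by (auto simp: runs_def)
    obtain s3 t2 where s3: "t2 \<le> (N - Suc i) * (Tb + ncost e + 20) + ncost e + 10" "exec d \<omega> ?w ?s2 t2 s3" "I N s3"
    proof -
      have "\<exists>s'. runs d \<omega> ?w ((N - Suc i) * (Tb + ncost e + 20) + ncost e + 10) ?s2 s' \<and> I N s'"
        using Suc.hyps(2) i by (intro Suc.hyps(1)[OF _ s1(3)]) auto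
      then show ?thesis using that by (auto simp only: runs_def)
    qed
    have "exec d \<omega> ?w s (1 + bcost ?b + t1 + t2) s3"
      by (rule exec.WhileTrue[OF b t1(2) s3(2)])
    moreover have "1 + bcost ?b + t1 + t2 \<le> (N - i) * (Tb + ncost e + 20) + ncost e + 10"
    proof -
      have "N - i = Suc (N - Suc i)" using i by simp
      then show ?thesis using t1(1) s3(1) by simp
    qed
    ultimately show ?case using s3(3) unfolding runs_def by blast
  qed
  from this[OF start] obtain s' where s': "runs d \<omega> ?w (N * (Tb + ncost e + 20) + ncost e + 10) s s'" "I N s'" by auto
  have "runs d \<omega> (NAssign (NConst x) (NConst 0)) 3 s' (s'\<lparr>nmem := (nmem s')(x := 0)\<rparr>)"
    by (rule runs_nassign) auto
  with s' show ?thesis unfolding For_def by (intro exI[of _ s'] conjI runs_seq) auto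
qed

text \<open>For bodies that preserve all counters and draw nothing, so that the invariant is about
  the arrays alone.\<close>

lemma runs_for:
  assumes x: "nm x = 0" and start: "I 0 A" and bound: "\<And>i A. nval e (mk (nm(x := i)) A dr) = N"
    and body: "\<And>i A. i < N \<Longrightarrow> I i A \<Longrightarrow>
      \<exists>A'. runs d \<omega> body Tb (mk (nm(x := i)) A dr) (mk (nm(x := i)) A' dr) \<and> I (Suc i) A'"
    and T: "N * (Tb + ncost e + 20) + ncost e + 20 \<le> T"
  shows "\<exists>A'. runs d \<omega> (For x e body) T (mk nm A dr) (mk nm A' dr) \<and> I N A'"
proof -
  define J where "J i s \<longleftrightarrow> (\<exists>A. s = mk (nm(x := i)) A dr \<and> I i A)" for i s
  have "J 0 (mk nm A dr)" using start x unfolding J_def by (intro exI[of _ A]) (auto simp: fun_upd_idem)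
  then have "\<exists>s'. runs d \<omega> (For x e body) (N * (Tb + ncost e + 20) + ncost e + 20) (mk nm A dr) (s'\<lparr>nmem := (nmem s')(x := 0)\<rparr>) \<and> J N s'"
  proof (rule runs_for_state)
    show "nmem s x = i \<and> nval e s = N" if "J i s" for i s
      using that bound by (auto simp: J_def)
    show "\<exists>s'. runs d \<omega> body Tb s s' \<and> nmem s' x = i \<and> J (Suc i) (s'\<lparr>nmem := (nmem s')(x := Suc i)\<rparr>)"
      if i: "i < N" and s: "J i s" for i s
    proof -
      from s obtain A where A: "s = mk (nm(x := i)) A dr" "I i A" by (auto simp: J_def)
      from body[OF i A(2)] obtain A' where "runs d \<omega> body Tb s (mk (nm(x := i)) A' dr)" "I (Suc i) A'"
        using A by auto
      then show ?thesis by (intro exI[of _ "mk (nm(x := i)) A' dr"]) (auto simp: J_def mk_nmem_upd)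
    qed
  qed
  then obtain A' where A': "runs d \<omega> (For x e body) (N * (Tb + ncost e + 20) + ncost e + 20) (mk nm A dr)
      (mk (nm(x := 0)) A' dr)" "I N A'"
    by (auto simp: J_def mk_nmem_upd)
  moreover have "nm(x := 0) = nm" using x by (simp add: fun_upd_idem)
  ultimately show ?thesis using runs_mono[OF A'(1) T] by auto
qed

definition same :: "nat set \<Rightarrow> memory \<Rightarrow> memory \<Rightarrow> bool" where
  "same K A A' \<longleftrightarrow> (\<forall>k. k \<notin> K \<longrightarrow> A' k = A k)"

lemma same_refl: "same K A A" by (simp add: same_def)

lemma same_trans: "same K A A' \<Longrightarrow> same K' A' A'' \<Longrightarrow> K \<subseteq> L \<Longrightarrow> K' \<subseteq> L \<Longrightarrow> same L A A''"
  by (auto simp: same_def subset_eq) (metis)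

text \<open>The summand may be evaluated in any memory that agrees with the initial one outside
  array k, as the loop writes nowhere else.\<close>

lemma runs_accumulate:
  assumes x: "nm x = 0" and k: "k < 32" and bound: "\<And>i A. nval e (mk (nm(x := i)) A dr) = N"
    and r: "\<And>i A'. i < N \<Longrightarrow> same {k} A A' \<Longrightarrow> rval r (mk (nm(x := i)) A' dr) = f i"
    and e0: "\<And>i A. nval e0 (mk (nm(x := i)) A dr) = p"
    and T: "N * (70 + 64 * ncost e0 + rcost r + ncost e + 20) + ncost e + 20 \<le> T"
  shows "\<exists>A'. runs d \<omega> (For x e (wr k e0 (RAdd (rd k e0) r))) T (mk nm A dr) (mk nm A' dr) \<and>
    same {k} A A' \<and> A' k p = A k p + (\<Sum>i<N. f i) \<and> (\<forall>j. j \<noteq> p \<longrightarrow> A' k j = A k j)"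
proof -
  define I where "I i A' \<longleftrightarrow> same {k} A A' \<and> A' k p = A k p + (\<Sum>i<i. f i) \<and> (\<forall>j. j \<noteq> p \<longrightarrow> A' k j = A k j)" for i A'
  have "\<exists>A'. runs d \<omega> (For x e (wr k e0 (RAdd (rd k e0) r))) T (mk nm A dr) (mk nm A' dr) \<and> I N A'"
  proof (rule runs_for[OF x _ bound _ T])
    show "I 0 A" by (simp add: I_def same_refl)
    fix i A' assume i: "i < N" and I: "I i A'"
    have v: "rval (RAdd (rd k e0) r) (mk (nm(x := i)) A' dr) = A k p + (\<Sum>i<Suc i. f i)"
      using I r[OF i, of A'] k e0 by (simp add: I_def)
    have "runs d \<omega> (wr k e0 (RAdd (rd k e0) r)) (70 + 64 * ncost e0 + rcost r) (mk (nm(x := i)) A' dr)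
        (mk (nm(x := i)) (put k p (A k p + (\<Sum>i<Suc i. f i)) A') dr)"
      by (rule runs_wr[OF k e0 v]) simp
    moreover have "I (Suc i) (put k p (A k p + (\<Sum>i<Suc i. f i)) A')"
      using I by (auto simp: I_def same_def put_apply)
    ultimately show "\<exists>A''. runs d \<omega> (wr k e0 (RAdd (rd k e0) r)) (70 + 64 * ncost e0 + rcost r) (mk (nm(x := i)) A' dr)
        (mk (nm(x := i)) A'' dr) \<and> I (Suc i) A''" by blast
  qed
  then show ?thesis by (simp add: I_def)
qed

text \<open>The hypothesis on r also grants that entries of array k not yet reached are the old
  ones, which makes updates in place possible.\<close>

lemma runs_map:
  assumes x: "nm x = 0" and k: "k < 32" and bound: "\<And>i A. nval e (mk (nm(x := i)) A dr) = N"
    and e0: "\<And>i A. i < N \<Longrightarrow> nval e0 (mk (nm(x := i)) A dr) = b + i"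
    and r: "\<And>i A'. i < N \<Longrightarrow> same {k} A A' \<Longrightarrow> (\<forall>j. j < b \<or> b + i \<le> j \<longrightarrow> A' k j = A k j) \<Longrightarrow>
      rval r (mk (nm(x := i)) A' dr) = f i"
    and T: "N * (34 + 32 * ncost e0 + rcost r + ncost e + 20) + ncost e + 20 \<le> T"
  shows "\<exists>A'. runs d \<omega> (For x e (wr k e0 r)) T (mk nm A dr) (mk nm A' dr) \<and>
    same {k} A A' \<and> (\<forall>i<N. A' k (b + i) = f i) \<and> (\<forall>j. j < b \<or> b + N \<le> j \<longrightarrow> A' k j = A k j)"
proof -
  define I where "I i A' \<longleftrightarrow> same {k} A A' \<and> (\<forall>i'<i. A' k (b + i') = f i') \<and> (\<forall>j. j < b \<or> b + i \<le> j \<longrightarrow> A' k j = A k j)" for i A'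
  have "\<exists>A'. runs d \<omega> (For x e (wr k e0 r)) T (mk nm A dr) (mk nm A' dr) \<and> I N A'"
  proof (rule runs_for[OF x _ bound _ T])
    show "I 0 A" by (simp add: I_def same_refl)
    fix i A' assume i: "i < N" and I: "I i A'"
    have "runs d \<omega> (wr k e0 r) (34 + 32 * ncost e0 + rcost r) (mk (nm(x := i)) A' dr)
        (mk (nm(x := i)) (put k (b + i) (f i) A') dr)"
      using I by (intro runs_wr[OF k e0[OF i] r[OF i]]) (auto simp: I_def)
    moreover have "I (Suc i) (put k (b + i) (f i) A')"
      using I by (auto simp: I_def same_def put_apply less_Suc_eq)
    ultimately show "\<exists>A''. runs d \<omega> (wr k e0 r) (34 + 32 * ncost e0 + rcost r) (mk (nm(x := i)) A' dr)
        (mk (nm(x := i)) A'' dr) \<and> I (Suc i) A''" by blast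
  qed
  then show ?thesis by (simp add: I_def)
qed

section \<open>One iteration of the ellipsoid method\<close>

definition dim :: nexp where "dim = NAdd (var 0) (NConst 1)"
definition entry :: "nat \<Rightarrow> nat \<Rightarrow> nexp" where
  "entry x y = NAdd (NMem (NAdd (NConst 20) (var x))) (var y)"
definition reg :: "nat \<Rightarrow> rexp" where "reg k = rd k (NConst 0)"
definition set_reg :: "nat \<Rightarrow> rexp \<Rightarrow> com" where "set_reg k r = wr k (NConst 0) r"

lemma dim_simps[simp]: "nval dim s = Suc (nmem s 0)" "ncost dim = 4"
  by (auto simp: dim_def)

lemma entry_simps[simp]: "nval (entry x y) s = nmem s (20 + nmem s x) + nmem s y" "ncost (entry x y) = 8"
  by (auto simp: entry_def)

lemma reg_simps[simp]: "k < 32 \<Longrightarrow> rval (reg k) (mk nm A dr) = A k 0" "rcost (reg k) = 66"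
  by (auto simp: reg_def)

lemma runs_set_reg:
  assumes "k < 32" "rval r (mk nm A dr) = v" "66 + rcost r \<le> T"
  shows "runs d \<omega> (set_reg k r) T (mk nm A dr) (mk nm (put k 0 v A) dr)"
  unfolding set_reg_def using assms by (intro runs_wr) auto

definition add_reg_loop :: "nat \<Rightarrow> nexp \<Rightarrow> nat \<Rightarrow> rexp \<Rightarrow> com" where
  "add_reg_loop x e k r = For x e (set_reg k (RAdd (reg k) r))"

lemma runs_add_reg_loop:
  assumes x: "nm x = 0" and k: "k < 32" and bound: "\<And>i A. nval e (mk (nm(x := i)) A dr) = N"
    and r: "\<And>i A'. i < N \<Longrightarrow> same {k} A A' \<Longrightarrow> rval r (mk (nm(x := i)) A' dr) = f i"
    and T: "N * (200 + rcost r + ncost e) + ncost e + 20 \<le> T"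
  shows "\<exists>A'. runs d \<omega> (add_reg_loop x e k r) T (mk nm A dr) (mk nm A' dr) \<and>
    same {k} A A' \<and> A' k 0 = A k 0 + (\<Sum>i<N. f i)"
proof -
  have "N * (70 + 64 * ncost (NConst 0) + rcost r + ncost e + 20) + ncost e + 20 \<le> N * (200 + rcost r + ncost e) + ncost e + 20"
    by (intro add_right_mono mult_left_mono) auto
  with T have T': "N * (70 + 64 * ncost (NConst 0) + rcost r + ncost e + 20) + ncost e + 20 \<le> T" by linarith
  show ?thesis
    using runs_accumulate[where d = d and \<omega> = \<omega> and A = A and ?e0.0 = "NConst 0" and p = 0, OF x k bound r _ T']
    unfolding add_reg_loop_def set_reg_def reg_def by auto
qed

text \<open>\<open>harm_line n l t\<close> with l in counter 8 and t in register 10.\<close>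

definition line_expr :: rexp where
  "line_expr = RSub (RSub (RSub (RMul (ROfNat (var 1)) (rd 3 (var 1))) (RMul (ROfNat (var 8)) (rd 3 (var 8))))
     (RMul (RSub (ROfNat (var 1)) (ROfNat (var 8))) (rd 3 (NSub (var 1) (var 8))))) (RMul (ROfNat (var 8)) (reg 10))"

definition scan_lines :: com where
  "scan_lines = For 8 (NAdd (var 1) (NConst 1)) (Seq (set_reg 16 line_expr)
     (If (RLe (reg 11) (reg 16)) (Seq (set_reg 11 (reg 16)) (set_reg 12 (ROfNat (var 8)))) Skip))"

definition example_loss :: com where
  "example_loss =
     Seq (set_reg 10 (RConst 0)) (Seq (add_reg_loop 7 dim 10 (RMul (rd 4 (var 7)) (rd 2 (entry 6 7))))
     (Seq (set_reg 11 (RConst 0)) (Seq (set_reg 12 (RConst 0)) (Seq scan_lines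
     (Seq (set_reg 9 (RAdd (reg 9) (reg 11)))
     (For 7 dim (wr 7 (var 7) (RSub (rd 7 (var 7)) (RMul (reg 12) (rd 2 (entry 6 7)))))))))))"

definition eval_loss :: com where
  "eval_loss = Seq (set_reg 9 (RConst 0)) (Seq (For 7 dim (wr 7 (var 7) (RConst 0))) (For 6 (var 1) example_loss))"

definition keep_best :: com where
  "keep_best = If (BNot (RLe (reg 13) (reg 9))) (Seq (set_reg 13 (reg 9)) (For 7 dim (wr 6 (var 7) (rd 4 (var 7))))) Skip"

text \<open>The transposed basis applied to the subgradient, that is, the cut in ball
  coordinates.\<close>

definition pull_back :: com where
  "pull_back = For 7 dim (Seq (wr 8 (var 7) (RConst 0))
     (For 6 dim (wr 8 (var 7) (RAdd (rd 8 (var 7)) (RMul (rd 5 (entry 6 7)) (rd 7 (var 6)))))))"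

definition norms :: com where
  "norms = Seq (set_reg 14 (RConst 0)) (Seq (set_reg 15 (RConst 0))
     (For 7 dim (Seq (set_reg 14 (RAdd (reg 14) (RMul (rd 8 (var 7)) (rd 8 (var 7)))))
       (If (RLe (RConst 0) (rd 8 (var 7))) (set_reg 15 (RAdd (reg 15) (rd 8 (var 7))))
         (set_reg 15 (RSub (reg 15) (rd 8 (var 7))))))))"

definition move :: com where
  "move = For 6 dim (Seq (set_reg 16 (RConst 0)) (Seq (add_reg_loop 7 dim 16 (RMul (rd 5 (entry 6 7)) (rd 8 (var 7))))
     (Seq (wr 4 (var 6) (RSub (rd 4 (var 6)) (RDiv (RMul (reg 18) (reg 16)) (reg 15))))
     (For 7 dim (wr 5 (entry 6 7) (RSub (RMul (reg 20) (rd 5 (entry 6 7)))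
        (RDiv (RMul (RMul (RSub (reg 20) (reg 19)) (reg 16)) (rd 8 (var 7))) (reg 14))))))))"

definition iteration :: com where
  "iteration = Seq eval_loss (Seq keep_best (Seq pull_back (Seq norms move)))"

text \<open>
  Natural number cells: 0 dimension, 1 number of examples, 2 and 3 doubling counts, 4 number of iterations,
  5 fill pointer, 6 to 9 loop counters, \<open>20 + i\<close> the offset of row \<open>i\<close> of a matrix (natural number expressions
  have no product).  Arrays: 0 accuracy, 1 norm bound, 2 examples, 3 harmonic numbers, 4 center, 5 basis,
  6 best iterate, 7 subgradient, 8 cut vector, 9 loss, 10 margin, 11 and 12 maximal line and its index,
  13 best loss, 14 and 15 squared Euclidean and \<open>l\<^sub>1\<close> norm of the cut vector, 16 and 17 scratch,
  18 to 20 the factors of an ellipsoid step.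
\<close>
locale machine =
  fixes d n :: nat and \<omega> :: "nat \<Rightarrow> example" and nm :: "nat \<Rightarrow> nat" and dr :: nat
  assumes nm0: "nm 0 = d" and nm1: "nm 1 = n"
    and counters: "nm 6 = 0" "nm 7 = 0" "nm 8 = 0"
    and table: "\<And>i. i < n + Suc d \<Longrightarrow> nm (20 + i) = i * Suc d"
begin

abbreviation D :: nat where "D \<equiv> Suc d"

lemma nm1'[simp]: "nm (Suc 0) = n" using nm1 by simp

lemmas nm_simps[simp] = nm0 nm1 counters

lemma entry_val[simp]:
  "i < n + D \<Longrightarrow> nm (20 + i) = i * D" by (rule table)

definition matrix :: "memory \<Rightarrow> nat \<Rightarrow> nat \<Rightarrow> nat \<Rightarrow> real" where
  "matrix A k i j = A k (i * D + j)"

lemma runs_scan_lines: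
  assumes H: "\<And>l. l \<le> n \<Longrightarrow> A 3 l = harm l" and A0: "A 11 0 = 0" "A 12 0 = 0"
    and nm': "nm' 1 = n" "nm' 8 = 0"
  shows "\<exists>A'. runs d \<omega> scan_lines ((n + 1) * 3000 + 100) (mk nm' A dr) (mk nm' A' dr) \<and> same {11, 12, 16} A A' \<and>
    A' 11 0 = harm_loss n (A 10 0) \<and> (\<exists>l\<le>n. A' 12 0 = real l \<and> harm_line n l (A 10 0) = harm_loss n (A 10 0))"
proof -
  define t where "t = A 10 0"
  define I where "I p A' \<longleftrightarrow> same {11, 12, 16} A A' \<and> (\<forall>l<p. harm_line n l t \<le> A' 11 0) \<and>
    (\<exists>l\<le>n. A' 12 0 = real l \<and> A' 11 0 = harm_line n l t)" for p A'
  have "\<exists>A'. runs d \<omega> scan_lines ((n + 1) * 3000 + 100) (mk nm' A dr) (mk nm' A' dr) \<and> I (n + 1) A'"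
    unfolding scan_lines_def
  proof (rule runs_for)
    show "nm' 8 = 0" by (rule nm')
    \<comment> \<open>The line of index 0 vanishes identically, so the zeros in registers 11 and 12
      are a valid first candidate.\<close>
    have "harm_line n 0 t = 0" by (simp add: harm_line_def)
    then show "I 0 A" using A0 by (auto simp: I_def same_refl intro!: exI[of _ 0])
    show "nval (NAdd (var 1) (NConst 1)) (mk (nm'(8 := i)) A dr) = n + 1" for i A using nm' by simp
    show "(n + 1) * (2900 + ncost (NAdd (var 1) (NConst 1)) + 20) + ncost (NAdd (var 1) (NConst 1)) + 20 \<le> (n + 1) * 3000 + 100"
      by simp
    fix p A' assume p: "p < n + 1" and I: "I p A'"
    let ?s = "mk (nm'(8 := p)) A' dr"
    define x where "x = harm_line n p t"
    have sm: "A' 3 = A 3" "A' 10 = A 10" using I by (auto simp: I_def same_def)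
    have "rval line_expr ?s = x"
      using p nm' by (simp add: line_expr_def x_def harm_line_def sm H t_def)
    then have 1: "runs d \<omega> (set_reg 16 line_expr) 1500 ?s (mk (nm'(8 := p)) (put 16 0 x A') dr)"
      by (intro runs_set_reg) (auto simp: line_expr_def)
    let ?A1 = "put 16 0 x A'"
    show "\<exists>A''. runs d \<omega> (Seq (set_reg 16 line_expr)
     (If (RLe (reg 11) (reg 16)) (Seq (set_reg 11 (reg 16)) (set_reg 12 (ROfNat (var 8)))) Skip)) 2900 ?s (mk (nm'(8 := p)) A'' dr) \<and> I (Suc p) A''"
    proof (cases "A' 11 0 \<le> x")
      case True
      let ?A2 = "put 12 0 (real p) (put 11 0 x ?A1)"
      have "runs d \<omega> (Seq (set_reg 11 (reg 16)) (set_reg 12 (ROfNat (var 8)))) 500 (mk (nm'(8 := p)) ?A1 dr) (mk (nm'(8 := p)) ?A2 dr)"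
        by (rule runs_seq[OF runs_set_reg runs_set_reg]) auto
      then have 2: "runs d \<omega> (If (RLe (reg 11) (reg 16)) (Seq (set_reg 11 (reg 16)) (set_reg 12 (ROfNat (var 8)))) Skip) 700
          (mk (nm'(8 := p)) ?A1 dr) (mk (nm'(8 := p)) ?A2 dr)"
        using True by (intro runs_if_true) auto
      have "I (Suc p) ?A2" using I True p unfolding I_def
        by (auto simp: same_def put_def x_def less_Suc_eq intro: order_trans)
      then show ?thesis by (intro exI[of _ ?A2] conjI runs_seq[OF 1 2]) simp
    next
      case False
      have 2: "runs d \<omega> (If (RLe (reg 11) (reg 16)) (Seq (set_reg 11 (reg 16)) (set_reg 12 (ROfNat (var 8)))) Skip) 700
          (mk (nm'(8 := p)) ?A1 dr) (mk (nm'(8 := p)) ?A1 dr)"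
        by (rule runs_if_false[OF _ runs_skip[OF order_refl]]) (use False in auto)
      have "I (Suc p) ?A1" using I False unfolding I_def
        by (auto simp: same_def put_def x_def less_Suc_eq)
      then show ?thesis by (intro exI[of _ ?A1] conjI runs_seq[OF 1 2]) simp
    qed
  qed
  then obtain A' where A': "runs d \<omega> scan_lines ((n + 1) * 3000 + 100) (mk nm' A dr) (mk nm' A' dr)" "I (n + 1) A'" by blast
  then obtain l where l: "l \<le> n" "A' 12 0 = real l" "A' 11 0 = harm_line n l t" by (auto simp: I_def)
  have "harm_loss n t = A' 11 0"
    using A'(2) harm_line_le_loss[OF l(1), of t] l(3) by (intro antisym harm_loss_le) (auto simp: I_def)
  with A' l show ?thesis by (intro exI[of _ A']) (auto simp: I_def t_def)
qed

lemma runs_example_loss: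
  assumes H: "\<And>l. l \<le> n \<Longrightarrow> A 3 l = harm l" and i: "i < n"
  shows "\<exists>A' l. runs d \<omega> example_loss ((n + D) * 8000 + 10000) (mk (nm(6 := i)) A dr) (mk (nm(6 := i)) A' dr) \<and>
    same {7, 9, 10, 11, 12, 16} A A' \<and> l \<le> n \<and>
    harm_line n l (\<Sum>j<D. A 4 j * matrix A 2 i j) = harm_loss n (\<Sum>j<D. A 4 j * matrix A 2 i j) \<and>
    A' 9 0 = A 9 0 + harm_loss n (\<Sum>j<D. A 4 j * matrix A 2 i j) \<and>
    (\<forall>j<D. A' 7 j = A 7 j - real l * matrix A 2 i j)"
proof -
  let ?m = "\<lambda>A. mk (nm(6 := i)) A dr"
  have row: "nm (20 + i) = i * D" using i by simp
  define t where "t = (\<Sum>j<D. A 4 j * matrix A 2 i j)"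
  have 1: "runs d \<omega> (set_reg 10 (RConst 0)) 100 (?m A) (?m (put 10 0 0 A))"
    by (rule runs_set_reg) auto
  obtain A2 where A2: "runs d \<omega> (add_reg_loop 7 dim 10 (RMul (rd 4 (var 7)) (rd 2 (entry 6 7)))) (D * 1000 + 100) (?m (put 10 0 0 A)) (?m A2)"
    "same {10} (put 10 0 0 A) A2" "A2 10 0 = t"
  proof -
    have "\<exists>A'. runs d \<omega> (add_reg_loop 7 dim 10 (RMul (rd 4 (var 7)) (rd 2 (entry 6 7)))) (D * 1000 + 100) (?m (put 10 0 0 A)) (?m A') \<and>
      same {10} (put 10 0 0 A) A' \<and> A' 10 0 = put 10 0 0 A 10 0 + (\<Sum>j<D. A 4 j * matrix A 2 i j)"
    proof (rule runs_add_reg_loop)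
      fix j A' assume "j < D" "same {10} (put 10 0 0 A) A'"
      then have "A' 4 = A 4" "A' 2 = A 2" by (simp_all add: same_def)
      then show "rval (RMul (rd 4 (var 7)) (rd 2 (entry 6 7))) (mk ((nm(6 := i))(7 := j)) A' dr) = A 4 j * matrix A 2 i j"
        using row by (simp add: matrix_def)
    qed auto
    then show ?thesis using that by (auto simp: t_def)
  qed
  have 3: "runs d \<omega> (set_reg 11 (RConst 0)) 100 (?m A2) (?m (put 11 0 0 A2))"
    by (rule runs_set_reg) auto
  have 4: "runs d \<omega> (set_reg 12 (RConst 0)) 100 (?m (put 11 0 0 A2)) (?m (put 12 0 0 (put 11 0 0 A2)))"
    by (rule runs_set_reg) auto
  let ?A4 = "put 12 0 0 (put 11 0 0 A2)"
  have sm4: "same {10, 11, 12} A ?A4" using A2(2) by (auto simp: same_def put_def)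
  have "\<exists>A'. runs d \<omega> scan_lines ((n + 1) * 3000 + 100) (?m ?A4) (?m A') \<and> same {11, 12, 16} ?A4 A' \<and>
    A' 11 0 = harm_loss n (?A4 10 0) \<and> (\<exists>l\<le>n. A' 12 0 = real l \<and> harm_line n l (?A4 10 0) = harm_loss n (?A4 10 0))"
    using H sm4 by (intro runs_scan_lines) (auto simp: same_def)
  then obtain A5 l where A5: "runs d \<omega> scan_lines ((n + 1) * 3000 + 100) (?m ?A4) (?m A5)" "same {11, 12, 16} ?A4 A5"
    "A5 11 0 = harm_loss n t" "l \<le> n" "A5 12 0 = real l" "harm_line n l t = harm_loss n t"
    using A2(3) by auto
  have sm5: "same {10, 11, 12, 16} A A5" by (rule same_trans[OF sm4 A5(2)]) auto
  let ?A6 = "put 9 0 (A 9 0 + harm_loss n t) A5"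
  have 6: "runs d \<omega> (set_reg 9 (RAdd (reg 9) (reg 11))) 300 (?m A5) (?m ?A6)"
    using sm5 A5(3) by (intro runs_set_reg) (auto simp: same_def)
  have sm6: "same {9, 10, 11, 12, 16} A ?A6" using sm5 by (auto simp: same_def put_def)
  obtain A7 where A7: "runs d \<omega> (For 7 dim (wr 7 (var 7) (RSub (rd 7 (var 7)) (RMul (reg 12) (rd 2 (entry 6 7)))))) (D * 1000 + 100) (?m ?A6) (?m A7)"
    "same {7} ?A6 A7" "\<And>j. j < D \<Longrightarrow> A7 7 j = A 7 j - real l * matrix A 2 i j"
  proof -
    have "\<exists>A'. runs d \<omega> (For 7 dim (wr 7 (var 7) (RSub (rd 7 (var 7)) (RMul (reg 12) (rd 2 (entry 6 7)))))) (D * 1000 + 100) (?m ?A6) (?m A') \<and>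
      same {7} ?A6 A' \<and> (\<forall>j<D. A' 7 (0 + j) = A 7 j - real l * matrix A 2 i j) \<and> (\<forall>j. j < 0 \<or> 0 + D \<le> j \<longrightarrow> A' 7 j = ?A6 7 j)"
    proof (rule runs_map)
      fix j A' assume j: "j < D" "same {7} ?A6 A'" "\<forall>j'. j' < 0 \<or> 0 + j \<le> j' \<longrightarrow> A' 7 j' = ?A6 7 j'"
      have "A' 12 = ?A6 12" "A' 2 = ?A6 2" using j(2) by (auto simp: same_def)
      moreover have "?A6 2 = A 2" "?A6 7 = A 7" using sm6 by (auto simp: same_def)
      moreover have "A' 7 j = ?A6 7 j" using j(3) by simp
      ultimately show "rval (RSub (rd 7 (var 7)) (RMul (reg 12) (rd 2 (entry 6 7)))) (mk ((nm(6 := i))(7 := j)) A' dr) = A 7 j - real l * matrix A 2 i j"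
        using row A5(5) by (simp add: matrix_def)
    qed auto
    then show ?thesis using that by auto
  qed
  have "same {7, 9, 10, 11, 12, 16} A A7" by (rule same_trans[OF sm6 A7(2)]) auto
  moreover have "A7 9 0 = A 9 0 + harm_loss n t" using A7(2) by (auto simp: same_def)
  moreover have "runs d \<omega> example_loss ((n + D) * 8000 + 10000) (?m A) (?m A7)"
    unfolding example_loss_def
    by (rule runs_seq[OF 1 runs_seq[OF A2(1) runs_seq[OF 3 runs_seq[OF 4 runs_seq[OF A5(1) runs_seq[OF 6 A7(1) order_refl] order_refl] order_refl] order_refl] order_refl]]) simp
  ultimately show ?thesis using A5(4,6) A7(3) unfolding t_def by blast
qed

lemma runs_eval_loss:
  assumes H: "\<And>l. l \<le> n \<Longrightarrow> A 3 l = harm l"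
  shows "\<exists>A' l. runs d \<omega> eval_loss ((n + D) * (n + D) * 30000 + 10000) (mk nm A dr) (mk nm A' dr) \<and>
    same {7, 9, 10, 11, 12, 16} A A' \<and>
    (\<forall>i<n. l i \<le> n \<and> harm_line n (l i) (\<Sum>j<D. A 4 j * matrix A 2 i j) = harm_loss n (\<Sum>j<D. A 4 j * matrix A 2 i j)) \<and>
    A' 9 0 = total_loss D n (matrix A 2) (A 4) \<and> (\<forall>j<D. A' 7 j = - (\<Sum>i<n. real (l i) * matrix A 2 i j))"
proof -
  let ?K = "{7, 9, 10, 11, 12, 16} :: nat set"
  have 1: "runs d \<omega> (set_reg 9 (RConst 0)) 100 (mk nm A dr) (mk nm (put 9 0 0 A) dr)"
    by (rule runs_set_reg) auto
  obtain A2 where A2: "runs d \<omega> (For 7 dim (wr 7 (var 7) (RConst 0))) (D * 1000 + 100) (mk nm (put 9 0 0 A) dr) (mk nm A2 dr)"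
    "same {7} (put 9 0 0 A) A2" "\<And>j. j < D \<Longrightarrow> A2 7 j = 0"
  proof -
    have "\<exists>A'. runs d \<omega> (For 7 dim (wr 7 (var 7) (RConst 0))) (D * 1000 + 100) (mk nm (put 9 0 0 A) dr) (mk nm A' dr) \<and>
      same {7} (put 9 0 0 A) A' \<and> (\<forall>j<D. A' 7 (0 + j) = 0) \<and> (\<forall>j. j < 0 \<or> 0 + D \<le> j \<longrightarrow> A' 7 j = put 9 0 0 A 7 j)"
      by (rule runs_map) auto
    then show ?thesis using that by auto
  qed
  define t where "t i = (\<Sum>j<D. A 4 j * matrix A 2 i j)" for i
  define I where "I p A' \<longleftrightarrow> (\<exists>l. same ?K A A' \<and> (\<forall>i<p. l i \<le> n \<and> harm_line n (l i) (t i) = harm_loss n (t i)) \<and>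
    A' 9 0 = (\<Sum>i<p. harm_loss n (t i)) \<and> (\<forall>j<D. A' 7 j = - (\<Sum>i<p. real (l i) * matrix A 2 i j)))" for p A'
  have "\<exists>A'. runs d \<omega> (For 6 (var 1) example_loss) (n * ((n + D) * 8000 + 10022) + 22) (mk nm A2 dr) (mk nm A' dr) \<and> I n A'"
  proof (rule runs_for)
    show "I 0 A2" using A2 by (auto simp: I_def same_def put_def)
    show "n * ((n + D) * 8000 + 10000 + ncost (var 1) + 20) + ncost (var 1) + 20 \<le> n * ((n + D) * 8000 + 10022) + 22"
      by simp
    fix p A' assume p: "p < n" and I: "I p A'"
    then obtain l where l: "same ?K A A'" "\<forall>i<p. l i \<le> n \<and> harm_line n (l i) (t i) = harm_loss n (t i)"
      "A' 9 0 = (\<Sum>i<p. harm_loss n (t i))" "\<forall>j<D. A' 7 j = - (\<Sum>i<p. real (l i) * matrix A 2 i j)"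
      by (auto simp: I_def)
    have sm: "A' 3 = A 3" "A' 4 = A 4" "A' 2 = A 2" using l(1) by (auto simp: same_def)
    have mat: "matrix A' 2 = matrix A 2" by (simp add: matrix_def sm fun_eq_iff)
    have "\<exists>A'' q. runs d \<omega> example_loss ((n + D) * 8000 + 10000) (mk (nm(6 := p)) A' dr) (mk (nm(6 := p)) A'' dr) \<and>
      same ?K A' A'' \<and> q \<le> n \<and> harm_line n q (\<Sum>j<D. A' 4 j * matrix A' 2 p j) = harm_loss n (\<Sum>j<D. A' 4 j * matrix A' 2 p j) \<and>
      A'' 9 0 = A' 9 0 + harm_loss n (\<Sum>j<D. A' 4 j * matrix A' 2 p j) \<and>
      (\<forall>j<D. A'' 7 j = A' 7 j - real q * matrix A' 2 p j)"
      using H p by (intro runs_example_loss) (auto simp: sm)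
    then obtain A'' q where q: "runs d \<omega> example_loss ((n + D) * 8000 + 10000) (mk (nm(6 := p)) A' dr) (mk (nm(6 := p)) A'' dr)"
      "same ?K A' A''" "q \<le> n" "harm_line n q (t p) = harm_loss n (t p)" "A'' 9 0 = A' 9 0 + harm_loss n (t p)"
      "\<forall>j<D. A'' 7 j = A' 7 j - real q * matrix A 2 p j"
      unfolding mat sm t_def by blast
    have "I (Suc p) A''"
      unfolding I_def
    \<comment> \<open>The index found for example p extends the choices for the earlier examples;
      the same indices define loss and subgradient.\<close>
    proof (intro exI[of _ "l(p := q)"] conjI)
      show "same ?K A A''" by (rule same_trans[OF l(1) q(2)]) auto
      show "\<forall>i<Suc p. (l(p := q)) i \<le> n \<and> harm_line n ((l(p := q)) i) (t i) = harm_loss n (t i)"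
        using l(2) q(3,4) by (auto simp: less_Suc_eq)
      show "A'' 9 0 = (\<Sum>i<Suc p. harm_loss n (t i))" using l(3) q(5) by simp
      have "(\<Sum>i<p. real ((l(p := q)) i) * matrix A 2 i j) = (\<Sum>i<p. real (l i) * matrix A 2 i j)" for j
        by (intro sum.cong) auto
      then show "\<forall>j<D. A'' 7 j = - (\<Sum>i<Suc p. real ((l(p := q)) i) * matrix A 2 i j)"
        using l(4) q(6) by simp
    qed
    with q(1) show "\<exists>A''. runs d \<omega> example_loss ((n + D) * 8000 + 10000) (mk (nm(6 := p)) A' dr) (mk (nm(6 := p)) A'' dr) \<and> I (Suc p) A''"
      by blast
  qed auto
  then obtain A3 where A3: "runs d \<omega> (For 6 (var 1) example_loss) (n * ((n + D) * 8000 + 10022) + 22) (mk nm A2 dr) (mk nm A3 dr)" "I n A3"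
    by blast
  have "100 + (D * 1000 + 100 + (n * ((n + D) * 8000 + 10022) + 22)) \<le> (n + D) * (n + D) * 30000 + 10000"
    by (simp add: algebra_simps)
  then have "runs d \<omega> eval_loss ((n + D) * (n + D) * 30000 + 10000) (mk nm A dr) (mk nm A3 dr)"
    unfolding eval_loss_def by (intro runs_seq[OF 1 runs_seq[OF A2(1) A3(1) order_refl]])
  with A3(2) show ?thesis unfolding I_def t_def total_loss_def by blast
qed

end

section \<open>The update of the record and of the ellipsoid\<close>

context machine
begin

lemma runs_keep_best:
  "\<exists>A'. runs d \<omega> keep_best (D * 1000 + 1000) (mk nm A dr) (mk nm A' dr) \<and> same {6, 13} A A' \<and>
    (if A 9 0 < A 13 0 then (\<forall>j<D. A' 6 j = A 4 j) \<and> A' 13 0 = A 9 0 else A' = A)"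
proof (cases "A 9 0 < A 13 0")
  case True
  let ?A1 = "put 13 0 (A 9 0) A"
  have 1: "runs d \<omega> (set_reg 13 (reg 9)) 200 (mk nm A dr) (mk nm ?A1 dr)"
    by (rule runs_set_reg) auto
  have "\<exists>A'. runs d \<omega> (For 7 dim (wr 6 (var 7) (rd 4 (var 7)))) (D * 300 + 100) (mk nm ?A1 dr) (mk nm A' dr) \<and>
      same {6} ?A1 A' \<and> (\<forall>j<D. A' 6 (0 + j) = A 4 j) \<and> (\<forall>j. j < 0 \<or> 0 + D \<le> j \<longrightarrow> A' 6 j = ?A1 6 j)"
    by (rule runs_map) (auto simp: same_def)
  then obtain A' where A': "runs d \<omega> (For 7 dim (wr 6 (var 7) (rd 4 (var 7)))) (D * 300 + 100) (mk nm ?A1 dr) (mk nm A' dr)"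
      "same {6} ?A1 A'" "\<forall>j<D. A' 6 j = A 4 j" by auto
  have "runs d \<omega> keep_best (D * 1000 + 1000) (mk nm A dr) (mk nm A' dr)"
    unfolding keep_best_def
    by (rule runs_if_true[OF _ runs_seq[OF 1 A'(1) order_refl]]) (use True in auto)
  moreover have "same {6, 13} A A'" "A' 13 0 = A 9 0" using A'(2) by (auto simp: same_def)
  ultimately show ?thesis using A'(3) True by auto
next
  case False
  have "runs d \<omega> keep_best (D * 1000 + 1000) (mk nm A dr) (mk nm A dr)"
    unfolding keep_best_def by (rule runs_if_false[OF _ runs_skip[OF order_refl]]) (use False in auto)
  then show ?thesis using False by (auto intro: same_refl)
qed

lemma runs_pull_back:
  "\<exists>A'. runs d \<omega> pull_back (D * (D * 2000 + 1000) + 1000) (mk nm A dr) (mk nm A' dr) \<and> same {8} A A' \<and>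
    (\<forall>j<D. A' 8 j = (\<Sum>i<D. matrix A 5 i j * A 7 i))"
proof -
  define I where "I p A' \<longleftrightarrow> same {8} A A' \<and> (\<forall>j<p. A' 8 j = (\<Sum>i<D. matrix A 5 i j * A 7 i))" for p A'
  have "\<exists>A'. runs d \<omega> pull_back (D * (D * 2000 + 1000) + 1000) (mk nm A dr) (mk nm A' dr) \<and> I D A'"
    unfolding pull_back_def
  proof (rule runs_for)
    show "I 0 A" by (simp add: I_def same_refl)
    show "D * ((D * 2000 + 500) + ncost dim + 20) + ncost dim + 20 \<le> D * (D * 2000 + 1000) + 1000"
      by (simp add: algebra_simps)
    fix p A' assume p: "p < D" and I: "I p A'"
    let ?m = "\<lambda>A. mk (nm(7 := p)) A dr"
    let ?A1 = "put 8 p 0 A'"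
    have 1: "runs d \<omega> (wr 8 (var 7) (RConst 0)) 200 (?m A') (?m ?A1)"
      by (rule runs_wr) auto
    have "\<exists>A''. runs d \<omega> (For 6 dim (wr 8 (var 7) (RAdd (rd 8 (var 7)) (RMul (rd 5 (entry 6 7)) (rd 7 (var 6)))))) (D * 2000 + 200) (?m ?A1) (?m A'') \<and>
      same {8} ?A1 A'' \<and> A'' 8 p = ?A1 8 p + (\<Sum>i<D. matrix A 5 i p * A 7 i) \<and> (\<forall>j. j \<noteq> p \<longrightarrow> A'' 8 j = ?A1 8 j)"
    proof (rule runs_accumulate)
      fix i A'' assume i: "i < D" "same {8} ?A1 A''"
      have "A'' 5 = A 5" "A'' 7 = A 7" using i(2) I by (auto simp: same_def I_def)
      then show "rval (RMul (rd 5 (entry 6 7)) (rd 7 (var 6))) (mk ((nm(7 := p))(6 := i)) A'' dr) = matrix A 5 i p * A 7 i"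
        using i by (simp add: matrix_def)
    qed (use p in auto)
    then obtain A'' where A'': "runs d \<omega> (For 6 dim (wr 8 (var 7) (RAdd (rd 8 (var 7)) (RMul (rd 5 (entry 6 7)) (rd 7 (var 6)))))) (D * 2000 + 200) (?m ?A1) (?m A'')"
      "same {8} ?A1 A''" "A'' 8 p = (\<Sum>i<D. matrix A 5 i p * A 7 i)" "\<forall>j. j \<noteq> p \<longrightarrow> A'' 8 j = ?A1 8 j"
      by auto
    have "I (Suc p) A''" using I A''(2-4) by (auto simp: I_def same_def less_Suc_eq)
    then show "\<exists>A''. runs d \<omega> (Seq (wr 8 (var 7) (RConst 0)) (For 6 dim (wr 8 (var 7) (RAdd (rd 8 (var 7)) (RMul (rd 5 (entry 6 7)) (rd 7 (var 6)))))))
       (D * 2000 + 500) (?m A') (?m A'') \<and> I (Suc p) A''"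
      by (intro exI[of _ A''] conjI runs_seq[OF 1 A''(1)]) auto
  qed auto
  then show ?thesis by (simp add: I_def)
qed

lemma runs_norms:
  "\<exists>A'. runs d \<omega> norms (D * 2000 + 1000) (mk nm A dr) (mk nm A' dr) \<and> same {14, 15} A A' \<and>
    A' 14 0 = (\<Sum>j<D. (A 8 j)\<^sup>2) \<and> A' 15 0 = (\<Sum>j<D. \<bar>A 8 j\<bar>)"
proof -
  have 1: "runs d \<omega> (set_reg 14 (RConst 0)) 100 (mk nm A dr) (mk nm (put 14 0 0 A) dr)"
    by (rule runs_set_reg) auto
  let ?A2 = "put 15 0 0 (put 14 0 0 A)"
  have 2: "runs d \<omega> (set_reg 15 (RConst 0)) 100 (mk nm (put 14 0 0 A) dr) (mk nm ?A2 dr)"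
    by (rule runs_set_reg) auto
  define I where "I p A' \<longleftrightarrow> same {14, 15} A A' \<and> A' 14 0 = (\<Sum>j<p. (A 8 j)\<^sup>2) \<and> A' 15 0 = (\<Sum>j<p. \<bar>A 8 j\<bar>)" for p A'
  let ?b1 = "set_reg 14 (RAdd (reg 14) (RMul (rd 8 (var 7)) (rd 8 (var 7))))"
  let ?b2 = "If (RLe (RConst 0) (rd 8 (var 7))) (set_reg 15 (RAdd (reg 15) (rd 8 (var 7)))) (set_reg 15 (RSub (reg 15) (rd 8 (var 7))))"
  have "\<exists>A'. runs d \<omega> (For 7 dim (Seq ?b1 ?b2)) (D * 2000 + 500) (mk nm ?A2 dr) (mk nm A' dr) \<and> I D A'"
  proof (rule runs_for)
    show "I 0 ?A2" by (auto simp: I_def same_def)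
    show "D * (1900 + ncost dim + 20) + ncost dim + 20 \<le> D * 2000 + 500" by simp
    fix p A' assume p: "p < D" and I: "I p A'"
    let ?m = "\<lambda>A. mk (nm(7 := p)) A dr"
    let ?A1 = "put 14 0 (\<Sum>j<Suc p. (A 8 j)\<^sup>2) A'"
    have A8: "A' 8 = A 8" using I by (simp add: I_def same_def)
    have b1: "runs d \<omega> ?b1 900 (?m A') (?m ?A1)"
      using I by (intro runs_set_reg) (auto simp: I_def A8 power2_eq_square)
    let ?A2 = "put 15 0 (\<Sum>j<Suc p. \<bar>A 8 j\<bar>) ?A1"
    have b2: "runs d \<omega> ?b2 900 (?m ?A1) (?m ?A2)"
    proof (cases "0 \<le> A 8 p")
      case True
      have "runs d \<omega> (set_reg 15 (RAdd (reg 15) (rd 8 (var 7)))) 500 (?m ?A1) (?m ?A2)"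
        using I True by (intro runs_set_reg) (auto simp: I_def A8)
      then show ?thesis by (rule runs_if_true[rotated]) (use True in \<open>auto simp: A8\<close>)
    next
      case False
      have "runs d \<omega> (set_reg 15 (RSub (reg 15) (rd 8 (var 7)))) 500 (?m ?A1) (?m ?A2)"
        using I False by (intro runs_set_reg) (auto simp: I_def A8)
      then show ?thesis by (rule runs_if_false[rotated]) (use False in \<open>auto simp: A8\<close>)
    qed
    have "I (Suc p) ?A2" using I by (auto simp: I_def same_def)
    then show "\<exists>A''. runs d \<omega> (Seq ?b1 ?b2) 1900 (?m A') (?m A'') \<and> I (Suc p) A''"
      by (intro exI[of _ ?A2] conjI runs_seq[OF b1 b2]) auto
  qed auto
  then obtain A' where A': "runs d \<omega> (For 7 dim (Seq ?b1 ?b2)) (D * 2000 + 500) (mk nm ?A2 dr) (mk nm A' dr)" "I D A'" by blast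
  have "runs d \<omega> norms (D * 2000 + 1000) (mk nm A dr) (mk nm A' dr)"
    unfolding norms_def by (rule runs_seq[OF 1 runs_seq[OF 2 A'(1) order_refl]]) simp
  with A'(2) show ?thesis by (auto simp: I_def)
qed

text \<open>Row-major addresses of different rows do not interfere.\<close>

lemma index_less_iff: "j < D \<Longrightarrow> i * D + j < i' * D \<longleftrightarrow> i < i'" for i j i' :: nat
proof
  assume "j < D" "i < i'"
  then have "Suc i * D \<le> i' * D" by (intro mult_right_mono) auto
  then show "i * D + j < i' * D" using \<open>j < D\<close> by simp
next
  assume "i * D + j < i' * D"
  then have "i * D < i' * D" by (rule le_less_trans[OF le_add1])
  then show "i < i'" by (simp only: mult_less_cancel2)
qed

text \<open>Row p of the new basis and entry p of the new center need only row p of the old basis,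
  through its product with the cut vector in register 16. The update can therefore be done in place,
  rows from p on being still the old ones.\<close>

lemma runs_move:
  assumes const: "A 18 0 = step_length D" "A 19 0 = shrink_factor D" "A 20 0 = stretch_factor D"
    and norm: "A 14 0 = (\<Sum>j<D. (A 8 j)\<^sup>2)" "A 15 0 = (\<Sum>j<D. \<bar>A 8 j\<bar>)"
  shows "\<exists>A'. runs d \<omega> move (D * (D * 4000 + 5000) + 1000) (mk nm A dr) (mk nm A' dr) \<and> same {4, 5, 16} A A' \<and>
    (\<forall>i<D. A' 4 i = ell_center D (A 4) (matrix A 5) (A 8) i) \<and>
    (\<forall>i<D. \<forall>j<D. matrix A' 5 i j = ell_basis D (matrix A 5) (A 8) i j)"
proof -
  define I where "I p A' \<longleftrightarrow> same {4, 5, 16} A A' \<and>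
    (\<forall>i<p. A' 4 i = ell_center D (A 4) (matrix A 5) (A 8) i) \<and> (\<forall>i. p \<le> i \<longrightarrow> A' 4 i = A 4 i) \<and>
    (\<forall>i<p. \<forall>j<D. matrix A' 5 i j = ell_basis D (matrix A 5) (A 8) i j) \<and>
    (\<forall>i. p \<le> i \<longrightarrow> (\<forall>j<D. matrix A' 5 i j = matrix A 5 i j))" for p A'
  have "\<exists>A'. runs d \<omega> move (D * (D * 4000 + 5000) + 1000) (mk nm A dr) (mk nm A' dr) \<and> I D A'"
    unfolding move_def
  proof (rule runs_for)
    show "I 0 A" by (simp add: I_def same_refl)
    show "D * ((D * 4000 + 3000) + ncost dim + 20) + ncost dim + 20 \<le> D * (D * 4000 + 5000) + 1000"
      by (simp add: algebra_simps)
    fix p A' assume p: "p < D" and I: "I p A'"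
    let ?m = "\<lambda>A. mk (nm(6 := p)) A dr"
    have row: "nm (20 + p) = p * D" using p by simp
    define u where "u = (\<Sum>k<D. matrix A 5 p k * A 8 k)"
    have sm: "A' k = A k" if "k \<notin> {4, 5, 16}" for k using I that by (simp add: I_def same_def)
    have 1: "runs d \<omega> (set_reg 16 (RConst 0)) 100 (?m A') (?m (put 16 0 0 A'))"
      by (rule runs_set_reg) auto
    have "\<exists>A''. runs d \<omega> (add_reg_loop 7 dim 16 (RMul (rd 5 (entry 6 7)) (rd 8 (var 7)))) (D * 1000 + 100) (?m (put 16 0 0 A')) (?m A'') \<and>
      same {16} (put 16 0 0 A') A'' \<and> A'' 16 0 = put 16 0 0 A' 16 0 + (\<Sum>k<D. matrix A 5 p k * A 8 k)"
    proof (rule runs_add_reg_loop)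
      fix j A'' assume j: "j < D" "same {16} (put 16 0 0 A') A''"
      have "A'' 5 = A' 5" "A'' 8 = A 8" using j(2) sm[of 8] by (auto simp: same_def)
      moreover have "matrix A' 5 p j = matrix A 5 p j" using I j(1) by (simp add: I_def)
      ultimately show "rval (RMul (rd 5 (entry 6 7)) (rd 8 (var 7))) (mk ((nm(6 := p))(7 := j)) A'' dr) = matrix A 5 p j * A 8 j"
        using row by (simp add: matrix_def)
    qed auto
    then obtain A2 where A2: "runs d \<omega> (add_reg_loop 7 dim 16 (RMul (rd 5 (entry 6 7)) (rd 8 (var 7)))) (D * 1000 + 100) (?m (put 16 0 0 A')) (?m A2)"
      "same {16} (put 16 0 0 A') A2" "A2 16 0 = u" by (auto simp: u_def)
    have sm2: "A2 k = A' k" if "k \<noteq> 16" for k using A2(2) that by (simp add: same_def)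
    define x where "x = ell_center D (A 4) (matrix A 5) (A 8) p"
    have x: "x = A 4 p - step_length D * u / (\<Sum>j<D. \<bar>A 8 j\<bar>)" by (simp add: x_def ell_center_def u_def)
    let ?A3 = "put 4 p x A2"
    have 3: "runs d \<omega> (wr 4 (var 6) (RSub (rd 4 (var 6)) (RDiv (RMul (reg 18) (reg 16)) (reg 15)))) 700 (?m A2) (?m ?A3)"
      using I A2(3) const norm by (intro runs_wr) (auto simp: I_def sm2 sm x)
    have "\<exists>A''. runs d \<omega> (For 7 dim (wr 5 (entry 6 7) (RSub (RMul (reg 20) (rd 5 (entry 6 7)))
        (RDiv (RMul (RMul (RSub (reg 20) (reg 19)) (reg 16)) (rd 8 (var 7))) (reg 14))))) (D * 2000 + 100) (?m ?A3) (?m A'') \<and>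
      same {5} ?A3 A'' \<and> (\<forall>j<D. A'' 5 (p * D + j) = ell_basis D (matrix A 5) (A 8) p j) \<and>
      (\<forall>j. j < p * D \<or> p * D + D \<le> j \<longrightarrow> A'' 5 j = ?A3 5 j)"
    proof (rule runs_map)
      fix j A'' assume j: "j < D" "same {5} ?A3 A''" "\<forall>j'. j' < p * D \<or> p * D + j \<le> j' \<longrightarrow> A'' 5 j' = ?A3 5 j'"
      have o: "A'' k = A k" if "k \<notin> {4, 5, 16}" for k using j(2) that sm sm2 by (simp add: same_def)
      have "A'' 16 = A2 16" using j(2) by (simp add: same_def)
      moreover have "A'' 5 (p * D + j) = matrix A 5 p j" using j(1,3) I by (simp add: sm2 I_def matrix_def)
      ultimately show "rval (RSub (RMul (reg 20) (rd 5 (entry 6 7)))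
        (RDiv (RMul (RMul (RSub (reg 20) (reg 19)) (reg 16)) (rd 8 (var 7))) (reg 14))) (mk ((nm(6 := p))(7 := j)) A'' dr) = ell_basis D (matrix A 5) (A 8) p j"
        using row A2(3) const norm by (simp add: o ell_basis_def u_def)
    qed (use row in auto)
    then obtain A4 where A4: "runs d \<omega> (For 7 dim (wr 5 (entry 6 7) (RSub (RMul (reg 20) (rd 5 (entry 6 7)))
        (RDiv (RMul (RMul (RSub (reg 20) (reg 19)) (reg 16)) (rd 8 (var 7))) (reg 14))))) (D * 2000 + 100) (?m ?A3) (?m A4)"
      "same {5} ?A3 A4" "\<And>j. j < D \<Longrightarrow> A4 5 (p * D + j) = ell_basis D (matrix A 5) (A 8) p j"
      "\<And>j. j < p * D \<or> p * D + D \<le> j \<Longrightarrow> A4 5 j = A' 5 j"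
      by (auto simp: sm2)
    have A44: "A4 4 = (A' 4)(p := x)" using A4(2) by (simp add: same_def put_def sm2)
    have other_row: "matrix A4 5 i j = matrix A' 5 i j" if "j < D" "i \<noteq> p" for i j
    proof -
      have "i * D + j < p * D \<or> p * D + D \<le> i * D + j"
        using that index_less_iff[of j i p] index_less_iff[of j i "Suc p"] by (cases "i < p") auto
      then show ?thesis unfolding matrix_def by (rule A4(4))
    qed
    have "I (Suc p) A4"
      unfolding I_def
    proof (intro conjI allI impI)
      show "same {4, 5, 16} A A4" using A4(2) sm sm2 by (auto simp: same_def put_def)
      show "A4 4 i = ell_center D (A 4) (matrix A 5) (A 8) i" if "i < Suc p" for i
        using that I by (auto simp: A44 x_def I_def less_Suc_eq)
      show "A4 4 i = A 4 i" if "Suc p \<le> i" for i using that I by (auto simp: A44 I_def)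
      show "matrix A4 5 i j = ell_basis D (matrix A 5) (A 8) i j" if "i < Suc p" "j < D" for i j
        using that I other_row[of j i] A4(3)[of j] by (cases "i = p") (auto simp: I_def matrix_def less_Suc_eq)
      show "matrix A4 5 i j = matrix A 5 i j" if "Suc p \<le> i" "j < D" for i j
        using that I other_row[of j i] by (auto simp: I_def)
    qed
    then show "\<exists>A''. runs d \<omega> (Seq (set_reg 16 (RConst 0)) (Seq (add_reg_loop 7 dim 16 (RMul (rd 5 (entry 6 7)) (rd 8 (var 7))))
     (Seq (wr 4 (var 6) (RSub (rd 4 (var 6)) (RDiv (RMul (reg 18) (reg 16)) (reg 15))))
     (For 7 dim (wr 5 (entry 6 7) (RSub (RMul (reg 20) (rd 5 (entry 6 7)))
        (RDiv (RMul (RMul (RSub (reg 20) (reg 19)) (reg 16)) (rd 8 (var 7))) (reg 14)))))))) (D * 4000 + 3000) (?m A') (?m A'') \<and> I (Suc p) A''"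
      by (intro exI[of _ A4] conjI runs_seq[OF 1 runs_seq[OF A2(1) runs_seq[OF 3 A4(1) order_refl] order_refl]]) simp
  qed auto
  then show ?thesis unfolding I_def by blast
qed

definition ell_view :: "memory \<Rightarrow> ell_state" where
  "ell_view A = \<lparr>center = A 4, basis = matrix A 5, best = A 6, best_val = A 13 0\<rparr>"

lemma runs_iteration:
  assumes H: "\<And>l. l \<le> n \<Longrightarrow> A 3 l = harm l"
    and const: "A 18 0 = step_length D" "A 19 0 = shrink_factor D" "A 20 0 = stretch_factor D"
  shows "\<exists>A'. runs d \<omega> iteration ((n + D) * (n + D) * 60000 + 20000) (mk nm A dr) (mk nm A' dr) \<and>
    same {4, 5, 6, 7, 8, 9, 10, 11, 12, 13, 14, 15, 16} A A' \<and>
    ell_step D n (matrix A 2) (ell_view A) (ell_view A')"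
proof -
  obtain A1 l where A1: "runs d \<omega> eval_loss ((n + D) * (n + D) * 30000 + 10000) (mk nm A dr) (mk nm A1 dr)"
    "same {7, 9, 10, 11, 12, 16} A A1"
    "\<forall>i<n. l i \<le> n \<and> harm_line n (l i) (\<Sum>j<D. A 4 j * matrix A 2 i j) = harm_loss n (\<Sum>j<D. A 4 j * matrix A 2 i j)"
    "A1 9 0 = total_loss D n (matrix A 2) (A 4)" "\<forall>j<D. A1 7 j = - (\<Sum>i<n. real (l i) * matrix A 2 i j)"
    using runs_eval_loss[of A, OF H] by blast
  obtain A2 where A2: "runs d \<omega> keep_best (D * 1000 + 1000) (mk nm A1 dr) (mk nm A2 dr)" "same {6, 13} A1 A2"
    "if A1 9 0 < A1 13 0 then (\<forall>j<D. A2 6 j = A1 4 j) \<and> A2 13 0 = A1 9 0 else A2 = A1"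
    using runs_keep_best by blast
  obtain A3 where A3: "runs d \<omega> pull_back (D * (D * 2000 + 1000) + 1000) (mk nm A2 dr) (mk nm A3 dr)" "same {8} A2 A3"
    "\<forall>j<D. A3 8 j = (\<Sum>i<D. matrix A2 5 i j * A2 7 i)"
    using runs_pull_back by blast
  obtain A4 where A4: "runs d \<omega> norms (D * 2000 + 1000) (mk nm A3 dr) (mk nm A4 dr)" "same {14, 15} A3 A4"
    "A4 14 0 = (\<Sum>j<D. (A3 8 j)\<^sup>2)" "A4 15 0 = (\<Sum>j<D. \<bar>A3 8 j\<bar>)"
    using runs_norms by blast
  have sm4: "A4 k = A k" if "k \<notin> {6, 7, 8, 9, 10, 11, 12, 13, 14, 15, 16}" for k
    using that A1(2) A2(2) A3(2) A4(2) by (simp add: same_def)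
  have A48: "A4 8 = A3 8" using A4(2) by (simp add: same_def)
  obtain A5 where A5: "runs d \<omega> move (D * (D * 4000 + 5000) + 1000) (mk nm A4 dr) (mk nm A5 dr)" "same {4, 5, 16} A4 A5"
    "\<forall>i<D. A5 4 i = ell_center D (A4 4) (matrix A4 5) (A4 8) i"
    "\<forall>i<D. \<forall>j<D. matrix A5 5 i j = ell_basis D (matrix A4 5) (A4 8) i j"
    using runs_move[of A4] const A4(3,4) by (auto simp: sm4 A48)
  have mat: "matrix B 5 = matrix C 5" if "B 5 = C 5" for B C using that by (simp add: matrix_def fun_eq_iff)
  have eqs: "A4 4 = A 4" "matrix A4 5 = matrix A 5" "matrix A2 5 = matrix A 5" "A2 7 = A1 7" "A1 4 = A 4" "A1 13 = A 13" "A1 6 = A 6"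
    "A5 6 = A2 6" "A5 13 = A2 13"
    using A1(2) A2(2) A3(2) A4(2) A5(2) by (auto simp: same_def intro!: mat)
  have "ell_step D n (matrix A 2) (ell_view A) (ell_view A5)"
    unfolding ell_step_def
  proof (intro exI conjI)
    show "\<forall>i<n. l i \<le> n \<and> harm_line n (l i) (\<Sum>j<D. center (ell_view A) j * matrix A 2 i j) = harm_loss n (\<Sum>j<D. center (ell_view A) j * matrix A 2 i j)"
      using A1(3) by (simp add: ell_view_def)
    show "\<forall>j<D. A4 8 j = (\<Sum>i<D. basis (ell_view A) i j * - (\<Sum>k<n. real (l k) * matrix A 2 k i))"
      using A3(3) A1(5) by (simp add: ell_view_def A48 eqs)
    show "\<forall>i<D. center (ell_view A5) i = ell_center D (center (ell_view A)) (basis (ell_view A)) (A4 8) i"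
      using A5(3) by (simp add: ell_view_def eqs)
    show "\<forall>i<D. \<forall>j<D. basis (ell_view A5) i j = ell_basis D (basis (ell_view A)) (A4 8) i j"
      using A5(4) by (simp add: ell_view_def eqs)
    show "if total_loss D n (matrix A 2) (center (ell_view A)) < best_val (ell_view A)
      then (\<forall>j<D. best (ell_view A5) j = center (ell_view A) j) \<and> best_val (ell_view A5) = total_loss D n (matrix A 2) (center (ell_view A))
      else (\<forall>j<D. best (ell_view A5) j = best (ell_view A) j) \<and> best_val (ell_view A5) = best_val (ell_view A)"
      using A2(3) A1(4) by (auto simp: ell_view_def eqs split: if_splits)
  qed
  moreover have "same {4, 5, 6, 7, 8, 9, 10, 11, 12, 13, 14, 15, 16} A A5"
    using A5(2) sm4 by (auto simp: same_def)
  moreover have "runs d \<omega> iteration ((n + D) * (n + D) * 60000 + 20000) (mk nm A dr) (mk nm A5 dr)"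
    unfolding iteration_def
    by (rule runs_seq[OF A1(1) runs_seq[OF A2(1) runs_seq[OF A3(1) runs_seq[OF A4(1) A5(1) order_refl] order_refl] order_refl]])
      (simp add: algebra_simps)
  ultimately show ?thesis by blast
qed

end

section \<open>Search loops and set-up\<close>

lemma mk_surj: "s = mk (nmem s) (\<lambda>k i. rmem s (32 * i + k)) (drawn s)"
proof -
  have "rmem s = (\<lambda>a. rmem s (32 * (a div 32) + a mod 32))" by (rule ext) simp
  then show ?thesis by (simp add: mk_def)
qed

text \<open>For search loops, whose number of passes M is known to the analysis but not to the
  program; the states are given as an explicit sequence.\<close>

lemma runs_while:
  assumes cond: "\<And>i. i \<le> M \<Longrightarrow> bval b (s i) \<longleftrightarrow> i < M"
    and body: "\<And>i. i < M \<Longrightarrow> runs d \<omega> c Tb (s i) (s (Suc i))"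
  shows "runs d \<omega> (While b c) (M * (Tb + 1 + bcost b) + 1 + bcost b) (s 0) (s M)"
proof -
  have "runs d \<omega> (While b c) ((M - i) * (Tb + 1 + bcost b) + 1 + bcost b) (s i) (s M)" if "i \<le> M" for i
    using that
  proof (induction "M - i" arbitrary: i)
    case 0
    then have "i = M" by simp
    then have "\<not> bval b (s i)" using cond[of M] by simp
    from exec.WhileFalse[OF this] show ?case using \<open>i = M\<close>
      unfolding runs_def by (intro exI[of _ "1 + bcost b"]) auto
  next
    case (Suc r)
    then have i: "i < M" by simp
    then obtain t1 where t1: "t1 \<le> Tb" "exec d \<omega> c (s i) t1 (s (Suc i))" using body[OF i] by (auto simp: runs_def)
    have "runs d \<omega> (While b c) ((M - Suc i) * (Tb + 1 + bcost b) + 1 + bcost b) (s (Suc i)) (s M)"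
      using Suc.hyps(2) i by (intro Suc.hyps(1)) auto
    then obtain t2 where t2: "t2 \<le> (M - Suc i) * (Tb + 1 + bcost b) + 1 + bcost b" "exec d \<omega> (While b c) (s (Suc i)) t2 (s M)"
      by (auto simp: runs_def)
    have "exec d \<omega> (While b c) (s i) (1 + bcost b + t1 + t2) (s M)"
      using cond[of i] i by (intro exec.WhileTrue[OF _ t1(2) t2(2)]) simp
    moreover have "M - i = Suc (M - Suc i)" using i by simp
    then have "1 + bcost b + t1 + t2 \<le> (M - i) * (Tb + 1 + bcost b) + 1 + bcost b" using t1(1) t2(1) by simp
    ultimately show ?case unfolding runs_def by blast
  qed
  from this[of 0] show ?thesis by simp
qed

text \<open>The number of doublings stands for a logarithm.\<close>
definition search_double :: "nat \<Rightarrow> rexp \<Rightarrow> rexp \<Rightarrow> com" where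
  "search_double x tgt r = Seq (set_reg 17 (RConst 1)) (Seq (NAssign (NConst x) (NConst 1))
     (While (BNot (RLe tgt (RMul (reg 17) r))) (Seq (set_reg 17 (RAdd (reg 17) (reg 17))) (NAssign (NConst x) (NAdd (var x) (NConst 1))))))"

text \<open>One more than the least exponent, because the counter starts at 1. The count is
  therefore positive, as m has to be in \<epsilon> / (179200 m).\<close>

definition double_count :: "real \<Rightarrow> real \<Rightarrow> nat" where
  "double_count t r = Suc (LEAST i. t \<le> 2 ^ i * r)"

text \<open>Target and factor must keep their values while the loop changes the counter x and the
  scratch register 17, which holds the power of two.\<close>

lemma runs_search_double:
  assumes tgt: "\<And>i y. rval tgt (mk (nm(x := i)) (put 17 0 y A) dr) = t"
    and r: "\<And>i y. rval r (mk (nm(x := i)) (put 17 0 y A) dr) = q" and q: "0 < q"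
    and T: "double_count t q * (600 + rcost tgt + rcost r) + 1000 + rcost tgt + rcost r \<le> T"
  shows "\<exists>A'. runs d \<omega> (search_double x tgt r) T (mk nm A dr) (mk (nm(x := double_count t q)) A' dr) \<and> same {17} A A'"
proof -
  define M where "M = (LEAST i. t \<le> 2 ^ i * q)"
  obtain i0 where i0: "t / q < 2 ^ i0" using real_arch_pow[of 2 "t / q"] by auto
  then have ex: "t \<le> 2 ^ i0 * q" using q by (simp add: divide_less_eq)
  have M: "t \<le> 2 ^ M * q" unfolding M_def using ex by (rule LeastI[where P = "\<lambda>i. t \<le> 2 ^ i * q"])
  have less: "\<not> t \<le> 2 ^ i * q" if "i < M" for i using that unfolding M_def by (rule not_less_Least)
  define s where "s i = mk (nm(x := Suc i)) (put 17 0 (2 ^ i) A) dr" for i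
  let ?b = "BNot (RLe tgt (RMul (reg 17) r))"
  let ?c = "Seq (set_reg 17 (RAdd (reg 17) (reg 17))) (NAssign (NConst x) (NAdd (var x) (NConst 1)))"
  have dc: "double_count t q = Suc M" by (simp add: double_count_def M_def)
  have w: "runs d \<omega> (While ?b ?c) (M * (310 + 1 + bcost ?b) + 1 + bcost ?b) (s 0) (s M)"
  proof (rule runs_while)
    show "bval ?b (s i) \<longleftrightarrow> i < M" if "i \<le> M" for i
      using that less[of i] M by (cases "i = M") (auto simp: s_def tgt r)
    fix i assume "i < M"
    have 1: "runs d \<omega> (set_reg 17 (RAdd (reg 17) (reg 17))) 250 (s i) (mk (nm(x := Suc i)) (put 17 0 (2 ^ Suc i) A) dr)"
    proof -
      have "put 17 0 (2 ^ Suc i) A = put 17 0 (2 ^ Suc i) (put 17 0 (2 ^ i) A)" by (simp add: put_def)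
      then show ?thesis unfolding s_def by (simp only:) (rule runs_set_reg; simp)
    qed
    have 2: "runs d \<omega> (NAssign (NConst x) (NAdd (var x) (NConst 1))) 10 (mk (nm(x := Suc i)) (put 17 0 (2 ^ Suc i) A) dr) (s (Suc i))"
    proof -
      have "s (Suc i) = (mk (nm(x := Suc i)) (put 17 0 (2 ^ Suc i) A) dr)\<lparr>nmem := (nmem (mk (nm(x := Suc i)) (put 17 0 (2 ^ Suc i) A) dr))(x := Suc (Suc i))\<rparr>"
        by (simp add: s_def mk_nmem_upd)
      then show ?thesis by (simp only:) (rule runs_nassign; simp)
    qed
    show "runs d \<omega> ?c 310 (s i) (s (Suc i))" by (rule runs_seq[OF 1 2]) simp
  qed
  have 1: "runs d \<omega> (set_reg 17 (RConst 1)) 100 (mk nm A dr) (mk nm (put 17 0 1 A) dr)"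
    by (rule runs_set_reg) auto
  have 2: "runs d \<omega> (NAssign (NConst x) (NConst 1)) 10 (mk nm (put 17 0 1 A) dr) (s 0)"
  proof -
    have "s 0 = (mk nm (put 17 0 1 A) dr)\<lparr>nmem := (nmem (mk nm (put 17 0 1 A) dr))(x := 1)\<rparr>"
      by (simp add: s_def mk_nmem_upd)
    then show ?thesis by (simp only:) (rule runs_nassign; simp)
  qed
  have "runs d \<omega> (search_double x tgt r) T (mk nm A dr) (s M)"
    unfolding search_double_def
    by (rule runs_seq[OF 1 runs_seq[OF 2 w order_refl]], rule order_trans[OF _ T]) (simp add: dc algebra_simps)
  then show ?thesis
    by (intro exI[of _ "put 17 0 (2 ^ M) A"]) (auto simp: s_def dc same_def)
qed

lemma double_count_bounds:
  assumes q: "0 < q" and t: "0 < t"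
  shows "1 \<le> double_count t q" "t / q \<le> 2 ^ double_count t q"
    "real (double_count t q) \<le> 2 + max 0 (2 * ln (t / q))"
proof -
  define M where "M = (LEAST i. t \<le> 2 ^ i * q)"
  have dc: "double_count t q = Suc M" by (simp add: double_count_def M_def)
  then show "1 \<le> double_count t q" by simp
  obtain i0 where "t / q < 2 ^ i0" using real_arch_pow[of 2 "t / q"] by auto
  then have ex: "t \<le> 2 ^ i0 * q" using q by (simp add: divide_less_eq)
  have "t \<le> 2 ^ M * q" unfolding M_def using ex by (rule LeastI[where P = "\<lambda>i. t \<le> 2 ^ i * q"])
  then have "t / q \<le> 2 ^ M" using q by (simp add: divide_le_eq)
  also have "\<dots> \<le> 2 ^ Suc M" by simp
  finally show "t / q \<le> 2 ^ double_count t q" by (simp add: dc)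
  show "real (double_count t q) \<le> 2 + max 0 (2 * ln (t / q))"
  proof (cases M)
    case (Suc M')
    then have "\<not> t \<le> 2 ^ M' * q" unfolding M_def by (intro not_less_Least) simp
    then have "2 ^ M' < t / q" using q by (simp add: less_divide_eq)
    then have "ln (2 ^ M') \<le> ln (t / q)" by (intro ln_mono) auto
    then have "real M' * ln 2 \<le> ln (t / q)" by (simp add: ln_realpow)
    \<comment> \<open>ln 2 >= 1 / 2 accounts for the factor 2 in front of the logarithm.\<close>
    moreover have "real M' * (1 / 2) \<le> real M' * ln 2"
      using ln2_ge_two_thirds by (intro mult_left_mono) auto
    ultimately show ?thesis by (simp add: dc Suc)
  qed (simp add: dc)
qed

text \<open>A real cannot be rounded to a natural number, so the count is found by linear search.
  This takes time proportional to the result, which is the number of passes of a later loop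
  anyway.\<close>

definition search_count :: "nat \<Rightarrow> rexp \<Rightarrow> rexp \<Rightarrow> com" where
  "search_count x tgt r = While (BNot (RLe tgt (RMul (ROfNat (var x)) r))) (NAssign (NConst x) (NAdd (var x) (NConst 1)))"

definition multiple_count :: "real \<Rightarrow> real \<Rightarrow> nat" where
  "multiple_count t r = (LEAST i. t \<le> real i * r)"

lemma runs_search_count:
  assumes x: "nm x = 0" and tgt: "\<And>i. rval tgt (mk (nm(x := i)) A dr) = t"
    and r: "\<And>i. rval r (mk (nm(x := i)) A dr) = q" and q: "0 < q"
    and T: "multiple_count t q * (50 + rcost tgt + rcost r) + 50 + rcost tgt + rcost r \<le> T"
  shows "runs d \<omega> (search_count x tgt r) T (mk nm A dr) (mk (nm(x := multiple_count t q)) A dr)"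
proof -
  define M where "M = (LEAST i. t \<le> real i * q)"
  obtain i0 :: nat where "t / q < real i0" using reals_Archimedean2 by blast
  then have ex: "t \<le> real i0 * q" using q by (simp add: divide_less_eq)
  have M: "t \<le> real M * q" unfolding M_def using ex by (rule LeastI[where P = "\<lambda>i. t \<le> real i * q"])
  have less: "\<not> t \<le> real i * q" if "i < M" for i using that unfolding M_def by (rule not_less_Least)
  define s where "s i = mk (nm(x := i)) A dr" for i
  let ?b = "BNot (RLe tgt (RMul (ROfNat (var x)) r))"
  have mc: "multiple_count t q = M" by (simp add: multiple_count_def M_def)
  have w: "runs d \<omega> (While ?b (NAssign (NConst x) (NAdd (var x) (NConst 1)))) (M * (10 + 1 + bcost ?b) + 1 + bcost ?b) (s 0) (s M)"
  proof (rule runs_while)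
    show "bval ?b (s i) \<longleftrightarrow> i < M" if "i \<le> M" for i
      using that less[of i] M by (cases "i = M") (auto simp: s_def tgt r)
    fix i assume "i < M"
    have "s (Suc i) = (s i)\<lparr>nmem := (nmem (s i))(x := Suc i)\<rparr>" by (simp add: s_def mk_nmem_upd)
    then show "runs d \<omega> (NAssign (NConst x) (NAdd (var x) (NConst 1))) 10 (s i) (s (Suc i))"
      by (simp only:) (rule runs_nassign; simp add: s_def)
  qed
  have "M * (10 + 1 + bcost ?b) + 1 + bcost ?b \<le> T"
    by (rule order_trans[OF _ T]) (simp add: mc algebra_simps)
  from runs_mono[OF w this] x show ?thesis
    by (simp add: search_count_def s_def mc fun_upd_idem)
qed

lemma multiple_count_bounds:
  assumes q: "0 < q" and t: "0 < t"
  shows "t \<le> real (multiple_count t q) * q" "real (multiple_count t q) * q \<le> t + q"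
proof -
  define M where "M = (LEAST i. t \<le> real i * q)"
  obtain i0 :: nat where "t / q < real i0" using reals_Archimedean2 by blast
  then have ex: "t \<le> real i0 * q" using q by (simp add: divide_less_eq)
  have M: "t \<le> real M * q" unfolding M_def using ex by (rule LeastI[where P = "\<lambda>i. t \<le> real i * q"])
  then show "t \<le> real (multiple_count t q) * q" by (simp add: multiple_count_def M_def)
  have "M \<noteq> 0" using M t by (metis mult_zero_left not_less of_nat_0)
  then obtain M' where M': "M = Suc M'" by (cases M) auto
  then have "\<not> t \<le> real M' * q" unfolding M_def by (intro not_less_Least) simp
  then have "real M * q \<le> t + q" by (simp add: M' algebra_simps)
  then show "real (multiple_count t q) * q \<le> t + q" by (simp add: multiple_count_def M_def)
qed

text \<open>Repeated addition of D in cell 5 produces the multiples i * D. The n + D entries cover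
  the n rows of examples as well as the D rows of the basis.\<close>

definition fill_table :: com where
  "fill_table = For 6 (NAdd (var 1) dim)
     (Seq (NAssign (NAdd (NConst 20) (var 6)) (var 5)) (NAssign (NConst 5) (NAdd (var 5) dim)))"

lemma runs_fill_table:
  assumes nm: "nm 0 = d" "nm 1 = n" "nm 5 = 0" "nm 6 = 0"
  shows "\<exists>nm'. runs d \<omega> fill_table ((n + Suc d) * 100 + 100) (mk nm A dr) (mk nm' A dr) \<and>
    (\<forall>i<n + Suc d. nm' (20 + i) = i * Suc d) \<and> (\<forall>x<20. x \<noteq> 5 \<longrightarrow> nm' x = nm x)"
proof -
  define I where "I i s \<longleftrightarrow> (\<exists>nm'. s = mk nm' A dr \<and> nm' 6 = i \<and> nm' 5 = i * Suc d \<and>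
    (\<forall>j<i. nm' (20 + j) = j * Suc d) \<and> (\<forall>x<20. x \<noteq> 5 \<and> x \<noteq> 6 \<longrightarrow> nm' x = nm x))" for i s
  let ?body = "Seq (NAssign (NAdd (NConst 20) (var 6)) (var 5)) (NAssign (NConst 5) (NAdd (var 5) dim))"
  have "I 0 (mk nm A dr)" unfolding I_def using nm by (intro exI[of _ nm]) auto
  then have "\<exists>s'. runs d \<omega> fill_table ((n + Suc d) * (30 + ncost (NAdd (var 1) dim) + 20) + ncost (NAdd (var 1) dim) + 20)
      (mk nm A dr) (s'\<lparr>nmem := (nmem s')(6 := 0)\<rparr>) \<and> I (n + Suc d) s'"
    unfolding fill_table_def
  proof (rule runs_for_state)
    show "nmem s 6 = i \<and> nval (NAdd (var 1) dim) s = n + Suc d" if "I i s" for i s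
      using that nm by (auto simp: I_def)
    fix i s assume i: "i < n + Suc d" and "I i s"
    then obtain nm' where nm': "s = mk nm' A dr" "nm' 6 = i" "nm' 5 = i * Suc d"
      "\<forall>j<i. nm' (20 + j) = j * Suc d" "\<forall>x<20. x \<noteq> 5 \<and> x \<noteq> 6 \<longrightarrow> nm' x = nm x" by (auto simp: I_def)
    let ?nm1 = "nm'(20 + i := i * Suc d)"
    let ?nm2 = "?nm1(5 := Suc i * Suc d)"
    have 1: "runs d \<omega> (NAssign (NAdd (NConst 20) (var 6)) (var 5)) 10 s (mk ?nm1 A dr)"
      using exec.NAssign[of d \<omega> "NAdd (NConst 20) (var 6)" "var 5" s] nm'
      unfolding runs_def by (intro exI[of _ "1 + ncost (NAdd (NConst 20) (var 6)) + ncost (var 5)"]) (simp add: mk_nmem_upd)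
    have "nm' 0 = d" using nm'(5) nm by simp
    then have 2: "runs d \<omega> (NAssign (NConst 5) (NAdd (var 5) dim)) 20 (mk ?nm1 A dr) (mk ?nm2 A dr)"
      using runs_nassign[of "NAdd (var 5) dim" "mk ?nm1 A dr" "Suc i * Suc d" 20 d \<omega> 5] nm'(3) by (simp add: mk_nmem_upd)
    have "I (Suc i) (mk (?nm2(6 := Suc i)) A dr)"
      unfolding I_def using nm'(4,5) by (intro exI[of _ "?nm2(6 := Suc i)"]) (auto simp: less_Suc_eq)
    then show "\<exists>s'. runs d \<omega> ?body 30 s s' \<and> nmem s' 6 = i \<and> I (Suc i) (s'\<lparr>nmem := (nmem s')(6 := Suc i)\<rparr>)"
      using nm'(2) by (intro exI[of _ "mk ?nm2 A dr"] conjI runs_seq[OF 1 2]) (auto simp: mk_nmem_upd)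
  qed
  then obtain s' where s': "runs d \<omega> fill_table ((n + Suc d) * (30 + ncost (NAdd (var 1) dim) + 20) + ncost (NAdd (var 1) dim) + 20)
      (mk nm A dr) (s'\<lparr>nmem := (nmem s')(6 := 0)\<rparr>)" "I (n + Suc d) s'" by blast
  from s'(2) obtain nm' where nm': "s' = mk nm' A dr" "\<forall>j<n + Suc d. nm' (20 + j) = j * Suc d"
    "\<forall>x<20. x \<noteq> 5 \<and> x \<noteq> 6 \<longrightarrow> nm' x = nm x" by (auto simp: I_def)
  note r = s'(1)[unfolded nm'(1) mk_nmem_upd mk_simps]
  show ?thesis
  proof (intro exI conjI)
    show "runs d \<omega> fill_table ((n + Suc d) * 100 + 100) (mk nm A dr) (mk (nm'(6 := 0)) A dr)"
      by (rule runs_mono[OF r]) simp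
  qed (use nm' nm in auto)
qed

text \<open>
  The i-th draw is written beyond entry \<open>(i + 1) * D\<close> of every array, so that it does not overlap
  the rows up to \<open>i\<close> of the array of examples.
\<close>
definition draw_addr :: nexp where
  "draw_addr = slot 0 (NAdd (NMem (NAdd (NConst 20) (var 6))) dim)"

text \<open>A draw writes consecutive cells, which run across the interleaved arrays; this reads
  cell b + j.\<close>

definition cell :: "memory \<Rightarrow> nat \<Rightarrow> nat \<Rightarrow> real" where
  "cell A b j = A ((b + j) mod 32) ((b + j) div 32)"

lemma rval_cell: "rval (RMem (NAdd e (var x))) (mk nm A dr) = cell A (nval e (mk nm A dr)) (nm x)"
  by (simp add: cell_def)

definition draw_examples :: com where
  "draw_examples = For 6 (var 1) (Seq (Draw draw_addr) (Seq
     (For 7 (var 0) (wr 2 (entry 6 7) (RMul (RMem (NAdd draw_addr (var 0))) (RMem (NAdd draw_addr (var 7))))))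
     (wr 2 (entry 6 0) (RMem (NAdd draw_addr (var 0))))))"

definition fill_harmonics :: com where
  "fill_harmonics = Seq (wr 3 (NConst 0) (RConst 0)) (For 6 (var 1)
     (wr 3 (NAdd (var 6) (NConst 1)) (RAdd (rd 3 (var 6)) (RDiv (RConst 1) (RAdd (ROfNat (var 6)) (RConst 1))))))"

definition set_factors :: com where
  "set_factors = Seq (set_reg 18 (RDiv (RConst 1) (RMul (RConst 8) (RMul (ROfNat dim) (ROfNat dim)))))
     (Seq (set_reg 19 (RSub (RConst 1) (RDiv (reg 18) (ROfNat dim))))
     (set_reg 20 (RAdd (RConst 1) (RMul (RConst 2) (RMul (reg 18) (reg 18))))))"

text \<open>The ball has radius \<open>w_max + 1\<close>; the extra 1 leaves room for the
  perturbations of size \<rho> around the true weights.\<close>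

definition init_ellipsoid :: com where
  "init_ellipsoid = Seq (set_reg 13 (RMul (RMul (ROfNat (var 1)) (ROfNat (var 1))) (ROfNat (var 1))))
     (Seq (For 7 dim (wr 4 (var 7) (RConst 0))) (Seq (For 7 dim (wr 6 (var 7) (RConst 0)))
     (For 6 dim (Seq (For 7 dim (wr 5 (entry 6 7) (RConst 0))) (wr 5 (entry 6 6) (RAdd (reg 1) (RConst 1)))))))"

text \<open>Source and target overlap, but pass i reads cell 32 i + 6 when only cells below i have
  been overwritten.\<close>

definition copy_output :: com where
  "copy_output = For 7 dim (RAssign (var 7) (rd 6 (var 7)))"

context machine
begin

lemma runs_fill_harmonics:
  "\<exists>A'. runs d \<omega> fill_harmonics (n * 1000 + 1000) (mk nm A dr) (mk nm A' dr) \<and> same {3} A A' \<and> (\<forall>l\<le>n. A' 3 l = harm l)"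
proof -
  have 1: "runs d \<omega> (wr 3 (NConst 0) (RConst 0)) 100 (mk nm A dr) (mk nm (put 3 0 0 A) dr)"
    by (rule runs_wr) auto
  define I where "I p A' \<longleftrightarrow> same {3} A A' \<and> (\<forall>l\<le>p. A' 3 l = harm l)" for p :: nat and A'
  let ?b = "wr 3 (NAdd (var 6) (NConst 1)) (RAdd (rd 3 (var 6)) (RDiv (RConst 1) (RAdd (ROfNat (var 6)) (RConst 1))))"
  have "\<exists>A'. runs d \<omega> (For 6 (var 1) ?b) (n * 800 + 100) (mk nm (put 3 0 0 A) dr) (mk nm A' dr) \<and> I n A'"
  proof (rule runs_for)
    show "I 0 (put 3 0 0 A)" by (auto simp: I_def same_def harm_def)
    show "n * (700 + ncost (var 1) + 20) + ncost (var 1) + 20 \<le> n * 800 + 100" by simp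
    fix p A' assume I: "I p A'"
    have "runs d \<omega> ?b 700 (mk (nm(6 := p)) A' dr) (mk (nm(6 := p)) (put 3 (Suc p) (harm (Suc p)) A') dr)"
      using I by (intro runs_wr) (auto simp: I_def harm_Suc inverse_eq_divide add.commute)
    moreover have "I (Suc p) (put 3 (Suc p) (harm (Suc p)) A')" using I by (auto simp: I_def same_def put_apply le_Suc_eq)
    ultimately show "\<exists>A''. runs d \<omega> ?b 700 (mk (nm(6 := p)) A' dr) (mk (nm(6 := p)) A'' dr) \<and> I (Suc p) A''" by blast
  qed auto
  then obtain A' where A': "runs d \<omega> (For 6 (var 1) ?b) (n * 800 + 100) (mk nm (put 3 0 0 A) dr) (mk nm A' dr)" "I n A'" by blast
  have "runs d \<omega> fill_harmonics (n * 1000 + 1000) (mk nm A dr) (mk nm A' dr)"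
    unfolding fill_harmonics_def by (rule runs_seq[OF 1 A'(1)]) simp
  with A'(2) show ?thesis by (auto simp: I_def)
qed

lemma runs_set_factors:
  "\<exists>A'. runs d \<omega> set_factors 1000 (mk nm A dr) (mk nm A' dr) \<and> same {18, 19, 20} A A' \<and>
    A' 18 0 = step_length D \<and> A' 19 0 = shrink_factor D \<and> A' 20 0 = stretch_factor D"
proof -
  let ?A1 = "put 18 0 (step_length D) A"
  let ?A2 = "put 19 0 (shrink_factor D) ?A1"
  let ?A3 = "put 20 0 (stretch_factor D) ?A2"
  have 1: "runs d \<omega> (set_reg 18 (RDiv (RConst 1) (RMul (RConst 8) (RMul (ROfNat dim) (ROfNat dim))))) 200 (mk nm A dr) (mk nm ?A1 dr)"
    by (rule runs_set_reg) (auto simp: step_length_def power2_eq_square)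
  have 2: "runs d \<omega> (set_reg 19 (RSub (RConst 1) (RDiv (reg 18) (ROfNat dim)))) 200 (mk nm ?A1 dr) (mk nm ?A2 dr)"
    by (rule runs_set_reg) (auto simp: shrink_factor_def)
  have 3: "runs d \<omega> (set_reg 20 (RAdd (RConst 1) (RMul (RConst 2) (RMul (reg 18) (reg 18))))) 300 (mk nm ?A2 dr) (mk nm ?A3 dr)"
    by (rule runs_set_reg) (auto simp: stretch_factor_def power2_eq_square)
  have "runs d \<omega> set_factors 1000 (mk nm A dr) (mk nm ?A3 dr)"
    unfolding set_factors_def by (rule runs_seq[OF 1 runs_seq[OF 2 3 order_refl]]) simp
  then show ?thesis by (intro exI[of _ ?A3]) (auto simp: same_def)
qed

lemma runs_init_ellipsoid:
  "\<exists>A'. runs d \<omega> init_ellipsoid (D * (D * 1000 + 3000) + 1000) (mk nm A dr) (mk nm A' dr) \<and> same {4, 5, 6, 13} A A' \<and>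
    ell_start D n (A 1 0 + 1) (ell_view A')"
proof -
  let ?A1 = "put 13 0 (real n * real n * real n) A"
  have 1: "runs d \<omega> (set_reg 13 (RMul (RMul (ROfNat (var 1)) (ROfNat (var 1))) (ROfNat (var 1)))) 200 (mk nm A dr) (mk nm ?A1 dr)"
    by (rule runs_set_reg) auto
  have zero: "\<exists>B'. runs d \<omega> (For 7 dim (wr k (var 7) (RConst 0))) (D * 300 + 100) (mk nm B dr) (mk nm B' dr) \<and>
      same {k} B B' \<and> (\<forall>j<D. B' k (0 + j) = 0) \<and> (\<forall>j. j < 0 \<or> 0 + D \<le> j \<longrightarrow> B' k j = B k j)" if "k < 32" for k B
    using that by (intro runs_map) auto
  obtain A2 where A2: "runs d \<omega> (For 7 dim (wr 4 (var 7) (RConst 0))) (D * 300 + 100) (mk nm ?A1 dr) (mk nm A2 dr)"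
      "same {4} ?A1 A2" "\<forall>j<D. A2 4 j = 0" using zero[of 4 ?A1] by auto
  obtain A3 where A3: "runs d \<omega> (For 7 dim (wr 6 (var 7) (RConst 0))) (D * 300 + 100) (mk nm A2 dr) (mk nm A3 dr)"
      "same {6} A2 A3" "\<forall>j<D. A3 6 j = 0" using zero[of 6 A2] by auto
  define R where "R = A 1 0 + 1"
  define I where "I p A' \<longleftrightarrow> same {5} A3 A' \<and> (\<forall>i<p. \<forall>j<D. matrix A' 5 i j = (if i = j then R else 0))" for p :: nat and A'
  let ?b = "Seq (For 7 dim (wr 5 (entry 6 7) (RConst 0))) (wr 5 (entry 6 6) (RAdd (reg 1) (RConst 1)))"
  have "\<exists>A'. runs d \<omega> (For 6 dim ?b) (D * (D * 500 + 1500) + 100) (mk nm A3 dr) (mk nm A' dr) \<and> I D A'"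
  proof (rule runs_for)
    show "I 0 A3" by (simp add: I_def same_refl)
    show "D * ((D * 500 + 1400) + ncost dim + 20) + ncost dim + 20 \<le> D * (D * 500 + 1500) + 100" by (simp add: algebra_simps)
    fix p A' assume p: "p < D" and I: "I p A'"
    let ?m = "\<lambda>A. mk (nm(6 := p)) A dr"
    have row: "nm (20 + p) = p * D" using p by simp
    have "\<exists>B'. runs d \<omega> (For 7 dim (wr 5 (entry 6 7) (RConst 0))) (D * 500 + 100) (?m A') (?m B') \<and>
      same {5} A' B' \<and> (\<forall>j<D. B' 5 (p * D + j) = 0) \<and> (\<forall>j. j < p * D \<or> p * D + D \<le> j \<longrightarrow> B' 5 j = A' 5 j)"
      using row by (intro runs_map) auto
    then obtain B where B: "runs d \<omega> (For 7 dim (wr 5 (entry 6 7) (RConst 0))) (D * 500 + 100) (?m A') (?m B)"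
      "same {5} A' B" "\<And>j. j < D \<Longrightarrow> B 5 (p * D + j) = 0" "\<And>j. j < p * D \<or> p * D + D \<le> j \<Longrightarrow> B 5 j = A' 5 j"
      by auto
    have "B 1 = A 1" using B(2) I A3(2) A2(2) by (auto simp: same_def I_def)
    let ?C = "put 5 (p * D + p) R B"
    have 2: "runs d \<omega> (wr 5 (entry 6 6) (RAdd (reg 1) (RConst 1))) 500 (?m B) (?m ?C)"
      using row \<open>B 1 = A 1\<close> by (intro runs_wr) (auto simp: R_def)
    have "I (Suc p) ?C"
      unfolding I_def
    proof (intro conjI allI impI)
      show "same {5} A3 ?C" using I B(2) by (auto simp: I_def same_def)
      fix i j assume ij: "i < Suc p" "j < D"
      show "matrix ?C 5 i j = (if i = j then R else 0)"
      proof (cases "i = p")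
        case True
        then show ?thesis using B(3)[OF ij(2)] by (simp add: matrix_def put_apply)
      next
        case False
        then have "i < p" using ij by simp
        then have "i * D + j < p * D" using index_less_iff[OF ij(2)] by blast
        then show ?thesis using B(4)[of "i * D + j"] I \<open>i < p\<close> ij(2) by (simp add: matrix_def put_apply I_def)
      qed
    qed
    then show "\<exists>A''. runs d \<omega> ?b (D * 500 + 1400) (?m A') (?m A'') \<and> I (Suc p) A''"
      by (intro exI[of _ ?C] conjI runs_seq[OF B(1) 2]) auto
  qed auto
  then obtain A4 where A4: "runs d \<omega> (For 6 dim ?b) (D * (D * 500 + 1500) + 100) (mk nm A3 dr) (mk nm A4 dr)" "I D A4" by blast
  have "runs d \<omega> init_ellipsoid (D * (D * 1000 + 3000) + 1000) (mk nm A dr) (mk nm A4 dr)"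
    unfolding init_ellipsoid_def
    by (rule runs_seq[OF 1 runs_seq[OF A2(1) runs_seq[OF A3(1) A4(1) order_refl] order_refl]]) (simp add: algebra_simps)
  moreover have "same {4, 5, 6, 13} A A4" using A4(2) A3(2) A2(2) by (auto simp: I_def same_def)
  moreover have "ell_start D n R (ell_view A4)"
    using A4(2) A3(2,3) A2(2,3) by (auto simp: I_def same_def ell_start_def ell_view_def)
  ultimately show ?thesis unfolding R_def by blast
qed

lemma runs_copy_output:
  "\<exists>s. runs d \<omega> copy_output (D * 300 + 100) (mk nm A dr) s \<and> (\<forall>j<D. rmem s j = A 6 j) \<and> drawn s = dr"
proof -
  define I where "I i s \<longleftrightarrow> nmem s = nm(7 := i) \<and> drawn s = dr \<and> (\<forall>j<i. rmem s j = A 6 j) \<and> (\<forall>j. i \<le> j \<longrightarrow> rmem s j = rmem (mk nm A dr) j)" for i and s :: ram_state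
  have "I 0 (mk nm A dr)" by (auto simp: I_def fun_upd_idem)
  then have "\<exists>s'. runs d \<omega> copy_output (D * (200 + ncost dim + 20) + ncost dim + 20) (mk nm A dr) (s'\<lparr>nmem := (nmem s')(7 := 0)\<rparr>) \<and> I D s'"
    unfolding copy_output_def
  proof (rule runs_for_state)
    show "nmem s 7 = i \<and> nval dim s = D" if "I i s" for i s using that by (simp add: I_def)
    fix i s assume i: "i < D" and I: "I i s"
    have "rmem s (32 * i + 6) = rmem (mk nm A dr) (32 * i + 6)" using I unfolding I_def by simp
    then have v: "rval (rd 6 (var 7)) s = A 6 i" using I by (simp add: rd_def I_def)
    let ?s = "s\<lparr>rmem := (rmem s)(i := A 6 i)\<rparr>"
    have "runs d \<omega> (RAssign (var 7) (rd 6 (var 7))) 200 s ?s"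
      using exec.RAssign[of d \<omega> "var 7" "rd 6 (var 7)" s] v I
      unfolding runs_def by (intro exI[of _ "1 + ncost (var 7) + rcost (rd 6 (var 7))"]) (simp add: I_def)
    moreover have "I (Suc i) (?s\<lparr>nmem := (nmem ?s)(7 := Suc i)\<rparr>)" using I by (auto simp: I_def less_Suc_eq)
    ultimately show "\<exists>s'. runs d \<omega> (RAssign (var 7) (rd 6 (var 7))) 200 s s' \<and> nmem s' 7 = i \<and> I (Suc i) (s'\<lparr>nmem := (nmem s')(7 := Suc i)\<rparr>)"
      using I by (intro exI[of _ ?s]) (auto simp: I_def)
  qed
  then obtain s' where s': "runs d \<omega> copy_output (D * (200 + ncost dim + 20) + ncost dim + 20) (mk nm A dr) (s'\<lparr>nmem := (nmem s')(7 := 0)\<rparr>)" "I D s'"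
    by blast
  have "runs d \<omega> copy_output (D * 300 + 100) (mk nm A dr) (s'\<lparr>nmem := (nmem s')(7 := 0)\<rparr>)"
    by (rule runs_mono[OF s'(1)]) simp
  then show ?thesis using s'(2) by (intro exI[of _ "s'\<lparr>nmem := (nmem s')(7 := 0)\<rparr>"]) (auto simp: I_def)
qed

lemma runs_draw:
  assumes i: "i < n"
  shows "\<exists>A'. runs d \<omega> (Draw draw_addr) (D * 10 + 1000) (mk (nm(6 := i)) A dr') (mk (nm(6 := i)) A' (Suc dr')) \<and>
    (\<forall>k<32. \<forall>j<Suc i * D. A' k j = A k j) \<and>
    (\<forall>j<d. cell A' (32 * (Suc i * D)) j = fst (\<omega> dr') j) \<and> cell A' (32 * (Suc i * D)) d = snd (\<omega> dr')"
proof -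
  let ?s = "mk (nm(6 := i)) A dr'"
  let ?a = "32 * (Suc i * D)"
  have addr: "nval draw_addr ?s = ?a" using i by (simp add: draw_addr_def)
  let ?m = "store_example d ?a (\<omega> dr') (rmem ?s)"
  let ?A = "\<lambda>k i. ?m (32 * i + k)"
  have "?s\<lparr>rmem := ?m, drawn := Suc dr'\<rparr> = mk (nm(6 := i)) ?A (Suc dr')"
    by (subst mk_surj) simp
  then have "runs d \<omega> (Draw draw_addr) (D * 10 + 1000) ?s (mk (nm(6 := i)) ?A (Suc dr'))"
    using exec.Draw[of d \<omega> draw_addr ?s] unfolding addr runs_def
    by (intro exI[of _ "1 + ncost draw_addr + (d + 1)"]) (simp add: draw_addr_def)
  moreover have "?A k j = A k j" if "k < 32" "j < Suc i * D" for k j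
  proof -
    have "Suc j \<le> Suc i * D" using that by simp
    then have "32 * Suc j \<le> 32 * (Suc i * D)" by (rule mult_left_mono) simp
    then have "32 * j + k < ?a" using that(1) by simp
    then show ?thesis using that(1) by (simp add: store_example_def)
  qed
  moreover have "32 * (x div 32) + x mod 32 = x" for x :: nat by simp
  ultimately show ?thesis by (intro exI[of _ ?A]) (simp add: store_example_def cell_def)
qed

text \<open>Draws overwrite entries from D on across the arrays, so the remaining arrays are set up
  afterwards; accuracy and norm bound survive in entry 0.\<close>

lemma runs_draw_examples:
  assumes A: "A 0 0 = \<epsilon>" "A 1 0 = wm"
  shows "\<exists>A'. runs d \<omega> draw_examples (n * (D * 3100 + 5000) + 100) (mk nm A 0) (mk nm A' n) \<and>
    A' 0 0 = \<epsilon> \<and> A' 1 0 = wm \<and> (\<forall>i<n. \<forall>j<D. matrix A' 2 i j = signed_features d (\<omega> i) j)"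
proof -
  define good where "good i A' \<longleftrightarrow> A' 0 0 = \<epsilon> \<and> A' 1 0 = wm \<and> (\<forall>i'<i. \<forall>j<D. matrix A' 2 i' j = signed_features d (\<omega> i') j)" for i A'
  define I where "I i s \<longleftrightarrow> (\<exists>A'. s = mk (nm(6 := i)) A' i \<and> good i A')" for i s
  let ?c = "For 7 (var 0) (wr 2 (entry 6 7) (RMul (RMem (NAdd draw_addr (var 0))) (RMem (NAdd draw_addr (var 7)))))"
  let ?l = "wr 2 (entry 6 0) (RMem (NAdd draw_addr (var 0)))"
  have "I 0 (mk nm A 0)" unfolding I_def good_def using A by (intro exI[of _ A]) (auto simp: fun_upd_idem)
  then have "\<exists>s'. runs d \<omega> draw_examples (n * ((D * 3000 + 4000 + D * 10) + ncost (var 1) + 20) + ncost (var 1) + 20) (mk nm A 0)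
      (s'\<lparr>nmem := (nmem s')(6 := 0)\<rparr>) \<and> I n s'"
    unfolding draw_examples_def
  proof (rule runs_for_state)
    show "nmem s 6 = i \<and> nval (var 1) s = n" if "I i s" for i s using that by (auto simp: I_def)
    fix i s assume i: "i < n" and "I i s"
    then obtain A0 where A0: "s = mk (nm(6 := i)) A0 i" "good i A0" by (auto simp: I_def)
    let ?m = "\<lambda>A. mk (nm(6 := i)) A (Suc i)"
    define p where "p = 32 * (Suc i * D)"
    let ?cell = "\<lambda>A j. cell A p j"
    have row: "nm (20 + i) = i * D" using i by simp
    obtain A1 where A1: "runs d \<omega> (Draw draw_addr) (D * 10 + 1000) s (?m A1)"
      "\<forall>k<32. \<forall>j<Suc i * D. A1 k j = A0 k j" "\<forall>j<d. ?cell A1 j = fst (\<omega> i) j" "?cell A1 d = snd (\<omega> i)"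
      using runs_draw[OF i, of A0 i] unfolding A0(1) p_def by blast
    \<comment> \<open>Row i of array 2 ends below entry Suc i * D, where the raw example begins, so
      copying does not destroy what is still to be read.\<close>
    have keep: "?cell A' j = ?cell A1 j" if "\<And>k. k \<noteq> 2 \<Longrightarrow> A' k = A1 k" "\<And>j. Suc i * D \<le> j \<Longrightarrow> A' 2 j = A1 2 j" for A' j
    proof -
      have "Suc i * D \<le> (p + j) div 32" by (simp add: p_def)
      then show ?thesis using that(1)[of "(p + j) mod 32"] that(2) by (cases "(p + j) mod 32 = 2") (auto simp: cell_def)
    qed
    have addr: "nval draw_addr (mk (nm(6 := i, 7 := j)) A' dr') = p" "nval draw_addr (mk (nm(6 := i)) A' dr') = p" for A' dr' j
      using row by (simp_all add: draw_addr_def p_def)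
    have dcost: "ncost draw_addr = 353" by (simp add: draw_addr_def)
    have "\<exists>A'. runs d \<omega> ?c (D * 3000 + 100) (?m A1) (?m A') \<and> same {2} A1 A' \<and> (\<forall>j<d. A' 2 (i * D + j) = snd (\<omega> i) * fst (\<omega> i) j) \<and>
      (\<forall>j. j < i * D \<or> i * D + d \<le> j \<longrightarrow> A' 2 j = A1 2 j)"
    proof (rule runs_map)
      fix j A' assume j: "j < d" "same {2} A1 A'" "\<forall>j'. j' < i * D \<or> i * D + j \<le> j' \<longrightarrow> A' 2 j' = A1 2 j'"
      have "?cell A' x = ?cell A1 x" for x
        by (rule keep) (use j in \<open>auto simp: same_def\<close>)
      then show "rval (RMul (RMem (NAdd draw_addr (var 0))) (RMem (NAdd draw_addr (var 7)))) (mk (nm(6 := i, 7 := j)) A' (Suc i)) = snd (\<omega> i) * fst (\<omega> i) j"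
        using A1(3,4) j(1) by (simp only: rval.simps(6) rval_cell addr) simp
    next
      show "d * (34 + 32 * ncost (entry 6 7) + rcost (RMul (RMem (NAdd draw_addr (var 0))) (RMem (NAdd draw_addr (var 7)))) + ncost (var 0) + 20) + ncost (var 0) + 20 \<le> D * 3000 + 100"
        by (simp add: dcost)
    qed (use row in auto)
    then obtain A2 where A2: "runs d \<omega> ?c (D * 3000 + 100) (?m A1) (?m A2)" "same {2} A1 A2"
      "\<forall>j<d. A2 2 (i * D + j) = snd (\<omega> i) * fst (\<omega> i) j" "\<forall>j. j < i * D \<or> i * D + d \<le> j \<longrightarrow> A2 2 j = A1 2 j" by blast
    have "?cell A2 d = snd (\<omega> i)"
      unfolding A1(4)[symmetric] by (rule keep) (use A2 in \<open>auto simp: same_def\<close>)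
    let ?A3 = "put 2 (i * D + d) (snd (\<omega> i)) A2"
    have 3: "runs d \<omega> ?l 2000 (?m A2) (?m ?A3)"
    proof (rule runs_wr)
      show "rval (RMem (NAdd draw_addr (var 0))) (?m A2) = snd (\<omega> i)"
        using \<open>?cell A2 d = snd (\<omega> i)\<close> by (simp only: rval_cell addr) simp
    qed (use row in \<open>auto simp: dcost\<close>)
    have "good (Suc i) ?A3"
      unfolding good_def
    proof (intro conjI allI impI)
      show "?A3 0 0 = \<epsilon>" "?A3 1 0 = wm" using A0(2) A1(2) A2(2) by (simp_all add: good_def same_def)
      fix i' j assume ij: "i' < Suc i" "j < D"
      show "matrix ?A3 2 i' j = signed_features d (\<omega> i') j"
      proof (cases "i' = i")
        case True
        then show ?thesis using A2(3) ij(2) by (cases "j = d") (auto simp: matrix_def put_apply signed_features_def)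
      next
        case False
        then have i': "i' < i" using ij by simp
        then have lt: "i' * D + j < i * D" using index_less_iff[OF ij(2)] by blast
        then have "A2 2 (i' * D + j) = A1 2 (i' * D + j)" using A2(4) by blast
        moreover have "A1 2 (i' * D + j) = A0 2 (i' * D + j)" using A1(2) lt by simp
        moreover have "i' * D + j \<noteq> i * D + d" using lt by linarith
        ultimately show ?thesis using A0(2) i' ij(2) by (simp add: matrix_def put_apply good_def)
      qed
    qed
    then have "I (Suc i) ((?m ?A3)\<lparr>nmem := (nmem (?m ?A3))(6 := Suc i)\<rparr>)"
      unfolding I_def by (intro exI[of _ ?A3]) (simp add: mk_nmem_upd)
    then show "\<exists>s'. runs d \<omega> (Seq (Draw draw_addr) (Seq ?c ?l)) (D * 3000 + 4000 + D * 10) s s' \<and> nmem s' 6 = i \<and>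
       I (Suc i) (s'\<lparr>nmem := (nmem s')(6 := Suc i)\<rparr>)"
      by (intro exI[of _ "?m ?A3"] conjI runs_seq[OF A1(1) runs_seq[OF A2(1) 3 order_refl]]) auto
  qed
  then obtain s' where s': "runs d \<omega> draw_examples (n * ((D * 3000 + 4000 + D * 10) + ncost (var 1) + 20) + ncost (var 1) + 20) (mk nm A 0)
      (s'\<lparr>nmem := (nmem s')(6 := 0)\<rparr>)" "I n s'" by blast
  then obtain A' where A': "s' = mk (nm(6 := n)) A' n" "good n A'" by (auto simp: I_def)
  have nm6: "nm(6 := 0) = nm" by (simp add: fun_upd_idem)
  have "runs d \<omega> draw_examples (n * (D * 3100 + 5000) + 100) (mk nm A 0) (mk nm A' n)"
  proof -
    have "n * (D * 3000 + 4000 + D * 10 + 2 + 20) \<le> n * (D * 3100 + 5000)"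
      by (intro mult_left_mono) simp_all
    then have "n * (D * 3000 + 4000 + D * 10 + ncost (var 1) + 20) + ncost (var 1) + 20 \<le> n * (D * 3100 + 5000) + 100"
      unfolding var_simps by linarith
    from runs_mono[OF s'(1) this] show ?thesis
      using nm6 by (simp add: A'(1) mk_nmem_upd)
  qed
  with A'(2) show ?thesis unfolding good_def by blast
qed

end

section \<open>The learning algorithm\<close>

definition logistic_program :: com where
  "logistic_program =
     Seq (search_double 2 (ROfNat (var 0)) (RMul (reg 0) (reg 0)))
     (Seq (search_count 1 (RMul (RConst (2 ^ 50)) (RMul (ROfNat (var 0)) (RMul (ROfNat (var 2)) (RMul (ROfNat (var 2)) (ROfNat (var 2)))))) (RMul (reg 0) (reg 0)))
     (Seq fill_table (Seq draw_examples (Seq fill_harmonics (Seq set_factors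
     (Seq (search_double 3 (RMul (RConst 256) (RMul (RAdd (reg 1) (RConst 1)) (RMul (ROfNat dim) (ROfNat dim)))) (reg 0))
     (Seq (search_count 4 (RAdd (RMul (RMul (RMul (ROfNat dim) (ROfNat dim)) (RMul (ROfNat dim) (ROfNat dim))) (RMul (RConst 11) (ROfNat (var 3)))) (RConst 1)) (RConst 1))
     (Seq init_ellipsoid (Seq (For 9 (var 4) iteration) copy_output)))))))))"

lemma machine_upd: "machine d n nm \<Longrightarrow> 9 \<le> x \<Longrightarrow> x < 20 \<Longrightarrow> machine d n (nm(x := v))"
  and machine_upd': "machine d n nm \<Longrightarrow> x \<in> {2, 3, 4, 5} \<Longrightarrow> machine d n (nm(x := v))"
  by (auto simp: machine_def)

text \<open>The abstract states are collected along the loop, because the ellipsoid bound speaks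
  about the whole sequence.\<close>

lemma (in machine) runs_iterations:
  assumes H: "\<And>l. l \<le> n \<Longrightarrow> A 3 l = harm l"
    and const: "A 18 0 = step_length D" "A 19 0 = shrink_factor D" "A 20 0 = stretch_factor D"
    and start: "ell_start D n R (ell_view A)" and nm: "nm 9 = 0" "nm 4 = N"
  shows "\<exists>A' ss. runs d \<omega> (For 9 (var 4) iteration) (N * ((n + D) * (n + D) * 60000 + 21000) + 100) (mk nm A dr) (mk nm A' dr) \<and>
    ell_start D n R (ss 0) \<and> (\<forall>k<N. ell_step D n (matrix A 2) (ss k) (ss (Suc k))) \<and> best (ss N) = A' 6"
proof -
  define I where "I p A' \<longleftrightarrow> same {4, 5, 6, 7, 8, 9, 10, 11, 12, 13, 14, 15, 16} A A' \<and>
    (\<exists>ss. ell_start D n R (ss 0) \<and> (\<forall>k<p. ell_step D n (matrix A 2) (ss k) (ss (Suc k))) \<and> ss p = ell_view A')" for p A'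
  have "\<exists>A'. runs d \<omega> (For 9 (var 4) iteration) (N * ((n + D) * (n + D) * 60000 + 21000) + 100) (mk nm A dr) (mk nm A' dr) \<and> I N A'"
  proof (rule runs_for)
    show "nm 9 = 0" by (rule nm)
    show "I 0 A" unfolding I_def using start by (intro conjI same_refl exI[of _ "\<lambda>_. ell_view A"]) auto
    show "nval (var 4) (mk (nm(9 := i)) A dr) = N" for i A using nm by simp
    have "N * ((n + D) * (n + D) * 60000 + 20000 + 2 + 20) \<le> N * ((n + D) * (n + D) * 60000 + 21000)"
      by (intro mult_left_mono) simp_all
    then show "N * ((n + D) * (n + D) * 60000 + 20000 + ncost (var 4) + 20) + ncost (var 4) + 20 \<le> N * ((n + D) * (n + D) * 60000 + 21000) + 100"
      unfolding var_simps by linarith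
    fix p A' assume p: "p < N" and "I p A'"
    then obtain ss where ss: "same {4, 5, 6, 7, 8, 9, 10, 11, 12, 13, 14, 15, 16} A A'" "ell_start D n R (ss 0)"
      "\<forall>k<p. ell_step D n (matrix A 2) (ss k) (ss (Suc k))" "ss p = ell_view A'" by (auto simp: I_def)
    interpret m: machine d n \<omega> "nm(9 := p)" dr
      using machine_upd[OF machine_axioms, of 9] by simp
    have eq: "A' 3 = A 3" "A' 18 = A 18" "A' 19 = A 19" "A' 20 = A 20" "A' 2 = A 2" using ss(1) by (simp_all add: same_def)
    obtain A'' where A'': "runs d \<omega> iteration ((n + D) * (n + D) * 60000 + 20000) (mk (nm(9 := p)) A' dr) (mk (nm(9 := p)) A'' dr)"
      "same {4, 5, 6, 7, 8, 9, 10, 11, 12, 13, 14, 15, 16} A' A''" "ell_step D n (matrix A' 2) (ell_view A') (ell_view A'')"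
      using m.runs_iteration[of A'] H const by (auto simp: eq)
    have mat: "matrix A' 2 = matrix A 2" by (simp add: matrix_def eq fun_eq_iff)
    have "I (Suc p) A''"
      unfolding I_def
    proof (intro conjI exI[of _ "ss(Suc p := ell_view A'')"])
      show "same {4, 5, 6, 7, 8, 9, 10, 11, 12, 13, 14, 15, 16} A A''" by (rule same_trans[OF ss(1) A''(2)]) auto
      show "\<forall>k<Suc p. ell_step D n (matrix A 2) ((ss(Suc p := ell_view A'')) k) ((ss(Suc p := ell_view A'')) (Suc k))"
        using ss(3,4) A''(3) by (auto simp: less_Suc_eq mat)
    qed (use ss in auto)
    with A''(1) show "\<exists>A''. runs d \<omega> iteration ((n + D) * (n + D) * 60000 + 20000) (mk (nm(9 := p)) A' dr) (mk (nm(9 := p)) A'' dr) \<and> I (Suc p) A''"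
      by blast
  qed
  then obtain A' ss where "runs d \<omega> (For 9 (var 4) iteration) (N * ((n + D) * (n + D) * 60000 + 21000) + 100) (mk nm A dr) (mk nm A' dr)"
    "ell_start D n R (ss 0)" "\<forall>k<N. ell_step D n (matrix A 2) (ss k) (ss (Suc k))" "ss N = ell_view A'"
    unfolding I_def by blast
  then show ?thesis by (intro exI[of _ A'] exI[of _ ss]) (auto simp: ell_view_def)
qed

section \<open>The counts computed by the program, total time and correctness of the run\<close>

definition scale_count :: "nat \<Rightarrow> real \<Rightarrow> nat" where
  "scale_count d \<epsilon> = double_count (real d) (\<epsilon> * \<epsilon>)"

definition sample_count :: "nat \<Rightarrow> real \<Rightarrow> nat" where
  "sample_count d \<epsilon> = multiple_count (sample_const * (real d * real (scale_count d \<epsilon>) ^ 3)) (\<epsilon> * \<epsilon>)"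

text \<open>A stand-in for the logarithm of R D / \<rho> with R = wm + 1 and \<rho> = \<epsilon> /
  (256 D), the argument of ln in the ellipsoid bound.\<close>

definition radius_count :: "nat \<Rightarrow> real \<Rightarrow> real \<Rightarrow> nat" where
  "radius_count d \<epsilon> wm = double_count (256 * ((wm + 1) * (real (Suc d) * real (Suc d)))) \<epsilon>"

text \<open>The ellipsoid bound asks for more than 32 / 3 times D^4 times the logarithm; 11 exceeds
  32 / 3, and the summand 1 makes the inequality strict.\<close>

definition iteration_count :: "nat \<Rightarrow> real \<Rightarrow> real \<Rightarrow> nat" where
  "iteration_count d \<epsilon> wm = multiple_count (real (Suc d) ^ 4 * (11 * real (radius_count d \<epsilon> wm)) + 1) 1"

text \<open>The example array agrees with the signed features only for i < n and j < D, while a step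
  reads no other entry.\<close>

lemma ell_step_cong:
  assumes step: "ell_step D n Z s s'" and Z: "\<And>i j. i < n \<Longrightarrow> j < D \<Longrightarrow> Z i j = Z' i j"
  shows "ell_step D n Z' s s'"
proof -
  have 1: "(\<Sum>j<D. u j * Z' i j) = (\<Sum>j<D. u j * Z i j)" if "i < n" for i u
    using Z[OF that] by (intro sum.cong) auto
  have 2: "(\<Sum>i<D. B i * - (\<Sum>k<n. real (l k) * Z' k i)) = (\<Sum>i<D. B i * - (\<Sum>k<n. real (l k) * Z k i))" for B l
    using Z by (intro sum.cong refl arg_cong2[where f = times] arg_cong[where f = uminus]) auto
  have 3: "total_loss D n Z' u = total_loss D n Z u" for u
    unfolding total_loss_def using 1 by (intro sum.cong) auto
  from step obtain l h where lh:
     "\<forall>i<n. l i \<le> n \<and> harm_line n (l i) (\<Sum>j<D. center s j * Z i j) = harm_loss n (\<Sum>j<D. center s j * Z i j)"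
     "\<forall>j<D. h j = (\<Sum>i<D. basis s i j * - (\<Sum>k<n. real (l k) * Z k i))"
     "\<forall>i<D. center s' i = ell_center D (center s) (basis s) h i"
     "\<forall>i<D. \<forall>j<D. basis s' i j = ell_basis D (basis s) h i j"
     "if total_loss D n Z (center s) < best_val s
      then (\<forall>j<D. best s' j = center s j) \<and> best_val s' = total_loss D n Z (center s)
      else (\<forall>j<D. best s' j = best s j) \<and> best_val s' = best_val s"
    unfolding ell_step_def by blast
  show ?thesis unfolding ell_step_def 2 3
    by (rule exI[of _ l], rule exI[of _ h], intro conjI) (use lh 1 in auto)
qed

lemma total_time_le:
  fixes m n D m2 N :: nat
  assumes "1 \<le> D"
  shows "m * 1000 + 2000 + (n * 1000 + 1000 + ((n + D) * 100 + 100 + (n * (D * 3100 + 5000) + 100 + (n * 1000 + 1000 + (1000 +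
    (m2 * 1000 + 2000 + (N * 1000 + 1000 + (D * (D * 1000 + 3000) + 1000 + (N * ((n + D) * (n + D) * 60000 + 21000) + 100 + (D * 300 + 100))))))))))
    \<le> 1000000 * (m + n + D + m2 + N) ^ 3"
proof -
  define q where "q = m + n + D + m2 + N"
  define Q where "Q = q ^ 3"
  have q: "1 \<le> q" "m \<le> q" "n \<le> q" "D \<le> q" "m2 \<le> q" "N \<le> q" "n + D \<le> q"
    using assms by (simp_all add: q_def)
  have Q: "q * q \<le> Q" "q \<le> Q" "1 \<le> Q" using q(1) by (auto simp: Q_def power3_eq_cube)
  then have le: "m \<le> Q" "n \<le> Q" "D \<le> Q" "m2 \<le> Q" "N \<le> Q" using q by linarith+
  have "n * D \<le> q * q" "D * D \<le> q * q" using q by (intro mult_mono; simp)+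
  then have p: "n * D \<le> Q" "D * D \<le> Q" using Q(1) by linarith+
  have "N * ((n + D) * (n + D)) \<le> q * (q * q)" using q by (intro mult_mono; simp)
  then have p3: "N * ((n + D) * (n + D)) \<le> Q" by (simp add: Q_def power3_eq_cube)
  \<comment> \<open>The products are replaced by variables bounded by Q, so that a linear inequality
    remains.\<close>
  have arith: "m * 1000 + 2000 + (n * 1000 + 1000 + ((n + D) * 100 + 100 + (3100 * a + 5000 * n + 100 + (n * 1000 + 1000 + (1000 +
    (m2 * 1000 + 2000 + (N * 1000 + 1000 + (1000 * b + 3000 * D + 1000 + (60000 * c + 21000 * N + 100 + (D * 300 + 100)))))))))) \<le> 1000000 * Q"
    if "a \<le> Q" "b \<le> Q" "c \<le> Q" for a b c
    using that le Q(3) by (simp add: algebra_simps)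
  have e: "n * (D * 3100 + 5000) = 3100 * (n * D) + 5000 * n" "D * (D * 1000 + 3000) = 1000 * (D * D) + 3000 * D"
    "N * ((n + D) * (n + D) * 60000 + 21000) = 60000 * (N * ((n + D) * (n + D))) + 21000 * N"
    by (simp_all add: algebra_simps)
  show ?thesis using arith[OF p p3] unfolding e q_def[symmetric] Q_def[symmetric] .
qed

text \<open>No assumption is made on the sample: the number of draws and the time bound are the same
  for all sequences, and only the states ss depend on it.\<close>

theorem logistic_program_runs:
  fixes d :: nat and \<epsilon> wm :: real and \<omega> :: "nat \<Rightarrow> example"
  assumes \<epsilon>: "0 < \<epsilon>"
  defines "n \<equiv> sample_count d \<epsilon>" and "N \<equiv> iteration_count d \<epsilon> wm"
  defines "q \<equiv> scale_count d \<epsilon> + n + Suc d + radius_count d \<epsilon> wm + N"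
  shows "\<exists>t s ss. exec d \<omega> logistic_program (initial_state d \<epsilon> wm) t s \<and> drawn s = n \<and> t \<le> 1000000 * q ^ 3 \<and>
    ell_start (Suc d) n (wm + 1) (ss 0) \<and>
    (\<forall>k<N. ell_step (Suc d) n (\<lambda>i j. signed_features d (\<omega> i) j) (ss k) (ss (Suc k))) \<and>
    (\<forall>j<Suc d. rmem s j = best (ss N) j)"
proof -
  define m m2 where "m = scale_count d \<epsilon>" and "m2 = radius_count d \<epsilon> wm"
  define nm0 :: "nat \<Rightarrow> nat" where "nm0 = (\<lambda>_. 0)(0 := d)"
  define A0 :: memory where "A0 = (\<lambda>k i. rmem (initial_state d \<epsilon> wm) (32 * i + k))"
  have init: "initial_state d \<epsilon> wm = mk nm0 A0 0"
    by (subst mk_surj) (simp add: A0_def nm0_def initial_state_def)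
  have A0: "A0 0 0 = \<epsilon>" "A0 1 0 = wm" by (simp_all add: A0_def initial_state_def)
  have e2: "0 < \<epsilon> * \<epsilon>" using \<epsilon> by simp
  obtain A1 where 1: "runs d \<omega> (search_double 2 (ROfNat (var 0)) (RMul (reg 0) (reg 0))) (m * 1000 + 2000) (mk nm0 A0 0) (mk (nm0(2 := m)) A1 0)"
    "same {17} A0 A1"
  proof -
    have "\<exists>A'. runs d \<omega> (search_double 2 (ROfNat (var 0)) (RMul (reg 0) (reg 0))) (double_count (real d) (\<epsilon> * \<epsilon>) * 1000 + 2000) (mk nm0 A0 0)
        (mk (nm0(2 := double_count (real d) (\<epsilon> * \<epsilon>))) A' 0) \<and> same {17} A0 A'"
      by (rule runs_search_double[OF _ _ e2]) (auto simp: nm0_def A0)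
    then show ?thesis using that by (auto simp: m_def scale_count_def)
  qed
  let ?nm1 = "nm0(2 := m)"
  let ?tgt = "RMul (RConst (2 ^ 50)) (RMul (ROfNat (var 0)) (RMul (ROfNat (var 2)) (RMul (ROfNat (var 2)) (ROfNat (var 2)))))"
  have A1: "A1 0 0 = \<epsilon>" "A1 1 0 = wm" using 1(2) A0 by (simp_all add: same_def)
  have n: "n = multiple_count (sample_const * (real d * real m ^ 3)) (\<epsilon> * \<epsilon>)"
    by (simp add: n_def sample_count_def m_def)
  have 2: "runs d \<omega> (search_count 1 ?tgt (RMul (reg 0) (reg 0))) (n * 1000 + 1000) (mk ?nm1 A1 0) (mk (?nm1(1 := n)) A1 0)"
    unfolding n
    by (rule runs_search_count[OF _ _ _ e2]) (auto simp: nm0_def A1 sample_const_def power3_eq_cube)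
  let ?nm2 = "?nm1(1 := n)"
  obtain nm3 where 3: "runs d \<omega> fill_table ((n + Suc d) * 100 + 100) (mk ?nm2 A1 0) (mk nm3 A1 0)"
    "\<forall>i<n + Suc d. nm3 (20 + i) = i * Suc d" "\<forall>x<20. x \<noteq> 5 \<longrightarrow> nm3 x = ?nm2 x"
    using runs_fill_table[of ?nm2 d n \<omega> A1 0] by (auto simp: nm0_def)
  have nm3: "nm3 0 = d" "nm3 1 = n" "nm3 4 = 0" "nm3 6 = 0" "nm3 7 = 0" "nm3 8 = 0" "nm3 9 = 0"
    using 3(3) by (auto simp: nm0_def)
  interpret m3: machine d n \<omega> nm3 n
    by standard (use nm3 3(2) in auto)
  obtain A4 where 4: "runs d \<omega> draw_examples (n * (Suc d * 3100 + 5000) + 100) (mk nm3 A1 0) (mk nm3 A4 n)"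
    "A4 0 0 = \<epsilon>" "A4 1 0 = wm" "\<forall>i<n. \<forall>j<Suc d. m3.matrix A4 2 i j = signed_features d (\<omega> i) j"
    using m3.runs_draw_examples[where A = A1 and \<epsilon> = \<epsilon> and wm = wm] A1 by blast
  obtain A5 where 5: "runs d \<omega> fill_harmonics (n * 1000 + 1000) (mk nm3 A4 n) (mk nm3 A5 n)" "same {3} A4 A5" "\<forall>l\<le>n. A5 3 l = harm l"
    using m3.runs_fill_harmonics[of A4] by blast
  obtain A6 where 6: "runs d \<omega> set_factors 1000 (mk nm3 A5 n) (mk nm3 A6 n)" "same {18, 19, 20} A5 A6"
    "A6 18 0 = step_length (Suc d)" "A6 19 0 = shrink_factor (Suc d)" "A6 20 0 = stretch_factor (Suc d)"
    using m3.runs_set_factors[of A5] by blast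
  have A6: "A6 0 0 = \<epsilon>" "A6 1 0 = wm" "A6 2 = A4 2" "A6 3 = A5 3" using 4(2,3) 5(2) 6(2) by (simp_all add: same_def)
  let ?tgt2 = "RMul (RConst 256) (RMul (RAdd (reg 1) (RConst 1)) (RMul (ROfNat dim) (ROfNat dim)))"
  have m2: "m2 = double_count (256 * ((wm + 1) * (real (Suc d) * real (Suc d)))) \<epsilon>"
    by (simp add: m2_def radius_count_def)
  obtain A7 where 7: "runs d \<omega> (search_double 3 ?tgt2 (reg 0)) (m2 * 1000 + 2000) (mk nm3 A6 n) (mk (nm3(3 := m2)) A7 n)"
    "same {17} A6 A7"
  proof -
    have "\<exists>A'. runs d \<omega> (search_double 3 ?tgt2 (reg 0)) (m2 * 1000 + 2000) (mk nm3 A6 n) (mk (nm3(3 := m2)) A' n) \<and> same {17} A6 A'"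
      unfolding m2 by (rule runs_search_double[OF _ _ \<epsilon>]) (auto simp: A6 A6[simplified] nm3)
    then show ?thesis using that by blast
  qed
  let ?nm4 = "nm3(3 := m2)"
  let ?tgt3 = "RAdd (RMul (RMul (RMul (ROfNat dim) (ROfNat dim)) (RMul (ROfNat dim) (ROfNat dim))) (RMul (RConst 11) (ROfNat (var 3)))) (RConst 1)"
  have N: "N = multiple_count (real (Suc d) ^ 4 * (11 * real m2) + 1) 1"
    by (simp add: N_def iteration_count_def m2_def)
  define nm5 where "nm5 = ?nm4(4 := N)"
  have 8: "runs d \<omega> (search_count 4 ?tgt3 (RConst 1)) (N * 1000 + 1000) (mk ?nm4 A7 n) (mk nm5 A7 n)"
    unfolding nm5_def N by (rule runs_search_count) (auto simp: nm3 power4_eq_xxxx)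
  have nm5: "nm5 4 = N" "nm5 9 = 0" by (simp_all add: nm5_def nm3)
  have "machine d n nm5"
    unfolding nm5_def by (intro machine_upd' m3.machine_axioms) simp_all
  then interpret m5: machine d n \<omega> nm5 n .
  from m5.runs_init_ellipsoid[of A7] obtain A9 where 9: "runs d \<omega> init_ellipsoid (Suc d * (Suc d * 1000 + 3000) + 1000) (mk nm5 A7 n) (mk nm5 A9 n)"
    "same {4, 5, 6, 13} A7 A9" "ell_start (Suc d) n (A7 1 0 + 1) (m5.ell_view A9)"
    by blast
  have A9: "A9 2 = A4 2" "A9 3 = A5 3" "A9 18 = A6 18" "A9 19 = A6 19" "A9 20 = A6 20" "A7 1 0 = wm"
    using A6 7(2) 9(2) by (simp_all add: same_def)
  have "\<exists>A' ss. runs d \<omega> (For 9 (var 4) iteration) (N * ((n + Suc d) * (n + Suc d) * 60000 + 21000) + 100) (mk nm5 A9 n) (mk nm5 A' n) \<and>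
    ell_start (Suc d) n (wm + 1) (ss 0) \<and> (\<forall>k<N. ell_step (Suc d) n (m5.matrix A9 2) (ss k) (ss (Suc k))) \<and> best (ss N) = A' 6"
    by (rule m5.runs_iterations) (use 5(3) 6 9(3) nm5 in \<open>auto simp: A9 A9[simplified]\<close>)
  then obtain A10 ss where 10: "runs d \<omega> (For 9 (var 4) iteration) (N * ((n + Suc d) * (n + Suc d) * 60000 + 21000) + 100) (mk nm5 A9 n) (mk nm5 A10 n)"
    "ell_start (Suc d) n (wm + 1) (ss 0)" "\<forall>k<N. ell_step (Suc d) n (m5.matrix A9 2) (ss k) (ss (Suc k))" "best (ss N) = A10 6"
    by blast
  obtain s where 11: "runs d \<omega> copy_output (Suc d * 300 + 100) (mk nm5 A10 n) s" "\<forall>j<Suc d. rmem s j = A10 6 j" "drawn s = n"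
    using m5.runs_copy_output[of A10] by blast
  have "runs d \<omega> logistic_program (1000000 * (m + n + Suc d + m2 + N) ^ 3) (initial_state d \<epsilon> wm) s"
    unfolding logistic_program_def init
    by (rule runs_seq[OF 1(1) runs_seq[OF 2 runs_seq[OF 3(1) runs_seq[OF 4(1) runs_seq[OF 5(1) runs_seq[OF 6(1)
        runs_seq[OF 7(1) runs_seq[OF 8 runs_seq[OF 9(1) runs_seq[OF 10(1) 11(1) order_refl] order_refl] order_refl] order_refl]
        order_refl] order_refl] order_refl] order_refl] order_refl]]) (rule total_time_le, simp)
  then have run: "runs d \<omega> logistic_program (1000000 * q ^ 3) (initial_state d \<epsilon> wm) s"
    by (simp only: q_def m_def m2_def)
  have "ell_step (Suc d) n (\<lambda>i j. signed_features d (\<omega> i) j) (ss k) (ss (Suc k))" if "k < N" for k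
  proof (rule ell_step_cong)
    show "ell_step (Suc d) n (m5.matrix A9 2) (ss k) (ss (Suc k))" using 10(3) that by blast
    show "m5.matrix A9 2 i j = signed_features d (\<omega> i) j" if "i < n" "j < Suc d" for i j
      using 4(4) that by (simp add: m5.matrix_def m3.matrix_def A9)
  qed
  moreover obtain t where "exec d \<omega> logistic_program (initial_state d \<epsilon> wm) t s" "t \<le> 1000000 * q ^ 3"
    using run unfolding runs_def by blast
  moreover have "\<forall>j<Suc d. rmem s j = best (ss N) j" using 10(4) 11(2) by simp
  ultimately show ?thesis using 10(2) 11(3) by (intro exI[of _ t] exI[of _ s] exI[of _ ss]) blast
qed

lemma sample_count_properties:
  fixes \<epsilon> :: real
  assumes d: "1 \<le> d" and \<epsilon>: "0 < \<epsilon>" "\<epsilon> < 1"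
  defines "m \<equiv> scale_count d \<epsilon>" and "n \<equiv> sample_count d \<epsilon>"
  shows "1 \<le> m" "real d / \<epsilon>\<^sup>2 \<le> 2 ^ m" "real m \<le> 2 * (1 + ln (real d / \<epsilon>\<^sup>2))"
    "sample_const * (real d * real m ^ 3) \<le> real n * \<epsilon>\<^sup>2"
    "real n * \<epsilon>\<^sup>2 \<le> sample_const * (real d * real m ^ 3) + \<epsilon>\<^sup>2"
    "real n \<le> (sample_const + 1) * (real d / \<epsilon>\<^sup>2 * real m ^ 3)"
    "1 \<le> real d / \<epsilon>\<^sup>2"
proof -
  have e2: "0 < \<epsilon> * \<epsilon>" "\<epsilon>\<^sup>2 = \<epsilon> * \<epsilon>" using \<epsilon> by (auto simp: power2_eq_square)
  have d0: "0 < real d" using d by simp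
  have "\<epsilon>\<^sup>2 \<le> 1" using \<epsilon> by (intro power_le_one) auto
  then show F1: "1 \<le> real d / \<epsilon>\<^sup>2" using d e2 by (simp add: le_divide_eq)
  note dc = double_count_bounds[OF e2(1) d0, folded scale_count_def m_def e2(2)]
  show m1: "1 \<le> m" by (rule dc(1))
  show "real d / \<epsilon>\<^sup>2 \<le> 2 ^ m" by (rule dc(2))
  show "real m \<le> 2 * (1 + ln (real d / \<epsilon>\<^sup>2))" using dc(3) ln_ge_zero[OF F1] by (simp only: max_def) simp
  have "0 < sample_const * (real d * real m ^ 3)" using d0 m1 by (simp add: sample_const_def)
  note mc = multiple_count_bounds[OF e2(1) this, unfolded m_def, folded sample_count_def, folded n_def m_def e2(2)]
  show "sample_const * (real d * real m ^ 3) \<le> real n * \<epsilon>\<^sup>2" by (rule mc(1))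
  show n2: "real n * \<epsilon>\<^sup>2 \<le> sample_const * (real d * real m ^ 3) + \<epsilon>\<^sup>2" by (rule mc(2))
  have "real n \<le> (sample_const * (real d * real m ^ 3) + \<epsilon>\<^sup>2) / \<epsilon>\<^sup>2"
    using n2 e2 by (simp add: le_divide_eq)
  also have "\<dots> = sample_const * (real d / \<epsilon>\<^sup>2 * real m ^ 3) + 1"
    using \<epsilon> by (simp add: add_divide_distrib)
  \<comment> \<open>The one additional example caused by rounding up is absorbed by replacing the
    constant with \<open>sample_const + 1\<close>.\<close>
  also have "1 \<le> real d / \<epsilon>\<^sup>2 * real m ^ 3"
  proof -
    have "1 * 1 \<le> real d / \<epsilon>\<^sup>2 * real m ^ 3" using F1 m1 by (intro mult_mono one_le_power) auto
    then show ?thesis by simp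
  qed
  finally show "real n \<le> (sample_const + 1) * (real d / \<epsilon>\<^sup>2 * real m ^ 3)" by (simp only: distrib_right mult_1_left)
qed

lemma iteration_count_properties:
  fixes d :: nat and \<epsilon> wm :: real
  assumes \<epsilon>: "0 < \<epsilon>" "\<epsilon> < 1" and wm: "0 \<le> wm"
  defines "D \<equiv> real (Suc d)" and "r \<equiv> radius_count d \<epsilon> wm" and "N \<equiv> iteration_count d \<epsilon> wm"
  shows "32 * D ^ 4 * ln ((wm + 1) * D / (\<epsilon> / (256 * D))) < 3 * real N"
    "real r \<le> 2 + 2 * (6 + ln (wm + 1) + 2 * D + 1 / \<epsilon>)" "real N \<le> D ^ 4 * (11 * real r) + 2"
proof -
  have D: "1 \<le> D" by (simp add: D_def)
  define Y where "Y = 256 * ((wm + 1) * (D * D))"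
  have Y: "0 < Y" using D wm by (simp add: Y_def)
  note dc = double_count_bounds[OF \<epsilon>(1) Y, unfolded Y_def D_def, folded radius_count_def, folded r_def D_def, folded Y_def]
  have eq: "(wm + 1) * D / (\<epsilon> / (256 * D)) = Y / \<epsilon>" by (simp add: Y_def)
  \<comment> \<open>Makes ln (Y / \<epsilon>) nonnegative, which removes the maximum with 0 in
    \<open>double_count_bounds\<close>.\<close>
  have Ye: "1 \<le> Y / \<epsilon>"
  proof -
    have "1 * (1 * 1) \<le> (wm + 1) * (D * D)" using D wm by (intro mult_mono) auto
    then have "\<epsilon> \<le> Y" using \<epsilon> by (simp add: Y_def)
    then show ?thesis using \<epsilon> by (simp add: le_divide_eq)
  qed
  have ln2: "ln (2 :: real) \<le> 7 / 10" using ln2_le_25_over_36 by simp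
  have "ln (Y / \<epsilon>) \<le> ln (2 ^ r)" using dc(2) Ye by (intro ln_mono) auto
  also have "\<dots> = real r * ln 2" by (simp add: ln_realpow)
  also have "\<dots> \<le> real r * 1" using ln2 by (intro mult_left_mono) auto
  finally have lnY: "ln (Y / \<epsilon>) \<le> real r" by simp
  have pos: "0 < D ^ 4 * (11 * real r) + 1" using D by (intro add_nonneg_pos mult_nonneg_nonneg) auto
  have mc: "D ^ 4 * (11 * real r) + 1 \<le> real N" "real N \<le> D ^ 4 * (11 * real r) + 1 + 1"
    using multiple_count_bounds[of 1 "D ^ 4 * (11 * real r) + 1"] pos
    by (simp_all only: N_def iteration_count_def r_def D_def) simp_all
  show "32 * D ^ 4 * ln ((wm + 1) * D / (\<epsilon> / (256 * D))) < 3 * real N"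
  proof -
    have "32 * D ^ 4 * ln (Y / \<epsilon>) \<le> 32 * D ^ 4 * real r" using lnY D by (intro mult_left_mono) auto
    moreover have "0 \<le> D ^ 4 * real r" using D by simp
    ultimately show ?thesis unfolding eq using mc(1) by simp
  qed
  show "real N \<le> D ^ 4 * (11 * real r) + 2" using mc(2) by simp
  have "ln (Y / \<epsilon>) = ln 256 + ln (wm + 1) + 2 * ln D + ln (1 / \<epsilon>)"
    using \<epsilon> D wm by (simp add: Y_def ln_mult ln_div)
  also have "\<dots> \<le> 6 + ln (wm + 1) + 2 * D + 1 / \<epsilon>"
  proof -
    have "ln (256 :: real) = ln (2 ^ 8)" by simp
    also have "\<dots> = 8 * ln 2" by (subst ln_realpow) auto
    finally have "ln (256 :: real) \<le> 6" using ln2 by simp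
    moreover have "ln D \<le> D" using D ln_le_minus_one[of D] by simp
    moreover have "ln (1 / \<epsilon>) \<le> 1 / \<epsilon>" using \<epsilon> ln_le_minus_one[of "1 / \<epsilon>"] by simp
    ultimately show ?thesis by simp
  qed
  finally have "ln (Y / \<epsilon>) \<le> 6 + ln (wm + 1) + 2 * D + 1 / \<epsilon>" .
  moreover have "0 \<le> ln (Y / \<epsilon>)" using Ye by (rule ln_ge_zero)
  ultimately show "real r \<le> 2 + 2 * (6 + ln (wm + 1) + 2 * D + 1 / \<epsilon>)"
    using dc(3) by (simp only: max_def) simp
qed

lemma sample_count_le_soft_bound:
  assumes "1 \<le> d" "0 < \<epsilon>" "\<epsilon> < 1"
  shows "real (sample_count d \<epsilon>) \<le> soft_bound (8 * (sample_const + 1)) 3 (real d / \<epsilon>\<^sup>2)"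
proof -
  note p = sample_count_properties[OF assms]
  have "real (sample_count d \<epsilon>) \<le> (sample_const + 1) * (real d / \<epsilon>\<^sup>2 * real (scale_count d \<epsilon>) ^ 3)" by (rule p(6))
  \<comment> \<open>The cube of the factor 2 in the bound on \<open>scale_count\<close> is the 8 of
    the final constant.\<close>
  also have "\<dots> \<le> (sample_const + 1) * (real d / \<epsilon>\<^sup>2 * (2 * (1 + ln (real d / \<epsilon>\<^sup>2))) ^ 3)"
    using p(3,7) by (intro mult_left_mono power_mono) (auto simp: sample_const_def)
  also have "\<dots> = soft_bound (8 * (sample_const + 1)) 3 (real d / \<epsilon>\<^sup>2)"
    unfolding soft_bound_def power_mult_distrib by (simp only: mult_ac) simp
  finally show ?thesis .
qed

text \<open>With X the base of \<open>poly_bound\<close>, d / \<epsilon>^2 <= X^3 and m <= 4 X^3, so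
  n has order X^(3 + 3 * 3) = X^12 and dominates the other counts; the total time is cubic in their
  sum, hence the exponent 36.\<close>

lemma running_time_le_poly_bound:
  fixes \<epsilon> wm :: real
  assumes d: "1 \<le> d" and \<epsilon>: "0 < \<epsilon>" "\<epsilon> < 1" and wm: "0 \<le> wm"
  defines "q \<equiv> scale_count d \<epsilon> + sample_count d \<epsilon> + Suc d + radius_count d \<epsilon> wm + iteration_count d \<epsilon> wm"
  shows "real (1000000 * q ^ 3) \<le> poly_bound (1000000 * (64 * (sample_const + 1) + 4000) ^ 3) 36 d \<epsilon> wm"
proof -
  define X where "X = real d + 1 / \<epsilon> + ln (2 + wm)"
  define D where "D = real (Suc d)"
  define m n r N where "m = real (scale_count d \<epsilon>)" and "n = real (sample_count d \<epsilon>)"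
    and "r = real (radius_count d \<epsilon> wm)" and "N = real (iteration_count d \<epsilon> wm)"
  note p = sample_count_properties[OF d \<epsilon>, folded m_def n_def]
  note i = iteration_count_properties[OF \<epsilon> wm, of d, folded D_def, folded r_def N_def]
  have lnw: "0 \<le> ln (2 + wm)" "ln (wm + 1) \<le> ln (2 + wm)" using wm by (auto intro: ln_mono)
  have le: "real d \<le> X" "1 / \<epsilon> \<le> X" "ln (wm + 1) \<le> X" "1 \<le> X"
  proof -
    have "0 < 1 / \<epsilon>" "1 \<le> real d" using d \<epsilon> by auto
    then show "real d \<le> X" "1 / \<epsilon> \<le> X" "ln (wm + 1) \<le> X" "1 \<le> X" unfolding X_def using lnw by linarith+
  qed
  have X2: "2 \<le> X"
  proof -
    have "1 \<le> 1 / \<epsilon>" using \<epsilon> by (simp add: le_divide_eq)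
    then show ?thesis using lnw d by (simp add: X_def)
  qed
  have mono: "X ^ a \<le> X ^ b" if "a \<le> b" for a b using le(4) that by (intro power_increasing) auto
  have F: "real d / \<epsilon>\<^sup>2 \<le> X ^ 3"
  proof -
    have "real d * ((1 / \<epsilon>) * (1 / \<epsilon>)) \<le> X * (X * X)" using le \<epsilon> by (intro mult_mono) auto
    then show ?thesis by (simp add: power2_eq_square power3_eq_cube)
  qed
  have m: "m \<le> 4 * X ^ 3"
  proof -
    have "ln (real d / \<epsilon>\<^sup>2) \<le> real d / \<epsilon>\<^sup>2 - 1" using p(7) by (intro ln_le_minus_one) linarith
    then have "ln (real d / \<epsilon>\<^sup>2) \<le> X ^ 3 - 1" using F by (rule order_trans[OF _ diff_right_mono])
    with p(3) have "m \<le> 2 * (1 + (X ^ 3 - 1))" by (rule order_trans[OF _ mult_left_mono[OF add_left_mono]]) simp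
    then have "m \<le> 2 * X ^ 3" by simp
    moreover have "0 \<le> X ^ 3" using le(4) by simp
    ultimately show ?thesis by linarith
  qed
  have m0: "0 \<le> m" by (simp add: m_def)
  have n: "n \<le> 64 * (sample_const + 1) * X ^ 12"
  proof -
    have "n \<le> (sample_const + 1) * (real d / \<epsilon>\<^sup>2 * m ^ 3)" by (rule p(6))
    also have "\<dots> \<le> (sample_const + 1) * (X ^ 3 * (4 * X ^ 3) ^ 3)"
      using F m m0 p(7) le(4) by (intro mult_left_mono mult_mono power_mono) (auto simp: sample_const_def)
    also have "\<dots> = 64 * (sample_const + 1) * X ^ 12"
    proof -
      have "X ^ 3 * (4 * X ^ 3) ^ 3 = 64 * X ^ 12"
        by (simp add: power_mult_distrib power_mult[symmetric] mult.left_commute flip: power_add)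
      then show ?thesis by (simp only:)
    qed
    finally show ?thesis .
  qed
  have D: "D \<le> 2 * X" "0 \<le> D" using le d by (auto simp: D_def)
  have r: "r \<le> 2 + 2 * (6 + X + 2 * D + X)"
    by (rule order_trans[OF i(2)], intro add_mono mult_left_mono) (use le in auto)
  then have r': "r \<le> 20 * X" using D X2 by (simp add: algebra_simps)
  have N: "N \<le> 3522 * X ^ 5"
  proof -
    have "N \<le> D ^ 4 * (11 * r) + 2" by (rule i(3))
    also have "\<dots> \<le> (2 * X) ^ 4 * (11 * (20 * X)) + 2 * X ^ 5"
    proof (intro add_mono mult_mono power_mono)
      show "2 \<le> 2 * X ^ 5" using one_le_power[OF le(4), of 5] by simp
    qed (use D r' le in \<open>auto simp: r_def\<close>)
    also have "\<dots> = 3522 * X ^ 5" by (simp add: eval_nat_numeral)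
    finally show ?thesis .
  qed
  have q: "real q = m + n + D + r + N" by (simp add: q_def m_def n_def D_def r_def N_def)
  \<comment> \<open>64 = 4^3 comes from m^3, and 4000 exceeds 4 + 2 + 20 + 3522, the coefficients of
    the remaining counts.\<close>
  have "real q \<le> (64 * (sample_const + 1) + 4000) * X ^ 12"
  proof -
    have "m \<le> 4 * X ^ 12" using m mono[of 3 12] by simp
    moreover have "D \<le> 2 * X ^ 12" using D mono[of 1 12] by simp
    moreover have "r \<le> 20 * X ^ 12" using r' mono[of 1 12] by simp
    moreover have "N \<le> 3522 * X ^ 12" using N mono[of 5 12] by simp
    moreover have "0 \<le> X ^ 12" using le(4) by simp
    ultimately have "real q \<le> 64 * (sample_const + 1) * X ^ 12 + 4000 * X ^ 12" using n unfolding q by linarith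
    then show ?thesis by (simp only: distrib_right)
  qed
  then have "real q ^ 3 \<le> ((64 * (sample_const + 1) + 4000) * X ^ 12) ^ 3" by (intro power_mono) auto
  also have "\<dots> = (64 * (sample_const + 1) + 4000) ^ 3 * X ^ 36"
    by (simp add: power_mult_distrib power_mult[symmetric])
  finally have "1000000 * real q ^ 3 \<le> 1000000 * ((64 * (sample_const + 1) + 4000) ^ 3 * X ^ 36)" by simp
  then show ?thesis by (simp add: poly_bound_def X_def[symmetric] mult.assoc)
qed

theorem theorem2p1:
  shows "\<exists>(c :: com) (C :: real) (k :: nat) (C' :: real) (k' :: nat).
    \<forall>(d :: nat) (\<epsilon> :: real) (w_max :: real) (D :: example measure) (w :: nat \<Rightarrow> real) (\<tau> :: real).
      1 \<le> d \<longrightarrow> 0 < \<epsilon> \<longrightarrow> \<epsilon> < 1 \<longrightarrow> sigmoid_model d w_max D w \<tau> \<longrightarrow>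
        (AE \<omega> in PiM (UNIV :: nat set) (\<lambda>_. D).
           \<exists>t s. exec d \<omega> c (initial_state d \<epsilon> w_max) t s \<and>
             real (drawn s) \<le> soft_bound C k (real d / \<epsilon>\<^sup>2) \<and>
             real t \<le> poly_bound C' k' d \<epsilon> w_max) \<and>
        with_prob_at_least (PiM (UNIV :: nat set) (\<lambda>_. D)) (99 / 100)
          (\<lambda>\<omega>. \<exists>t s. exec d \<omega> c (initial_state d \<epsilon> w_max) t s \<and>
             sq_error d D w \<tau> (output_weights s) (output_bias d s) \<le> \<epsilon>)"
proof (rule exI[of _ logistic_program], rule exI[of _ "8 * (sample_const + 1)"], rule exI[of _ 3],
    rule exI[of _ "1000000 * (64 * (sample_const + 1) + 4000) ^ 3"], rule exI[of _ 36], intro allI impI)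
  fix d :: nat and \<epsilon> w_max :: real and D :: "example measure" and w :: "nat \<Rightarrow> real" and \<tau> :: real
  assume d: "1 \<le> d" and \<epsilon>: "0 < \<epsilon>" "\<epsilon> < 1" and model: "sigmoid_model d w_max D w \<tau>"
  interpret sigmoid_learning d w_max D w \<tau> by standard (rule model)
  define n where "n = sample_count d \<epsilon>"
  define N where "N = iteration_count d \<epsilon> w_max"
  define m where "m = scale_count d \<epsilon>"
  define Z where "Z \<omega> = (\<lambda>i j. signed_features d (\<omega> i) j)" for \<omega> :: "nat \<Rightarrow> example"
  have run: "\<exists>t s ss. exec d \<omega> logistic_program (initial_state d \<epsilon> w_max) t s \<and>
      real (drawn s) \<le> soft_bound (8 * (sample_const + 1)) 3 (real d / \<epsilon>\<^sup>2) \<and>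
      real t \<le> poly_bound (1000000 * (64 * (sample_const + 1) + 4000) ^ 3) 36 d \<epsilon> w_max \<and>
      ell_start (Suc d) n (w_max + 1) (ss 0) \<and>
      (\<forall>k<N. ell_step (Suc d) n (Z \<omega>) (ss k) (ss (Suc k))) \<and> (\<forall>j<Suc d. rmem s j = best (ss N) j)" for \<omega>
  proof -
    obtain t s ss where ts: "exec d \<omega> logistic_program (initial_state d \<epsilon> w_max) t s" "drawn s = n"
      "t \<le> 1000000 * (scale_count d \<epsilon> + n + Suc d + radius_count d \<epsilon> w_max + N) ^ 3"
      "ell_start (Suc d) n (w_max + 1) (ss 0)" "\<forall>k<N. ell_step (Suc d) n (Z \<omega>) (ss k) (ss (Suc k))"
      "\<forall>j<Suc d. rmem s j = best (ss N) j"
      using logistic_program_runs[OF \<epsilon>(1), of d \<omega> w_max] unfolding n_def N_def Z_def by blast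
    have "real t \<le> real (1000000 * (scale_count d \<epsilon> + n + Suc d + radius_count d \<epsilon> w_max + N) ^ 3)"
      using ts(3) by (rule of_nat_mono)
    also have "\<dots> \<le> poly_bound (1000000 * (64 * (sample_const + 1) + 4000) ^ 3) 36 d \<epsilon> w_max"
      unfolding n_def N_def by (rule running_time_le_poly_bound[OF d \<epsilon> w_max_nonneg])
    finally have "real t \<le> poly_bound (1000000 * (64 * (sample_const + 1) + 4000) ^ 3) 36 d \<epsilon> w_max" .
    moreover have "real (drawn s) \<le> soft_bound (8 * (sample_const + 1)) 3 (real d / \<epsilon>\<^sup>2)"
      using sample_count_le_soft_bound[OF d \<epsilon>] by (simp only: ts(2) n_def)
    ultimately show ?thesis using ts(1,4-6) by (intro exI conjI)
  qed
  note sp = sample_count_properties[OF d \<epsilon>, folded m_def n_def]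
  note sb = sample_size_bounds[OF d \<epsilon> sp(1,2,4,5)]
  note ip = iteration_count_properties(1)[OF \<epsilon> w_max_nonneg, of d, folded N_def]
  have e: "0 < \<epsilon> / 256" "\<epsilon> / 256 < 1 / 2" "0 < \<epsilon> / 128" "0 < \<epsilon> / (179200 * real m)" using \<epsilon> sp(1) by auto
  obtain A where A: "A \<in> sets (PiM (UNIV :: nat set) (\<lambda>_. D))" "99 / 100 \<le> measure (PiM (UNIV :: nat set) (\<lambda>_. D)) A"
    "\<And>\<omega>. \<omega> \<in> A \<Longrightarrow> (\<forall>v. (\<integral>z. smooth_loss (\<epsilon> / 256) (margin d v z) \<partial>D) \<le> (\<Sum>i<n. smooth_loss (\<epsilon> / 256) (margin d v (\<omega> i))) / real n + \<epsilon> / 128) \<and>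
     (\<Sum>i<n. logistic_loss (margin d w_star (\<omega> i))) / real n \<le> (\<integral>z. logistic_loss (margin d w_star z) \<partial>D) + \<epsilon> / 128 \<and>
     (\<forall>i<n. L2_set (fst (\<omega> i)) {..<d} \<le> sqrt (real d) \<and> (snd (\<omega> i) = 1 \<or> snd (\<omega> i) = -1))"
    using good_event[OF e(1,2) sb(1) e(3,4) sb(2,3)] by blast
  have "sq_error d D w \<tau> (output_weights s) (output_bias d s) \<le> \<epsilon>"
    if \<omega>: "\<omega> \<in> A" and ss: "ell_start (Suc d) n (w_max + 1) (ss 0)"
      "\<forall>k<N. ell_step (Suc d) n (Z \<omega>) (ss k) (ss (Suc k))" "\<forall>j<Suc d. rmem s j = best (ss N) j" for \<omega> s ss
  proof -
    \<comment> \<open>Coordinates of examples are at most D, so this \<rho> makes the optimisation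
      error per example, in units of n, equal to \<epsilon> / 256.\<close>
    define \<rho> where "\<rho> = \<epsilon> / (256 * real (Suc d))"
    have \<rho>: "0 < \<rho>" "\<rho> * real (Suc d) = \<epsilon> / 256" using \<epsilon> by (simp_all add: \<rho>_def field_simps del: of_nat_Suc)
    have "\<rho> \<le> \<rho> * real (Suc d)" using \<rho>(1) by simp
    then have "\<rho> \<le> 1" using \<epsilon> \<rho>(2) by simp
    have "total_loss (Suc d) n (Z \<omega>) (best (ss N))
        \<le> total_loss (Suc d) n (Z \<omega>) w_star + real n * (real n * (\<rho> * real (Suc d)))"
    proof (rule ell_steps_near_optimal)
      show "L2_set w_star {..<Suc d} + \<rho> \<le> w_max + 1" using L2_set_w_star \<open>\<rho> \<le> 1\<close> by simp
      show "32 * real (Suc d) ^ 4 * ln ((w_max + 1) * real (Suc d) / \<rho>) < 3 * real N" unfolding \<rho>_def by (rule ip)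
      fix i j assume ij: "i < n" "j < Suc d"
      have y: "\<bar>snd (\<omega> i)\<bar> = 1" and x: "L2_set (fst (\<omega> i)) {..<d} \<le> sqrt (real d)" using A(3)[OF \<omega>] ij by auto
      show "\<bar>Z \<omega> i j\<bar> \<le> real (Suc d)"
      proof (cases "j < d")
        case True
        have "\<bar>fst (\<omega> i) j\<bar> \<le> L2_set (\<lambda>j. \<bar>fst (\<omega> i) j\<bar>) {..<d}"
          using True by (intro member_le_L2_set) auto
        also have "\<dots> = L2_set (fst (\<omega> i)) {..<d}" by (simp add: L2_set_def)
        also have "\<dots> \<le> sqrt (real d)" by (rule x)
        \<comment> \<open>sqrt d <= D gives one bound for the features and for the constant
          coordinate.\<close>
        also have "\<dots> \<le> sqrt ((real (Suc d))\<^sup>2)" by (intro real_sqrt_le_mono) (simp add: power2_eq_square algebra_simps)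
        finally show ?thesis using True y by (simp add: Z_def signed_features_def abs_mult)
      next
        case False
        then show ?thesis using y by (simp add: Z_def signed_features_def)
      qed
    qed (use \<rho> ss in auto)
    also have "total_loss (Suc d) n (Z \<omega>) (best (ss N)) = total_loss (Suc d) n (Z \<omega>) (rmem s)"
      using ss(3) by (intro total_loss_cong) simp
    finally have "total_loss (Suc d) n (Z \<omega>) (rmem s)
        \<le> total_loss (Suc d) n (Z \<omega>) w_star + real n * (real n * (\<epsilon> / 256))" unfolding \<rho>(2) .
    then show ?thesis
      unfolding output_weights_def output_bias_def Z_def
      using A(3)[OF \<omega>] by (intro near_optimal_sq_error[OF d \<epsilon> sb(1,4), of \<omega>]) blast+
  qed
  then have success: "\<forall>\<omega>\<in>A. \<exists>t s. exec d \<omega> logistic_program (initial_state d \<epsilon> w_max) t s \<and>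
      sq_error d D w \<tau> (output_weights s) (output_bias d s) \<le> \<epsilon>"
    using run by meson
  show "(AE \<omega> in PiM (UNIV :: nat set) (\<lambda>_. D).
           \<exists>t s. exec d \<omega> logistic_program (initial_state d \<epsilon> w_max) t s \<and>
             real (drawn s) \<le> soft_bound (8 * (sample_const + 1)) 3 (real d / \<epsilon>\<^sup>2) \<and>
             real t \<le> poly_bound (1000000 * (64 * (sample_const + 1) + 4000) ^ 3) 36 d \<epsilon> w_max) \<and>
        with_prob_at_least (PiM (UNIV :: nat set) (\<lambda>_. D)) (99 / 100)
          (\<lambda>\<omega>. \<exists>t s. exec d \<omega> logistic_program (initial_state d \<epsilon> w_max) t s \<and>
             sq_error d D w \<tau> (output_weights s) (output_bias d s) \<le> \<epsilon>)"
  proof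
    show "AE \<omega> in PiM (UNIV :: nat set) (\<lambda>_. D).
           \<exists>t s. exec d \<omega> logistic_program (initial_state d \<epsilon> w_max) t s \<and>
             real (drawn s) \<le> soft_bound (8 * (sample_const + 1)) 3 (real d / \<epsilon>\<^sup>2) \<and>
             real t \<le> poly_bound (1000000 * (64 * (sample_const + 1) + 4000) ^ 3) 36 d \<epsilon> w_max"
      using run by (intro AE_I2) blast
    show "with_prob_at_least (PiM (UNIV :: nat set) (\<lambda>_. D)) (99 / 100)
          (\<lambda>\<omega>. \<exists>t s. exec d \<omega> logistic_program (initial_state d \<epsilon> w_max) t s \<and>
             sq_error d D w \<tau> (output_weights s) (output_bias d s) \<le> \<epsilon>)"
      unfolding with_prob_at_least_def using A(1,2) success by blast
  qed
qed

end
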